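(* Let $n\ge1$, $d\ge0$. Then $\mathbb{C}[\binom{\langle n\rangle}{n}_d]/\langle I_{d,n}+L_{d,n}\rangle\cong\mathbb{C}[L\mathcal Q_d(n)]$, the homogeneous coordinate ring of the Drinfel'd Lagrangian Grassmannian; i.e. $I_{d,n}+L_{d,n}$ is the homogeneous ideal of $L\mathcal Q_d(n)$.
   Context: $\langle n\rangle=\{\bar n<\dots<\bar1<1<\dots<n\}$ with $\bar\imath=-i$, and $\mathbb{C}^{2n}$ has basis $e_{\bar n},\dots,e_n$ with symplectic form $\Omega$ given by $\Omega(e_{\bar\imath},e_i)=1$ and all other pairs of basis vectors pairing to $0$; $\mathrm{LG}(n)$ is the variety of maximal isotropic subspaces. $\mathbb{C}[\binom{\langle n\rangle}{n}_d]$ is the polynomial ring in variables $p^{(a)}_\alpha$, $\alpha$ an $n$-element subset of $\langle n\rangle$, $0\le a\le d$; $p^{(a)}_\alpha$ is the coordinate on $(S^d\mathbb{C}^2)^*\otimes\bigwedge^n\mathbb{C}^{2n}$ taking the coefficient of $s^at^{d-a}$ in the $\alpha$-th Pl\"ucker coordinate (a tuple of degree-$d$ binary forms in $s,t$). $I_{d,n}$ is the homogeneous ideal of the Drinfel'd Grassmannian $\mathcal Q_d(n,2n)$, the closure in $\mathbb P((S^d\mathbb{C}^2)^*\otimes\bigwedge^n\mathbb{C}^{2n})$ of the set of degree-$d$ algebraic maps $\mathbb P^1\to\mathrm{Gr}(n,2n)$ (each given by its Pl\"ucker coordinates, degree-$d$ forms without common zero). $L_{d,n}$ is the ideal generated by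 the linear forms $\sum_{i\in[n]:\{i,\bar\imath\}\cap\beta=\emptyset}\epsilon_i\,p^{(a)}_{\beta\cup\{\bar\imath,i\}}$, for $0\le a\le d$ and $(n-2)$-element subsets $\beta=\{\beta_1<\dots<\beta_{n-2}\}\subseteq\langle n\rangle$, where $\epsilon_i$ is the sign of the permutation sorting $(\bar\imath,i,\beta_1,\dots,\beta_{n-2})$. $L\mathcal Q_d(n)$ is the closure in $\mathbb P((S^d\mathbb{C}^2)^*\otimes\mathrm{L}(\omega_n))\subseteq\mathbb P((S^d\mathbb{C}^2)^*\otimes\bigwedge^n\mathbb{C}^{2n})$ of the set of degree-$d$ algebraic maps $\mathbb P^1\to\mathrm{LG}(n)$ (degree measured in the Pl\"ucker embedding), where $\mathrm{L}(\omega_n)=\ker(\Omega\lrcorner\bullet:\bigwedge^n\mathbb{C}^{2n}\to\bigwedge^{n-2}\mathbb{C}^{2n})$. *)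

theory Defs
  imports "HOL-Library.Poly_Mapping" "HOL-Combinatorics.Permutations" Complex_Main
begin

text \<open>Variables p^(a)_alpha are pairs (a, alpha), alpha a set of integers
  (the element written i-bar is -i). Polynomials: the standard representation
  monomial (var =>0 nat) to coefficient, i.e. ((nat * int set) =>0 nat) =>0 complex.\<close>

type_synonym pvar = "nat \<times> int set"
type_synonym mpoly = "(pvar \<Rightarrow>\<^sub>0 nat) \<Rightarrow>\<^sub>0 complex"

definition bracket :: "nat \<Rightarrow> int set" where
  "bracket n = {- int n .. -1} \<union> {1 .. int n}"

definition nsubsets :: "nat \<Rightarrow> nat \<Rightarrow> int set set" where
  "nsubsets n k = {A. A \<subseteq> bracket n \<and> card A = k}"

definition Vars :: "nat \<Rightarrow> nat \<Rightarrow> pvar set" where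
  "Vars d n = {(a, A). a \<le> d \<and> A \<in> nsubsets n n}"

definition pvar :: "pvar \<Rightarrow> mpoly" where
  "pvar v = Poly_Mapping.single (Poly_Mapping.single v 1) 1"

definition meval :: "(pvar \<Rightarrow> complex) \<Rightarrow> mpoly \<Rightarrow> complex" where
  "meval x p = (\<Sum>m\<in>Poly_Mapping.keys p. Poly_Mapping.lookup p m * (\<Prod>v\<in>Poly_Mapping.keys (m :: pvar \<Rightarrow>\<^sub>0 nat). x v ^ Poly_Mapping.lookup m v))"

definition PRing :: "nat \<Rightarrow> nat \<Rightarrow> mpoly set" where
  "PRing d n = {p. \<forall>m\<in>Poly_Mapping.keys p. Poly_Mapping.keys (m :: pvar \<Rightarrow>\<^sub>0 nat) \<subseteq> Vars d n}"

definition ideal_gen :: "mpoly set \<Rightarrow> mpoly set \<Rightarrow> mpoly set" where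
  "ideal_gen R G = {p. \<exists>F g. finite F \<and> F \<subseteq> G \<and> (\<forall>f\<in>F. g f \<in> R) \<and> p = (\<Sum>f\<in>F. g f * f)}"

definition vanishing :: "mpoly set \<Rightarrow> (pvar \<Rightarrow> complex) set \<Rightarrow> mpoly set" where
  "vanishing R S = {p \<in> R. \<forall>x\<in>S. meval x p = 0}"

text \<open>The alpha-th Pluecker coordinate (a binary form of degree d) evaluated at (s,t).\<close>
definition plueval :: "nat \<Rightarrow> (pvar \<Rightarrow> complex) \<Rightarrow> int set \<Rightarrow> complex \<Rightarrow> complex \<Rightarrow> complex" where
  "plueval d x A s t = (\<Sum>a\<le>d. x (a, A) * s ^ a * t ^ (d - a))"

text \<open>Maximal minor with rows alpha (sorted increasingly) of the 2n x n matrix U whose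
  columns u_0..u_{n-1} span a subspace; U k i is the e_k-coordinate of u_i.\<close>
definition minor :: "nat \<Rightarrow> (int \<Rightarrow> nat \<Rightarrow> complex) \<Rightarrow> int set \<Rightarrow> complex" where
  "minor n U A = (\<Sum>\<sigma> | \<sigma> permutes {..<n}.
       of_int (sign \<sigma>) * (\<Prod>j<n. U (sorted_list_of_set A ! j) (\<sigma> j)))"

definition Omega :: "nat \<Rightarrow> (int \<Rightarrow> complex) \<Rightarrow> (int \<Rightarrow> complex) \<Rightarrow> complex" where
  "Omega n u v = (\<Sum>i\<in>{1..int n}. u (- i) * v i - u i * v (- i))"

text \<open>Degree-d maps P^1 -> Gr(n,2n), given by their Pluecker coordinates.\<close>
definition GrMaps :: "nat \<Rightarrow> nat \<Rightarrow> (pvar \<Rightarrow> complex) set" where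
  "GrMaps d n = {x. \<forall>s t. (s, t) \<noteq> (0, 0) \<longrightarrow>
      (\<exists>A\<in>nsubsets n n. plueval d x A s t \<noteq> 0) \<and>
      (\<exists>U. \<forall>A\<in>nsubsets n n. plueval d x A s t = minor n U A)}"

definition LGMaps :: "nat \<Rightarrow> nat \<Rightarrow> (pvar \<Rightarrow> complex) set" where
  "LGMaps d n = {x. \<forall>s t. (s, t) \<noteq> (0, 0) \<longrightarrow>
      (\<exists>A\<in>nsubsets n n. plueval d x A s t \<noteq> 0) \<and>
      (\<exists>U. (\<forall>A\<in>nsubsets n n. plueval d x A s t = minor n U A) \<and>
           (\<forall>i<n. \<forall>j<n. Omega n (\<lambda>k. U k i) (\<lambda>k. U k j) = 0))}"

text \<open>I_{d,n}: homogeneous ideal of the Drinfel'd Grassmannian, i.e. all polynomials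
  vanishing on (the closure of the cone over) the set of degree-d maps.\<close>
definition Iideal :: "nat \<Rightarrow> nat \<Rightarrow> mpoly set" where
  "Iideal d n = vanishing (PRing d n) (GrMaps d n)"

definition sort_sign :: "int list \<Rightarrow> int" where
  "sort_sign xs = (-1) ^ card {(j, k). j < k \<and> k < length xs \<and> xs ! j > xs ! k}"

definition Lgens :: "nat \<Rightarrow> nat \<Rightarrow> mpoly set" where
  "Lgens d n = {p. \<exists>a B. 2 \<le> n \<and> a \<le> d \<and> B \<in> nsubsets n (n - 2) \<and>
      p = (\<Sum>i\<in>{i\<in>{1..int n}. {i, - i} \<inter> B = {}}.
             of_int (sort_sign ((- i) # i # sorted_list_of_set B)) * pvar (a, B \<union> {- i, i}))}"

end

theory Submission
  imports Defs "HOL-Combinatorics.Multiset_Permutations" "Jordan_Normal_Form.Determinant"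
begin

text \<open>
  Attach to every variable \<open>(a, A)\<close> a height function on \<open>{- n..n}\<close>. Two straightening rules hold.
  Modulo the ideal of the Drinfel'd Grassmannian a product \<open>p\<^sub>v p\<^sub>w\<close> is a combination of products of
  comparable variables with the same sum of heights and larger differences; it comes from the
  divisibility of the exchange relations by powers of a linear form and a dimension count. Modulo the linear forms every variable
  is a combination of variables with \<open>ht v x \<le> ht v (- x)\<close> for \<open>x \<ge> 0\<close>, and a variable and its reflection
  are proportional. Hence monomials in such variables which are pairwise comparable, also after reflecting one
  factor, span the quotient by \<open>I + L\<close>: the sum of the squares of the total heights increases under quadratic straightening.

  Conversely, one-parameter families of maps to the Lagrangian Grassmannian, built by successively adding
  boxes, give every variable a prescribed order of vanishing which is a weighted sum over the cells
  below its height function. For suitable weights different standard monomials acquire different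
  orders, so they are linearly independent as functions on \<open>LGMaps\<close>, and \<open>I + L\<close> contains every polynomial
  vanishing there.\<close>

text \<open>\<open>Iideal\<close> is known only as the set of polynomials vanishing on maps, without
  generators. Hence a relation is put into it by evaluation on maps, and straightening relations
  need only exist with the right shape; their coefficients are never computed. Existence for a fixed
  weight is a matter of counting: the reflection principle gives as many standard products as there
  are linear functionals separating the solutions of the exchange relations, and families of maps
  show that the standard products are independent. The two straightening rules disturb each other:
  the linear one destroys comparability, the quadratic one creates variables of the wrong half.
  Termination rests on the total height, which is invariant under the linear rule and under
  reflection because both preserve the sum of the heights at \<open>y\<close> and
  \<open>- y\<close>. An isotropic family must add the boxes at \<open>y\<close> and
  \<open>- y\<close> with one common parameter, so only weights symmetric under reflection are
  available. Such weights do not see which of the two gaps carries which height; comparability with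
  the reflected factor is what still allows the largest factor of a monomial to be
  recovered.\<close>

section \<open>Garnir relations for functions on the subsets of given size of an ordered set\<close>

definition ballot :: "int set \<Rightarrow> int set \<Rightarrow> bool" where
  "ballot T C \<longleftrightarrow> (\<forall>x. card {c\<in>C. x < c} \<le> card {c\<in>T - C. x < c})"

definition upsum :: "int set \<Rightarrow> nat \<Rightarrow> (int set \<Rightarrow> 'b::comm_ring_1) \<Rightarrow> int set \<Rightarrow> 'b" where
  "upsum T j P D = (\<Sum>C | D \<subseteq> C \<and> C \<subseteq> T \<and> card C = j. P C)"

definition upsum_off :: "int set \<Rightarrow> nat \<Rightarrow> (int set \<Rightarrow> 'b::comm_ring_1) \<Rightarrow> int set \<Rightarrow> int set \<Rightarrow> 'b" where
  "upsum_off T j P Q Z = (\<Sum>C | Q \<subseteq> C \<and> C \<subseteq> T \<and> C \<inter> Z = {} \<and> card C = j. P C)"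

text \<open>Double counting: a set \<open>C\<close> above \<open>D\<close> is met once for each of
  the \<open>j - card D\<close> elements \<open>e\<close> of \<open>C - D\<close>.\<close>

lemma sum_upsum_insert:
  assumes "finite T" "D \<subseteq> T" "card D \<le> j"
  shows "(\<Sum>e\<in>T - D. upsum T j P (insert e D)) = of_nat (j - card D) * upsum T j P D"
proof -
  let ?F = "{C. D \<subseteq> C \<and> C \<subseteq> T \<and> card C = j}"
  have fin: "finite ?F" using assms(1) by (auto intro: finite_subset[of _ "Pow T"])
  have "(\<Sum>e\<in>T - D. upsum T j P (insert e D)) = (\<Sum>e\<in>T - D. \<Sum>C\<in>?F. if e \<in> C then P C else 0)"
    unfolding upsum_def sum.If_cases[OF fin]
    by (intro sum.cong refl) (auto intro!: sum.cong)
  also have "\<dots> = (\<Sum>C\<in>?F. \<Sum>e\<in>T - D. if e \<in> C then P C else 0)"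
    by (rule sum.swap)
  also have "\<dots> = (\<Sum>C\<in>?F. of_nat (j - card D) * P C)"
  proof (rule sum.cong[OF refl])
    fix C assume C: "C \<in> ?F"
    then have fC: "finite C" using assms(1) finite_subset by blast
    have "(\<Sum>e\<in>T - D. if e \<in> C then P C else 0) = of_nat (card ((T - D) \<inter> C)) * P C"
      using assms(1) by (simp add: sum.If_cases Int_def)
    moreover have "(T - D) \<inter> C = C - D" using C by auto
    moreover have "card (C - D) = j - card D"
      using C fC by (subst card_Diff_subset) (auto intro: finite_subset)
    ultimately show "(\<Sum>e\<in>T - D. if e \<in> C then P C else 0) = of_nat (j - card D) * P C" by simp
  qed
  finally show ?thesis by (simp add: upsum_def sum_distrib_left)
qed

lemma upsum_full:
  assumes "finite T" "D \<subseteq> T" "card D = j"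
  shows "upsum T j P D = P D"
proof -
  have "C = D" if "D \<subseteq> C" "C \<subseteq> T" "card C = j" for C
    using that assms card_subset_eq[of C D] finite_subset[of C T] by simp
  then have "{C. D \<subseteq> C \<and> C \<subseteq> T \<and> card C = j} = {D}"
    using assms by auto
  then show ?thesis by (simp add: upsum_def)
qed

lemma upsum_off_insert:
  assumes "finite T" "z \<notin> Q" "z \<in> T"
  shows "upsum_off T j P Q (insert z Z) = upsum_off T j P Q Z - upsum_off T j P (insert z Q) Z"
proof -
  let ?A = "{C. Q \<subseteq> C \<and> C \<subseteq> T \<and> C \<inter> insert z Z = {} \<and> card C = j}"
  let ?B = "{C. insert z Q \<subseteq> C \<and> C \<subseteq> T \<and> C \<inter> Z = {} \<and> card C = j}"
  let ?U = "{C. Q \<subseteq> C \<and> C \<subseteq> T \<and> C \<inter> Z = {} \<and> card C = j}"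
  have fin: "finite ?A" "finite ?B" using assms(1) by (auto intro: finite_subset[of _ "Pow T"])
  have "?U = ?A \<union> ?B" "?A \<inter> ?B = {}" by auto
  then have "sum P ?U = sum P ?A + sum P ?B"
    using fin by (simp add: sum.union_disjoint)
  then show ?thesis by (simp add: upsum_off_def)
qed

lemma upsum_off_empty: "upsum_off T j P Q {} = upsum T j P Q"
  by (simp add: upsum_off_def upsum_def)

text \<open>The same argument runs with three targets: the zero polynomial, the ideal
  \<open>J\<close>, and the span of given elements modulo \<open>J\<close>. Division by positive
  integers is asked for because double counting yields multiples.\<close>

locale divisible_subgroup =
  fixes Y :: "'b::comm_ring_1 set"
  assumes zero: "0 \<in> Y"
    and add: "a \<in> Y \<Longrightarrow> b \<in> Y \<Longrightarrow> a + b \<in> Y"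
    and uminus: "a \<in> Y \<Longrightarrow> - a \<in> Y"
    and divide: "r > 0 \<Longrightarrow> of_nat r * a \<in> Y \<Longrightarrow> a \<in> Y"
begin

lemma diff: "a \<in> Y \<Longrightarrow> b \<in> Y \<Longrightarrow> a - b \<in> Y"
  using add[of a "- b"] uminus[of b] by simp

lemma sum_mem: "(\<And>i. i \<in> I \<Longrightarrow> f i \<in> Y) \<Longrightarrow> sum f I \<in> Y"
  by (induction I rule: infinite_finite_induct) (auto intro: zero add)

text \<open>Downward induction on \<open>card D\<close>: the sums at the one-element extensions of
  \<open>D\<close> add up to \<open>j - card D\<close> times the sum at \<open>D\<close>, and this
  factor can be divided out.\<close>

lemma upsum_mem:
  assumes "finite T"
    and base: "\<And>D. D \<subseteq> T \<Longrightarrow> Suc (card D) = j \<Longrightarrow> (\<Sum>e\<in>T - D. P (insert e D)) \<in> Y"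
  shows "D \<subseteq> T \<Longrightarrow> card D < j \<Longrightarrow> upsum T j P D \<in> Y"
proof (induction "j - card D" arbitrary: D rule: less_induct)
  case less
  have fD: "finite D" using less.prems assms(1) finite_subset by blast
  have "(\<Sum>e\<in>T - D. upsum T j P (insert e D)) \<in> Y"
  proof (cases "Suc (card D) = j")
    case True
    have "(\<Sum>e\<in>T - D. upsum T j P (insert e D)) = (\<Sum>e\<in>T - D. P (insert e D))"
      using fD True less.prems assms(1) by (intro sum.cong refl upsum_full) auto
    then show ?thesis using base[OF less.prems(1) True] by simp
  next
    case False
    show ?thesis
    proof (rule sum_mem)
      fix e assume "e \<in> T - D"
      then show "upsum T j P (insert e D) \<in> Y"
        using less.prems fD False by (intro less.hyps) auto
    qed
  qed
  then show ?case
    using less.prems assms(1) sum_upsum_insert[of T D j P]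
    by (auto intro: divide[of "j - card D"])
qed

text \<open>Inclusion-exclusion: avoiding \<open>Z\<close> is an alternating combination of sums
  over the sets that contain \<open>Q\<close> and a part of \<open>Z\<close>. All of these lie in
  \<open>Y\<close> as long as \<open>card Q + card Z\<close> stays below \<open>r\<close>.\<close>

lemma upsum_off_mem:
  assumes "finite T"
    and H: "\<And>D. D \<subseteq> T \<Longrightarrow> card D < r \<Longrightarrow> upsum T j P D \<in> Y"
  shows "finite Z \<Longrightarrow> Z \<subseteq> T \<Longrightarrow> Q \<subseteq> T \<Longrightarrow> Q \<inter> Z = {} \<Longrightarrow> card Q + card Z < r
    \<Longrightarrow> upsum_off T j P Q Z \<in> Y"
proof (induction Z arbitrary: Q rule: finite_induct)
  case empty
  then show ?case using H[of Q] by (simp add: upsum_off_empty)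
next
  case (insert z Z)
  have fQ: "finite Q" by (rule finite_subset[OF insert.prems(2) assms(1)])
  have "upsum_off T j P Q Z \<in> Y"
    by (rule insert.IH) (use insert.prems insert.hyps in auto)
  moreover have "upsum_off T j P (insert z Q) Z \<in> Y"
    by (rule insert.IH) (use insert.prems insert.hyps fQ in auto)
  ultimately show ?case using insert.prems assms(1) by (auto simp: upsum_off_insert intro: diff)
qed

text \<open>At the threshold a single term of the inclusion-exclusion is not yet known to lie in
  \<open>Y\<close>, the one where all of \<open>Z\<close> is contained. Modulo \<open>Y\<close>,
  avoiding \<open>Z\<close> is therefore the same as containing it, up to sign.\<close>

lemma upsum_off_flip:
  assumes "finite T"
    and H: "\<And>D. D \<subseteq> T \<Longrightarrow> card D < r \<Longrightarrow> upsum T j P D \<in> Y"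
  shows "finite Z \<Longrightarrow> Z \<subseteq> T \<Longrightarrow> Q \<subseteq> T \<Longrightarrow> Q \<inter> Z = {} \<Longrightarrow> card Q + card Z = r
    \<Longrightarrow> upsum_off T j P Q Z - (-1) ^ card Z * upsum T j P (Q \<union> Z) \<in> Y"
proof (induction Z arbitrary: Q rule: finite_induct)
  case empty
  then show ?case by (simp add: upsum_off_empty zero)
next
  case (insert z Z)
  have fQ: "finite Q" by (rule finite_subset[OF insert.prems(2) assms(1)])
  have "upsum_off T j P Q Z \<in> Y"
    by (rule upsum_off_mem[OF assms(1) H]) (use insert.prems insert.hyps in auto)
  moreover have "upsum_off T j P (insert z Q) Z - (-1) ^ card Z * upsum T j P (insert z Q \<union> Z) \<in> Y"
    by (rule insert.IH) (use insert.prems insert.hyps fQ in auto)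
  ultimately have "upsum_off T j P Q Z -
     (upsum_off T j P (insert z Q) Z - (-1) ^ card Z * upsum T j P (insert z Q \<union> Z)) \<in> Y"
    by (rule diff)
  then show ?case using insert.prems insert.hyps assms(1) by (simp add: upsum_off_insert algebra_simps)
qed

text \<open>Garnir straightening: if the prefix above \<open>x\<close> contains too many elements of \<open>C\<close>, exchange them
  against elements below \<open>x\<close>; this decreases the sum of the elements.\<close>

lemma ballot_span:
  assumes "finite T"
    and base: "\<And>D. D \<subseteq> T \<Longrightarrow> Suc (card D) = j \<Longrightarrow> (\<Sum>e\<in>T - D. P (insert e D)) \<in> Y"
    and bal: "\<And>C. C \<subseteq> T \<Longrightarrow> card C = j \<Longrightarrow> ballot T C \<Longrightarrow> P C \<in> Y"
  shows "C \<subseteq> T \<Longrightarrow> card C = j \<Longrightarrow> P C \<in> Y"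
proof (induction "nat (\<Sum>e\<in>C. e - Min T)" arbitrary: C rule: less_induct)
  case less
  have fC: "finite C" using less.prems assms(1) finite_subset by blast
  show ?case
  proof (cases "ballot T C")
    case True
    then show ?thesis using bal less.prems by blast
  next
    case False
    then obtain x where x: "card {c\<in>C. x < c} > card {c\<in>T - C. x < c}"
      by (auto simp: ballot_def not_le)
    \<comment> \<open>Kept are the elements of \<open>C\<close> up to \<open>x\<close>, forbidden
      the elements of \<open>T - C\<close> above \<open>x\<close>. The violated inequality at
      \<open>x\<close> is exactly \<open>card Q + card Z < j\<close>.\<close>
    define Q where "Q = {c\<in>C. \<not> x < c}"
    define Z where "Z = {c\<in>T - C. x < c}"
    have cQ: "card Q + card {c\<in>C. x < c} = j"
      using fC less.prems(2) unfolding Q_def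
      by (subst card_Un_disjoint[symmetric]) (auto intro!: arg_cong[of _ _ card])
    have "upsum_off T j P Q Z \<in> Y"
      using assms(1) x cQ less.prems
      by (intro upsum_off_mem[OF assms(1) upsum_mem[OF assms(1) base]]) (auto simp: Q_def Z_def)
    let ?F = "{C'. Q \<subseteq> C' \<and> C' \<subseteq> T \<and> C' \<inter> Z = {} \<and> card C' = j}"
    have finF: "finite ?F" using assms(1) by (auto intro: finite_subset[of _ "Pow T"])
    have CF: "C \<in> ?F" using less.prems by (auto simp: Q_def Z_def)
    have "P C' \<in> Y" if C': "C' \<in> ?F - {C}" for C'
    proof -
      have fC': "finite C'" using C' assms(1) finite_subset by blast
      have sub: "C' - C \<subseteq> {e. e \<le> x}" "C - C' \<subseteq> {e. x < e}"
        using C' by (auto simp: Q_def Z_def not_less)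
      have cd: "card (C' - C) = card (C - C')"
        using C' less.prems(2) fC fC' by (simp add: card_Diff_subset_Int Int_commute)
      have ne: "C - C' \<noteq> {}"
        using C' less.prems(2) fC fC' by (metis (mono_tags, lifting) DiffE Diff_eq_empty_iff card_subset_eq mem_Collect_eq singletonI)
      have "(\<Sum>e\<in>C' - C. e) \<le> (\<Sum>e\<in>C' - C. x)" using sub by (intro sum_mono) auto
      also have "\<dots> = (\<Sum>e\<in>C - C'. x)" using cd by simp
      also have "\<dots> < (\<Sum>e\<in>C - C'. e)" using sub ne fC by (intro sum_strict_mono) auto
      finally have "(\<Sum>e\<in>C' - C. e) < (\<Sum>e\<in>C - C'. e)" .
      moreover have "(\<Sum>e\<in>C'. e) = (\<Sum>e\<in>C' - C. e) + (\<Sum>e\<in>C' \<inter> C. e)"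
        using sum.Int_Diff[OF fC', of "\<lambda>e. e" C] by simp
      moreover have "(\<Sum>e\<in>C. e) = (\<Sum>e\<in>C - C'. e) + (\<Sum>e\<in>C' \<inter> C. e)"
        using sum.Int_Diff[OF fC, of "\<lambda>e. e" C'] by (simp add: Int_commute)
      ultimately have lt: "(\<Sum>e\<in>C'. e) < (\<Sum>e\<in>C. e)" by simp
      \<comment> \<open>The shift by \<open>Min T\<close> makes the measure nonnegative, so that
        \<open>nat\<close> preserves strict inequality; it cancels in comparisons because all sets
        have \<open>j\<close> elements.\<close>
      have pos: "0 \<le> (\<Sum>e\<in>C'. e - Min T)"
        using C' assms(1) by (intro sum_nonneg) (auto intro: Min_le)
      have "(\<Sum>e\<in>C'. e - Min T) < (\<Sum>e\<in>C. e - Min T)"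
        using lt C' less.prems(2) by (simp add: sum_subtractf)
      then have "nat (\<Sum>e\<in>C'. e - Min T) < nat (\<Sum>e\<in>C. e - Min T)" using pos by simp
      then show ?thesis using C' by (intro less.hyps[of C']) simp_all
    qed
    then have "(\<Sum>C'\<in>?F - {C}. P C') \<in> Y" by (intro sum_mem)
    moreover have "upsum_off T j P Q Z = P C + (\<Sum>C'\<in>?F - {C}. P C')"
      unfolding upsum_off_def using finF CF by (subst sum.remove) auto
    ultimately show ?thesis using diff[OF \<open>upsum_off T j P Q Z \<in> Y\<close>] by fastforce
  qed
qed

text \<open>Among \<open>2 * j\<close> elements the complement of \<open>C\<close> is the only
  \<open>j\<close>-subset that avoids \<open>C\<close>, so the flip at threshold \<open>j\<close>
  compares \<open>P\<close> at two complementary sets. It makes a variable proportional to its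
  reflection later on.\<close>

lemma complement_flip:
  fixes T :: "int set" and P :: "int set \<Rightarrow> 'b"
  assumes "finite T" "card T = 2 * j"
    and base: "\<And>D. D \<subseteq> T \<Longrightarrow> Suc (card D) = j \<Longrightarrow> (\<Sum>e\<in>T - D. P (insert e D)) \<in> Y"
    and "C \<subseteq> T" "card C = j"
  shows "P (T - C) - (-1) ^ j * P C \<in> Y"
proof -
  have fC: "finite C" using assms finite_subset by blast
  have "{C'. {} \<subseteq> C' \<and> C' \<subseteq> T \<and> C' \<inter> C = {} \<and> card C' = j} = {T - C}" (is "?L = _")
  proof -
    have "C' = T - C" if "C' \<subseteq> T" "C' \<inter> C = {}" "card C' = j" for C'
      using that assms fC by (intro card_subset_eq) (auto simp: card_Diff_subset)
    then show ?thesis using assms fC by (auto simp: card_Diff_subset)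
  qed
  then have e: "upsum_off T j P {} C = P (T - C)" unfolding upsum_off_def by simp
  have H: "upsum T j P D \<in> Y" if "D \<subseteq> T" "card D < j" for D
    using upsum_mem[where T = T and j = j and P = P, OF assms(1) base] that by blast
  have "upsum_off T j P {} C - (-1) ^ card C * upsum T j P ({} \<union> C) \<in> Y"
    using assms(4,5) by (intro upsum_off_flip[where r = j and T = T, OF assms(1) H fC]) simp_all
  then show ?thesis
    unfolding e Un_empty_left upsum_full[OF assms(1,4,5)] assms(5) .
qed

end

section \<open>Counting\<close>

lemma card_subsets_insert:
  assumes "finite T" "b \<notin> T"
  shows "card {C. C \<subseteq> insert b T \<and> R C} = card {C. C \<subseteq> T \<and> R (insert b C)} + card {C. C \<subseteq> T \<and> R C}"
proof -
  have "{C. C \<subseteq> insert b T \<and> R C} = insert b ` {C. C \<subseteq> T \<and> R (insert b C)} \<union> {C. C \<subseteq> T \<and> R C}" (is "?L = ?A \<union> ?B")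
  proof (rule Set.set_eqI)
    fix C show "C \<in> ?L \<longleftrightarrow> C \<in> ?A \<union> ?B"
    proof (cases "b \<in> C")
      case True
      then have "C = insert b (C - {b})" by auto
      then show ?thesis using True assms by (auto intro!: image_eqI[of _ _ "C - {b}"] simp: subset_insert_iff insert_absorb)
    next
      case False
      then show ?thesis by auto
    qed
  qed
  moreover have "?A \<inter> ?B = {}" using assms by auto
  moreover have "finite ?A" "finite ?B" using assms(1) by auto
  moreover have "card ?A = card {C. C \<subseteq> T \<and> R (insert b C)}"
    using assms by (intro card_image inj_onI) (metis (no_types, lifting) insert_ident mem_Collect_eq subsetD)
  ultimately show ?thesis by (simp add: card_Un_disjoint)
qed

text \<open>A lattice path is read from the largest element of \<open>T\<close> downwards, with a
  step down for each element outside \<open>C\<close>; it reaches depth \<open>k\<close>.\<close>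

definition dips :: "int set \<Rightarrow> int set \<Rightarrow> nat \<Rightarrow> bool" where
  "dips T C k \<longleftrightarrow> (\<exists>x. card {c\<in>T - C. x < c} \<ge> card {c\<in>C. x < c} + k)"

lemma dips_0: "finite T \<Longrightarrow> C \<subseteq> T \<Longrightarrow> dips T C 0"
proof -
  assume a: "finite T" "C \<subseteq> T"
  have "{c\<in>C. Max T < c} = {}" using a by (auto simp: not_less)
  then show ?thesis unfolding dips_def by (intro exI[of _ "Max T"]) (metis add_0 card.empty le0 add_0_right)
qed

text \<open>The largest element is the first step of the path, so deleting it changes the required
  depth by one. For \<open>k > 0\<close> the empty final segment is never a witness on the left-hand
  side.\<close>

lemma dips_insert:
  assumes "finite T" "\<forall>a\<in>T. a < b" "C \<subseteq> T" "k > 0"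
  shows "dips (insert b T) (insert b C) k \<longleftrightarrow> dips T C (Suc k)"
    and "dips (insert b T) C k \<longleftrightarrow> dips T C (k - 1)"
proof -
  have fC: "finite C" using assms finite_subset by blast
  have bT: "b \<notin> T" "b \<notin> C" using assms by auto
  have 1: "{c \<in> insert b T - insert b C. x < c} = {c \<in> T - C. x < c}" for x using bT by auto
  have 2: "{c \<in> insert b C. x < c} = (if x < b then insert b {c \<in> C. x < c} else {c \<in> C. x < c})" for x by auto
  have 3: "{c \<in> insert b T - C. x < c} = (if x < b then insert b {c \<in> T - C. x < c} else {c \<in> T - C. x < c})" for x
    using bT by auto
  have 4: "card {c \<in> insert b T - C. x < c} = (if x < b then Suc (card {c \<in> T - C. x < c}) else card {c \<in> T - C. x < c})" for x
    unfolding 3 using bT assms(1) by simp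
  have big: "{c \<in> T - C. x < c} = {}" "{c \<in> C. x < c} = {}" if "\<not> x < b" for x
    using assms that by fastforce+
  show "dips (insert b T) (insert b C) k \<longleftrightarrow> dips T C (Suc k)"
    unfolding dips_def 1 2
  proof (rule ex_cong1)
    fix x show "(card (if x < b then insert b {c \<in> C. x < c} else {c \<in> C. x < c}) + k \<le> card {c \<in> T - C. x < c})
      = (card {c \<in> C. x < c} + Suc k \<le> card {c \<in> T - C. x < c})"
    proof (cases "x < b")
      case True
      then show ?thesis using bT fC by (simp add: card_insert_if)
    next
      case False
      then show ?thesis unfolding big[OF False] using assms(4) by simp
    qed
  qed
  show "dips (insert b T) C k \<longleftrightarrow> dips T C (k - 1)"
  proof
    assume "dips (insert b T) C k"
    then obtain x where x: "card {c \<in> C. x < c} + k \<le> card {c \<in> insert b T - C. x < c}" by (auto simp: dips_def)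
    then have "card {c \<in> C. x < c} + (k - 1) \<le> card {c \<in> T - C. x < c}"
      using assms(4) 4[of x] by (cases "x < b") (simp_all split: if_splits)
    then show "dips T C (k - 1)" by (auto simp: dips_def)
  next
    assume "dips T C (k - 1)"
    then obtain x where x: "card {c \<in> C. x < c} + (k - 1) \<le> card {c \<in> T - C. x < c}" by (auto simp: dips_def)
    show "dips (insert b T) C k"
    proof (cases "x < b")
      case True
      then have "card {c \<in> C. x < c} + k \<le> card {c \<in> insert b T - C. x < c}"
        using x assms(4) True 4[of x] by (simp split: if_splits)
      then show ?thesis by (auto simp: dips_def)
    next
      case False
      then have "k = 1" using x assms(4) unfolding big[OF False] by simp
      \<comment> \<open>For depth one the final segment consisting of \<open>b\<close> alone is a
        witness.\<close>
      moreover have "{c \<in> C. b - 1 < c} = {}" "{c \<in> T - C. b - 1 < c} = {}" using assms by fastforce+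
      ultimately have "card {c \<in> C. b - 1 < c} + k \<le> card {c \<in> insert b T - C. b - 1 < c}"
        unfolding 4 by (simp only:) simp
      then show ?thesis by (auto simp: dips_def)
    qed
  qed
qed

text \<open>Reflection principle. The condition \<open>card T \<le> 2 * j + k\<close> says that the
  path ends no deeper than \<open>k\<close>, so a path touching that level can be reflected there
  and becomes an arbitrary \<open>(j + k)\<close>-subset. The bijection is replaced by Pascal's rule
  for the first step.\<close>

lemma card_dips:
  assumes "finite T"
  shows "card T \<le> 2 * j + k \<Longrightarrow> card {C. C \<subseteq> T \<and> card C = j \<and> dips T C k} = card T choose (j + k)"
  using assms
proof (induction T arbitrary: j k rule: finite_linorder_max_induct)
  case empty
  have "dips {} {} k \<longleftrightarrow> k = 0" by (auto simp: dips_def)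
  then have "{C. C \<subseteq> {} \<and> card C = j \<and> dips {} C k} = (if j = 0 \<and> k = 0 then {{}} else {})" by auto
  then show ?case by auto
next
  case (insert b T)
  have bT: "b \<notin> T" using insert by auto
  show ?case
  proof (cases "k = 0")
    case True
    then have "{C. C \<subseteq> insert b T \<and> card C = j \<and> dips (insert b T) C k} = {C. C \<subseteq> insert b T \<and> card C = j}"
      using insert(1) dips_0[of "insert b T"] by auto
    then show ?thesis using True insert(1) by (simp add: n_subsets)
  next
    case False
    then obtain k' where k: "k = Suc k'" by (cases k) auto
    have "card {C. C \<subseteq> insert b T \<and> card C = j \<and> dips (insert b T) C k} =
       card {C. C \<subseteq> T \<and> card (insert b C) = j \<and> dips (insert b T) (insert b C) k} +
       card {C. C \<subseteq> T \<and> card C = j \<and> dips (insert b T) C k}"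
      using insert(1) bT by (intro card_subsets_insert)
    also have "{C. C \<subseteq> T \<and> card C = j \<and> dips (insert b T) C k} = {C. C \<subseteq> T \<and> card C = j \<and> dips T C k'}"
      using insert k by (auto simp: dips_insert)
    also have "{C. C \<subseteq> T \<and> card (insert b C) = j \<and> dips (insert b T) (insert b C) k}
       = {C. C \<subseteq> T \<and> Suc (card C) = j \<and> dips T C (Suc k)}"
      using insert k bT by (auto simp: dips_insert card_insert_if finite_subset subset_iff)
    finally have eq: "card {C. C \<subseteq> insert b T \<and> card C = j \<and> dips (insert b T) C k} =
       card {C. C \<subseteq> T \<and> Suc (card C) = j \<and> dips T C (Suc k)} + card {C. C \<subseteq> T \<and> card C = j \<and> dips T C k'}" .
    have cT: "card (insert b T) = Suc (card T)" using insert bT by simp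
    have r: "card {C. C \<subseteq> T \<and> card C = j \<and> dips T C k'} = card T choose (j + k')"
      using insert.prems k cT by (intro insert.IH) auto
    show ?thesis
    proof (cases j)
      case 0
      have "card T \<le> k'" using insert.prems 0 k cT by simp
      then have "card T choose k' = Suc (card T) choose Suc k'"
        by (cases "card T = k'") (auto simp: binomial_eq_0)
      then show ?thesis using eq r 0 k cT by simp
    next
      case (Suc j')
      have "card {C. C \<subseteq> T \<and> card C = j' \<and> dips T C (Suc k)} = card T choose (j' + Suc k)"
        using insert.prems k cT Suc by (intro insert.IH) auto
      then show ?thesis using eq r Suc k cT by (simp add: add.commute)
    qed
  qed
qed

lemma not_ballot_iff_dips:
  assumes "C \<subseteq> T"
  shows "\<not> ballot T C \<longleftrightarrow> dips T (T - C) 1"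
proof -
  have "T - (T - C) = C" using assms by auto
  then show ?thesis unfolding ballot_def dips_def by (auto simp: not_le less_eq_Suc_le)
qed

text \<open>Complementation turns the sets that fail the ballot condition into sets whose path
  reaches depth one. The ballot sets of size \<open>j\<close> correspond to the standard Young
  tableaux of shape \<open>(card T - j, j)\<close>.\<close>

lemma card_ballot:
  assumes "finite T" "2 * j \<le> card T"
  shows "card {C. C \<subseteq> T \<and> card C = j \<and> ballot T C} + card {C. C \<subseteq> T \<and> card C = card T - j \<and> dips T C 1}
    = card T choose j"
proof -
  have fin: "finite {C. C \<subseteq> T \<and> R C}" for R using assms(1) by auto
  have d: "dips T C 1 \<longleftrightarrow> \<not> ballot T (T - C)" if "C \<subseteq> T" for C
    using not_ballot_iff_dips[of "T - C" T] that by (simp add: double_diff)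
  have "bij_betw (\<lambda>C. T - C) {C. C \<subseteq> T \<and> card C = j \<and> \<not> ballot T C} {C. C \<subseteq> T \<and> card C = card T - j \<and> dips T C 1}"
  proof (rule bij_betwI[where g = "\<lambda>C. T - C"])
    show "(\<lambda>C. T - C) \<in> {C. C \<subseteq> T \<and> card C = j \<and> \<not> ballot T C} \<rightarrow> {C. C \<subseteq> T \<and> card C = card T - j \<and> dips T C 1}"
      using finite_subset[OF _ assms(1)] d[of "T - _"] by (simp add: Pi_iff card_Diff_subset double_diff)
    show "(\<lambda>C. T - C) \<in> {C. C \<subseteq> T \<and> card C = card T - j \<and> dips T C 1} \<rightarrow> {C. C \<subseteq> T \<and> card C = j \<and> \<not> ballot T C}"
      using finite_subset[OF _ assms(1)] assms(2) by (auto simp: card_Diff_subset d simp del: One_nat_def)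
  qed (simp_all add: double_diff)
  then have "card {C. C \<subseteq> T \<and> card C = card T - j \<and> dips T C 1} = card {C. C \<subseteq> T \<and> card C = j \<and> \<not> ballot T C}"
    by (rule bij_betw_same_card[symmetric])
  moreover have "card {C. C \<subseteq> T \<and> card C = j \<and> ballot T C} + card {C. C \<subseteq> T \<and> card C = j \<and> \<not> ballot T C}
    = card {C. C \<subseteq> T \<and> card C = j}"
  proof -
    have "{C. C \<subseteq> T \<and> card C = j} = {C. C \<subseteq> T \<and> card C = j \<and> ballot T C} \<union> {C. C \<subseteq> T \<and> card C = j \<and> \<not> ballot T C}"
      by blast
    moreover have "{C. C \<subseteq> T \<and> card C = j \<and> ballot T C} \<inter> {C. C \<subseteq> T \<and> card C = j \<and> \<not> ballot T C} = {}"
      by blast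
    ultimately show ?thesis using fin by (simp only: card_Un_disjoint)
  qed
  ultimately show ?thesis using n_subsets[OF assms(1)] by simp
qed

text \<open>The greatest depth reached by the path, zero if it never goes below its start.\<close>

definition dip :: "int set \<Rightarrow> int set \<Rightarrow> nat" where
  "dip T C = (LEAST k. \<forall>x. card {c\<in>T - C. x < c} \<le> card {c\<in>C. x < c} + k)"

lemma dip_le_iff:
  assumes "finite T"
  shows "dip T C \<le> k \<longleftrightarrow> (\<forall>x. card {c\<in>T - C. x < c} \<le> card {c\<in>C. x < c} + k)"
proof
  let ?R = "\<lambda>k. \<forall>x. card {c\<in>T - C. x < c} \<le> card {c\<in>C. x < c} + k"
  have "card {c\<in>T - C. x < c} \<le> card T" for x using assms by (intro card_mono) auto
  then have "?R (card T)" by (auto intro: trans_le_add2)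
  then have "?R (dip T C)" unfolding dip_def by (rule LeastI)
  then show "dip T C \<le> k \<Longrightarrow> ?R k" by (meson add_left_mono le_trans)
  show "?R k \<Longrightarrow> dip T C \<le> k" unfolding dip_def by (rule Least_le)
qed

lemma dips_iff_dip: "finite T \<Longrightarrow> dips T C (Suc k) \<longleftrightarrow> dip T C > k"
proof -
  assume fin: "finite T"
  have "dips T C (Suc k) \<longleftrightarrow> \<not> (\<forall>x. card {c\<in>T - C. x < c} \<le> card {c\<in>C. x < c} + k)"
    unfolding dips_def by (simp only: not_all not_le less_eq_Suc_le add_Suc_right)
  then show ?thesis unfolding dip_le_iff[OF fin, symmetric] by (simp only: not_le)
qed

text \<open>Both sides are the difference of \<open>2 * p choose (p + k)\<close> and
  \<open>2 * p choose (p + Suc k)\<close>. This equality is what matches the standard products of a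
  weight with the functionals separating its solutions.\<close>

lemma card_dip_eq_card_ballot:
  assumes "finite T" "card T = 2 * p" "k \<le> p"
  shows "card {C. C \<subseteq> T \<and> card C = p \<and> dip T C = k} = card {B. B \<subseteq> T \<and> card B = p - k \<and> ballot T B}"
proof -
  have fin: "finite {C. C \<subseteq> T \<and> R C}" for R using assms(1) by auto
  have "card {C. C \<subseteq> T \<and> card C = p \<and> dip T C = k} + card {C. C \<subseteq> T \<and> card C = p \<and> dips T C (Suc k)}
     = card {C. C \<subseteq> T \<and> card C = p \<and> dips T C k}"
  proof -
    have "dip T C = k \<or> dips T C (Suc k) \<longleftrightarrow> dips T C k" if "C \<subseteq> T" for C
      using that assms(1) by (cases k) (auto simp: dips_iff_dip dips_0)
    then have "{C. C \<subseteq> T \<and> card C = p \<and> dips T C k} = {C. C \<subseteq> T \<and> card C = p \<and> dip T C = k} \<union> {C. C \<subseteq> T \<and> card C = p \<and> dips T C (Suc k)}"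
      by blast
    moreover have "{C. C \<subseteq> T \<and> card C = p \<and> dip T C = k} \<inter> {C. C \<subseteq> T \<and> card C = p \<and> dips T C (Suc k)} = {}"
      using assms(1) by (auto simp: dips_iff_dip)
    ultimately show ?thesis using fin by (simp add: card_Un_disjoint)
  qed
  moreover have "card {C. C \<subseteq> T \<and> card C = p \<and> dips T C (Suc k)} = card T choose (p + Suc k)"
      "card {C. C \<subseteq> T \<and> card C = p \<and> dips T C k} = card T choose (p + k)"
    using assms(1,2) by (simp_all only: card_dips)
  ultimately have 1: "card {C. C \<subseteq> T \<and> card C = p \<and> dip T C = k} + (2 * p choose (p + Suc k)) = 2 * p choose (p + k)"
    using assms(2) by (simp only:)
  have "card {C. C \<subseteq> T \<and> card C = card T - (p - k) \<and> dips T C 1} = card T choose (card T - (p - k) + 1)"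
    using assms by (intro card_dips) auto
  moreover have "card T - (p - k) + 1 = p + Suc k" using assms by simp
  moreover have "card {B. B \<subseteq> T \<and> card B = p - k \<and> ballot T B} + card {C. C \<subseteq> T \<and> card C = card T - (p - k) \<and> dips T C 1}
      = card T choose (p - k)"
    using assms(2) by (intro card_ballot[OF assms(1)]) simp
  ultimately have 2: "card {B. B \<subseteq> T \<and> card B = p - k \<and> ballot T B} + (2 * p choose (p + Suc k)) = 2 * p choose (p - k)"
    using assms(2) by (simp only:)
  have "2 * p - (p - k) = p + k" using assms(3) by simp
  then have "2 * p choose (p - k) = 2 * p choose (p + k)"
    using binomial_symmetric[of "p - k" "2 * p"] by simp
  then show ?thesis using 1 2 by linarith
qed

section \<open>Linear algebra\<close>

text \<open>Gaussian elimination: a pivot \<open>i0\<close> of equation \<open>l\<close> is removed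
  from the other equations, and its own coefficient \<open>c0\<close> is then determined by equation
  \<open>l\<close>.\<close>

lemma nontrivial_linear_relation:
  fixes M :: "'l \<Rightarrow> 'i \<Rightarrow> complex"
  assumes "finite \<Lambda>"
  shows "finite I \<Longrightarrow> card \<Lambda> < card I \<Longrightarrow> \<exists>c. (\<exists>i\<in>I. c i \<noteq> 0) \<and> (\<forall>l\<in>\<Lambda>. (\<Sum>i\<in>I. c i * M l i) = 0)"
  using assms
proof (induction \<Lambda> arbitrary: I M rule: finite_induct)
  case empty
  then have "I \<noteq> {}" by auto
  then show ?case by (intro exI[of _ "\<lambda>_. 1"]) auto
next
  case (insert l \<Lambda>)
  show ?case
  proof (cases "\<forall>i\<in>I. M l i = 0")
    case True
    have "card \<Lambda> < card I" using insert.prems insert.hyps by simp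
    then obtain c where "\<exists>i\<in>I. c i \<noteq> 0" "\<forall>l\<in>\<Lambda>. (\<Sum>i\<in>I. c i * M l i) = 0"
      using insert.IH[OF insert.prems(1), of M] by blast
    then show ?thesis using True by (intro exI[of _ c]) simp
  next
    case False
    then obtain i0 where i0: "i0 \<in> I" "M l i0 \<noteq> 0" by blast
    define I' where "I' = I - {i0}"
    have I': "finite I'" "card \<Lambda> < card I'" "i0 \<notin> I'" "I = insert i0 I'"
      using insert.prems insert.hyps i0 by (auto simp: I'_def)
    define M' where "M' = (\<lambda>k i. M k i - M k i0 * (M l i / M l i0))"
    obtain c where c: "\<exists>i\<in>I'. c i \<noteq> 0" "\<forall>k\<in>\<Lambda>. (\<Sum>i\<in>I'. c i * M' k i) = 0"
      using insert.IH[OF I'(1,2), of M'] by blast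
    define c0 where "c0 = - (\<Sum>i\<in>I'. c i * (M l i / M l i0))"
    define c' where "c' = c(i0 := c0)"
    have s: "(\<Sum>i\<in>I. c' i * M k i) = c0 * M k i0 + (\<Sum>i\<in>I'. c i * M k i)" for k
    proof -
      have "(\<Sum>i\<in>I'. c' i * M k i) = (\<Sum>i\<in>I'. c i * M k i)"
        using I'(3) by (intro sum.cong) (auto simp: c'_def)
      then show ?thesis unfolding I'(4) using I'(1,3) by (simp add: c'_def)
    qed
    have "(\<Sum>i\<in>I. c' i * M k i) = (\<Sum>i\<in>I'. c i * M' k i)" for k
      unfolding s M'_def c0_def by (simp add: algebra_simps sum_subtractf sum_distrib_left)
    moreover have "(\<Sum>i\<in>I'. c i * M' l i) = 0" using i0(2) by (simp add: M'_def)
    ultimately have "\<forall>k\<in>insert l \<Lambda>. (\<Sum>i\<in>I. c' i * M k i) = 0" using c(2) by simp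
    moreover have "\<exists>i\<in>I. c' i \<noteq> 0" using c(1) I'(3,4) by (auto simp: c'_def)
    ultimately show ?thesis by blast
  qed
qed

locale function_subspace =
  fixes V :: "('w \<Rightarrow> complex) set"
  assumes zero: "(\<lambda>w. 0) \<in> V"
    and lincomb: "\<phi> \<in> V \<Longrightarrow> \<psi> \<in> V \<Longrightarrow> (\<lambda>w. a * \<phi> w + b * \<psi> w) \<in> V"
begin

lemma sum_mem: "finite S \<Longrightarrow> (\<And>s. s \<in> S \<Longrightarrow> f s \<in> V) \<Longrightarrow> (\<lambda>w. \<Sum>s\<in>S. c s * f s w) \<in> V"
proof (induction S rule: finite_induct)
  case empty
  then show ?case by (simp add: zero)
next
  case (insert x F)
  then have "(\<lambda>w. c x * f x w + 1 * (\<Sum>s\<in>F. c s * f s w)) \<in> V"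
    by (intro lincomb) auto
  then show ?case using insert.hyps by simp
qed

lemma minus_sum_mem:
  assumes "finite S" "\<phi> \<in> V" "\<And>s. s \<in> S \<Longrightarrow> f s \<in> V"
  shows "(\<lambda>w. \<phi> w - (\<Sum>s\<in>S. c s * f s w)) \<in> V"
  using lincomb[OF assms(2) sum_mem[of S f c, OF assms(1,3)], of 1 "-1"] by simp

text \<open>By independence some element of \<open>V\<close> has a value at \<open>s0\<close> other
  than the one predicted from its values on \<open>S\<close>. The difference vanishes on
  \<open>S\<close>; normalised, it is the new dual function and corrects the old ones at
  \<open>s0\<close>.\<close>

lemma dual_basis:
  assumes "finite S"
  shows "(\<And>a. \<forall>\<phi>\<in>V. (\<Sum>s\<in>S. a s * \<phi> s) = 0 \<Longrightarrow> \<forall>s\<in>S. a s = 0)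
    \<Longrightarrow> \<exists>f. \<forall>s\<in>S. f s \<in> V \<and> (\<forall>s'\<in>S. f s s' = (if s' = s then 1 else 0))"
  using assms
proof (induction S rule: finite_induct)
  case empty
  then show ?case by simp
next
  case (insert s0 S)
  have "\<forall>s\<in>S. a s = 0" if "\<forall>\<phi>\<in>V. (\<Sum>s\<in>S. a s * \<phi> s) = 0" for a
  proof -
    have "\<forall>\<phi>\<in>V. (\<Sum>s\<in>insert s0 S. (a(s0 := 0)) s * \<phi> s) = 0"
    proof
      fix \<phi> assume "\<phi> \<in> V"
      have "(\<Sum>s\<in>S. (a(s0 := 0)) s * \<phi> s) = (\<Sum>s\<in>S. a s * \<phi> s)"
        using insert.hyps by (intro sum.cong) auto
      then show "(\<Sum>s\<in>insert s0 S. (a(s0 := 0)) s * \<phi> s) = 0"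
        using that \<open>\<phi> \<in> V\<close> insert.hyps by simp
    qed
    from insert.prems[OF this] show ?thesis using insert.hyps(2) by (metis fun_upd_other insertCI)
  qed
  then obtain f where f: "\<And>s. s \<in> S \<Longrightarrow> f s \<in> V" "\<And>s s'. s \<in> S \<Longrightarrow> s' \<in> S \<Longrightarrow> f s s' = (if s' = s then 1 else 0)"
    using insert.IH by blast
  have "\<exists>\<phi>\<in>V. \<phi> s0 - (\<Sum>s\<in>S. \<phi> s * f s s0) \<noteq> 0"
  proof (rule ccontr)
    assume "\<not> ?thesis"
    then have z: "\<phi> s0 - (\<Sum>s\<in>S. \<phi> s * f s s0) = 0" if "\<phi> \<in> V" for \<phi> using that by blast
    have "\<forall>\<phi>\<in>V. (\<Sum>s\<in>insert s0 S. (\<lambda>s. if s = s0 then 1 else - f s s0) s * \<phi> s) = 0"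
    proof
      fix \<phi> assume "\<phi> \<in> V"
      have "(\<Sum>s\<in>S. (if s = s0 then 1 else - f s s0) * \<phi> s) = (\<Sum>s\<in>S. - (\<phi> s * f s s0))"
        using insert.hyps by (intro sum.cong) auto
      then show "(\<Sum>s\<in>insert s0 S. (\<lambda>s. if s = s0 then 1 else - f s s0) s * \<phi> s) = 0"
        using z[OF \<open>\<phi> \<in> V\<close>] insert.hyps by (simp add: sum_negf)
    qed
    from insert.prems[OF this] show False by auto
  qed
  then obtain \<phi> where \<phi>: "\<phi> \<in> V" "\<phi> s0 - (\<Sum>s\<in>S. \<phi> s * f s s0) \<noteq> 0" by blast
  define \<psi> where "\<psi> = (\<lambda>w. \<phi> w - (\<Sum>s\<in>S. \<phi> s * f s w))"
  have \<psi>V: "\<psi> \<in> V" unfolding \<psi>_def by (rule minus_sum_mem[OF insert.hyps(1) \<phi>(1) f(1)])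
  have \<psi>0: "\<psi> s0 \<noteq> 0" using \<phi>(2) by (simp add: \<psi>_def)
  have \<psi>S: "\<psi> s' = 0" if "s' \<in> S" for s'
  proof -
    have "(\<Sum>s\<in>S. \<phi> s * f s s') = (\<Sum>s\<in>S. if s = s' then \<phi> s else 0)"
      using f(2) that by (intro sum.cong) auto
    then show ?thesis using that insert.hyps by (simp add: \<psi>_def)
  qed
  define g where "g = (\<lambda>s. if s = s0 then (\<lambda>w. \<psi> w / \<psi> s0) else (\<lambda>w. f s w - f s s0 / \<psi> s0 * \<psi> w))"
  have "g s \<in> V \<and> (\<forall>s'\<in>insert s0 S. g s s' = (if s' = s then 1 else 0))" if "s \<in> insert s0 S" for s
  proof (cases "s = s0")
    case True
    have "(\<lambda>w. (1 / \<psi> s0) * \<psi> w + 0 * \<psi> w) \<in> V" by (rule lincomb[OF \<psi>V \<psi>V])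
    then show ?thesis using True \<psi>0 \<psi>S insert.hyps by (auto simp: g_def)
  next
    case False
    then have s: "s \<in> S" using that by simp
    have "(\<lambda>w. 1 * f s w + (- f s s0 / \<psi> s0) * \<psi> w) \<in> V" by (rule lincomb[OF f(1)[OF s] \<psi>V])
    then show ?thesis using False s \<psi>0 \<psi>S f(2)[OF s] insert.hyps by (auto simp: g_def)
  qed
  then show ?case by blast
qed

text \<open>Dimension count: at most \<open>card \<Lambda>\<close> linear forms separate the points of \<open>V\<close>, so at least as many
  independent evaluations span all evaluations.\<close>

lemma evaluations_span:
  fixes L :: "'l \<Rightarrow> 'w \<Rightarrow> complex"
  assumes "finite S" "finite \<Lambda>" "card \<Lambda> \<le> card S" "S \<subseteq> \<Omega>" "w \<in> \<Omega>"
    and indep: "\<And>a. \<forall>\<phi>\<in>V. (\<Sum>s\<in>S. a s * \<phi> s) = 0 \<Longrightarrow> \<forall>s\<in>S. a s = 0"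
    and sep: "\<And>\<phi>. \<phi> \<in> V \<Longrightarrow> \<forall>l\<in>\<Lambda>. (\<Sum>w\<in>\<Omega>. L l w * \<phi> w) = 0 \<Longrightarrow> \<forall>w\<in>\<Omega>. \<phi> w = 0"
  shows "\<exists>a. \<forall>\<phi>\<in>V. \<phi> w = (\<Sum>s\<in>S. a s * \<phi> s)"
proof -
  obtain f where f: "\<And>s. s \<in> S \<Longrightarrow> f s \<in> V" "\<And>s s'. s \<in> S \<Longrightarrow> s' \<in> S \<Longrightarrow> f s s' = (if s' = s then 1 else 0)"
    using dual_basis[OF assms(1) indep] by blast
  have vanish: "\<phi> w = 0" if \<phi>: "\<phi> \<in> V" "\<forall>s\<in>S. \<phi> s = 0" for \<phi>
  proof -
    \<comment> \<open>With the dual functions, \<phi> makes one element more than there are forms,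
      so some nontrivial combination is killed by all forms and vanishes on \<Omega>. Evaluation on
      \<open>S\<close> removes the coefficients of the dual functions, hence that of \<phi> is
      nonzero.\<close>
    define F where "F = (\<lambda>i. case i of None \<Rightarrow> \<phi> | Some s \<Rightarrow> f s)"
    define I where "I = insert None (Some ` S)"
    have I: "finite I" "card \<Lambda> < card I"
      using assms(1,3) by (auto simp: I_def card_image)
    obtain c where c: "\<exists>i\<in>I. c i \<noteq> 0" "\<forall>l\<in>\<Lambda>. (\<Sum>i\<in>I. c i * (\<Sum>w\<in>\<Omega>. L l w * F i w)) = 0"
      using nontrivial_linear_relation[OF assms(2) I, of "\<lambda>l i. \<Sum>w\<in>\<Omega>. L l w * F i w"] by blast
    define \<psi> where "\<psi> = (\<lambda>w. \<Sum>i\<in>I. c i * F i w)"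
    have "\<psi> \<in> V" unfolding \<psi>_def
      by (rule sum_mem[OF I(1)]) (auto simp: I_def F_def f \<phi>)
    moreover have "(\<Sum>w\<in>\<Omega>. L l w * \<psi> w) = (\<Sum>i\<in>I. c i * (\<Sum>w\<in>\<Omega>. L l w * F i w))" for l
      unfolding \<psi>_def sum_distrib_left by (subst sum.swap) (simp add: algebra_simps)
    ultimately have \<psi>0: "\<forall>w\<in>\<Omega>. \<psi> w = 0" using c(2) by (intro sep) auto
    have \<psi>: "\<psi> w = c None * \<phi> w + (\<Sum>s\<in>S. c (Some s) * f s w)" for w
      unfolding \<psi>_def I_def using assms(1) by (simp add: sum.reindex F_def)
    have cs: "c (Some s') = 0" if "s' \<in> S" for s'
    proof -
      have "(\<Sum>s\<in>S. c (Some s) * f s s') = (\<Sum>s\<in>S. if s = s' then c (Some s) else 0)"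
        using f(2) that by (intro sum.cong) auto
      then show ?thesis using \<psi>[of s'] \<psi>0 \<phi>(2) that assms(1,4) by auto
    qed
    then have "c None \<noteq> 0" using c(1) by (auto simp: I_def)
    then show ?thesis using \<psi>[of w] \<psi>0 cs assms(5) by simp
  qed
  have "\<phi> w = (\<Sum>s\<in>S. f s w * \<phi> s)" if \<phi>: "\<phi> \<in> V" for \<phi>
  proof -
    have "(\<lambda>w. \<phi> w - (\<Sum>s\<in>S. \<phi> s * f s w)) \<in> V" by (rule minus_sum_mem[OF assms(1) \<phi> f(1)])
    moreover have "\<phi> s' - (\<Sum>s\<in>S. \<phi> s * f s s') = 0" if "s' \<in> S" for s'
    proof -
      have "(\<Sum>s\<in>S. \<phi> s * f s s') = (\<Sum>s\<in>S. if s = s' then \<phi> s else 0)"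
        using f(2) that by (intro sum.cong) auto
      then show ?thesis using that assms(1) by simp
    qed
    ultimately have "\<phi> w - (\<Sum>s\<in>S. \<phi> s * f s w) = 0" by (intro vanish) auto
    then show ?thesis by (simp add: mult.commute)
  qed
  then show ?thesis by (intro exI[of _ "\<lambda>s. f s w"]) simp
qed

end

section \<open>Weight spaces of quadrics\<close>

lemma order_1_cancel:
  fixes u F :: "complex poly"
  assumes "poly u 1 \<noteq> 0" "[:-1, 1:] ^ k dvd u * F"
  shows "[:-1, 1:] ^ k dvd F"
proof (cases "F = 0")
  case False
  have "u \<noteq> 0" using assms(1) by auto
  then have "k \<le> order 1 (u * F)" using assms(2) False order_divides[of 1 k "u * F"] by auto
  moreover have "order 1 (u * F) = order 1 u + order 1 F" using \<open>u \<noteq> 0\<close> False by (intro order_mult) auto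
  moreover have "order 1 u = 0" using assms(1) by (rule order_0I)
  ultimately show ?thesis using order_divides[of 1 k F] by auto
qed auto

text \<open>The support lies in a window of length less than \<open>k\<close>. After division by the
  lowest power of the variable, a nonzero multiple of \<open>[:-1, 1:] ^ k\<close> would still have
  degree at least \<open>k\<close>.\<close>

lemma poly_narrow_eq_0:
  fixes G :: "complex poly"
  assumes "[:-1, 1:] ^ k dvd G" "\<And>i. coeff G i \<noteq> 0 \<Longrightarrow> M < 2 * i + k \<and> 2 * i < M + k"
  shows "G = 0"
proof (rule ccontr)
  assume G: "G \<noteq> 0"
  define l where "l = (LEAST i. coeff G i \<noteq> 0)"
  have "coeff G (degree G) \<noteq> 0" using G by simp
  then have l: "coeff G l \<noteq> 0" and low: "\<forall>i<l. coeff G i = 0"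
    unfolding l_def by (rule LeastI) (use not_less_Least in blast)
  then have "monom 1 l dvd G" by (subst monom_1_dvd_iff') auto
  then obtain H where H: "G = monom 1 l * H" by (elim dvdE)
  then have H0: "H \<noteq> 0" using G by auto
  have "[:-1, 1:] ^ k dvd H" using assms(1) unfolding H
    by (rule order_1_cancel[rotated]) (simp add: poly_monom)
  then have "k \<le> order 1 H" using H0 order_divides[of 1 k H] by auto
  also have "\<dots> \<le> degree H" using H0 by (rule order_degree)
  finally have "k \<le> degree H" .
  moreover have "degree G = l + degree H" unfolding H using H0 by (simp add: degree_mult_eq degree_monom_eq)
  ultimately have "l + k \<le> degree G" by simp
  moreover have "M < 2 * l + k" using assms(2)[OF l] by simp
  moreover have "2 * degree G < M + k" using assms(2)[OF \<open>coeff G (degree G) \<noteq> 0\<close>] by simp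
  ultimately show False by linarith
qed

definition fpoly :: "nat \<Rightarrow> (int set \<times> nat \<Rightarrow> complex) \<Rightarrow> int set \<Rightarrow> complex poly" where
  "fpoly M \<phi> C = (\<Sum>i\<le>M. monom (\<phi> (C, i)) i)"

text \<open>The linear conditions satisfied by the products of two coordinates of one weight on
  every map: interchange of the two factors, and the exchange relations in the form of divisibility.
  The set \<open>C\<close> distributes the letters that are not common to both factors, and
  \<open>i\<close> distributes the exponent.\<close>

definition sols :: "int set \<Rightarrow> nat \<Rightarrow> nat \<Rightarrow> (int set \<times> nat \<Rightarrow> complex) set" where
  "sols T p M = {\<phi>. (\<forall>C\<subseteq>T. card C = p \<longrightarrow> (\<forall>i\<le>M. \<phi> (T - C, i) = (-1) ^ p * \<phi> (C, M - i))) \<and>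
     (\<forall>D\<subseteq>T. card D \<le> p \<longrightarrow> [:-1, 1:] ^ (p - card D) dvd upsum T p (fpoly M \<phi>) D)}"

text \<open>The inequality puts the heights of the first factor below those of the second at every
  gap, see \<open>std_ht_le\<close>.\<close>

definition std_pairs :: "int set \<Rightarrow> nat \<Rightarrow> nat \<Rightarrow> (int set \<times> nat) set" where
  "std_pairs T p M = {(C, i). C \<subseteq> T \<and> card C = p \<and> 2 * i + dip T C \<le> M}"

text \<open>A pair stands for coefficient \<open>i\<close> of the sum over the supersets of
  \<open>B\<close>. Ballot sets and the lower part of the exponents are enough to separate solutions
  and are exactly as many as \<open>std_pairs\<close>.\<close>

definition test_pairs :: "int set \<Rightarrow> nat \<Rightarrow> nat \<Rightarrow> (int set \<times> nat) set" where
  "test_pairs T p M = {(B, i). B \<subseteq> T \<and> card B \<le> p \<and> ballot T B \<and> 2 * i + (p - card B) \<le> M}"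

lemma coeff_fpoly: "coeff (fpoly M \<phi> C) i = (if i \<le> M then \<phi> (C, i) else 0)"
  unfolding fpoly_def by (simp add: coeff_sum)

lemma coeff_upsum: "coeff (upsum T p (fpoly M \<phi>) D) i = (if i \<le> M then upsum T p (\<lambda>C. \<phi> (C, i)) D else 0)"
  unfolding upsum_def by (simp add: coeff_sum coeff_fpoly)

text \<open>Both sets are fibred over \<open>k\<close>, which is \<open>dip T C\<close> on one side
  and \<open>p - card B\<close> on the other; the range of \<open>i\<close> depends on
  \<open>k\<close> alone.\<close>

lemma card_pairs:
  assumes "finite T" "card T = 2 * p"
  shows "finite (std_pairs T p M)" "finite (test_pairs T p M)" "card (test_pairs T p M) = card (std_pairs T p M)"
proof -
  let ?I = "\<lambda>k. {i. 2 * i + k \<le> M}"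
  let ?A = "\<lambda>k. {C. C \<subseteq> T \<and> card C = p \<and> dip T C = k} \<times> ?I k"
  let ?B = "\<lambda>k. {B. B \<subseteq> T \<and> card B = p - k \<and> ballot T B} \<times> ?I k"
  have finI: "finite (?I k)" for k by (rule finite_subset[of _ "{..M}"]) auto
  have fin: "finite {C. C \<subseteq> T \<and> R C}" for R using assms(1) by auto
  have "dip T C \<le> p" if "C \<subseteq> T" "card C = p" for C
  proof -
    have "card {c\<in>T - C. x < c} \<le> card (T - C)" for x using assms(1) by (intro card_mono) auto
    moreover have "card (T - C) = p" using that assms finite_subset[of C T] by (simp add: card_Diff_subset)
    ultimately have "\<forall>x. card {c\<in>T - C. x < c} \<le> card {c\<in>C. x < c} + p" by (metis trans_le_add2)
    then show ?thesis using dip_le_iff[OF assms(1)] by blast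
  qed
  then have A: "std_pairs T p M = (\<Union>k\<in>{..p}. ?A k)" by (auto simp: std_pairs_def)
  have B: "test_pairs T p M = (\<Union>k\<in>{..p}. ?B k)"
  proof (rule Set.set_eqI)
    fix z show "z \<in> test_pairs T p M \<longleftrightarrow> z \<in> (\<Union>k\<in>{..p}. ?B k)"
    proof
      assume "z \<in> test_pairs T p M"
      then show "z \<in> (\<Union>k\<in>{..p}. ?B k)"
        by (intro UN_I[of "p - card (fst z)"]) (auto simp: test_pairs_def)
    qed (auto simp: test_pairs_def)
  qed
  show "finite (std_pairs T p M)" "finite (test_pairs T p M)"
    unfolding A B using finI fin by auto
  have "card (test_pairs T p M) = (\<Sum>k\<in>{..p}. card (?B k))" unfolding B
    using finI fin by (intro card_UN_disjoint) auto
  also have "\<dots> = (\<Sum>k\<in>{..p}. card (?A k))"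
    using card_dip_eq_card_ballot[OF assms] by (intro sum.cong) (simp_all add: card_cartesian_product)
  also have "\<dots> = card (std_pairs T p M)" unfolding A
    using finI fin by (intro card_UN_disjoint[symmetric]) auto
  finally show "card (test_pairs T p M) = card (std_pairs T p M)" .
qed

text \<open>Once all sums at sets smaller than \<open>j\<close> vanish, the sums at sets of size
  \<open>j\<close> obey the relations of the ballot problem, so only ballot sets matter. There the
  tests kill the low coefficients, the symmetry kills the high ones, and the remaining window is too
  narrow for the required divisibility.\<close>

lemma sols_separation:
  assumes T: "finite T" "card T = 2 * p" and \<phi>: "\<phi> \<in> sols T p M"
    and test: "\<And>B i. (B, i) \<in> test_pairs T p M \<Longrightarrow> upsum T p (\<lambda>C. \<phi> (C, i)) B = 0"
    and C: "C \<subseteq> T" "card C = p" "i \<le> M"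
  shows "\<phi> (C, i) = 0"
proof -
  interpret Y: divisible_subgroup "{0 :: complex poly}"
    by unfold_locales auto
  let ?G = "upsum T p (fpoly M \<phi>)"
  have G0: "B \<subseteq> T \<Longrightarrow> card B \<le> p \<Longrightarrow> ?G B = 0" for B
  proof (induction "card B" arbitrary: B rule: less_induct)
    case less
    define j where "j = card B"
    have H: "?G D \<in> {0}" if "D \<subseteq> T" "card D < j" for D
      using less.hyps[of D] that less.prems(2) by (simp add: j_def)
    have base: "(\<Sum>e\<in>T - D. ?G (insert e D)) \<in> {0}" if "D \<subseteq> T" "Suc (card D) = j" for D
      using sum_upsum_insert[OF T(1) that(1), of p "fpoly M \<phi>"] H[OF that(1)] that(2) less.prems(2)
      by (simp add: j_def)
    have bal: "?G B' \<in> {0}" if B': "B' \<subseteq> T" "card B' = j" "ballot T B'" for B'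
    proof -
      define k where "k = p - j"
      have fB': "finite B'" by (rule finite_subset[OF B'(1) T(1)])
      have "upsum_off T p (fpoly M \<phi>) {} B' - (-1) ^ card B' * ?G ({} \<union> B') \<in> {0}"
        by (rule Y.upsum_off_flip[OF T(1) H fB']) (use B' in auto)
      then have off: "upsum_off T p (fpoly M \<phi>) {} B' = (-1) ^ j * ?G B'" using B'(2) by simp
      have coff: "upsum_off T p (\<lambda>C. \<phi> (C, i)) {} B' = (-1) ^ j * coeff (?G B') i" if "i \<le> M" for i
      proof -
        have "coeff (upsum_off T p (fpoly M \<phi>) {} B') i = coeff ((-1) ^ j * ?G B') i" by (simp only: off)
        moreover have "coeff ((-1) ^ j * ?G B') i = (-1) ^ j * coeff (?G B') i"
          by (cases "even j") simp_all
        ultimately show ?thesis using that by (simp add: upsum_off_def coeff_sum coeff_fpoly)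
      qed
      \<comment> \<open>Complements turn the sets containing \<open>B'\<close> into those avoiding
        it, and \<open>off\<close> turns these back: the coefficients of \<open>?G B'\<close> are
        symmetric under \<open>i\<close> to \<open>M - i\<close> up to sign.\<close>
      have anti: "coeff (?G B') (M - i) = (-1) ^ p * ((-1) ^ j * coeff (?G B') i)" if "i \<le> M" for i
      proof -
        have "coeff (?G B') (M - i) = (\<Sum>C | B' \<subseteq> C \<and> C \<subseteq> T \<and> card C = p. \<phi> (C, M - i))"
          unfolding coeff_upsum by (simp add: upsum_def)
        also have "\<dots> = (\<Sum>C | B' \<subseteq> C \<and> C \<subseteq> T \<and> card C = p. (-1) ^ p * \<phi> (T - C, i))"
        proof (rule sum.cong[OF refl])
          fix C assume "C \<in> {C. B' \<subseteq> C \<and> C \<subseteq> T \<and> card C = p}"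
          then have "\<phi> (T - C, i) = (-1) ^ p * \<phi> (C, M - i)" using \<phi> that by (simp add: sols_def)
          moreover have "(-1) ^ p * (-1) ^ p = (1 :: complex)" by (simp flip: power_add)
          ultimately show "\<phi> (C, M - i) = (-1) ^ p * \<phi> (T - C, i)"
            by (simp flip: mult.assoc)
        qed
        also have "\<dots> = (\<Sum>C | {} \<subseteq> C \<and> C \<subseteq> T \<and> C \<inter> B' = {} \<and> card C = p. (-1) ^ p * \<phi> (C, i))"
        proof (rule sum.reindex_bij_witness[where i = "\<lambda>C. T - C" and j = "\<lambda>C. T - C"])
          fix C assume C: "C \<in> {C. B' \<subseteq> C \<and> C \<subseteq> T \<and> card C = p}"
          then have "finite C" using T(1) finite_subset[of C T] by simp
          then show "T - C \<in> {C. {} \<subseteq> C \<and> C \<subseteq> T \<and> C \<inter> B' = {} \<and> card C = p}"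
            using C T by (auto simp: card_Diff_subset)
          show "T - (T - C) = C" using C by auto
        next
          fix C assume C: "C \<in> {C. {} \<subseteq> C \<and> C \<subseteq> T \<and> C \<inter> B' = {} \<and> card C = p}"
          then have "finite C" using T(1) finite_subset[of C T] by simp
          then show "T - C \<in> {C. B' \<subseteq> C \<and> C \<subseteq> T \<and> card C = p}"
            using C T B'(1) by (auto simp: card_Diff_subset)
          show "T - (T - C) = C" using C by auto
        qed simp
        also have "\<dots> = (-1) ^ p * upsum_off T p (\<lambda>C. \<phi> (C, i)) {} B'"
          by (simp add: upsum_off_def sum_distrib_left)
        finally show ?thesis by (simp only: coff[OF that])
      qed
      have low: "coeff (?G B') i = 0" if "2 * i + k \<le> M" for i
        using test[of B' i] that B' less.prems(2) by (simp add: test_pairs_def k_def j_def coeff_upsum)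
      have "?G B' = 0"
      proof (rule poly_narrow_eq_0)
        have "\<forall>D\<subseteq>T. card D \<le> p \<longrightarrow> [:-1, 1:] ^ (p - card D) dvd ?G D"
          using \<phi> unfolding sols_def by blast
        then have "[:-1, 1:] ^ (p - card B') dvd ?G B'"
          using B'(1,2) less.prems(2) j_def by auto
        then show "[:-1, 1:] ^ k dvd ?G B'" using B'(2) by (simp only: k_def)
        show "M < 2 * i + k \<and> 2 * i < M + k" if "coeff (?G B') i \<noteq> 0" for i
        proof (rule ccontr)
          assume a: "\<not> ?thesis"
          have iM: "i \<le> M" using that by (auto simp: coeff_upsum split: if_splits)
          show False
          proof (cases "2 * i + k \<le> M")
            case True then show False using low that by simp
          next
            case False
            then have "2 * (M - i) + k \<le> M" using a iM by auto
            then have "coeff (?G B') (M - i) = 0" by (rule low)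
            then show False using anti[OF iM] that by simp
          qed
        qed
      qed
      then show ?thesis by simp
    qed
    have "?G B \<in> {0}"
      by (rule Y.ballot_span[OF T(1) base bal less.prems(1) j_def[symmetric]])
    then show ?case by simp
  qed
  have "?G C = fpoly M \<phi> C" using C by (intro upsum_full[OF T(1)])
  then have "coeff (fpoly M \<phi> C) i = 0" using G0[of C] C by simp
  then show ?thesis using C by (simp add: coeff_fpoly)
qed

lemma function_subspace_sols:
  assumes "finite T"
  shows "function_subspace (sols T p M)"
proof
  have "fpoly M (\<lambda>w. 0) = (\<lambda>C. 0)" by (auto simp: fpoly_def)
  then show "(\<lambda>w. 0) \<in> sols T p M" by (simp add: sols_def upsum_def)
next
  fix \<phi> \<psi> :: "int set \<times> nat \<Rightarrow> complex" and a b
  assume \<phi>: "\<phi> \<in> sols T p M" and \<psi>: "\<psi> \<in> sols T p M"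
  have f: "fpoly M (\<lambda>w. a * \<phi> w + b * \<psi> w) C = smult a (fpoly M \<phi> C) + smult b (fpoly M \<psi> C)" for C
    by (rule poly_eqI) (simp add: coeff_fpoly)
  have u: "upsum T p (fpoly M (\<lambda>w. a * \<phi> w + b * \<psi> w)) D
      = smult a (upsum T p (fpoly M \<phi>) D) + smult b (upsum T p (fpoly M \<psi>) D)" for D
    by (rule poly_eqI) (simp add: upsum_def f coeff_sum sum.distrib sum_distrib_left)
  show "(\<lambda>w. a * \<phi> w + b * \<psi> w) \<in> sols T p M"
    unfolding sols_def mem_Collect_eq u
  proof (intro conjI allI impI)
    fix C i assume "C \<subseteq> T" "card C = p" "i \<le> M"
    then show "a * \<phi> (T - C, i) + b * \<psi> (T - C, i) = (-1) ^ p * (a * \<phi> (C, M - i) + b * \<psi> (C, M - i))"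
      using \<phi> \<psi> by (simp add: sols_def algebra_simps)
  next
    fix D assume "D \<subseteq> T" "card D \<le> p"
    then show "[:-1, 1:] ^ (p - card D) dvd smult a (upsum T p (fpoly M \<phi>) D) + smult b (upsum T p (fpoly M \<psi>) D)"
      using \<phi> \<psi> by (intro dvd_add dvd_smult) (auto simp: sols_def)
  qed
qed

text \<open>The count closes here: independent evaluations that are as many as the separating
  functionals must span. Independence stays a hypothesis, because it is proved by families of maps
  and not from the equations.\<close>

lemma sols_straightening:
  assumes T: "finite T" "card T = 2 * p" and C: "C \<subseteq> T" "card C = p" "i \<le> M"
    and indep: "\<And>a. \<forall>\<phi>\<in>sols T p M. (\<Sum>s\<in>std_pairs T p M. a s * \<phi> s) = 0 \<Longrightarrow> \<forall>s\<in>std_pairs T p M. a s = 0"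
  shows "\<exists>a. \<forall>\<phi>\<in>sols T p M. \<phi> (C, i) = (\<Sum>s\<in>std_pairs T p M. a s * \<phi> s)"
proof -
  interpret function_subspace "sols T p M" by (rule function_subspace_sols[OF T(1)])
  define \<Omega> where "\<Omega> = {C. C \<subseteq> T \<and> card C = p} \<times> {..M}"
  define L :: "int set \<times> nat \<Rightarrow> int set \<times> nat \<Rightarrow> complex" where
    "L = (\<lambda>(B, i) (C, i'). if B \<subseteq> C \<and> i' = i then 1 else 0)"
  have fin: "finite {C. C \<subseteq> T \<and> card C = p}" using T(1) by auto
  have L: "(\<Sum>w\<in>\<Omega>. L (B, i) w * \<phi> w) = upsum T p (\<lambda>C. \<phi> (C, i)) B" if "i \<le> M" for B i \<phi>
  proof -
    have "(\<Sum>w\<in>\<Omega>. L (B, i) w * \<phi> w) = (\<Sum>C | C \<subseteq> T \<and> card C = p. \<Sum>i'\<le>M. L (B, i) (C, i') * \<phi> (C, i'))"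
      unfolding \<Omega>_def by (simp add: sum.cartesian_product)
    also have "\<dots> = (\<Sum>C | C \<subseteq> T \<and> card C = p. if B \<subseteq> C then \<phi> (C, i) else 0)"
    proof (rule sum.cong[OF refl])
      fix C
      have "(\<Sum>i'\<le>M. L (B, i) (C, i') * \<phi> (C, i')) = (\<Sum>i'\<le>M. if i' = i then (if B \<subseteq> C then \<phi> (C, i) else 0) else 0)"
        by (intro sum.cong) (auto simp: L_def)
      then show "(\<Sum>i'\<le>M. L (B, i) (C, i') * \<phi> (C, i')) = (if B \<subseteq> C then \<phi> (C, i) else 0)"
        using that by simp
    qed
    also have "\<dots> = upsum T p (\<lambda>C. \<phi> (C, i)) B"
      unfolding upsum_def using fin by (subst sum.inter_filter[symmetric]) (auto intro!: sum.cong)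
    finally show ?thesis .
  qed
  show ?thesis
  proof (rule evaluations_span[where L = L and \<Lambda> = "test_pairs T p M" and \<Omega> = \<Omega>])
    show "finite (std_pairs T p M)" "finite (test_pairs T p M)" "card (test_pairs T p M) \<le> card (std_pairs T p M)"
      using card_pairs[OF T, of M] by auto
    show "std_pairs T p M \<subseteq> \<Omega>" by (auto simp: std_pairs_def \<Omega>_def)
    show "(C, i) \<in> \<Omega>" using C by (auto simp: \<Omega>_def)
    show "\<forall>s\<in>std_pairs T p M. a s = 0" if "\<forall>\<phi>\<in>sols T p M. (\<Sum>s\<in>std_pairs T p M. a s * \<phi> s) = 0" for a
      using that by (rule indep)
    show "\<forall>w\<in>\<Omega>. \<phi> w = 0" if "\<phi> \<in> sols T p M" "\<forall>l\<in>test_pairs T p M. (\<Sum>w\<in>\<Omega>. L l w * \<phi> w) = 0" for \<phi>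
    proof -
      have "upsum T p (\<lambda>C. \<phi> (C, i)) B = 0" if Bi: "(B, i) \<in> test_pairs T p M" for B i
      proof -
        have "i \<le> M" using Bi by (auto simp: test_pairs_def)
        then show ?thesis using L[of i B \<phi>] \<open>\<forall>l\<in>test_pairs T p M. _ l = 0\<close> Bi by auto
      qed
      from sols_separation[OF T that(1) this] show ?thesis by (auto simp: \<Omega>_def)
    qed
  qed
qed

section \<open>Determinants with rows selected by a list\<close>

text \<open>Inversions between two blocks; the parity is the sign of merging two sorted
  lists.\<close>

definition invs :: "int set \<Rightarrow> int set \<Rightarrow> nat" where
  "invs A B = (\<Sum>a\<in>A. card {b\<in>B. b < a})"

lemma sort_sign_Cons:
  "sort_sign (x # xs) = (-1) ^ length (filter (\<lambda>y. y < x) xs) * sort_sign xs"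
proof -
  let ?S = "\<lambda>xs :: int list. {(j, k). j < k \<and> k < length xs \<and> xs ! j > xs ! k}"
  let ?A = "{k. k < length xs \<and> xs ! k < x}"
  have fin: "finite (?S ys)" for ys :: "int list"
    by (rule finite_subset[of _ "{..<length ys} \<times> {..<length ys}"]) auto
  have "?S (x # xs) = (\<lambda>k. (0, Suc k)) ` ?A \<union> map_prod Suc Suc ` ?S xs" (is "_ = ?L \<union> ?R")
  proof (rule Set.set_eqI, clarify)
    fix j k
    show "(j, k) \<in> ?S (x # xs) \<longleftrightarrow> (j, k) \<in> ?L \<union> ?R"
      by (cases j; cases k) auto
  qed
  moreover have "?L \<inter> ?R = {}" by auto
  moreover have "card ?L = card ?A" by (rule card_image) (auto simp: inj_on_def)
  moreover have "card ?R = card (?S xs)" by (rule card_image) (auto simp: inj_on_def)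
  ultimately have "card (?S (x # xs)) = card ?A + card (?S xs)"
    using fin[of xs] by (simp add: card_Un_disjoint)
  then show ?thesis
    unfolding sort_sign_def by (simp add: power_add length_filter_conv_card)
qed

lemma sort_sign_Nil: "sort_sign [] = 1"
  by (simp add: sort_sign_def)

lemma sort_sign_append:
  "sort_sign (xs @ ys) = sort_sign xs * sort_sign ys * (-1) ^ (\<Sum>x\<leftarrow>xs. length (filter (\<lambda>y. y < x) ys))"
  by (induction xs) (simp_all add: sort_sign_Nil sort_sign_Cons power_add)

lemma sort_sign_append_distinct:
  assumes "distinct xs" "distinct ys"
  shows "sort_sign (xs @ ys) = sort_sign xs * sort_sign ys * (-1) ^ invs (set xs) (set ys)"
proof -
  have "length (filter (\<lambda>y. y < x) ys) = card {b \<in> set ys. b < x}" for x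
    using distinct_card[of "filter (\<lambda>y. y < x) ys"] assms(2) by simp
  then have "(\<Sum>x\<leftarrow>xs. length (filter (\<lambda>y. y < x) ys)) = invs (set xs) (set ys)"
    unfolding invs_def using assms(1) by (simp add: sum_list_distinct_conv_sum_set)
  then show ?thesis unfolding sort_sign_append by simp
qed

lemma sort_sign_sorted: "sorted xs \<Longrightarrow> sort_sign xs = 1"
proof (induction xs)
  case (Cons x xs)
  then have "filter (\<lambda>y. y < x) xs = []" by (auto simp: filter_empty_conv)
  then show ?case using Cons by (simp add: sort_sign_Cons)
qed (simp add: sort_sign_Nil)

lemma sort_sign_square: "sort_sign xs * sort_sign xs = 1"
  unfolding sort_sign_def by (simp flip: power_add)

lemma of_int_sort_sign_square: "of_int (sort_sign xs) * (of_int (sort_sign xs) * a) = (a :: 'a :: comm_ring_1)"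
  by (simp flip: mult.assoc of_int_mult add: sort_sign_square)

text \<open>Detached from determinants so that the sorting rule also applies when only an initial
  part of the list of rows is permuted.\<close>

locale alternating =
  fixes g :: "int list \<Rightarrow> 'a::comm_ring_1" and m :: nat
  assumes swap: "length pre + length post + 2 = m \<Longrightarrow> g (pre @ x # y # post) = - g (pre @ y # x # post)"
begin

lemma insort_sign:
  "sorted ys \<Longrightarrow> length pre + length ys + 1 = m \<Longrightarrow>
    g (pre @ x # ys) = (-1) ^ length (filter (\<lambda>y. y < x) ys) * g (pre @ insort x ys)"
proof (induction ys arbitrary: pre)
  case (Cons y ys)
  show ?case
  proof (cases "x \<le> y")
    case True
    then have "filter (\<lambda>y. y < x) (y # ys) = []" using Cons.prems(1) by (auto simp: filter_empty_conv)
    then show ?thesis using True by simp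
  next
    case False
    have "g (pre @ x # y # ys) = - g ((pre @ [y]) @ x # ys)"
      using swap[of pre ys x y] Cons.prems(2) by simp
    also have "g ((pre @ [y]) @ x # ys) = (-1) ^ length (filter (\<lambda>y. y < x) ys) * g ((pre @ [y]) @ insort x ys)"
      using Cons.prems by (intro Cons.IH) auto
    finally show ?thesis using False by simp
  qed
qed simp

lemma sort_sign_eq:
  "length pre + length xs = m \<Longrightarrow> g (pre @ xs) = of_int (sort_sign xs) * g (pre @ sort xs)"
proof (induction xs arbitrary: pre)
  case (Cons x xs)
  have "length (filter (\<lambda>y. y < x) (sort xs)) = length (filter (\<lambda>y. y < x) xs)"
    by (simp add: filter_sort)
  then have i: "g (pre @ x # sort xs) = (-1) ^ length (filter (\<lambda>y. y < x) xs) * g (pre @ insort x (sort xs))"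
    using insort_sign[of "sort xs" pre x] Cons.prems by simp
  have "g (pre @ x # xs) = of_int (sort_sign xs) * g (pre @ x # sort xs)"
    using Cons.IH[of "pre @ [x]"] Cons.prems by simp
  then show ?case unfolding i by (simp add: sort_sign_Cons ac_simps)
qed (simp add: sort_sign_Nil)

lemma permutation_eq:
  assumes "distinct xs" "length xs = m"
  shows "g xs = of_int (sort_sign xs) * g (sorted_list_of_set (set xs))"
  using sort_sign_eq[of "[]" xs] assms by (simp add: sorted_list_of_set_sort_remdups distinct_remdups_id)

end

definition mdet :: "nat \<Rightarrow> (int \<Rightarrow> nat \<Rightarrow> 'a::comm_ring_1) \<Rightarrow> int list \<Rightarrow> 'a" where
  "mdet m U xs = det (mat m m (\<lambda>(i, j). U (xs ! i) j))"

lemma permutes_less: "\<sigma> permutes {0..<m::nat} \<Longrightarrow> i < m \<Longrightarrow> \<sigma> i < m"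
  using permutes_in_image[of \<sigma> "{0..<m}" i] by simp

lemma mdet_expand:
  "mdet m U xs = (\<Sum>\<sigma> | \<sigma> permutes {0..<m}. of_int (sign \<sigma>) * (\<Prod>i = 0..<m. U (xs ! i) (\<sigma> i)))"
  unfolding mdet_def
  by (subst det_def'[of _ m]) (auto intro!: sum.cong prod.cong simp: permutes_less)

lemma minor_eq_mdet: "minor n U A = mdet n U (sorted_list_of_set A)"
  unfolding minor_def mdet_expand by (simp add: atLeast0LessThan)

lemma mdet_permute:
  assumes "length xs = m" "\<sigma> permutes {0..<m}"
  shows "mdet m U (map (\<lambda>i. xs ! \<sigma> i) [0..<m]) = of_int (sign \<sigma>) * mdet m U xs"
proof -
  let ?A = "mat m m (\<lambda>(i, j). U (xs ! i) j)"
  have "mat m m (\<lambda>(i, j). ?A $$ (\<sigma> i, j)) = mat m m (\<lambda>(i, j). U (map (\<lambda>i. xs ! \<sigma> i) [0..<m] ! i) j)"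
    using assms(2) by (intro cong_mat) (auto simp: permutes_less)
  then show ?thesis unfolding mdet_def using det_permute_rows[of ?A m \<sigma>] assms(2) by simp
qed

lemma mdet_swap:
  assumes "length pre + length post + 2 = m"
  shows "mdet m U (pre @ x # y # post) = - mdet m U (pre @ y # x # post)"
proof -
  let ?xs = "pre @ y # x # post" and ?k = "length pre"
  let ?\<sigma> = "Transposition.transpose ?k (Suc ?k)"
  have \<sigma>: "?\<sigma> permutes {0..<m}" using assms by (intro permutes_swap_id) auto
  have "pre @ x # y # post = map (\<lambda>i. ?xs ! ?\<sigma> i) [0..<m]"
  proof (rule nth_equalityI)
    show "length (pre @ x # y # post) = length (map (\<lambda>i. ?xs ! ?\<sigma> i) [0..<m])" using assms by simp
    fix i assume "i < length (pre @ x # y # post)"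
    then have "i < m" using assms by simp
    moreover have "(pre @ x # y # post) ! i = ?xs ! ?\<sigma> i"
    proof (cases "i = ?k \<or> i = Suc ?k")
      case False
      then have "?\<sigma> i = i" by (auto simp: transpose_def)
      then show ?thesis using False by (auto simp: nth_append nth_Cons split: nat.splits)
    qed (auto simp: nth_append)
    ultimately show "(pre @ x # y # post) ! i = map (\<lambda>i. ?xs ! ?\<sigma> i) [0..<m] ! i" by simp
  qed
  then have "mdet m U (pre @ x # y # post) = of_int (sign ?\<sigma>) * mdet m U ?xs"
    using mdet_permute[OF _ \<sigma>, of ?xs U] assms by simp
  then show ?thesis by (simp add: sign_swap_id)
qed

lemma alternating_mdet: "alternating (mdet m U) m"
  by unfold_locales (rule mdet_swap)

lemma mdet_sort: "distinct xs \<Longrightarrow> length xs = m \<Longrightarrow>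
    mdet m U xs = of_int (sort_sign xs) * mdet m U (sorted_list_of_set (set xs))"
  by (rule alternating.permutation_eq[OF alternating_mdet])

lemma mdet_append_sort:
  assumes "distinct xs" "length xs + length ys = m"
  shows "mdet m U (xs @ ys) = of_int (sort_sign xs) * mdet m U (sorted_list_of_set (set xs) @ ys)"
proof -
  have "alternating (\<lambda>xs. mdet m U (xs @ ys)) (length xs)"
  proof
    fix pre post :: "int list" and x y assume "length pre + length post + 2 = length xs"
    then show "mdet m U ((pre @ x # y # post) @ ys) = - mdet m U ((pre @ y # x # post) @ ys)"
      using mdet_swap[of pre "post @ ys" m U x y] assms(2) by simp
  qed
  from alternating.permutation_eq[OF this assms(1) refl] show ?thesis .
qed

lemma mdet_not_distinct:
  assumes "length xs = m" "\<not> distinct xs"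
  shows "mdet m U xs = 0"
proof -
  obtain i j where ij: "i < m" "j < m" "i \<noteq> j" "xs ! i = xs ! j"
    using assms by (auto simp: distinct_conv_nth)
  show ?thesis unfolding mdet_def
    by (rule det_identical_rows[of _ m i j]) (use ij in auto)
qed

lemma bij_betw_permutations_of_set:
  assumes "finite P" "card P = m"
  shows "bij_betw (\<lambda>\<sigma>. map (\<lambda>i. sorted_list_of_set P ! \<sigma> i) [0..<m]) {\<sigma>. \<sigma> permutes {0..<m}} (permutations_of_set P)"
    (is "bij_betw ?f ?S _")
proof -
  let ?P = "sorted_list_of_set P"
  have P: "length ?P = m" "distinct ?P" "set ?P = P" using assms by auto
  have inj: "inj_on ?f ?S"
  proof (rule inj_onI)
    fix \<sigma> \<tau> assume s: "\<sigma> \<in> ?S" "\<tau> \<in> ?S" "?f \<sigma> = ?f \<tau>"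
    show "\<sigma> = \<tau>"
    proof
      fix i show "\<sigma> i = \<tau> i"
      proof (cases "i < m")
        case True
        then have "?P ! \<sigma> i = ?P ! \<tau> i" using s(3) by (auto simp: map_eq_conv)
        moreover have "\<sigma> i < m" "\<tau> i < m" using s True by (auto simp: permutes_less)
        ultimately show ?thesis using P nth_eq_iff_index_eq[of ?P] by simp
      next
        case False
        then show ?thesis using s(1,2) permutes_not_in[of \<sigma> "{0..<m}" i] permutes_not_in[of \<tau> "{0..<m}" i] by simp
      qed
    qed
  qed
  have sub: "?f ` ?S \<subseteq> permutations_of_set P"
  proof
    fix xs assume "xs \<in> ?f ` ?S"
    then obtain \<sigma> where \<sigma>: "\<sigma> permutes {0..<m}" and xs: "xs = ?f \<sigma>" by auto
    have "set xs = (\<lambda>i. ?P ! i) ` \<sigma> ` {0..<m}" unfolding xs by (simp add: image_image)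
    also have "\<dots> = (\<lambda>i. ?P ! i) ` {0..<m}" using permutes_image[OF \<sigma>] by simp
    also have "\<dots> = P" using P by (metis atLeast_upt list.set_map map_nth atLeast0LessThan)
    finally have s: "set xs = P" .
    have "length xs = m" unfolding xs by simp
    then have "distinct xs" using s assms by (auto intro: card_distinct)
    then show "xs \<in> permutations_of_set P" using s by auto
  qed
  have "card (?f ` ?S) = card (permutations_of_set P)"
    using assms inj by (simp add: card_image card_permutations)
  then have "?f ` ?S = permutations_of_set P"
    using sub by (intro card_subset_eq) auto
  then show ?thesis using inj by (simp add: bij_betw_def)
qed

text \<open>Both signs are values of one determinant, that of a permutation matrix: once by sorting
  its rows, once by the permutation of its rows.\<close>

lemma sort_sign_permute:
  assumes "finite P" "card P = m" "\<sigma> permutes {0..<m}"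
  shows "sort_sign (map (\<lambda>i. sorted_list_of_set P ! \<sigma> i) [0..<m]) = sign \<sigma>"
proof -
  let ?P = "sorted_list_of_set P"
  let ?xs = "map (\<lambda>i. ?P ! \<sigma> i) [0..<m]"
  define U :: "int \<Rightarrow> nat \<Rightarrow> int" where "U = (\<lambda>r j. if r = ?P ! j then 1 else 0)"
  have P: "length ?P = m" "distinct ?P" "set ?P = P" using assms by auto
  have "mat m m (\<lambda>(i, j). U (?P ! i) j) = 1\<^sub>m m"
    using P by (intro eq_matI) (auto simp: U_def nth_eq_iff_index_eq)
  then have one: "mdet m U ?P = 1" unfolding mdet_def by simp
  have "?xs \<in> permutations_of_set P"
    using bij_betw_permutations_of_set[OF assms(1,2)] assms(3) by (auto simp: bij_betw_def)
  then have "set ?xs = P" "distinct ?xs" using permutations_of_setD[of ?xs P] by blast+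
  then have "mdet m U ?xs = of_int (sort_sign ?xs)"
    using mdet_sort[of ?xs m U] one by simp
  moreover have "mdet m U ?xs = of_int (sign \<sigma>)"
    using mdet_permute[OF P(1) assms(3), of U] one by simp
  ultimately show ?thesis by simp
qed

lemma det_eq_sum_permutations:
  fixes W :: "int \<Rightarrow> nat \<Rightarrow> 'a::comm_ring_1"
  assumes "finite P" "card P = m"
  shows "(\<Sum>xs\<in>permutations_of_set P. of_int (sort_sign xs) * (\<Prod>i<m. W (xs ! i) i))
     = det (mat m m (\<lambda>(r, i). W (sorted_list_of_set P ! r) i))"
proof -
  let ?P = "sorted_list_of_set P"
  let ?M = "mat m m (\<lambda>(r, i). W (?P ! r) i)"
  have "det ?M = det (transpose_mat ?M)" by (rule det_transpose[of ?M m, symmetric]) simp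
  also have "\<dots> = (\<Sum>\<sigma> | \<sigma> permutes {0..<m}. of_int (sign \<sigma>) * (\<Prod>i = 0..<m. W (?P ! \<sigma> i) i))"
    by (subst det_def'[of _ m]) (auto intro!: sum.cong prod.cong simp: permutes_less)
  also have "\<dots> = (\<Sum>\<sigma> | \<sigma> permutes {0..<m}. of_int (sort_sign (map (\<lambda>i. ?P ! \<sigma> i) [0..<m])) *
      (\<Prod>i<m. W (map (\<lambda>i. ?P ! \<sigma> i) [0..<m] ! i) i))"
    using sort_sign_permute[OF assms]
    by (intro sum.cong refl arg_cong2[of _ _ _ _ "(*)"] prod.cong) (auto simp: atLeast0LessThan)
  also have "\<dots> = (\<Sum>xs\<in>permutations_of_set P. of_int (sort_sign xs) * (\<Prod>i<m. W (xs ! i) i))"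
    by (rule sum.reindex_bij_betw[OF bij_betw_permutations_of_set[OF assms]])
  finally show ?thesis by simp
qed

text \<open>Subtracting the congruent columns leaves \<open>k\<close> multiples of \<open>q\<close>.
  The column operations are collected in the triangular factor \<open>E\<close>, whose last
  \<open>k\<close> diagonal entries are \<open>q\<close>.\<close>

lemma det_dvd_congruent_columns:
  fixes f :: "nat \<Rightarrow> nat \<Rightarrow> 'a::comm_ring_1"
  assumes "\<And>i. n \<le> i \<Longrightarrow> i < n + k \<Longrightarrow> \<exists>j<n. \<forall>r. q dvd f r i - f r j"
  shows "q ^ k dvd det (mat (n + k) (n + k) (\<lambda>(r, i). f r i))"
proof -
  let ?m = "n + k"
  obtain J where J: "\<And>i. n \<le> i \<Longrightarrow> i < ?m \<Longrightarrow> J i < n \<and> (\<forall>r. q dvd f r i - f r (J i))"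
    using assms by metis
  have "\<exists>h. \<forall>r i. n \<le> i \<longrightarrow> i < ?m \<longrightarrow> f r i - f r (J i) = q * h r i"
  proof -
    have "\<forall>r i. \<exists>h. n \<le> i \<longrightarrow> i < ?m \<longrightarrow> f r i - f r (J i) = q * h"
      using J by (meson dvdE)
    then show ?thesis by metis
  qed
  then obtain h where h: "\<And>r i. n \<le> i \<Longrightarrow> i < ?m \<Longrightarrow> f r i - f r (J i) = q * h r i" by blast
  define B where "B = mat ?m ?m (\<lambda>(r, i). if i < n then f r i else h r i)"
  define E where "E = mat ?m ?m (\<lambda>(l, i). if l = i then (if i < n then 1 else q) else if n \<le> i \<and> l = J i then 1 else 0)"
  have BE: "B \<in> carrier_mat ?m ?m" "E \<in> carrier_mat ?m ?m" by (auto simp: B_def E_def)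
  have "mat ?m ?m (\<lambda>(r, i). f r i) = B * E"
  proof (rule eq_matI)
    fix r i assume "r < dim_row (B * E)" "i < dim_col (B * E)"
    then have r: "r < ?m" and i: "i < ?m" by (auto simp: B_def E_def)
    have "(B * E) $$ (r, i) = (\<Sum>l\<in>{0..<?m}. B $$ (r, l) * E $$ (l, i))"
      using r i by (simp add: B_def E_def scalar_prod_def)
    also have "\<dots> = f r i"
    proof (cases "i < n")
      case True
      have "(\<Sum>l\<in>{0..<?m}. B $$ (r, l) * E $$ (l, i)) = (\<Sum>l\<in>{0..<?m}. if l = i then f r i else 0)"
        using r i True by (intro sum.cong) (auto simp: B_def E_def)
      then show ?thesis using i by simp
    next
      case False
      then have Ji: "J i < n" "J i \<noteq> i" "J i < ?m" using J[of i] i by auto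
      have "(\<Sum>l\<in>{0..<?m}. B $$ (r, l) * E $$ (l, i)) =
         (\<Sum>l\<in>{0..<?m}. (if l = i then h r i * q else 0) + (if l = J i then f r (J i) else 0))"
        using r i False Ji by (intro sum.cong) (auto simp: B_def E_def)
      also have "\<dots> = h r i * q + f r (J i)" using i Ji by (simp add: sum.distrib)
      also have "\<dots> = f r i" using h[of i r] False i by (simp add: algebra_simps)
      finally show ?thesis .
    qed
    finally show "mat ?m ?m (\<lambda>(r, i). f r i) $$ (r, i) = (B * E) $$ (r, i)" using r i by simp
  qed (simp_all add: B_def E_def)
  then have "det (mat ?m ?m (\<lambda>(r, i). f r i)) = det B * det E" using det_mult[OF BE] by simp
  moreover have "det E = q ^ k"
  proof -
    have "upper_triangular E"
    proof (rule upper_triangularI)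
      fix i l assume "l < i" "i < dim_row E"
      then have "\<not> (n \<le> l \<and> i = J l)" using J[of l] by (auto simp: E_def)
      then show "E $$ (i, l) = 0" using \<open>l < i\<close> \<open>i < dim_row E\<close> by (auto simp: E_def)
    qed
    then have "det E = prod_list (diag_mat E)" using BE(2) by (rule det_upper_triangular)
    also have "\<dots> = (\<Prod>i\<in>{0..<?m}. if i < n then 1 else q)"
      unfolding prod_list_diag_prod by (intro prod.cong) (auto simp: E_def)
    also have "\<dots> = q ^ card ({0..<?m} \<inter> - {i. i < n})"
      by (subst prod.If_cases) simp_all
    also have "{0..<?m} \<inter> - {i. i < n} = {n..<?m}" by auto
    finally show ?thesis by simp
  qed
  ultimately show ?thesis by simp
qed

section \<open>The exchange relations on maps to the Grassmannian\<close>

lemma sort_sign_sets: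
  assumes "finite A" "finite B"
  shows "sort_sign (sorted_list_of_set A @ sorted_list_of_set B) = (-1) ^ invs A B"
  using assms by (subst sort_sign_append_distinct) (simp_all add: sort_sign_sorted)

text \<open>Arrangements are grouped by the set \<open>C\<close> of their first \<open>n\<close>
  entries. Within a group the signs of rearranging the two blocks cancel against the signs of the
  minors, so all members contribute the same.\<close>

lemma sum_permutations_split:
  fixes U U' :: "int \<Rightarrow> nat \<Rightarrow> 'a::comm_ring_1"
  assumes P: "finite P" "card P = n + k" and Q: "length Q + k = n"
  shows "(\<Sum>xs\<in>permutations_of_set P. of_int (sort_sign xs) * mdet n U' (take n xs) * mdet n U (drop n xs @ Q))
    = of_nat (fact n * fact k) * (\<Sum>C | C \<subseteq> P \<and> card C = n.
        of_int ((-1) ^ invs C (P - C)) * mdet n U' (sorted_list_of_set C) * mdet n U (sorted_list_of_set (P - C) @ Q))"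
proof -
  let ?g = "\<lambda>xs. of_int (sort_sign xs) * mdet n U' (take n xs) * mdet n U (drop n xs @ Q)"
  let ?t = "\<lambda>C. of_int ((-1) ^ invs C (P - C)) * mdet n U' (sorted_list_of_set C) * mdet n U (sorted_list_of_set (P - C) @ Q)"
  let ?F = "{C. C \<subseteq> P \<and> card C = n}"
  let ?S = "permutations_of_set P"
  have finF: "finite ?F" using P(1) by auto
  have maps: "(\<lambda>xs. set (take n xs)) ` ?S \<subseteq> ?F"
  proof
    fix C assume "C \<in> (\<lambda>xs. set (take n xs)) ` ?S"
    then obtain xs where xs: "set xs = P" "distinct xs" and C: "C = set (take n xs)"
      by (auto dest: permutations_of_setD)
    have "length xs = n + k" using xs P(2) distinct_card by metis
    then show "C \<in> ?F" using xs set_take_subset[of n xs] distinct_card[of "take n xs"] by (simp add: C)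
  qed
  have fiber: "(\<Sum>xs\<in>{xs \<in> ?S. set (take n xs) = C}. ?g xs) = of_nat (fact n * fact k) * ?t C" if C: "C \<in> ?F" for C
  proof -
    have fC: "finite C" "finite (P - C)" "card C = n" "card (P - C) = k" "C \<subseteq> P"
      using C P finite_subset[of C P] by (auto simp: card_Diff_subset)
    let ?R = "permutations_of_set C \<times> permutations_of_set (P - C)"
    have len: "length ys = n" "length zs = k" if "(ys, zs) \<in> ?R" for ys zs
      using that fC length_finite_permutations_of_set by auto
    have im: "{xs \<in> ?S. set (take n xs) = C} = (\<lambda>(ys, zs). ys @ zs) ` ?R"
    proof (intro equalityI subsetI)
      fix xs assume "xs \<in> {xs \<in> ?S. set (take n xs) = C}"
      then have xs: "set xs = P" "distinct xs" "set (take n xs) = C" by (auto dest: permutations_of_setD)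
      have "set (take n xs) \<union> set (drop n xs) = P" using xs(1) by (simp flip: set_append)
      moreover have "set (take n xs) \<inter> set (drop n xs) = {}" using xs(2) by (rule set_take_disj_set_drop_if_distinct) simp
      ultimately have "set (drop n xs) = P - C" using xs(3) by blast
      then have "(take n xs, drop n xs) \<in> ?R" using xs by (auto intro!: permutations_of_setI)
      then show "xs \<in> (\<lambda>(ys, zs). ys @ zs) ` ?R" by (intro image_eqI[of _ _ "(take n xs, drop n xs)"]) auto
    next
      fix xs assume "xs \<in> (\<lambda>(ys, zs). ys @ zs) ` ?R"
      then obtain ys zs where yz: "(ys, zs) \<in> ?R" "xs = ys @ zs" by auto
      then have "set ys = C" "distinct ys" "set zs = P - C" "distinct zs" by (auto dest: permutations_of_setD)
      then show "xs \<in> {xs \<in> ?S. set (take n xs) = C}"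
        using yz(2) len[OF yz(1)] fC(5) by (auto intro!: permutations_of_setI)
    qed
    have inj: "inj_on (\<lambda>(ys, zs). ys @ zs) ?R"
      by (rule inj_onI) (use len in fastforce)
    have "(\<Sum>xs\<in>{xs \<in> ?S. set (take n xs) = C}. ?g xs) = (\<Sum>(ys, zs)\<in>?R. ?g (ys @ zs))"
      unfolding im by (subst sum.reindex[OF inj]) (simp add: case_prod_unfold)
    also have "\<dots> = (\<Sum>(ys, zs)\<in>?R. ?t C)"
    proof (rule sum.cong[OF refl], clarify)
      fix ys zs assume yz: "ys \<in> permutations_of_set C" "zs \<in> permutations_of_set (P - C)"
      then have s: "set ys = C" "distinct ys" "set zs = P - C" "distinct zs" by (auto dest: permutations_of_setD)
      have l: "length ys = n" "length zs = k" using len yz by auto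
      have 1: "mdet n U' ys = of_int (sort_sign ys) * mdet n U' (sorted_list_of_set C)"
        using mdet_sort[OF s(2) l(1), of U'] s(1) by simp
      have 2: "mdet n U (zs @ Q) = of_int (sort_sign zs) * mdet n U (sorted_list_of_set (P - C) @ Q)"
        using mdet_append_sort[OF s(4), of Q n U] l(2) Q s(3) by simp
      have "of_int (sort_sign (ys @ zs)) = (of_int (sort_sign ys) * of_int (sort_sign zs) * of_int ((-1) ^ invs C (P - C)) :: 'a)"
        using sort_sign_append_distinct[OF s(2,4)] s(1,3) by (simp only: of_int_mult)
      then have "?g (ys @ zs) = of_int (sort_sign ys) * of_int (sort_sign zs) * of_int ((-1) ^ invs C (P - C))
         * (of_int (sort_sign ys) * mdet n U' (sorted_list_of_set C)) * (of_int (sort_sign zs) * mdet n U (sorted_list_of_set (P - C) @ Q))"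
        using l 1 2 by simp
      also have "\<dots> = of_int (sort_sign ys) * (of_int (sort_sign ys) * (of_int (sort_sign zs) * (of_int (sort_sign zs) * ?t C)))"
        by (simp only: ac_simps)
      also have "\<dots> = ?t C" by (simp only: of_int_sort_sign_square)
      finally show "?g (ys @ zs) = ?t C" .
    qed
    also have "\<dots> = of_nat (card ?R) * ?t C" by simp
    also have "card ?R = fact n * fact k" using fC by (simp add: card_cartesian_product)
    finally show ?thesis .
  qed
  have "(\<Sum>xs\<in>?S. ?g xs) = (\<Sum>C\<in>?F. \<Sum>xs\<in>{xs \<in> ?S. set (take n xs) = C}. ?g xs)"
    by (rule sum.group[OF _ finF maps, symmetric]) simp
  also have "\<dots> = (\<Sum>C\<in>?F. of_nat (fact n * fact k) * ?t C)" by (rule sum.cong[OF refl fiber])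
  finally show ?thesis by (simp only: sum_distrib_left)
qed

text \<open>Expanding both minors yields determinants of size \<open>n + k\<close> made of all
  \<open>n\<close> columns of \<open>U'\<close> and \<open>k\<close> columns of \<open>U\<close>.
  Modulo \<open>q\<close> each of the latter repeats one of the former. For \<open>U = U'\<close>
  these are the classical exchange relations.\<close>

lemma sum_permutations_dvd:
  fixes U U' :: "int \<Rightarrow> nat \<Rightarrow> 'a::comm_ring_1"
  assumes P: "finite P" "card P = n + k" and Q: "length Q + k = n"
    and dvd: "\<And>r j. q dvd U r j - U' r j"
  shows "q ^ k dvd (\<Sum>xs\<in>permutations_of_set P. of_int (sort_sign xs) * mdet n U' (take n xs) * mdet n U (drop n xs @ Q))"
proof -
  let ?S = "permutations_of_set P" and ?Per = "{\<sigma> :: nat \<Rightarrow> nat. \<sigma> permutes {0..<n}}"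
  define W where "W = (\<lambda>\<rho> \<sigma> r i. if i < n then U' r (\<rho> i) else U r (\<sigma> (i - n)))"
  define c where "c = (\<lambda>(\<rho> :: nat \<Rightarrow> nat) \<sigma>. of_int (sign \<rho>) * of_int (sign \<sigma>) * (\<Prod>i = k..<n. U (Q ! (i - k)) (\<sigma> i)))"
  have trm: "of_int (sort_sign xs) * mdet n U' (take n xs) * mdet n U (drop n xs @ Q) =
     (\<Sum>\<rho>\<in>?Per. \<Sum>\<sigma>\<in>?Per. c \<rho> \<sigma> * (of_int (sort_sign xs) * (\<Prod>i<n + k. W \<rho> \<sigma> (xs ! i) i)))" (is "?l = ?r")
    if xs: "xs \<in> ?S" for xs
  proof -
    have len: "length xs = n + k" using xs P length_finite_permutations_of_set by metis
    have 1: "(\<Prod>i = 0..<n. U' (take n xs ! i) (\<rho> i)) = (\<Prod>i = 0..<n. W \<rho> \<sigma> (xs ! i) i)" for \<rho> \<sigma>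
      by (rule prod.cong) (auto simp: W_def)
    have 2: "(\<Prod>i = 0..<n. U ((drop n xs @ Q) ! i) (\<sigma> i)) =
        (\<Prod>i = n..<n + k. W \<rho> \<sigma> (xs ! i) i) * (\<Prod>i = k..<n. U (Q ! (i - k)) (\<sigma> i))" for \<rho> \<sigma>
    proof -
      have "(\<Prod>i = 0..<n. U ((drop n xs @ Q) ! i) (\<sigma> i)) =
        (\<Prod>i = 0..<k. U ((drop n xs @ Q) ! i) (\<sigma> i)) * (\<Prod>i = k..<n. U ((drop n xs @ Q) ! i) (\<sigma> i))"
        using Q by (intro prod.atLeastLessThan_concat[symmetric]) auto
      also have "(\<Prod>i = k..<n. U ((drop n xs @ Q) ! i) (\<sigma> i)) = (\<Prod>i = k..<n. U (Q ! (i - k)) (\<sigma> i))"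
        using len by (intro prod.cong) (auto simp: nth_append)
      also have "(\<Prod>i = 0..<k. U ((drop n xs @ Q) ! i) (\<sigma> i)) = (\<Prod>i = 0 + n..<k + n. W \<rho> \<sigma> (xs ! i) i)"
        unfolding prod.shift_bounds_nat_ivl using len by (intro prod.cong) (auto simp: nth_append W_def add.commute)
      finally show ?thesis by (simp add: add.commute)
    qed
    have 3: "(\<Prod>i<n + k. W \<rho> \<sigma> (xs ! i) i) = (\<Prod>i = 0..<n. W \<rho> \<sigma> (xs ! i) i) * (\<Prod>i = n..<n + k. W \<rho> \<sigma> (xs ! i) i)" for \<rho> \<sigma>
      unfolding lessThan_atLeast0 by (rule prod.atLeastLessThan_concat[symmetric]) auto
    have "?l = of_int (sort_sign xs) * (\<Sum>\<rho>\<in>?Per. \<Sum>\<sigma>\<in>?Per. (of_int (sign \<rho>) * (\<Prod>i = 0..<n. U' (take n xs ! i) (\<rho> i))) *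
        (of_int (sign \<sigma>) * (\<Prod>i = 0..<n. U ((drop n xs @ Q) ! i) (\<sigma> i))))"
      unfolding mdet_expand by (simp only: sum_product mult.assoc)
    also have "\<dots> = ?r"
      unfolding sum_distrib_left
    proof (intro sum.cong refl)
      fix \<rho> \<sigma>
      show "of_int (sort_sign xs) * (of_int (sign \<rho>) * (\<Prod>i = 0..<n. U' (take n xs ! i) (\<rho> i)) *
            (of_int (sign \<sigma>) * (\<Prod>i = 0..<n. U ((drop n xs @ Q) ! i) (\<sigma> i))))
         = c \<rho> \<sigma> * (of_int (sort_sign xs) * (\<Prod>i<n + k. W \<rho> \<sigma> (xs ! i) i))"
        unfolding 1[of \<rho> \<sigma>] 2[of \<sigma> \<rho>] 3 c_def by (simp only: ac_simps)
    qed
    finally show ?thesis .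
  qed
  have "(\<Sum>xs\<in>?S. of_int (sort_sign xs) * mdet n U' (take n xs) * mdet n U (drop n xs @ Q)) =
     (\<Sum>xs\<in>?S. \<Sum>\<rho>\<in>?Per. \<Sum>\<sigma>\<in>?Per. c \<rho> \<sigma> * (of_int (sort_sign xs) * (\<Prod>i<n + k. W \<rho> \<sigma> (xs ! i) i)))"
    by (rule sum.cong[OF refl trm])
  also have "\<dots> = (\<Sum>\<rho>\<in>?Per. \<Sum>xs\<in>?S. \<Sum>\<sigma>\<in>?Per. c \<rho> \<sigma> * (of_int (sort_sign xs) * (\<Prod>i<n + k. W \<rho> \<sigma> (xs ! i) i)))"
    by (rule sum.swap)
  also have "\<dots> = (\<Sum>\<rho>\<in>?Per. \<Sum>\<sigma>\<in>?Per. \<Sum>xs\<in>?S. c \<rho> \<sigma> * (of_int (sort_sign xs) * (\<Prod>i<n + k. W \<rho> \<sigma> (xs ! i) i)))"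
    by (rule sum.cong[OF refl sum.swap])
  also have "\<dots> = (\<Sum>\<rho>\<in>?Per. \<Sum>\<sigma>\<in>?Per. c \<rho> \<sigma> * det (mat (n + k) (n + k) (\<lambda>(r, i). W \<rho> \<sigma> (sorted_list_of_set P ! r) i)))"
    unfolding sum_distrib_left[symmetric] det_eq_sum_permutations[OF P] ..
  finally have eq: "(\<Sum>xs\<in>?S. of_int (sort_sign xs) * mdet n U' (take n xs) * mdet n U (drop n xs @ Q)) = \<dots>" .
  have "q ^ k dvd det (mat (n + k) (n + k) (\<lambda>(r, i). W \<rho> \<sigma> (sorted_list_of_set P ! r) i))"
    if \<rho>: "\<rho> permutes {0..<n}" and \<sigma>: "\<sigma> permutes {0..<n}" for \<rho> \<sigma>
  proof (rule det_dvd_congruent_columns[where f = "\<lambda>r i. W \<rho> \<sigma> (sorted_list_of_set P ! r) i"])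
    fix i assume i: "n \<le> i" "i < n + k"
    then have "\<sigma> (i - n) < n" using Q permutes_less[OF \<sigma>, of "i - n"] by linarith
    then have "\<sigma> (i - n) \<in> \<rho> ` {0..<n}" using permutes_image[OF \<rho>] by simp
    then obtain j where j: "j < n" "\<rho> j = \<sigma> (i - n)" by auto
    then show "\<exists>j<n. \<forall>r. q dvd W \<rho> \<sigma> (sorted_list_of_set P ! r) i - W \<rho> \<sigma> (sorted_list_of_set P ! r) j"
      using i dvd by (intro exI[of _ j]) (auto simp: W_def)
  qed
  then show ?thesis unfolding eq by (intro dvd_sum dvd_mult) auto
qed

lemma exchange_dvd:
  fixes U U' :: "int \<Rightarrow> nat \<Rightarrow> complex poly"
  assumes P: "finite P" "card P = n + k" and Q: "length Q + k = n"
    and dvd: "\<And>r j. q dvd U r j - U' r j"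
  shows "q ^ k dvd (\<Sum>C | C \<subseteq> P \<and> card C = n.
        of_int ((-1) ^ invs C (P - C)) * mdet n U' (sorted_list_of_set C) * mdet n U (sorted_list_of_set (P - C) @ Q))"
    (is "_ dvd ?S")
proof -
  let ?c = "fact n * fact k :: nat"
  have c: "(of_nat ?c :: complex) \<noteq> 0" by simp
  have "q ^ k dvd of_nat ?c * ?S"
    using sum_permutations_dvd[where U = U and U' = U', OF P Q dvd] unfolding sum_permutations_split[OF P Q] .
  also have "(of_nat ?c :: complex poly) * ?S = smult (of_nat ?c) ?S"
    by (simp only: of_nat_poly) simp
  finally show ?thesis using c dvd_smult_cancel by blast
qed

lemma invs_Un_left: "finite A \<Longrightarrow> finite B \<Longrightarrow> A \<inter> B = {} \<Longrightarrow> invs (A \<union> B) C = invs A C + invs B C"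
  unfolding invs_def by (rule sum.union_disjoint)

lemma invs_Un_right:
  assumes "finite B" "finite C" "B \<inter> C = {}"
  shows "invs A (B \<union> C) = invs A B + invs A C"
proof -
  have "card {b \<in> B \<union> C. b < a} = card {b \<in> B. b < a} + card {b \<in> C. b < a}" for a
  proof -
    have "{b \<in> B \<union> C. b < a} = {b \<in> B. b < a} \<union> {b \<in> C. b < a}" by auto
    then show ?thesis using assms by (subst card_Un_disjoint[symmetric]) auto
  qed
  then show ?thesis unfolding invs_def by (simp add: sum.distrib)
qed

lemma invs_add_swap:
  assumes "finite A" "finite B" "A \<inter> B = {}"
  shows "invs A B + invs B A = card A * card B"
proof -
  have c: "card {x \<in> S. R x} = (\<Sum>x\<in>S. if R x then 1 else 0)" if "finite S" for S :: "int set" and R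
    using that by (simp add: sum.If_cases Int_def)
  have "invs B A = (\<Sum>b\<in>B. \<Sum>a\<in>A. if a < b then 1 else 0)"
    unfolding invs_def using c[OF assms(1)] by simp
  also have "\<dots> = (\<Sum>a\<in>A. \<Sum>b\<in>B. if a < b then 1 else 0)" by (rule sum.swap)
  finally have "invs A B + invs B A = (\<Sum>a\<in>A. \<Sum>b\<in>B. (if b < a then 1 else 0) + (if a < b then 1 else 0))"
    unfolding invs_def using c[OF assms(2)] by (simp add: sum.distrib)
  also have "\<dots> = (\<Sum>a\<in>A. \<Sum>b\<in>B. 1)"
    using assms(3) by (intro sum.cong refl) (auto simp: not_less_iff_gr_or_eq)
  finally show ?thesis by simp
qed

lemma laplace_row_replaced:
  fixes A :: "'a::comm_ring_1 mat"
  assumes A: "A \<in> carrier_mat n n" and j: "j < n"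
  shows "det (mat n n (\<lambda>(i, l). if i = j then v l else A $$ (i, l))) = (\<Sum>l<n. v l * adj_mat A $$ (l, j))"
proof -
  let ?B = "mat n n (\<lambda>(i, l). if i = j then v l else A $$ (i, l))"
  have "det ?B = (\<Sum>l<n. ?B $$ (j, l) * cofactor ?B j l)"
    using j by (intro laplace_expansion_row) auto
  also have "\<dots> = (\<Sum>l<n. v l * adj_mat A $$ (l, j))"
  proof (rule sum.cong[OF refl])
    fix l assume "l \<in> {..<n}"
    moreover have "mat_delete ?B j l = mat_delete A j l"
      unfolding mat_delete_def using A j by (intro cong_mat) auto
    ultimately show "?B $$ (j, l) * cofactor ?B j l = v l * adj_mat A $$ (l, j)"
      using A j by (simp add: adj_mat_def cofactor_def)
  qed
  finally show ?thesis .
qed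

text \<open>Cramer's rule: replacing single rows of a maximal minor yields another frame, up to the
  adjugate matrix.\<close>

lemma mdet_replaced_frame:
  fixes V :: "int \<Rightarrow> nat \<Rightarrow> 'a::comm_ring_1"
  assumes L: "length L = n"
    and W: "\<And>k j. k \<in> set xs \<union> set L \<Longrightarrow> j < n \<Longrightarrow> W k j = mdet n V (L[j := k])" and xs: "length xs = n"
  shows "mdet n W xs * mdet n V L = mdet n V xs * mdet n V L ^ n"
proof -
  define A where "A = mat n n (\<lambda>(i, l). V (L ! i) l)"
  have A: "A \<in> carrier_mat n n" by (simp add: A_def)
  have adjA: "adj_mat A \<in> carrier_mat n n" "A * adj_mat A = det A \<cdot>\<^sub>m 1\<^sub>m n"
    using adj_mat[OF A] by auto
  have Wkj: "W k j = (\<Sum>l<n. V k l * adj_mat A $$ (l, j))" if "k \<in> set xs \<union> set L" "j < n" for k j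
  proof -
    have "mdet n V (L[j := k]) = det (mat n n (\<lambda>(i, l). if i = j then V k l else A $$ (i, l)))"
      unfolding mdet_def using that L by (intro arg_cong[of _ _ det] cong_mat) (auto simp: A_def nth_list_update)
    then show ?thesis using W[OF that] laplace_row_replaced[OF A that(2), of "V k"] by simp
  qed
  have m: "mdet n W ys = mdet n V ys * det (adj_mat A)" if ys: "length ys = n" "set ys \<subseteq> set xs \<union> set L" for ys
  proof -
    let ?V = "mat n n (\<lambda>(i, l). V (ys ! i) l)"
    have "mat n n (\<lambda>(i, j). W (ys ! i) j) = ?V * adj_mat A"
    proof (rule eq_matI)
      fix i j assume "i < dim_row (?V * adj_mat A)" "j < dim_col (?V * adj_mat A)"
      then have ij: "i < n" "j < n" using adjA by auto
      then have "ys ! i \<in> set ys" using ys by simp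
      then have "ys ! i \<in> set xs \<union> set L" using ys(2) by blast
      then show "mat n n (\<lambda>(i, j). W (ys ! i) j) $$ (i, j) = (?V * adj_mat A) $$ (i, j)"
        using ij Wkj adjA by (simp add: scalar_prod_def lessThan_atLeast0)
    qed (use adjA in auto)
    then show ?thesis unfolding mdet_def using det_mult[of ?V n "adj_mat A"] adjA by simp
  qed
  have "mdet n V L * det (adj_mat A) = det (A * adj_mat A)"
    using det_mult[OF A adjA(1)] by (simp add: mdet_def A_def)
  also have "\<dots> = mdet n V L ^ n" unfolding adjA(2) by (simp add: mdet_def A_def)
  finally have "mdet n V L * det (adj_mat A) = mdet n V L ^ n" .
  moreover have "mdet n W xs * mdet n V L = mdet n V xs * (mdet n V L * det (adj_mat A))"
    using m[OF xs] by (simp add: ac_simps)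
  ultimately show ?thesis by simp
qed

section \<open>Plucker coordinates along a map as polynomials, and their exchange relations\<close>

definition plpoly :: "nat \<Rightarrow> (pvar \<Rightarrow> complex) \<Rightarrow> int set \<Rightarrow> complex poly" where
  "plpoly d x A = (\<Sum>a\<le>d. monom (x (a, A)) a)"

text \<open>The coordinates are extended to lists as an alternating function, so that a single row
  can be replaced without sorting.\<close>

definition plist :: "nat \<Rightarrow> nat \<Rightarrow> (pvar \<Rightarrow> complex) \<Rightarrow> int list \<Rightarrow> complex poly" where
  "plist d n x xs = (if distinct xs \<and> set xs \<subseteq> bracket n then of_int (sort_sign xs) * plpoly d x (set xs) else 0)"

lemma finite_bracket [simp]: "finite (bracket n)"
  by (simp add: bracket_def)

lemma poly_plpoly: "poly (plpoly d x A) s = plueval d x A s 1"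
  by (simp add: plpoly_def plueval_def poly_sum poly_monom)

lemma poly_mdet: "poly (mdet n W xs) s = mdet n (\<lambda>k j. poly (W k j) s) xs"
  unfolding mdet_expand by (simp add: poly_sum poly_prod)

lemma GrMaps_frame:
  assumes "x \<in> GrMaps d n"
  obtains V where "\<And>xs. length xs = n \<Longrightarrow> set xs \<subseteq> bracket n \<Longrightarrow> poly (plist d n x xs) s = mdet n V xs"
proof -
  have "(s, 1 :: complex) \<noteq> (0, 0)" by simp
  then obtain V where V: "\<And>A. A \<in> nsubsets n n \<Longrightarrow> plueval d x A s 1 = minor n V A"
    using assms unfolding GrMaps_def by blast
  have "poly (plist d n x xs) s = mdet n V xs" if xs: "length xs = n" "set xs \<subseteq> bracket n" for xs
  proof (cases "distinct xs")
    case True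
    then have "set xs \<in> nsubsets n n" using xs by (simp add: nsubsets_def distinct_card)
    then have "poly (plpoly d x (set xs)) s = mdet n V (sorted_list_of_set (set xs))"
      using V by (simp add: poly_plpoly minor_eq_mdet)
    then show ?thesis using True xs mdet_sort[OF True xs(1), of V] by (simp add: plist_def)
  next
    case False
    then show ?thesis using mdet_not_distinct[OF xs(1) False] by (simp add: plist_def)
  qed
  then show thesis using that by blast
qed

lemma nsubsets_list:
  assumes "A \<in> nsubsets n n"
  shows "finite A" "length (sorted_list_of_set A) = n" "set (sorted_list_of_set A) = A"
    "A \<subseteq> bracket n" "card A = n"
proof -
  show "finite A" using assms finite_subset[of A "bracket n"] by (simp add: nsubsets_def)
  then show "length (sorted_list_of_set A) = n" "set (sorted_list_of_set A) = A" "A \<subseteq> bracket n" "card A = n"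
    using assms by (auto simp: nsubsets_def)
qed

lemma plist_sorted: "A \<in> nsubsets n n \<Longrightarrow> plist d n x (sorted_list_of_set A) = plpoly d x A"
  using nsubsets_list[of A n] by (simp add: plist_def sort_sign_sorted)

text \<open>\<open>GrMaps\<close> provides a frame for each parameter value separately, without any
  regularity in \<open>s\<close>. Replacing one letter of \<open>A\<close> at a time gives a matrix
  of Plucker coordinates, which are polynomials, and by Cramer's rule it is a frame up to powers of
  the coordinate at \<open>A\<close>.\<close>

lemma polynomial_frame:
  assumes x: "x \<in> GrMaps d n" and A: "A \<in> nsubsets n n" and xs: "length xs = n" "set xs \<subseteq> bracket n"
  defines "W \<equiv> \<lambda>k j. plist d n x ((sorted_list_of_set A)[j := k])"
  shows "mdet n W xs * plpoly d x A = plist d n x xs * plpoly d x A ^ n"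
proof -
  let ?L = "sorted_list_of_set A"
  note L = nsubsets_list[OF A]
  have "poly (mdet n W xs * plpoly d x A) s = poly (plist d n x xs * plpoly d x A ^ n) s" for s
  proof -
    obtain V where V: "\<And>xs. length xs = n \<Longrightarrow> set xs \<subseteq> bracket n \<Longrightarrow> poly (plist d n x xs) s = mdet n V xs"
      using GrMaps_frame[OF x, of s] by blast
    have "mdet n (\<lambda>k j. poly (W k j) s) xs * mdet n V ?L = mdet n V xs * mdet n V ?L ^ n"
    proof (rule mdet_replaced_frame[OF L(2) _ xs(1)])
      fix k j assume "k \<in> set xs \<union> set ?L" "j < n"
      then have "set (?L[j := k]) \<subseteq> bracket n" using xs(2) L set_update_subset_insert[of ?L j k] by auto
      then show "poly (W k j) s = mdet n V (?L[j := k])" unfolding W_def using L by (intro V) auto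
    qed
    moreover have "mdet n V ?L = poly (plpoly d x A) s"
      using V[of ?L] L plist_sorted[OF A, of d x] by simp
    ultimately show ?thesis using V[OF xs] by (simp add: poly_mdet)
  qed
  then show ?thesis by (simp add: poly_eq_poly_eq_iff[symmetric] fun_eq_iff)
qed

text \<open>The frame is compared with itself at the parameters \<open>t\<close> and
  \<open>z * t\<close>, where \<open>z\<close> is the polynomial variable. Both agree at
  \<open>z = 1\<close>, that is, modulo \<open>[:-1, 1:]\<close>. The pivot \<open>A\<close> is
  nonzero at \<open>t\<close>, so its powers can be cancelled.\<close>

lemma exchange_maps:
  assumes x: "x \<in> GrMaps d n" and P: "P \<subseteq> bracket n" "card P = n + k"
    and Q: "set Q \<subseteq> bracket n" "length Q + k = n"
  shows "[:-1, 1:] ^ k dvd (\<Sum>C | C \<subseteq> P \<and> card C = n. of_int ((-1) ^ invs C (P - C)) *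
     pcompose (plpoly d x C) [:0, t:] * [:poly (plist d n x (sorted_list_of_set (P - C) @ Q)) t:])"
    (is "_ dvd ?S")
proof -
  have "(t, 1 :: complex) \<noteq> (0, 0)" by simp
  then obtain A where A: "A \<in> nsubsets n n" "plueval d x A t 1 \<noteq> 0" using x unfolding GrMaps_def by blast
  define W where "W = (\<lambda>k j. plist d n x ((sorted_list_of_set A)[j := k]))"
  define u where "u = plpoly d x A"
  have fr: "mdet n W xs * u = plist d n x xs * u ^ n" if "length xs = n" "set xs \<subseteq> bracket n" for xs
    unfolding W_def u_def by (rule polynomial_frame[OF x A(1) that])
  have u: "poly u t \<noteq> 0" using A(2) by (simp add: u_def poly_plpoly)
  define U where "U = (\<lambda>r j. [:poly (W r j) t:])"
  define U' where "U' = (\<lambda>r j. pcompose (W r j) [:0, t:])"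
  have finP: "finite P" by (rule finite_subset[OF P(1)]) simp
  have "[:-1, 1:] dvd U r j - U' r j" for r j
  proof -
    have "poly (U r j - U' r j) 1 = 0" by (simp add: U_def U'_def poly_pcompose)
    then show ?thesis unfolding poly_eq_0_iff_dvd .
  qed
  then have dT: "[:-1, 1:] ^ k dvd (\<Sum>C | C \<subseteq> P \<and> card C = n.
        of_int ((-1) ^ invs C (P - C)) * mdet n U' (sorted_list_of_set C) * mdet n U (sorted_list_of_set (P - C) @ Q))"
    (is "_ dvd ?T") by (intro exchange_dvd finP P Q(2))
  define v where "v = pcompose u [:0, t:] ^ n * [:poly u t ^ n:]"
  have eqn: "?T * (pcompose u [:0, t:] * [:poly u t:]) = v * ?S"
    unfolding sum_distrib_left sum_distrib_right
  proof (rule sum.cong[OF refl])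
    fix C assume C: "C \<in> {C. C \<subseteq> P \<and> card C = n}"
    let ?C = "sorted_list_of_set C" and ?D = "sorted_list_of_set (P - C) @ Q"
    have fC: "finite C" using C finP finite_subset by auto
    have cD: "length ?D = n" "set ?D \<subseteq> bracket n"
      using C P Q finP fC by (auto simp: card_Diff_subset)
    have Cn: "C \<in> nsubsets n n" using C P by (auto simp: nsubsets_def)
    note CL = nsubsets_list[OF Cn]
    have a: "mdet n U' ?C * pcompose u [:0, t:] = pcompose (plpoly d x C) [:0, t:] * pcompose u [:0, t:] ^ n"
    proof -
      have "poly (mdet n U' ?C * pcompose u [:0, t:]) z = poly (pcompose (plpoly d x C) [:0, t:] * pcompose u [:0, t:] ^ n) z" for z
      proof -
        have "poly (mdet n W ?C * u) (z * t) = poly (plist d n x ?C * u ^ n) (z * t)"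
          using fr[of ?C] CL by simp
        then show ?thesis unfolding plist_sorted[OF Cn]
          by (simp add: U'_def poly_mdet poly_pcompose)
      qed
      then show ?thesis by (simp add: poly_eq_poly_eq_iff[symmetric] fun_eq_iff)
    qed
    have b: "mdet n U ?D * [:poly u t:] = [:poly (plist d n x ?D) t:] * [:poly u t ^ n:]"
    proof -
      have "poly (mdet n U ?D * [:poly u t:]) z = poly ([:poly (plist d n x ?D) t:] * [:poly u t ^ n:]) z" for z
      proof -
        have "poly (mdet n W ?D * u) t = poly (plist d n x ?D * u ^ n) t" using fr[OF cD] by simp
        then show ?thesis by (simp add: U_def poly_mdet mult.commute)
      qed
      then show ?thesis by (simp add: poly_eq_poly_eq_iff[symmetric] fun_eq_iff)
    qed
    have "of_int ((-1) ^ invs C (P - C)) * mdet n U' ?C * mdet n U ?D * (pcompose u [:0, t:] * [:poly u t:])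
       = of_int ((-1) ^ invs C (P - C)) * (mdet n U' ?C * pcompose u [:0, t:]) * (mdet n U ?D * [:poly u t:])"
      by (simp only: ac_simps)
    also have "\<dots> = v * (of_int ((-1) ^ invs C (P - C)) * pcompose (plpoly d x C) [:0, t:] * [:poly (plist d n x ?D) t:])"
      unfolding a b v_def by (simp only: ac_simps)
    finally show "of_int ((-1) ^ invs C (P - C)) * mdet n U' ?C * mdet n U ?D * (pcompose u [:0, t:] * [:poly u t:]) = \<dots>" .
  qed
  have "[:-1, 1:] ^ k dvd v * ?S" using dvd_mult2[OF dT, of "pcompose u [:0, t:] * [:poly u t:]"] unfolding eqn .
  moreover have "poly v 1 \<noteq> 0" using u by (simp add: v_def poly_pcompose)
  ultimately show ?thesis by (rule order_1_cancel[rotated])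
qed

text \<open>Reduction modulo \<open>q\<close> is linear, so the remainders are the coefficients of a
  polynomial in \<open>t\<close> that vanishes identically.\<close>

lemma dvd_coefficients:
  fixes f :: "nat \<Rightarrow> complex poly"
  assumes "\<And>t. q dvd (\<Sum>N\<le>K. smult (t ^ N) (f N))" "N \<le> K"
  shows "q dvd f N"
proof -
  have "coeff (f N mod q) j = 0" for j
  proof -
    have "(\<Sum>N\<le>K. t ^ N * coeff (f N mod q) j) = 0" for t
    proof -
      have "(\<Sum>N\<le>K. smult (t ^ N) (f N)) mod q = (\<Sum>N\<le>K. smult (t ^ N) (f N mod q))"
      proof (induction K)
        case (Suc K)
        then show ?case by (simp add: poly_mod_add_left mod_smult_left)
      qed (simp add: mod_smult_left)
      then have "(\<Sum>N\<le>K. smult (t ^ N) (f N mod q)) = 0" using assms(1)[of t] by (simp add: dvd_eq_mod_eq_0)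
      then have "coeff (\<Sum>N\<le>K. smult (t ^ N) (f N mod q)) j = 0" by simp
      then show ?thesis by (simp add: coeff_sum)
    qed
    then have "poly (\<Sum>N\<le>K. monom (coeff (f N mod q) j) N) t = 0" for t
      by (simp add: poly_sum poly_monom mult.commute)
    then have "(\<Sum>N\<le>K. monom (coeff (f N mod q) j) N) = 0" using poly_all_0_iff_0 by blast
    then have "coeff (\<Sum>N\<le>K. monom (coeff (f N mod q) j) N) N = 0" by simp
    then show ?thesis using assms(2) by (simp add: coeff_sum)
  qed
  then have "f N mod q = 0" by (intro poly_eqI) simp
  then show ?thesis by (simp add: dvd_eq_mod_eq_0)
qed

text \<open>\<open>N\<close> is the total exponent. The truncated difference \<open>N - d\<close> is
  the least exponent of the first factor that leaves at most \<open>d\<close> for the second, so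
  \<open>i\<close> ranges up to \<open>N - 2 * (N - d)\<close>. The sign is the part of the exchange
  sign that depends on \<open>C\<close>.\<close>

definition quad :: "nat \<Rightarrow> nat \<Rightarrow> (pvar \<Rightarrow> complex) \<Rightarrow> int set \<Rightarrow> int set \<Rightarrow> int set \<times> nat \<Rightarrow> complex" where
  "quad d N x X T = (\<lambda>(C, i). (-1) ^ invs (T - C) C * x (N - d + i, X \<union> (T - C)) * x (N - (N - d) - i, X \<union> C))"

lemma smult_sum_right: "smult c (sum f S) = (\<Sum>i\<in>S. smult c (f i))"
  by (induction S rule: infinite_finite_induct) (simp_all add: smult_add_right)

lemma neg_one_power_parity:
  assumes "even (a + b + c)" shows "(-1) ^ a * (-1) ^ b = ((-1) ^ c :: 'a::comm_ring_1)"
proof -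
  have "even (a + b) \<longleftrightarrow> even c" using assms by auto
  then show ?thesis by (cases "even c") (simp_all flip: power_add)
qed

text \<open>The merging signs of an exchange relation split into a factor that is constant for fixed
  \<open>D\<close> and the sign built into \<open>quad\<close>.\<close>

lemma exchange_sign:
  assumes "finite X" "finite T" "X \<inter> T = {}" "D \<subseteq> C" "C \<subseteq> T" "card (C - D) = k"
  shows "(-1) ^ invs (X \<union> (T - C)) (C - D) * (-1) ^ invs (C - D) (X \<union> D)
    = (-1) ^ (card X * k + invs (T - D) D) * ((-1) ^ invs (T - C) C :: 'a::comm_ring_1)"
proof -
  have fin: "finite (T - C)" "finite (C - D)" "finite D" "finite C"
    using assms finite_subset[of C T] finite_subset[of D C] by auto
  have 1: "invs (X \<union> (T - C)) (C - D) = invs X (C - D) + invs (T - C) (C - D)"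
    using assms fin by (intro invs_Un_left) auto
  have 2: "invs (C - D) (X \<union> D) = invs (C - D) X + invs (C - D) D"
    using assms fin by (intro invs_Un_right) auto
  have 3: "invs X (C - D) + invs (C - D) X = card X * k"
    using invs_add_swap[of X "C - D"] assms fin by auto
  have 4: "invs (T - C) C = invs (T - C) (C - D) + invs (T - C) D"
  proof -
    have "(C - D) \<inter> D = {}" "(C - D) \<union> D = C" using assms(4) by auto
    then show ?thesis using invs_Un_right[OF fin(2,3), of "T - C"] by simp
  qed
  have 5: "invs (T - D) D = invs (T - C) D + invs (C - D) D"
  proof -
    have "(T - C) \<inter> (C - D) = {}" "(T - C) \<union> (C - D) = T - D" using assms(4,5) by auto
    then show ?thesis using invs_Un_left[OF fin(1,2), of D] by simp
  qed
  have "even (invs (X \<union> (T - C)) (C - D) + invs (C - D) (X \<union> D) + (card X * k + invs (T - D) D + invs (T - C) C))"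
    unfolding 1 2 4 5 3[symmetric]
    by (cases "even (invs X (C - D))"; cases "even (invs (C - D) X)"; cases "even (invs (T - C) (C - D))";
        cases "even (invs (C - D) D)"; cases "even (invs (T - C) D)"; simp)
  then have "(-1) ^ invs (X \<union> (T - C)) (C - D) * (-1) ^ invs (C - D) (X \<union> D)
    = ((-1) ^ (card X * k + invs (T - D) D + invs (T - C) C) :: 'a)" by (rule neg_one_power_parity)
  then show ?thesis by (simp only: power_add)
qed

lemma quad_flip:
  assumes T: "finite T" "card T = 2 * p" and C: "C \<subseteq> T" "card C = p" and i: "i \<le> N - 2 * (N - d)" "N \<le> 2 * d"
  shows "quad d N x X T (T - C, i) = (-1) ^ p * quad d N x X T (C, N - 2 * (N - d) - i)"
proof -
  have fC: "finite C" "finite (T - C)" using T C finite_subset[of C T] by auto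
  have "card (T - C) = p" using T C fC by (simp add: card_Diff_subset)
  then have "invs (T - C) C + invs C (T - C) = p * p" using invs_add_swap[of "T - C" C] fC C by auto
  then have "even (p + invs (T - C) C + invs C (T - C))" by (simp add: add.assoc)
  then have s: "(-1) ^ p * (-1) ^ invs (T - C) C = ((-1) ^ invs C (T - C) :: complex)"
    by (rule neg_one_power_parity)
  have "N - d + (N - 2 * (N - d) - i) = N - (N - d) - i" "N - (N - d) - (N - 2 * (N - d) - i) = N - d + i"
    using i by auto
  then show ?thesis using C(1) by (simp add: quad_def double_diff s[symmetric])
qed

text \<open>The exchange relation with letters \<open>X \<union> (T - D)\<close> to distribute and
  rows \<open>X \<union> D\<close> fixed in the second minor; the coefficient of
  \<open>t ^ N\<close> isolates the total exponent \<open>N\<close>.\<close>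

lemma quad_dvd:
  assumes x: "x \<in> GrMaps d n" and X: "X \<subseteq> bracket n" "T \<subseteq> bracket n" "X \<inter> T = {}"
    and T: "card T = 2 * p" "card X + p = n" and N: "N \<le> 2 * d" and D: "D \<subseteq> T" "card D \<le> p"
  shows "[:-1, 1:] ^ (p - card D) dvd upsum T p (fpoly (N - 2 * (N - d)) (quad d N x X T)) D"
proof -
  define k where "k = p - card D"
  have fin: "finite X" "finite T" "finite D"
    using X D finite_subset[OF _ finite_bracket[of n]] finite_subset[of D T] by auto
  define P where "P = X \<union> (T - D)"
  define Q where "Q = sorted_list_of_set (X \<union> D)"
  have P: "P \<subseteq> bracket n" "card P = n + k"
  proof -
    show "P \<subseteq> bracket n" using X by (auto simp: P_def)
    have "card P = card X + card (T - D)" unfolding P_def using fin X by (intro card_Un_disjoint) auto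
    then show "card P = n + k" using T D fin by (simp add: card_Diff_subset k_def)
  qed
  have Q: "set Q \<subseteq> bracket n" "length Q + k = n"
  proof -
    show "set Q \<subseteq> bracket n" using X D fin by (auto simp: Q_def)
    have "card (X \<union> D) = card X + card D" using fin X D by (intro card_Un_disjoint) auto
    then show "length Q + k = n" using T D by (simp add: Q_def k_def)
  qed
  have finP: "finite P" using fin by (simp add: P_def)
  let ?F = "{C. D \<subseteq> C \<and> C \<subseteq> T \<and> card C = p}"
  let ?e = "\<lambda>C. (-1) ^ invs (T - C) C :: complex poly"
  have swap: "(\<Sum>C | C \<subseteq> P \<and> card C = n. of_int ((-1) ^ invs C (P - C)) *
     pcompose (plpoly d x C) [:0, t:] * [:poly (plist d n x (sorted_list_of_set (P - C) @ Q)) t:])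
     = (-1) ^ (card X * k + invs (T - D) D) *
       (\<Sum>C\<in>?F. ?e C * (pcompose (plpoly d x (X \<union> (T - C))) [:0, t:] * [:poly (plpoly d x (X \<union> C)) t:]))" (is "?L = ?c * ?R") for t
  proof -
    let ?G = "{C. X \<subseteq> C \<and> C \<subseteq> P \<and> card C = n}"
    have "?L = (\<Sum>C\<in>?G. of_int ((-1) ^ invs C (P - C)) *
     pcompose (plpoly d x C) [:0, t:] * [:poly (plist d n x (sorted_list_of_set (P - C) @ Q)) t:])"
    proof (rule sum.mono_neutral_right)
      show "finite {C. C \<subseteq> P \<and> card C = n}" using finP by simp
      show "\<forall>C\<in>{C. C \<subseteq> P \<and> card C = n} - ?G. of_int ((-1) ^ invs C (P - C)) *
         pcompose (plpoly d x C) [:0, t:] * [:poly (plist d n x (sorted_list_of_set (P - C) @ Q)) t:] = 0"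
      proof
        \<comment> \<open>A letter of \<open>X\<close> missing from \<open>C\<close> would occur
          twice in the second minor, so only the sets containing \<open>X\<close> survive.\<close>
        fix C assume "C \<in> {C. C \<subseteq> P \<and> card C = n} - ?G"
        then obtain y where "y \<in> X" "y \<notin> C" by auto
        then have "y \<in> P - C" "y \<in> set Q" using fin by (auto simp: P_def Q_def)
        then have "\<not> distinct (sorted_list_of_set (P - C) @ Q)" using finP by auto
        then have "plist d n x (sorted_list_of_set (P - C) @ Q) = 0" unfolding plist_def by (simp only: simp_thms if_False)
        then show "of_int ((-1) ^ invs C (P - C)) *
         pcompose (plpoly d x C) [:0, t:] * [:poly (plist d n x (sorted_list_of_set (P - C) @ Q)) t:] = 0" by simp
      qed
    qed auto
    also have "\<dots> = (\<Sum>C\<in>?F. ?c * (?e C * (pcompose (plpoly d x (X \<union> (T - C))) [:0, t:] * [:poly (plpoly d x (X \<union> C)) t:])))"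
    proof (rule sum.reindex_bij_witness[where j = "\<lambda>C. T - C" and i = "\<lambda>C. X \<union> (T - C)"])
      fix C assume C: "C \<in> ?G"
      then have fC: "finite C" using finP finite_subset by auto
      have e: "C = X \<union> (T - (T - C))" using C by (auto simp: P_def)
      then show "X \<union> (T - (T - C)) = C" by simp
      have "card (X \<union> (T - (T - C))) = card X + card (T - (T - C))"
        by (rule card_Un_disjoint) (use fin X in auto)
      then have "card (T - (T - C)) = p" using C T e by simp
      moreover have "T - (T - (T - C)) = T - C" by auto
      then have "card (T - C) = card T - card (T - (T - C))"
        using fin card_Diff_subset[of "T - (T - C)" T] by auto
      ultimately have cp: "card (T - C) = p" using T by simp
      then show "T - C \<in> ?F" using C D X by (auto simp: P_def)
      let ?C = "T - C"
      have PC: "P - C = ?C - D" using C by (auto simp: P_def)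
      have kk: "card (?C - D) = k" using cp C fin D X by (subst card_Diff_subset) (auto simp: k_def P_def)
      have sXC: "X \<union> (T - ?C) = C" using e by simp
      have nd: "distinct (sorted_list_of_set (P - C) @ Q)" using C D X fin by (auto simp: PC Q_def)
      have set: "set (sorted_list_of_set (P - C) @ Q) = X \<union> ?C" using C D X fin by (auto simp: PC Q_def P_def)
      have sgn: "sort_sign (sorted_list_of_set (P - C) @ Q) = (-1) ^ invs (?C - D) (X \<union> D)"
        unfolding Q_def PC using fin by (intro sort_sign_sets) auto
      have pl: "plist d n x (sorted_list_of_set (P - C) @ Q) = (-1) ^ invs (?C - D) (X \<union> D) * plpoly d x (X \<union> ?C)"
      proof -
        have "X \<union> ?C \<subseteq> bracket n" using X by auto
        then show ?thesis unfolding plist_def set sgn using nd by simp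
      qed
      have sg: "(-1) ^ invs C (P - C) * (-1) ^ invs (?C - D) (X \<union> D) = ?c * ?e ?C"
      proof -
        have "D \<subseteq> ?C" using C D X by (auto simp: P_def)
        then show ?thesis
          using exchange_sign[of X T D ?C k, OF fin(1,2) X(3) _ _ kk] unfolding PC sXC by blast
      qed
      have cst: "[:poly ((-1) ^ m * r) t:] = (-1) ^ m * [:poly r t:]" for m and r :: "complex poly"
        by (cases "even m") simp_all
      show "?c * (?e ?C * (pcompose (plpoly d x (X \<union> (T - ?C))) [:0, t:] * [:poly (plpoly d x (X \<union> ?C)) t:]))
        = of_int ((-1) ^ invs C (P - C)) * pcompose (plpoly d x C) [:0, t:] * [:poly (plist d n x (sorted_list_of_set (P - C) @ Q)) t:]"
      proof -
        have "of_int ((-1) ^ invs C (P - C)) * pcompose (plpoly d x C) [:0, t:] * [:poly (plist d n x (sorted_list_of_set (P - C) @ Q)) t:]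
          = ((-1) ^ invs C (P - C) * (-1) ^ invs (?C - D) (X \<union> D)) * (pcompose (plpoly d x C) [:0, t:] * [:poly (plpoly d x (X \<union> ?C)) t:])"
          unfolding pl cst of_int_power of_int_minus of_int_1 by (simp only: ac_simps)
        then show ?thesis unfolding sg sXC by (simp only: mult.assoc)
      qed
    next
      fix C assume C: "C \<in> ?F"
      then have fC: "finite C" using fin finite_subset by auto
      show "T - (X \<union> (T - C)) = C" using C X by auto
      have "card (X \<union> (T - C)) = card X + card (T - C)" using fin X by (intro card_Un_disjoint) auto
      then have "card (X \<union> (T - C)) = n" using C T fC by (simp add: card_Diff_subset)
      then show "X \<union> (T - C) \<in> ?G" using C by (auto simp: P_def)
    qed
    finally show ?thesis by (simp only: sum_distrib_left)
  qed
  define f where "f = (\<lambda>N. \<Sum>C\<in>?F. smult ((-1) ^ invs (T - C) C)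
      (\<Sum>a | a \<le> d \<and> a \<le> N \<and> N - a \<le> d. monom (x (a, X \<union> (T - C)) * x (N - a, X \<union> C)) a))"
  have sumf: "(\<Sum>C\<in>?F. ?e C * (pcompose (plpoly d x (X \<union> (T - C))) [:0, t:] * [:poly (plpoly d x (X \<union> C)) t:]))
      = (\<Sum>N\<le>2 * d. smult (t ^ N) (f N))" for t
  proof -
    have prod: "pcompose (plpoly d x A) [:0, t:] * [:poly (plpoly d x B) t:] =
       (\<Sum>N\<le>2 * d. smult (t ^ N) (\<Sum>a | a \<le> d \<and> a \<le> N \<and> N - a \<le> d. monom (x (a, A) * x (N - a, B)) a))" for A B
    proof -
      have "poly (pcompose (plpoly d x A) [:0, t:] * [:poly (plpoly d x B) t:]) z =
         poly (\<Sum>N\<le>2 * d. smult (t ^ N) (\<Sum>a | a \<le> d \<and> a \<le> N \<and> N - a \<le> d. monom (x (a, A) * x (N - a, B)) a)) z" for z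
      proof -
        have "poly (pcompose (plpoly d x A) [:0, t:] * [:poly (plpoly d x B) t:]) z =
          (\<Sum>a\<le>d. x (a, A) * (z * t) ^ a) * (\<Sum>b\<le>d. x (b, B) * t ^ b)"
          by (simp add: poly_pcompose plpoly_def poly_sum poly_monom mult.commute)
        also have "\<dots> = (\<Sum>a\<le>d. \<Sum>b\<le>d. x (a, A) * (z * t) ^ a * (x (b, B) * t ^ b))"
          by (rule sum_product)
        also have "\<dots> = (\<Sum>(a, b)\<in>{..d} \<times> {..d}. x (a, A) * (z * t) ^ a * (x (b, B) * t ^ b))"
          by (simp add: sum.cartesian_product)
        also have "\<dots> = (\<Sum>(N, a)\<in>(SIGMA N:{..2 * d}. {a. a \<le> d \<and> a \<le> N \<and> N - a \<le> d}). t ^ N * (x (a, A) * x (N - a, B) * z ^ a))"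
          by (rule sum.reindex_bij_witness[where i = "\<lambda>(N, a). (a, N - a)" and j = "\<lambda>(a, b). (a + b, a)"])
             (auto simp: power_mult_distrib power_add)
        also have "\<dots> = (\<Sum>N\<le>2 * d. t ^ N * (\<Sum>a | a \<le> d \<and> a \<le> N \<and> N - a \<le> d. x (a, A) * x (N - a, B) * z ^ a))"
          by (subst sum.Sigma[symmetric]) (auto simp: sum_distrib_left)
        finally show ?thesis by (simp add: poly_sum poly_monom)
      qed
      then show ?thesis by (simp add: poly_eq_poly_eq_iff[symmetric] fun_eq_iff)
    qed
    have e: "?e C * r = smult ((-1) ^ invs (T - C) C) r" for C and r :: "complex poly"
      by (cases "even (invs (T - C) C)") simp_all
    show ?thesis unfolding prod e f_def smult_sum_right smult_smult
      by (subst (2) sum.swap) (simp only: mult.commute)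
  qed
  have "[:-1, 1:] ^ k dvd (\<Sum>N\<le>2 * d. smult (t ^ N) (f N))" for t
  proof -
    have "q dvd r" if "q dvd (-1) ^ m * r" for q r :: "complex poly" and m :: nat
      using that by (cases "even m") auto
    then show ?thesis using exchange_maps[OF x P Q, of t] unfolding swap sumf .
  qed
  then have "[:-1, 1:] ^ k dvd f N" using N by (rule dvd_coefficients)
  \<comment> \<open>The exponents in \<open>f N\<close> start at \<open>N - d\<close>. The split off
    power of the variable does not vanish at \<open>1\<close> and leaves the divisibility
    untouched.\<close>
  moreover have "f N = monom 1 (N - d) * upsum T p (fpoly (N - 2 * (N - d)) (quad d N x X T)) D"
  proof -
    have "(\<Sum>a | a \<le> d \<and> a \<le> N \<and> N - a \<le> d. monom (x (a, A) * x (N - a, B)) a) =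
       monom 1 (N - d) * (\<Sum>i\<le>N - 2 * (N - d). monom (x (N - d + i, A) * x (N - (N - d) - i, B)) i)" for A B
      unfolding sum_distrib_left
      by (rule sum.reindex_bij_witness[where i = "\<lambda>i. N - d + i" and j = "\<lambda>a. a - (N - d)"])
         (use N in \<open>auto simp: mult_monom\<close>)
    moreover have "fpoly M (quad d N x X T) C = smult ((-1) ^ invs (T - C) C)
       (\<Sum>i\<le>M. monom (x (N - d + i, X \<union> (T - C)) * x (N - (N - d) - i, X \<union> C)) i)" for M C
      unfolding fpoly_def quad_def smult_sum_right by (simp add: smult_monom mult.assoc)
    ultimately show ?thesis unfolding f_def upsum_def by (simp add: sum_distrib_left)
  qed
  ultimately have "[:-1, 1:] ^ k dvd monom 1 (N - d) * upsum T p (fpoly (N - 2 * (N - d)) (quad d N x X T)) D" by simp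
  then show ?thesis unfolding k_def by (rule order_1_cancel[rotated]) (simp add: poly_monom)
qed

lemma quad_in_sols:
  assumes "x \<in> GrMaps d n" "X \<subseteq> bracket n" "T \<subseteq> bracket n" "X \<inter> T = {}"
    "card T = 2 * p" "card X + p = n" "N \<le> 2 * d"
  shows "quad d N x X T \<in> sols T p (N - 2 * (N - d))"
proof -
  have "finite T" by (rule finite_subset[OF assms(3)]) simp
  then show ?thesis unfolding sols_def using quad_dvd[OF assms] quad_flip[OF _ assms(5) _ _ _ assms(7)] by blast
qed

section \<open>Height functions\<close>

text \<open>The variable \<open>(a, A)\<close> is recorded by its heights on the \<open>2 n\<close> gaps of the circular word
  \<open>- n, ..., - 1, 1, ..., n\<close>: the gap \<open>y \<ge> 0\<close> follows the letter \<open>y\<close>, the gap \<open>y \<le> 0\<close> precedes it, and the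
  gaps \<open>- n\<close> and \<open>n\<close> coincide. The straightening order is the pointwise
  order on heights.\<close>

definition ht :: "pvar \<Rightarrow> int \<Rightarrow> int" where
  "ht v y = (if 0 \<le> y then int (fst v) + int (card {k \<in> snd v. y < k})
     else int (fst v) + y + int (card {k \<in> snd v. y \<le> k}))"

text \<open>The weights of all cells below the height function. The gap \<open>- int n\<close> is
  left out because it coincides with the gap \<open>n\<close>.\<close>

definition wt :: "nat \<Rightarrow> (int \<Rightarrow> nat \<Rightarrow> nat) \<Rightarrow> pvar \<Rightarrow> nat" where
  "wt n w v = (\<Sum>y\<in>{- int n + 1..int n}. \<Sum>h\<le>nat (ht v y). w y h)"

text \<open>\<open>lo y\<close> and \<open>hi n y\<close> are the letters before and after the gap
  \<open>y\<close> of the circular word; at the gap \<open>n\<close> these are \<open>n\<close> and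
  \<open>- n\<close>.\<close>

definition lo :: "int \<Rightarrow> int" where "lo y = (if y \<le> 0 then y - 1 else y)"

definition hi :: "nat \<Rightarrow> int \<Rightarrow> int" where
  "hi n y = (if y = int n then - int n else if 0 \<le> y then y + 1 else y)"

text \<open>A letter moves back across the gap \<open>y\<close>, which lowers the height there and
  nowhere else. Crossing the gap \<open>n\<close> costs one unit of the exponent.\<close>

definition lower :: "nat \<Rightarrow> int \<Rightarrow> pvar \<Rightarrow> pvar" where
  "lower n y v = (if y = int n then fst v - 1 else fst v, insert (lo y) (snd v - {hi n y}))"

lemma nsubsetsD:
  assumes "A \<in> nsubsets n n"
  shows "finite A" "card A = n" "0 \<notin> A" "\<And>k. k \<in> A \<Longrightarrow> - int n \<le> k \<and> k \<le> int n"
  using assms nsubsets_list[OF assms] by (auto simp: nsubsets_def bracket_def)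

lemma card_Collect_insert:
  assumes "finite A"
  shows "int (card {k \<in> A. R k}) = int (card {k \<in> A - {c}. R k}) + (if c \<in> A \<and> R c then 1 else 0)"
proof (cases "c \<in> A \<and> R c")
  case True
  then have "{k \<in> A. R k} = insert c {k \<in> A - {c}. R k}" by auto
  then show ?thesis using True assms by simp
next
  case False
  then have "{k \<in> A. R k} = {k \<in> A - {c}. R k}" by auto
  then show ?thesis using False by simp
qed

lemma card_Collect_add:
  assumes "finite A" "c \<notin> A"
  shows "int (card {k \<in> insert c A. R k}) = int (card {k \<in> A. R k}) + (if R c then 1 else 0)"
proof -
  have "{k \<in> insert c A. R k} = (if R c then insert c {k \<in> A. R k} else {k \<in> A. R k})" by auto
  then show ?thesis using assms by simp
qed

lemma ht_at_n: "A \<in> nsubsets n n \<Longrightarrow> ht (a, A) (int n) = int a"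
proof -
  assume "A \<in> nsubsets n n"
  from nsubsetsD[OF this] have "{k \<in> A. int n < k} = {}" by fastforce
  then have "card {k \<in> A. int n < k} = 0" by (simp only: card.empty)
  then show ?thesis by (simp add: ht_def)
qed

lemma ht_at_minus_n: "A \<in> nsubsets n n \<Longrightarrow> ht (a, A) (- int n) = int a"
proof -
  assume A: "A \<in> nsubsets n n"
  from nsubsetsD[OF A] have "{k \<in> A. - int n \<le> k} = A" by fastforce
  then have "card {k \<in> A. - int n \<le> k} = n" using nsubsetsD(2)[OF A] by (simp only:)
  then show ?thesis using ht_at_n[OF A, of a] by (cases "n = 0") (auto simp: ht_def)
qed

lemma ht_step_pos:
  assumes "A \<in> nsubsets n n" "1 \<le> y"
  shows "ht (a, A) (y - 1) = ht (a, A) y + (if y \<in> A then 1 else 0)"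
proof -
  have "{k \<in> A - {y}. y - 1 < k} = {k \<in> A - {y}. y < k}" by auto
  then show ?thesis
    using assms(2) card_Collect_insert[OF nsubsetsD(1)[OF assms(1)], of "\<lambda>k. y - 1 < k" y]
      card_Collect_insert[OF nsubsetsD(1)[OF assms(1)], of "\<lambda>k. y < k" y]
    by (simp add: ht_def)
qed

text \<open>On the negative side a letter keeps the height and a missing letter changes it, the
  opposite of \<open>ht_step_pos\<close>. Hence reflected heights belong to the complement of the
  negated set, the index set of the orthogonal coordinate subspace.\<close>

lemma ht_step_neg:
  assumes "A \<in> nsubsets n n" "1 \<le> y"
  shows "ht (a, A) (- (y - 1)) = ht (a, A) (- y) + (if - y \<in> A then 0 else 1)"
proof -
  note fin = nsubsetsD(1)[OF assms(1)]
  have "{k \<in> A - {- y}. - y \<le> k} = {k \<in> A - {- y}. - y < k}" by auto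
  then have 1: "int (card {k \<in> A. - y \<le> k}) = int (card {k \<in> A. - y < k}) + (if - y \<in> A then 1 else 0)"
    using card_Collect_insert[OF fin, of "\<lambda>k. - y \<le> k" "- y"] card_Collect_insert[OF fin, of "\<lambda>k. - y < k" "- y"] by simp
  show ?thesis
  proof (cases "y = 1")
    case True
    have "- 1 < k \<longleftrightarrow> 0 < k" if "k \<in> A" for k using nsubsetsD(3)[OF assms(1)] that by (cases "k = 0") auto
    then have "{k \<in> A. 0 < k} = {k \<in> A. - y < k}" using True by auto
    then have "card {k \<in> A. 0 < k} = card {k \<in> A. - y < k}" by (simp only:)
    then show ?thesis using True 1 by (simp add: ht_def)
  next
    case False
    have "{k \<in> A. - y + 1 \<le> k} = {k \<in> A. - y < k}" by auto
    then have "card {k \<in> A. - (y - 1) \<le> k} = card {k \<in> A. - y < k}" by (simp only: minus_diff_eq) (simp only: diff_conv_add_uminus add.commute)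
    then show ?thesis using False assms(2) 1 by (simp add: ht_def)
  qed
qed

lemma ht_nonneg:
  assumes A: "A \<in> nsubsets n n" and y: "- int n \<le> y"
  shows "int a \<le> ht (a, A) y"
proof (cases "0 \<le> y")
  case False
  have "A = {k \<in> A. y \<le> k} \<union> {k \<in> A. k < y}" by auto
  then have "n \<le> card {k \<in> A. y \<le> k} + card {k \<in> A. k < y}"
    using nsubsetsD(2)[OF A] by (metis card_Un_le)
  moreover have "card {k \<in> A. k < y} \<le> card {- int n..<y}"
    using nsubsetsD(4)[OF A] by (intro card_mono) auto
  ultimately show ?thesis using False y by (simp add: ht_def)
qed (simp add: ht_def)

lemma ht_upper:
  assumes A: "A \<in> nsubsets n n" and y: "- int n \<le> y" "y \<le> int n"
  shows "ht (a, A) y \<le> int a + int n - \<bar>y\<bar>"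
proof (cases "0 \<le> y")
  case True
  have "card {k \<in> A. y < k} \<le> card {y<..int n}"
    using nsubsetsD(4)[OF A] by (intro card_mono) auto
  then show ?thesis using True y by (simp add: ht_def)
next
  case False
  have "card {k \<in> A. y \<le> k} \<le> card A" using nsubsetsD(1)[OF A] by (intro card_mono) auto
  then show ?thesis using False y nsubsetsD(2)[OF A] by (simp add: ht_def)
qed

lemma lower_ht:
  assumes A: "A \<in> nsubsets n n" and y: "- int n < y" "y \<le> int n" and n: "n \<ge> 1"
    and l: "hi n y \<in> A" "lo y \<notin> A" "y = int n \<Longrightarrow> a \<ge> 1" and z: "- int n \<le> z" "z \<le> int n"
  shows "ht (lower n y (a, A)) z = ht (a, A) z - (if z = y \<or> y = int n \<and> z = - int n then 1 else 0)"
proof -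
  note fin = nsubsetsD(1)[OF A]
  define N where "N = insert (lo y) (A - {hi n y})"
  have c: "int (card {k \<in> N. R k}) = int (card {k \<in> A. R k})
     - (if R (hi n y) then 1 else 0) + (if R (lo y) then 1 else 0)" for R
    using card_Collect_insert[OF fin, of R "hi n y"] card_Collect_add[of "A - {hi n y}" "lo y" R] fin l
    unfolding N_def by auto
  obtain b where b: "lower n y (a, A) = (b, N)" "int b = int a - (if y = int n then 1 else 0)"
    using l(3) by (auto simp: lower_def N_def)
  show ?thesis
    using b(2) c[of "\<lambda>k. z < k"] c[of "\<lambda>k. z \<le> k"] y z n unfolding b(1) ht_def fst_conv snd_conv lo_def hi_def
    by (auto split: if_splits)
qed

lemma lower_nsubsets:
  assumes A: "A \<in> nsubsets n n" and y: "- int n < y" "y \<le> int n"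
    and l: "hi n y \<in> A" "lo y \<notin> A"
  shows "insert (lo y) (A - {hi n y}) \<in> nsubsets n n"
proof -
  have "lo y \<in> bracket n" using y by (auto simp: lo_def bracket_def)
  moreover have "card (insert (lo y) (A - {hi n y})) = n"
    using nsubsetsD(1,2)[OF A] l by (auto simp: card_insert_if) (metis Suc_pred card_gt_0_iff empty_iff)
  ultimately show ?thesis using A by (auto simp: nsubsets_def)
qed

lemma wt_lower:
  assumes A: "A \<in> nsubsets n n" and y: "- int n < y" "y \<le> int n" and n: "n \<ge> 1"
    and l: "hi n y \<in> A" "lo y \<notin> A" "y = int n \<Longrightarrow> a \<ge> 1"
  shows "wt n w (a, A) = wt n w (lower n y (a, A)) + w y (nat (ht (a, A) y))"
    and "ht (a, A) y \<ge> 1"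
proof -
  note h = lower_ht[OF A y n l]
  have A': "snd (lower n y (a, A)) \<in> nsubsets n n" using lower_nsubsets[OF A y l(1,2)] by (simp add: lower_def)
  have "0 \<le> ht (lower n y (a, A)) y"
    using ht_nonneg[OF A', of y "fst (lower n y (a, A))"] y by simp
  then show 1: "ht (a, A) y \<ge> 1" using h[of y] y by simp
  let ?Y = "{- int n + 1..int n}"
  have yY: "y \<in> ?Y" "finite ?Y" using y by auto
  have "(\<Sum>z\<in>?Y - {y}. \<Sum>h\<le>nat (ht (a, A) z). w z h) = (\<Sum>z\<in>?Y - {y}. \<Sum>h\<le>nat (ht (lower n y (a, A)) z). w z h)"
    using h y by (intro sum.cong refl) (auto simp: h)
  moreover have "nat (ht (a, A) y) = Suc (nat (ht (lower n y (a, A)) y))" using h[of y] 1 y by simp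
  ultimately show "wt n w (a, A) = wt n w (lower n y (a, A)) + w y (nat (ht (a, A) y))"
    unfolding wt_def sum.remove[OF yY(2,1)] by simp
qed

section \<open>Adding a box\<close>

definition below :: "nat \<Rightarrow> (int \<Rightarrow> int) \<Rightarrow> pvar \<Rightarrow> bool" where
  "below n W v \<longleftrightarrow> (\<forall>z. - int n \<le> z \<and> z \<le> int n \<longrightarrow> ht v z \<le> W z)"

text \<open>The profile \<open>W\<close> records which coordinates have become nonzero; these have
  exactly the prescribed order at zero.\<close>

definition alg_inv :: "nat \<Rightarrow> (int \<Rightarrow> nat \<Rightarrow> nat) \<Rightarrow> (int \<Rightarrow> int) \<Rightarrow> (pvar \<Rightarrow> complex poly) \<Rightarrow> bool" where
  "alg_inv n w W x \<longleftrightarrow> (\<forall>a A. A \<in> nsubsets n n \<longrightarrow>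
     (if below n W (a, A) then \<exists>g. x (a, A) = monom 1 (wt n w (a, A)) * g \<and> poly g 0 \<noteq> 0 else x (a, A) = 0))"

text \<open>These inequalities force every variable below the raised profile that touches the new
  level to have a peak at \<open>y\<close>. At the gap \<open>n\<close> the neighbours are
  \<open>n - 1\<close> and \<open>- (n - 1)\<close>, and \<open>0 \<le> W y\<close> guarantees a
  unit of the exponent to give up.\<close>

definition addable :: "nat \<Rightarrow> (int \<Rightarrow> int) \<Rightarrow> int \<Rightarrow> bool" where
  "addable n W y \<longleftrightarrow>
     (if y = int n then W (y - 1) \<le> W y + 1 \<and> W (- (y - 1)) \<le> W y + 1 \<and> 0 \<le> W y \<and> W (- y) = W y
      else if y > 0 then W (y - 1) \<le> W y + 1 \<and> W (y + 1) \<le> W y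
      else if y < 0 then W (y + 1) \<le> W y + 1 \<and> W (y - 1) \<le> W y
      else W 1 \<le> W 0 \<and> W (-1) \<le> W 0)"

definition raise :: "nat \<Rightarrow> (int \<Rightarrow> int) \<Rightarrow> int \<Rightarrow> int \<Rightarrow> int" where
  "raise n W y = (\<lambda>z. W z + (if z = y \<or> y = int n \<and> z = - int n then 1 else 0))"

definition can_lower :: "nat \<Rightarrow> int \<Rightarrow> pvar \<Rightarrow> bool" where
  "can_lower n y v \<longleftrightarrow> hi n y \<in> snd v \<and> lo y \<notin> snd v \<and> (y = int n \<longrightarrow> fst v \<ge> 1)"

text \<open>The effect on Plucker coordinates of adding a multiple of row \<open>lo y\<close> to row
  \<open>hi n y\<close>. At the gap \<open>n\<close> the multiple is proportional to
  \<open>s / t\<close>, and clearing the denominator raises the degree.\<close>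

definition add_box :: "nat \<Rightarrow> int \<Rightarrow> nat \<Rightarrow> (int set \<Rightarrow> complex) \<Rightarrow> (pvar \<Rightarrow> complex poly) \<Rightarrow> pvar \<Rightarrow> complex poly" where
  "add_box n y e c x v = x v + (if can_lower n y v then smult (c (snd v)) (monom 1 e * x (lower n y v)) else 0)"

text \<open>Heights at neighbouring gaps differ by zero or one, so the bounds at the neighbours
  decide whether the two letters next to \<open>y\<close> belong to \<open>A\<close>.\<close>

lemma addable_can_lower:
  assumes ad: "addable n W y" and n: "n \<ge> 1" and y: "- int n < y" "y \<le> int n"
    and A: "A \<in> nsubsets n n" and b: "below n (raise n W y) (a, A)" and h: "ht (a, A) y = W y + 1"
  shows "can_lower n y (a, A)"
proof -
  have B: "ht (a, A) z \<le> raise n W y z" if "- int n \<le> z" "z \<le> int n" for z using b that by (simp add: below_def)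
  consider "y = int n" | "0 < y" "y < int n" | "y < 0" | "y = 0" "y \<noteq> int n" using y by linarith
  then show ?thesis
  proof cases
    case 1
    have W: "W (y - 1) \<le> W y + 1" "W (- (y - 1)) \<le> W y + 1" "0 \<le> W y" "W (- y) = W y"
      using ad 1 by (auto simp: addable_def)
    have "ht (a, A) (y - 1) \<le> raise n W y (y - 1)" "ht (a, A) (- (y - 1)) \<le> raise n W y (- (y - 1))"
      using 1 n B[of "y - 1"] B[of "- (y - 1)"] by auto
    moreover have "raise n W y (y - 1) = W (y - 1)" "raise n W y (- (y - 1)) = W (- (y - 1))"
      using 1 n by (auto simp: raise_def)
    ultimately have "ht (a, A) (y - 1) \<le> ht (a, A) y" "ht (a, A) (- (y - 1)) \<le> ht (a, A) y"
      using W h by auto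
    moreover have "ht (a, A) (- y) = ht (a, A) y" using 1 ht_at_n[OF A] ht_at_minus_n[OF A] by simp
    ultimately have "y \<notin> A" "- y \<in> A"
      using ht_step_pos[OF A, of y a] ht_step_neg[OF A, of y a] 1 n by (auto split: if_splits)
    moreover have "a \<ge> 1" using h W(3) 1 ht_at_n[OF A, of a] by simp
    ultimately show ?thesis using 1 n by (simp add: can_lower_def lo_def hi_def)
  next
    case 2
    have W: "W (y - 1) \<le> W y + 1" "W (y + 1) \<le> W y" using ad 2 by (auto simp: addable_def)
    have "ht (a, A) (y - 1) \<le> raise n W y (y - 1)" "ht (a, A) (y + 1) \<le> raise n W y (y + 1)"
      using 2 B[of "y - 1"] B[of "y + 1"] by auto
    then have "ht (a, A) (y - 1) \<le> ht (a, A) y" "ht (a, A) (y + 1) < ht (a, A) y"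
      using W h 2 by (auto simp: raise_def)
    then have "y \<notin> A" "y + 1 \<in> A"
      using ht_step_pos[OF A, of y a] ht_step_pos[OF A, of "y + 1" a] 2 by (auto split: if_splits)
    then show ?thesis using 2 by (simp add: can_lower_def lo_def hi_def)
  next
    case 3
    have W: "W (y + 1) \<le> W y + 1" "W (y - 1) \<le> W y" using ad 3 by (auto simp: addable_def)
    have "ht (a, A) (y - 1) \<le> raise n W y (y - 1)" "ht (a, A) (y + 1) \<le> raise n W y (y + 1)"
      using 3 y B[of "y - 1"] B[of "y + 1"] by auto
    then have "ht (a, A) (y + 1) \<le> ht (a, A) y" "ht (a, A) (y - 1) < ht (a, A) y"
      using W h 3 y by (auto simp: raise_def)
    then have "y \<in> A" "y - 1 \<notin> A"
      using ht_step_neg[OF A, of "- y" a] ht_step_neg[OF A, of "- y + 1" a] 3 by (auto split: if_splits simp: algebra_simps)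
    then show ?thesis using 3 by (simp add: can_lower_def lo_def hi_def)
  next
    case 4
    have W: "W 1 \<le> W 0" "W (-1) \<le> W 0" using ad 4 by (auto simp: addable_def)
    have "ht (a, A) 1 \<le> raise n W y 1" "ht (a, A) (-1) \<le> raise n W y (-1)"
      using 4 n B[of 1] B[of "-1"] by auto
    then have "ht (a, A) 1 < ht (a, A) 0" "ht (a, A) (-1) < ht (a, A) 0"
      using W h 4 by (auto simp: raise_def)
    then have "1 \<in> A" "-1 \<notin> A"
      using ht_step_pos[OF A, of 1 a] ht_step_neg[OF A, of 1 a] by (auto split: if_splits)
    then show ?thesis using 4 by (simp add: can_lower_def lo_def hi_def)
  qed
qed

text \<open>A variable whose height at \<open>y\<close> reaches the new box gets its lowest term from that box; for
  all others the new term has strictly larger order, since the weights increase with the height.\<close>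

lemma alg_inv_add_box:
  assumes inv: "alg_inv n w W x" and ad: "addable n W y" and n: "n \<ge> 1" and y: "- int n < y" "y \<le> int n"
    and w: "\<And>y. strict_mono (w y)" and c: "\<And>A. c A \<noteq> 0"
  shows "alg_inv n w (raise n W y) (add_box n y (w y (nat (W y + 1))) c x)"
  unfolding alg_inv_def
proof (intro allI impI)
  fix a :: nat and A :: "int set" assume A: "A \<in> nsubsets n n"
  let ?v = "(a, A)" and ?x' = "add_box n y (w y (nat (W y + 1))) c x"
  let ?l = "lower n y ?v"
  have old: "if below n W (b, B) then \<exists>g. x (b, B) = monom 1 (wt n w (b, B)) * g \<and> poly g 0 \<noteq> 0 else x (b, B) = 0"
    if "B \<in> nsubsets n n" for b B using inv that unfolding alg_inv_def by blast
  have lw: "snd ?l \<in> nsubsets n n" if "can_lower n y ?v"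
    using that lower_nsubsets[OF A y] by (auto simp: can_lower_def lower_def)
  have lht: "ht ?l z = ht ?v z - (if z = y \<or> y = int n \<and> z = - int n then 1 else 0)"
    if "can_lower n y ?v" "- int n \<le> z" "z \<le> int n" for z
    using lower_ht[OF A y n] that by (auto simp: can_lower_def)
  have lwt: "wt n w ?v = wt n w ?l + w y (nat (ht ?v y))" "ht ?v y \<ge> 1" if "can_lower n y ?v"
    using wt_lower[OF A y n] that by (auto simp: can_lower_def)
  have lbelow: "below n W ?l \<longleftrightarrow> below n (raise n W y) ?v" if "can_lower n y ?v"
    unfolding below_def raise_def using lht[OF that] by (smt (verit, best))
  have oldl: "\<exists>g. x ?l = monom 1 (wt n w ?l) * g \<and> poly g 0 \<noteq> 0"
    if "can_lower n y ?v" "below n (raise n W y) ?v"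
    using old[OF lw[OF that(1)], of "fst ?l"] lbelow[OF that(1)] that(2) by simp
  show "if below n (raise n W y) ?v then \<exists>g. ?x' ?v = monom 1 (wt n w ?v) * g \<and> poly g 0 \<noteq> 0 else ?x' ?v = 0"
  proof (cases "below n (raise n W y) ?v")
    case False
    have "\<not> below n W ?v"
    proof
      assume "below n W ?v"
      then have "below n (raise n W y) ?v" unfolding below_def raise_def by (smt (verit, best))
      then show False using False by simp
    qed
    then have "x ?v = 0" using old[OF A, of a] by simp
    moreover have "x ?l = 0" if "can_lower n y ?v"
      using old[OF lw[OF that], of "fst ?l"] lbelow[OF that] False by simp
    ultimately show ?thesis using False by (simp add: add_box_def)
  next
    case b: True
    have hb: "ht ?v y \<le> W y + 1" using b[unfolded below_def raise_def, rule_format, of y] y by simp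
    show ?thesis
    proof (cases "below n W ?v")
      case False
      have "ht ?v y = W y + 1"
      proof (rule ccontr)
        assume ne: "ht ?v y \<noteq> W y + 1"
        have "below n W ?v" unfolding below_def
        proof (intro allI impI)
          fix z assume z: "- int n \<le> z \<and> z \<le> int n"
          show "ht ?v z \<le> W z"
          proof (cases "z = y \<or> y = int n \<and> z = - int n")
            case True
            then have "ht ?v z = ht ?v y" "W z = W y"
              using ht_at_n[OF A, of a] ht_at_minus_n[OF A, of a] ad by (auto simp: addable_def)
            then show ?thesis using hb ne by simp
          next
            case False
            then show ?thesis using b z by (auto simp: below_def raise_def)
          qed
        qed
        then show False using False by simp
      qed
      then have cl: "can_lower n y ?v" by (rule addable_can_lower[OF ad n y A b])
      obtain g where g: "x ?l = monom 1 (wt n w ?l) * g" "poly g 0 \<noteq> 0" using oldl[OF cl b] by blast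
      have "x ?v = 0" using old[OF A, of a] False by simp
      then have "?x' ?v = smult (c A) (monom 1 (w y (nat (ht ?v y))) * x ?l)"
        using cl \<open>ht ?v y = W y + 1\<close> by (simp add: add_box_def)
      also have "\<dots> = monom 1 (wt n w ?v) * smult (c A) g"
        unfolding g(1) lwt(1)[OF cl] by (simp add: mult_monom add.commute flip: mult.assoc)
      finally show ?thesis using b g(2) c by (auto intro!: exI[of _ "smult (c A) g"])
    next
      case True
      then obtain g where g: "x ?v = monom 1 (wt n w ?v) * g" "poly g 0 \<noteq> 0" using old[OF A, of a] by auto
      show ?thesis
      proof (cases "can_lower n y ?v")
        case False
        then show ?thesis using b g by (auto simp: add_box_def)
      next
        case cl: True
        obtain g' where g': "x ?l = monom 1 (wt n w ?l) * g'" using oldl[OF cl b] by blast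
        have "ht ?v y \<le> W y" using True y by (simp add: below_def)
        then have "nat (ht ?v y) < nat (W y + 1)" using lwt(2)[OF cl] by simp
        then have "w y (nat (ht ?v y)) < w y (nat (W y + 1))" using w strict_monoD by blast
        then obtain m where m: "w y (nat (W y + 1)) = w y (nat (ht ?v y)) + Suc m"
          using less_imp_Suc_add by auto
        have "monom 1 (w y (nat (W y + 1))) * x ?l = monom 1 (wt n w ?v) * (monom 1 (Suc m) * g')"
          unfolding g' lwt(1)[OF cl] m by (simp add: mult_monom ac_simps flip: mult.assoc)
        then have "?x' ?v = monom 1 (wt n w ?v) * (g + smult (c A) (monom 1 (Suc m) * g'))"
          using cl g by (simp add: add_box_def distrib_left)
        moreover have "poly (g + smult (c A) (monom 1 (Suc m) * g')) 0 \<noteq> 0"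
          using g(2) by (simp add: poly_monom)
        ultimately show ?thesis using b by auto
      qed
    qed
  qed
qed

section \<open>Row operations on frames, their effect on minors and on isotropy\<close>

definition sg :: "int \<Rightarrow> int \<Rightarrow> int set \<Rightarrow> int" where
  "sg l h A = sort_sign (map (\<lambda>k. if k = h then l else k) (sorted_list_of_set A))"

definition row_add :: "int \<Rightarrow> int \<Rightarrow> complex \<Rightarrow> (int \<Rightarrow> nat \<Rightarrow> complex) \<Rightarrow> int \<Rightarrow> nat \<Rightarrow> complex" where
  "row_add l h c U = (\<lambda>k j. U k j + (if k = h then c * U l j else 0))"

text \<open>The flag \<open>lg\<close> adds isotropy, so that one construction serves the maps to
  both kinds of Grassmannian.\<close>

definition frameable :: "nat \<Rightarrow> bool \<Rightarrow> (int set \<Rightarrow> complex) \<Rightarrow> bool" where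
  "frameable n lg P \<longleftrightarrow> (\<exists>A\<in>nsubsets n n. P A \<noteq> 0) \<and>
     (\<exists>U. (\<forall>A\<in>nsubsets n n. P A = minor n U A) \<and>
       (lg \<longrightarrow> (\<forall>i<n. \<forall>j<n. Omega n (\<lambda>k. U k i) (\<lambda>k. U k j) = 0)))"

lemma sg_square: "of_int (sg l h A) * of_int (sg l h A) = (1 :: 'a :: ring_1)"
  unfolding sg_def by (simp flip: of_int_mult add: sort_sign_square)

lemma sg_nonzero: "(of_int (sg l h A) :: complex) \<noteq> 0"
  using sg_square[of l h A, where ?'a = complex] by auto

lemma mdet_row_add:
  assumes xs: "distinct xs" "length xs = n" "h \<in> set xs" and lh: "l \<noteq> h"
  shows "mdet n (row_add l h c U) xs = mdet n U xs + c * mdet n U (map (\<lambda>k. if k = h then l else k) xs)"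
proof -
  let ?ys = "map (\<lambda>k. if k = h then l else k) xs"
  obtain i0 where i0: "i0 < n" "xs ! i0 = h" using xs by (auto simp: in_set_conv_nth)
  have ne: "xs ! i \<noteq> h" if "i < n" "i \<noteq> i0" for i
    using that i0 xs nth_eq_iff_index_eq[of xs i i0] by auto
  have "(\<Prod>i = 0..<n. row_add l h c U (xs ! i) (\<sigma> i)) = (\<Prod>i = 0..<n. U (xs ! i) (\<sigma> i)) + c * (\<Prod>i = 0..<n. U (?ys ! i) (\<sigma> i))" for \<sigma> :: "nat \<Rightarrow> nat"
  proof -
    have r: "(\<Prod>i = 0..<n. f i) = f i0 * (\<Prod>i\<in>{0..<n} - {i0}. f i)" for f :: "nat \<Rightarrow> complex"
      using i0 by (intro prod.remove) auto
    have 1: "(\<Prod>i\<in>{0..<n} - {i0}. row_add l h c U (xs ! i) (\<sigma> i)) = (\<Prod>i\<in>{0..<n} - {i0}. U (xs ! i) (\<sigma> i))"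
      using ne by (intro prod.cong) (auto simp: row_add_def)
    have 2: "(\<Prod>i\<in>{0..<n} - {i0}. U (?ys ! i) (\<sigma> i)) = (\<Prod>i\<in>{0..<n} - {i0}. U (xs ! i) (\<sigma> i))"
      using ne xs by (intro prod.cong) auto
    have 3: "row_add l h c U (xs ! i0) (\<sigma> i0) = U (xs ! i0) (\<sigma> i0) + c * U (?ys ! i0) (\<sigma> i0)"
      using i0 xs by (simp add: row_add_def)
    show ?thesis unfolding r 1 2 3 by (simp add: algebra_simps)
  qed
  then show ?thesis unfolding mdet_expand by (simp add: sum.distrib sum_distrib_left algebra_simps)
qed

lemma minor_row_add:
  assumes A: "A \<in> nsubsets n n" and lh: "l \<noteq> h"
  shows "minor n (row_add l h c U) A = minor n U A +
    (if h \<in> A \<and> l \<notin> A then c * of_int (sg l h A) * minor n U (insert l (A - {h})) else 0)"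
proof (cases "h \<in> A")
  case False
  note L = nsubsets_list[OF A]
  have "sorted_list_of_set A ! i \<noteq> h" if "i < n" for i
    using L that False nth_mem[of i "sorted_list_of_set A"] by auto
  then have "minor n (row_add l h c U) A = minor n U A"
    unfolding minor_eq_mdet mdet_expand by (intro sum.cong refl arg_cong2[of _ _ _ _ "(*)"] prod.cong) (auto simp: row_add_def)
  then show ?thesis using False by simp
next
  case True
  let ?xs = "sorted_list_of_set A" let ?ys = "map (\<lambda>k. if k = h then l else k) ?xs"
  note L = nsubsets_list[OF A]
  have eq: "minor n (row_add l h c U) A = minor n U A + c * mdet n U ?ys"
    unfolding minor_eq_mdet using L True lh by (intro mdet_row_add) auto
  show ?thesis
  proof (cases "l \<in> A")
    case lA: True
    have "\<not> distinct ?ys"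
    proof
      assume "distinct ?ys"
      then have "inj_on (\<lambda>k. if k = h then l else k) A" using L by (simp add: distinct_map)
      then show False using lA True lh by (auto dest: inj_onD[of _ _ l h])
    qed
    then have "mdet n U ?ys = 0" using L by (intro mdet_not_distinct) auto
    then show ?thesis using eq lA by simp
  next
    case False
    have "inj_on (\<lambda>k. if k = h then l else k) A" using False by (auto simp: inj_on_def)
    then have d: "distinct ?ys" using L by (simp add: distinct_map)
    have "set ?ys = insert l (A - {h})" using L True by auto
    then have "mdet n U ?ys = of_int (sg l h A) * minor n U (insert l (A - {h}))"
      using mdet_sort[OF d, of n U] L by (simp add: sg_def minor_eq_mdet)
    then show ?thesis using eq False True by simp
  qed
qed

text \<open>The operation is triangular: the coordinates without the letter \<open>hi n y\<close>
  are only scaled, hence vanish, and they are the ones that are added to the others.\<close>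

lemma nonvanishing_add_box:
  assumes z: "\<And>A. A \<in> nsubsets n n \<Longrightarrow> t * P A + (if hi n y \<in> A \<and> lo y \<notin> A then c A * P (insert (lo y) (A - {hi n y})) else 0) = (0 :: complex)"
    and t: "t \<noteq> 0" and y: "- int n < y" "y \<le> int n" and n: "n \<ge> 1" and A: "A \<in> nsubsets n n"
  shows "P A = 0"
proof -
  have lh: "lo y \<noteq> hi n y" using y n by (auto simp: lo_def hi_def)
  have "P B = 0" if "B \<in> nsubsets n n" "hi n y \<notin> B" for B using z[OF that(1)] that(2) t by simp
  moreover have "insert (lo y) (A - {hi n y}) \<in> nsubsets n n" if "hi n y \<in> A" "lo y \<notin> A"
    using lower_nsubsets[OF A y] that by simp
  ultimately have "(if hi n y \<in> A \<and> lo y \<notin> A then c A * P (insert (lo y) (A - {hi n y})) else 0) = 0"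
    using lh by auto
  then have "t * P A = 0" using z[OF A] by simp
  then show ?thesis using t by simp
qed

text \<open>Rows \<open>1\<close> and \<open>-1\<close> are dual to each other, so this is a
  symplectic transvection.\<close>

lemma Omega_row_add_0:
  "Omega n (\<lambda>k. row_add (-1) 1 c U k i) (\<lambda>k. row_add (-1) 1 c U k j) = Omega n (\<lambda>k. U k i) (\<lambda>k. U k j)"
  unfolding Omega_def by (intro sum.cong refl) (auto simp: row_add_def algebra_simps)

text \<open>The change \<open>D\<close> in the pairing of rows \<open>x\<close> and
  \<open>- x\<close> cancels against that of rows \<open>x + 1\<close> and \<open>- x - 1\<close>.
  This forces the boxes at \<open>y\<close> and \<open>- y\<close> to be added together, with
  opposite coefficients.\<close>

lemma Omega_row_add_pair:
  fixes c :: complex and U :: "int \<Rightarrow> nat \<Rightarrow> complex"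
  assumes "0 < x" "x < int n"
  defines "V \<equiv> row_add (- x - 1) (- x) (- c) (row_add x (x + 1) c U)"
  shows "Omega n (\<lambda>k. V k i) (\<lambda>k. V k j) = Omega n (\<lambda>k. U k i) (\<lambda>k. U k j)"
proof -
  define D where "D = c * (U x i * U (- x - 1) j - U (- x - 1) i * U x j)"
  have V: "V k j = U k j + (if k = x + 1 then c * U x j else 0) + (if k = - x then - c * U (- x - 1) j else 0)" for k j
    using assms by (auto simp: V_def row_add_def)
  have "V (- k) i * V k j - V k i * V (- k) j = U (- k) i * U k j - U k i * U (- k) j
      + (if k = x then D else 0) + (if k = x + 1 then - D else 0)" if "k \<in> {1..int n}" for k
  proof -
    consider "k = x" | "k = x + 1" | "k \<noteq> x" "k \<noteq> x + 1" by blast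
    then show ?thesis
    proof cases
      case 1
      then have f: "V (- k) i = U (- x) i - c * U (- x - 1) i" "V (- k) j = U (- x) j - c * U (- x - 1) j"
        "V k i = U x i" "V k j = U x j" using assms(1,2) by (auto simp: V)
      show ?thesis unfolding f using 1 by (simp add: D_def algebra_simps)
    next
      case 2
      then have f: "V (- k) i = U (- x - 1) i" "V (- k) j = U (- x - 1) j"
        "V k i = U (x + 1) i + c * U x i" "V k j = U (x + 1) j + c * U x j" using assms(1,2) by (auto simp: V)
      have nk: "- k = - x - 1" using 2 by simp
      show ?thesis unfolding f unfolding nk using 2 by (simp add: D_def algebra_simps)
    next
      case 3
      then have "V (- k) i = U (- k) i" "V (- k) j = U (- k) j" "V k i = U k i" "V k j = U k j"
        using that assms(1,2) by (auto simp: V)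
      then show ?thesis using 3 by simp
    qed
  qed
  then have "Omega n (\<lambda>k. V k i) (\<lambda>k. V k j) = (\<Sum>k\<in>{1..int n}. U (- k) i * U k j - U k i * U (- k) j
      + (if k = x then D else 0) + (if k = x + 1 then - D else 0))"
    unfolding Omega_def by (rule sum.cong[OF refl])
  also have "\<dots> = Omega n (\<lambda>k. U k i) (\<lambda>k. U k j)"
    unfolding Omega_def using assms(1,2) by (simp add: sum.distrib)
  finally show ?thesis .
qed

lemma mdet_scale_column:
  assumes "j0 < n"
  shows "mdet n (\<lambda>k j. if j = j0 then t * U k j else U k j) xs = t * mdet n U xs"
proof -
  have "(\<Prod>i = 0..<n. if \<sigma> i = j0 then t * U (xs ! i) (\<sigma> i) else U (xs ! i) (\<sigma> i)) = t * (\<Prod>i = 0..<n. U (xs ! i) (\<sigma> i))"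
    if \<sigma>: "\<sigma> permutes {0..<n}" for \<sigma>
  proof -
    have "(\<Prod>i = 0..<n. if \<sigma> i = j0 then t * U (xs ! i) (\<sigma> i) else U (xs ! i) (\<sigma> i)) =
       (\<Prod>i = 0..<n. (if \<sigma> i = j0 then t else 1) * U (xs ! i) (\<sigma> i))"
      by (intro prod.cong) auto
    also have "\<dots> = (\<Prod>i = 0..<n. if \<sigma> i = j0 then t else 1) * (\<Prod>i = 0..<n. U (xs ! i) (\<sigma> i))"
      by (rule prod.distrib)
    also have "(\<Prod>i = 0..<n. if \<sigma> i = j0 then t else 1) = (\<Prod>i = 0..<n. if i = j0 then t else 1)"
      using prod.permute[OF \<sigma>, of "\<lambda>i. if i = j0 then t else 1"] by (simp add: o_def)
    also have "\<dots> = t" using assms by simp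
    finally show ?thesis .
  qed
  then show ?thesis unfolding mdet_expand sum_distrib_left by (intro sum.cong) (auto simp: algebra_simps)
qed

lemma mdet_shear_columns:
  assumes j0: "j0 < n" and w: "w j0 = 0" and xs: "length xs = n"
  shows "mdet n (\<lambda>k j. U k j - w j * U k j0) xs = mdet n U xs"
proof -
  define G where "G = mat n n (\<lambda>(l, j). (if l = j then 1 else 0) - (if l = j0 then w j else 0))"
  have G: "G \<in> carrier_mat n n" by (simp add: G_def)
  let ?V = "mat n n (\<lambda>(i, l). U (xs ! i) l)"
  have "mat n n (\<lambda>(i, j). U (xs ! i) j - w j * U (xs ! i) j0) = ?V * G"
  proof (rule eq_matI)
    fix i j assume "i < dim_row (?V * G)" "j < dim_col (?V * G)"
    then have ij: "i < n" "j < n" by (auto simp: G_def)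
    have "(?V * G) $$ (i, j) = (\<Sum>l\<in>{0..<n}. (if l = j then U (xs ! i) l else 0) - (if l = j0 then w j * U (xs ! i) l else 0))"
      using ij by (simp add: G_def scalar_prod_def) (intro sum.cong, auto simp: algebra_simps)
    also have "\<dots> = U (xs ! i) j - w j * U (xs ! i) j0" using ij j0 by (simp add: sum_subtractf)
    finally show "mat n n (\<lambda>(i, j). U (xs ! i) j - w j * U (xs ! i) j0) $$ (i, j) = (?V * G) $$ (i, j)"
      using ij by simp
  qed (auto simp: G_def)
  then have "mdet n (\<lambda>k j. U k j - w j * U k j0) xs = mdet n U xs * det G"
    unfolding mdet_def using det_mult[OF _ G, of ?V] by simp
  moreover have "det G = 1"
  proof -
    have "(\<Prod>i = 0..<n. G $$ (i, \<sigma> i)) = (if \<sigma> = id then 1 else 0)" if \<sigma>: "\<sigma> permutes {0..<n}" for \<sigma>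
    proof (cases "\<sigma> = id")
      case True
      have "(\<Prod>i = 0..<n. G $$ (i, \<sigma> i)) = (\<Prod>i = 0..<n. 1)"
        using True w by (intro prod.cong) (auto simp: G_def)
      then show ?thesis using True by simp
    next
      case False
      have "\<exists>i<n. i \<noteq> j0 \<and> \<sigma> i \<noteq> i"
      proof (rule ccontr)
        assume "\<not> ?thesis"
        then have f: "\<sigma> i = i" if "i \<noteq> j0" for i
          using that permutes_not_in[OF \<sigma>, of i] by (cases "i < n") auto
        have "\<sigma> j0 = j0" using f[of "\<sigma> j0"] permutes_inj[OF \<sigma>] by (metis injD)
        then have "\<sigma> i = id i" for i using f[of i] by (cases "i = j0") auto
        then have "\<sigma> = id" by blast
        then show False using False by simp
      qed
      then obtain i where i: "i < n" "i \<noteq> j0" "\<sigma> i \<noteq> i" by blast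
      then have "G $$ (i, \<sigma> i) = 0" using permutes_less[OF \<sigma> i(1)] by (simp add: G_def)
      then have "(\<Prod>i = 0..<n. G $$ (i, \<sigma> i)) = 0" using i by (intro prod_zero) auto
      then show ?thesis using False by simp
    qed
    then have "det G = (\<Sum>\<sigma> | \<sigma> permutes {0..<n}. of_int (sign \<sigma>) * (if \<sigma> = id then 1 else 0))"
      by (subst det_def'[OF G]) (intro sum.cong, auto)
    also have "\<dots> = (\<Sum>\<sigma> | \<sigma> permutes {0..<n}. if \<sigma> = id then 1 else 0)"
      by (intro sum.cong) (auto simp: sign_id)
    also have "\<dots> = 1" using permutes_id[of "{0..<n}"] by (simp add: finite_permutations)
    finally show ?thesis .
  qed
  ultimately show ?thesis by simp
qed

lemma Omega_column_combination:
  "Omega n (\<lambda>k. a * u k + b * u' k) v = a * Omega n u v + b * Omega n u' v"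
  "Omega n v (\<lambda>k. a * u k + b * u' k) = a * Omega n v u + b * Omega n v u'"
  unfolding Omega_def by (simp_all add: sum.distrib sum_subtractf sum_distrib_left algebra_simps)

lemma Omega_self: "Omega n u u = 0"
  by (simp add: Omega_def)

lemma Omega_swap: "Omega n u v = - Omega n v u"
  unfolding Omega_def sum_negf[symmetric] by (intro sum.cong) (auto simp: algebra_simps)

lemma Omega_unit: "n \<ge> 1 \<Longrightarrow> Omega n (\<lambda>k. if k = - int n then 1 else 0) v = v (int n)"
proof -
  assume n: "n \<ge> 1"
  have "Omega n (\<lambda>k. if k = - int n then 1 else 0) v = (\<Sum>k\<in>{1..int n}. if k = int n then v k else 0)"
    unfolding Omega_def by (intro sum.cong) auto
  then show ?thesis using n by simp
qed

text \<open>The degree-raising letter. If the frame is column reduced so that row \<open>n\<close> has a single nonzero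
  entry, only that column is modified; for \<open>t \<noteq> 0\<close> this is a row operation, and the case \<open>t = 0\<close>
  follows by polynomial continuation.\<close>

lemma loop_frame:
  assumes n: "n \<ge> 1" and U: "lg \<Longrightarrow> \<forall>i<n. \<forall>j<n. Omega n (\<lambda>k. U k i) (\<lambda>k. U k j) = 0"
  shows "\<exists>V. (\<forall>A\<in>nsubsets n n. minor n V A = t * minor n U A +
       (if - int n \<in> A \<and> int n \<notin> A then c * of_int (sg (int n) (- int n) A) * minor n U (insert (int n) (A - {- int n})) else 0)) \<and>
     (lg \<longrightarrow> (\<forall>i<n. \<forall>j<n. Omega n (\<lambda>k. V k i) (\<lambda>k. V k j) = 0))"
proof (cases "\<exists>j0<n. U (int n) j0 \<noteq> 0")
  case False
  then have zrow: "U (int n) j = 0" if "j < n" for j using that by blast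
  have z: "minor n U B = 0" if B: "B \<in> nsubsets n n" "int n \<in> B" for B
  proof -
    note L = nsubsets_list[OF B(1)]
    obtain i where i: "i < n" "sorted_list_of_set B ! i = int n" using L B(2) by (metis in_set_conv_nth)
    have "(\<Prod>i = 0..<n. U (sorted_list_of_set B ! i) (\<sigma> i)) = 0" if "\<sigma> permutes {0..<n}" for \<sigma>
      using i zrow permutes_less[OF that i(1)] by (intro prod_zero bexI[of _ i]) auto
    then show ?thesis unfolding minor_eq_mdet mdet_expand by (intro sum.neutral) simp
  qed
  \<comment> \<open>With row \<open>n\<close> equal to zero the additional term vanishes, and
    scaling one column scales all minors, also for \<open>t = 0\<close>.\<close>
  define V where "V = (\<lambda>k j. if j = 0 then t * U k j else U k j)"
  have "minor n V A = t * minor n U A + (if - int n \<in> A \<and> int n \<notin> A then c * of_int (sg (int n) (- int n) A) * minor n U (insert (int n) (A - {- int n})) else 0)"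
    if A: "A \<in> nsubsets n n" for A
  proof -
    have "minor n U (insert (int n) (A - {- int n})) = 0" if "- int n \<in> A \<and> int n \<notin> A"
      using lower_nsubsets[OF A, of "int n"] that n by (intro z) (auto simp: lo_def hi_def)
    then have "(if - int n \<in> A \<and> int n \<notin> A then c * of_int (sg (int n) (- int n) A) * minor n U (insert (int n) (A - {- int n})) else 0) = 0"
      by simp
    moreover have "minor n V A = t * minor n U A"
      unfolding minor_eq_mdet V_def by (rule mdet_scale_column) (use n in simp)
    ultimately show ?thesis by (simp only: add_0_right)
  qed
  moreover have "\<forall>i<n. \<forall>j<n. Omega n (\<lambda>k. V k i) (\<lambda>k. V k j) = 0" if lg
  proof -
    have "(\<lambda>k. V k i) = (\<lambda>k. (if i = 0 then t else 1) * U k i + 0 * U k i)" for i by (auto simp: V_def)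
    then show ?thesis using U[OF that] by (simp only: Omega_column_combination) simp
  qed
  ultimately show ?thesis by (intro exI[of _ V]) blast
next
  case True
  then obtain j0 where j0: "j0 < n" "U (int n) j0 \<noteq> 0" by blast
  define r where "r = U (int n) j0"
  define w where "w = (\<lambda>j. if j = j0 then 0 else U (int n) j / r)"
  define U1 where "U1 = (\<lambda>k j. U k j - w j * U k j0)"
  have m1: "minor n U1 A = minor n U A" if "A \<in> nsubsets n n" for A
    unfolding minor_eq_mdet U1_def using j0 nsubsets_list[OF that] by (intro mdet_shear_columns) (auto simp: w_def)
  have U1n: "U1 (int n) j = (if j = j0 then r else 0)" for j
    using j0 by (auto simp: U1_def w_def r_def)
  define V where "V = (\<lambda>t k j. if j = j0 then t * U1 k j + (if k = - int n then c * r else 0) else U1 k j)"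
  let ?ins = "\<lambda>A. insert (int n) (A - {- int n})"
  have main: "minor n (V t) A = t * minor n U A + (if - int n \<in> A \<and> int n \<notin> A then c * of_int (sg (int n) (- int n) A) * minor n U (?ins A) else 0)"
    if A: "A \<in> nsubsets n n" for A t
  proof -
    let ?e = "if - int n \<in> A \<and> int n \<notin> A then c * of_int (sg (int n) (- int n) A) * minor n U (?ins A) else 0"
    have insA: "?ins A \<in> nsubsets n n" if "- int n \<in> A" "int n \<notin> A"
      using lower_nsubsets[OF A, of "int n"] that n by (auto simp: lo_def hi_def)
    have nz: "minor n (V t) A = t * minor n U A + ?e" if t: "t \<noteq> 0" for t
    proof -
      have V: "V t = (\<lambda>k j. if j = j0 then t * row_add (int n) (- int n) (c / t) U1 k j else row_add (int n) (- int n) (c / t) U1 k j)"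
        using t by (auto simp: V_def row_add_def U1n fun_eq_iff algebra_simps)
      have "minor n (V t) A = t * minor n (row_add (int n) (- int n) (c / t) U1) A"
        unfolding V minor_eq_mdet by (rule mdet_scale_column[OF j0(1)])
      then show ?thesis using minor_row_add[OF A, of "int n" "- int n" "c / t" U1] n t m1[OF A] m1[OF insA]
        by (auto simp: algebra_simps)
    qed
    define W where "W = (\<lambda>k j. if j = j0 then [:if k = - int n then c * r else 0, U1 k j:] else [:U1 k j:])"
    have pW: "poly (mdet n W (sorted_list_of_set A)) t = minor n (V t) A" for t
    proof -
      have "(\<lambda>k j. poly (W k j) t) = V t" by (auto simp: W_def V_def fun_eq_iff)
      then show ?thesis by (simp add: poly_mdet minor_eq_mdet)
    qed
    let ?p = "mdet n W (sorted_list_of_set A) - [:?e, minor n U A:]"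
    have "UNIV - {0} \<subseteq> {t. poly ?p t = 0}" using nz by (auto simp: pW)
    then have "infinite {t. poly ?p t = 0}"
      using infinite_UNIV_char_0[where ?'a = complex] by (meson finite_Diff2 finite.simps finite_subset)
    then have "?p = 0" using poly_roots_finite by blast
    then have "poly ?p t = 0" by simp
    then show ?thesis by (simp add: pW)
  qed
  moreover have "\<forall>i<n. \<forall>j<n. Omega n (\<lambda>k. V t k i) (\<lambda>k. V t k j) = 0" if lg
  proof -
    have c1: "(\<lambda>k. U1 k i) = (\<lambda>k. 1 * U k i + (- w i) * U k j0)" for i by (simp add: U1_def)
    have U1iso: "Omega n (\<lambda>k. U1 k i) (\<lambda>k. U1 k j) = 0" if "i < n" "j < n" for i j
      unfolding c1 Omega_column_combination using U[OF \<open>lg\<close>] that j0 by simp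
    have cj0: "(\<lambda>k. V t k j0) = (\<lambda>k. t * U1 k j0 + (c * r) * (if k = - int n then 1 else 0))" by (auto simp: V_def)
    have cj: "(\<lambda>k. V t k j) = (\<lambda>k. U1 k j)" if "j \<noteq> j0" for j using that by (auto simp: V_def)
    have mixed: "Omega n (\<lambda>k. V t k j0) (\<lambda>k. V t k j) = 0" if "j < n" "j \<noteq> j0" for j
      unfolding cj[OF that(2)] cj0 Omega_column_combination using U1iso[OF j0(1) that(1)] Omega_unit[OF n] U1n that by simp
    show ?thesis
    proof (intro allI impI)
      fix i j assume ij: "i < n" "j < n"
      consider "i = j0" "j = j0" | "i = j0" "j \<noteq> j0" | "i \<noteq> j0" "j = j0" | "i \<noteq> j0" "j \<noteq> j0" by blast
      then show "Omega n (\<lambda>k. V t k i) (\<lambda>k. V t k j) = 0"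
      proof cases
        case 3
        then show ?thesis using mixed[OF ij(1)] Omega_swap[of n "\<lambda>k. V t k i" "\<lambda>k. V t k j"] by simp
      next
        case 4
        then show ?thesis using cj U1iso[OF ij] by simp
      qed (use mixed ij in \<open>auto simp: Omega_self\<close>)
    qed
  qed
  ultimately show ?thesis by (intro exI[of _ "V t"]) blast
qed

section \<open>One-parameter families of maps, enlarged box by box\<close>

definition good_family :: "nat \<Rightarrow> bool \<Rightarrow> nat \<Rightarrow> (pvar \<Rightarrow> complex poly) \<Rightarrow> bool" where
  "good_family n lg k x \<longleftrightarrow> finite {z. \<not> (\<forall>s t. (s, t) \<noteq> (0, 0) \<longrightarrow>
     frameable n lg (\<lambda>A. plueval k (\<lambda>v. poly (x v) z) A s t))}"

lemma minor_add_box: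
  assumes y: "- int n < y" "y < int n" and A: "A \<in> nsubsets n n"
  shows "minor n (row_add (lo y) (hi n y) c U) A = minor n U A +
    (if hi n y \<in> A \<and> lo y \<notin> A then c * of_int (sg (lo y) (hi n y) A) * minor n U (insert (lo y) (A - {hi n y})) else 0)"
  using y by (intro minor_row_add[OF A]) (auto simp: lo_def hi_def)

lemma frameable_row_add:
  assumes y: "- int n < y" "y < int n" and n: "n \<ge> 1" and P: "frameable n lg P"
    and lg: "\<And>U i j. lg \<Longrightarrow> Omega n (\<lambda>k. row_add (lo y) (hi n y) c U k i) (\<lambda>k. row_add (lo y) (hi n y) c U k j)
       = Omega n (\<lambda>k. U k i) (\<lambda>k. U k j)"
  shows "frameable n lg (\<lambda>A. P A + (if hi n y \<in> A \<and> lo y \<notin> A then c * of_int (sg (lo y) (hi n y) A) * P (insert (lo y) (A - {hi n y})) else 0))"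
    (is "frameable n lg ?P'")
proof -
  obtain U where U: "\<And>A. A \<in> nsubsets n n \<Longrightarrow> P A = minor n U A"
    "lg \<Longrightarrow> \<forall>i<n. \<forall>j<n. Omega n (\<lambda>k. U k i) (\<lambda>k. U k j) = 0"
    using P unfolding frameable_def by blast
  have "\<exists>A\<in>nsubsets n n. ?P' A \<noteq> 0"
  proof (rule ccontr)
    assume a: "\<not> ?thesis"
    have "P A = 0" if "A \<in> nsubsets n n" for A
      by (rule nonvanishing_add_box[where t = 1 and c = "\<lambda>A. c * of_int (sg (lo y) (hi n y) A)" and y = y, OF _ _ _ _ n that])
         (use a y in auto)
    then show False using P unfolding frameable_def by blast
  qed
  moreover have "?P' A = minor n (row_add (lo y) (hi n y) c U) A" if "A \<in> nsubsets n n" for A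
    unfolding minor_add_box[OF y that] using U(1)[OF that] U(1)[OF lower_nsubsets[OF that, of y]] y by auto
  ultimately show ?thesis unfolding frameable_def using U(2) lg by (intro conjI exI[of _ "row_add (lo y) (hi n y) c U"]) auto
qed

lemma plueval_add_box:
  assumes "y \<noteq> int n"
  shows "plueval k (\<lambda>v. poly (add_box n y e (\<lambda>A. c * of_int (g A)) x v) z) A s t = plueval k (\<lambda>v. poly (x v) z) A s t +
    (if hi n y \<in> A \<and> lo y \<notin> A then (c * z ^ e) * of_int (g A) * plueval k (\<lambda>v. poly (x v) z) (insert (lo y) (A - {hi n y})) s t else 0)"
  using assms unfolding plueval_def
  by (auto simp: add_box_def can_lower_def lower_def poly_monom sum.distrib sum_distrib_left algebra_simps)

text \<open>Without a coefficient at \<open>Suc k\<close>, reading the old form in degree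
  \<open>Suc k\<close> multiplies it by \<open>t\<close>; the new term comes from exponents shifted
  by one, which multiplies it by \<open>s\<close>.\<close>

lemma plueval_add_loop:
  assumes "\<And>B. x (Suc k, B) = 0 \<or> B \<notin> nsubsets n n" and A: "A \<in> nsubsets n n" and n: "n \<ge> 1"
  shows "plueval (Suc k) (\<lambda>v. poly (add_box n (int n) e (\<lambda>A. c * of_int (g A)) x v) z) A s t = t * plueval k (\<lambda>v. poly (x v) z) A s t +
    (if - int n \<in> A \<and> int n \<notin> A then (c * z ^ e * s) * of_int (g A) * plueval k (\<lambda>v. poly (x v) z) (insert (int n) (A - {- int n})) s t else 0)"
proof -
  let ?l = "hi n (int n) \<in> A \<and> lo (int n) \<notin> A" let ?B = "insert (lo (int n)) (A - {hi n (int n)})"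
  have lh: "hi n (int n) = - int n" "lo (int n) = int n" using n by (auto simp: hi_def lo_def)
  have "plueval (Suc k) (\<lambda>v. poly (add_box n (int n) e (\<lambda>A. c * of_int (g A)) x v) z) A s t =
     (\<Sum>a\<le>Suc k. poly (x (a, A)) z * s ^ a * t ^ (Suc k - a)) +
     (\<Sum>a\<le>Suc k. if ?l \<and> a \<ge> 1 then c * of_int (g A) * z ^ e * poly (x (a - 1, ?B)) z * s ^ a * t ^ (Suc k - a) else 0)"
    unfolding plueval_def sum.distrib[symmetric]
    by (intro sum.cong) (auto simp: add_box_def can_lower_def lower_def poly_monom algebra_simps)
  also have "(\<Sum>a\<le>Suc k. poly (x (a, A)) z * s ^ a * t ^ (Suc k - a)) = t * plueval k (\<lambda>v. poly (x v) z) A s t"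
    unfolding plueval_def sum_distrib_left using assms(1)[of A] A
    by (simp add: Suc_diff_le) (intro sum.cong, auto simp: Suc_diff_le)
  also have "(\<Sum>a\<le>Suc k. if ?l \<and> a \<ge> 1 then c * of_int (g A) * z ^ e * poly (x (a - 1, ?B)) z * s ^ a * t ^ (Suc k - a) else 0)
     = (if ?l then (c * z ^ e * s) * of_int (g A) * plueval k (\<lambda>v. poly (x v) z) ?B s t else 0)"
    unfolding sum.atMost_Suc_shift plueval_def by (auto simp: sum_distrib_left algebra_simps)
  finally show ?thesis unfolding lh .
qed

lemma good_family_add_box:
  assumes y: "- int n < y" "y < int n" and n: "n \<ge> 1" and x: "good_family n lg k x"
    and lg: "lg \<Longrightarrow> y = 0"
  shows "good_family n lg k (add_box n y e (\<lambda>A. c * of_int (sg (lo y) (hi n y) A)) x)"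
proof -
  let ?ok = "\<lambda>x z. \<forall>s t. (s, t) \<noteq> (0, 0) \<longrightarrow> frameable n lg (\<lambda>A. plueval k (\<lambda>v. poly (x v) z) A s t)"
  let ?x' = "add_box n y e (\<lambda>A. c * of_int (sg (lo y) (hi n y) A)) x"
  have "?ok ?x' z" if "?ok x z" for z
  proof (intro allI impI)
    fix s t :: complex assume st: "(s, t) \<noteq> (0, 0)"
    have yn: "y \<noteq> int n" using y by simp
    show "frameable n lg (\<lambda>A. plueval k (\<lambda>v. poly (?x' v) z) A s t)"
      unfolding plueval_add_box[OF yn]
    proof (rule frameable_row_add[OF y n])
      show "frameable n lg (\<lambda>A. plueval k (\<lambda>v. poly (x v) z) A s t)" using that st by blast
      show "Omega n (\<lambda>k. row_add (lo y) (hi n y) (c * z ^ e) U k i) (\<lambda>k. row_add (lo y) (hi n y) (c * z ^ e) U k j)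
         = Omega n (\<lambda>k. U k i) (\<lambda>k. U k j)" if lg for U i j
        using lg[OF that] n by (simp add: lo_def hi_def Omega_row_add_0)
    qed
  qed
  then have "{z. \<not> ?ok ?x' z} \<subseteq> {z. \<not> ?ok x z}" by blast
  then show ?thesis using x unfolding good_family_def by (rule finite_subset)
qed

lemma good_family_add_pair:
  assumes y: "0 < y" "y < int n" and n: "n \<ge> 1" and x: "good_family n lg k x"
  shows "good_family n lg k (add_box n (- y) e (\<lambda>A. - 1 * of_int (sg (lo (- y)) (hi n (- y)) A))
     (add_box n y e (\<lambda>A. 1 * of_int (sg (lo y) (hi n y) A)) x))" (is "good_family n lg k ?x''")
proof -
  let ?x' = "add_box n y e (\<lambda>A. 1 * of_int (sg (lo y) (hi n y) A)) x"
  let ?ok = "\<lambda>x z. \<forall>s t. (s, t) \<noteq> (0, 0) \<longrightarrow> frameable n lg (\<lambda>A. plueval k (\<lambda>v. poly (x v) z) A s t)"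
  have "?ok ?x'' z" if z: "?ok x z" for z
  proof (intro allI impI)
    fix s t :: complex assume st: "(s, t) \<noteq> (0, 0)"
    have yn: "y \<noteq> int n" "- y \<noteq> int n" using y by auto
    let ?P = "\<lambda>A. plueval k (\<lambda>v. poly (x v) z) A s t"
    let ?P' = "\<lambda>A. plueval k (\<lambda>v. poly (?x' v) z) A s t"
    let ?P'' = "\<lambda>A. plueval k (\<lambda>v. poly (?x'' v) z) A s t"
    have P: "frameable n lg ?P" using z st by blast
    then obtain U where U: "\<And>A. A \<in> nsubsets n n \<Longrightarrow> ?P A = minor n U A"
      "lg \<Longrightarrow> \<forall>i<n. \<forall>j<n. Omega n (\<lambda>k. U k i) (\<lambda>k. U k j) = 0"
      unfolding frameable_def by blast
    have "frameable n False ?P" using P unfolding frameable_def by blast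
    then have "frameable n False ?P'" unfolding plueval_add_box[OF yn(1)]
      by (rule frameable_row_add[rotated 3]) (use y n in auto)
    then have "frameable n False ?P''" unfolding plueval_add_box[OF yn(2)]
      by (rule frameable_row_add[rotated 3]) (use y n in auto)
    then have nz: "\<exists>A\<in>nsubsets n n. ?P'' A \<noteq> 0" unfolding frameable_def by blast
    let ?c = "1 * z ^ e" let ?c' = "- 1 * z ^ e"
    let ?U' = "row_add (lo y) (hi n y) ?c U"
    let ?U'' = "row_add (lo (- y)) (hi n (- y)) ?c' ?U'"
    have P': "?P' A = minor n ?U' A" if "A \<in> nsubsets n n" for A
    proof -
      have "minor n ?U' A = minor n U A + (if hi n y \<in> A \<and> lo y \<notin> A then ?c * of_int (sg (lo y) (hi n y) A) * minor n U (insert (lo y) (A - {hi n y})) else 0)"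
        using y by (intro minor_add_box[OF _ _ that]) auto
      then show ?thesis unfolding plueval_add_box[OF yn(1)] using U(1)[OF that] U(1)[OF lower_nsubsets[OF that, of y]] y by auto
    qed
    have P'': "?P'' A = minor n ?U'' A" if "A \<in> nsubsets n n" for A
    proof -
      have "minor n ?U'' A = minor n ?U' A + (if hi n (- y) \<in> A \<and> lo (- y) \<notin> A then ?c' * of_int (sg (lo (- y)) (hi n (- y)) A) * minor n ?U' (insert (lo (- y)) (A - {hi n (- y)})) else 0)"
        using y by (intro minor_add_box[OF _ _ that]) auto
      then show ?thesis unfolding plueval_add_box[OF yn(2)] using P'[OF that] P'[OF lower_nsubsets[OF that, of "- y"]] y by auto
    qed
    have "?U'' = row_add (- y - 1) (- y) (- (z ^ e)) (row_add y (y + 1) (z ^ e) U)"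
      using y by (simp add: lo_def hi_def)
    then have "Omega n (\<lambda>k. ?U'' k i) (\<lambda>k. ?U'' k j) = Omega n (\<lambda>k. U k i) (\<lambda>k. U k j)" for i j
      using Omega_row_add_pair[OF y, of "z ^ e" U i j] by simp
    then show "frameable n lg ?P''" unfolding frameable_def using nz P'' U(2) by (intro conjI exI[of _ ?U'']) auto
  qed
  then have "{z. \<not> ?ok ?x'' z} \<subseteq> {z. \<not> ?ok x z}" by blast
  then show ?thesis using x unfolding good_family_def by (rule finite_subset)
qed

text \<open>For \<open>t\<close> nonzero the operation is invertible. At \<open>t = 0\<close> only
  the new term remains, and it is nonzero because of the top coefficient at \<open>B\<close>; the
  additional exceptional parameters are zero and the roots of this coefficient.\<close>

lemma good_family_add_loop:
  assumes n: "n \<ge> 1" and x: "good_family n lg k x" and top: "\<And>B. x (Suc k, B) = 0 \<or> B \<notin> nsubsets n n"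
    and B: "B \<in> nsubsets n n" "int n \<in> B" "- int n \<notin> B" "x (k, B) \<noteq> 0"
  shows "good_family n lg (Suc k) (add_box n (int n) e (\<lambda>A. 1 * of_int (sg (lo (int n)) (hi n (int n)) A)) x)"
proof -
  let ?ok = "\<lambda>k x z. \<forall>s t. (s, t) \<noteq> (0, 0) \<longrightarrow> frameable n lg (\<lambda>A. plueval k (\<lambda>v. poly (x v) z) A s t)"
  let ?x' = "add_box n (int n) e (\<lambda>A. 1 * of_int (sg (lo (int n)) (hi n (int n)) A)) x"
  have lh: "lo (int n) = int n" "hi n (int n) = - int n" using n by (auto simp: lo_def hi_def)
  have "?ok (Suc k) ?x' z" if ok: "?ok k x z" and z: "z \<noteq> 0" "poly (x (k, B)) z \<noteq> 0" for z
  proof (intro allI impI)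
    fix s t :: complex assume st: "(s, t) \<noteq> (0, 0)"
    let ?P = "\<lambda>A. plueval k (\<lambda>v. poly (x v) z) A s t"
    let ?P' = "\<lambda>A. plueval (Suc k) (\<lambda>v. poly (?x' v) z) A s t"
    let ?c = "1 * z ^ e * s"
    have P': "?P' A = t * ?P A + (if - int n \<in> A \<and> int n \<notin> A then ?c * of_int (sg (int n) (- int n) A) * ?P (insert (int n) (A - {- int n})) else 0)"
      if "A \<in> nsubsets n n" for A
      using plueval_add_loop[where g = "sg (lo (int n)) (hi n (int n))" and c = 1, OF top that n] unfolding lh .
    have P: "frameable n lg ?P" using ok st by blast
    then obtain U where U: "\<And>A. A \<in> nsubsets n n \<Longrightarrow> ?P A = minor n U A"
      "lg \<Longrightarrow> \<forall>i<n. \<forall>j<n. Omega n (\<lambda>k. U k i) (\<lambda>k. U k j) = 0"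
      unfolding frameable_def by blast
    have ins: "insert (int n) (A - {- int n}) \<in> nsubsets n n" if "A \<in> nsubsets n n" "- int n \<in> A" "int n \<notin> A" for A
      using lower_nsubsets[OF that(1), of "int n"] that n lh by auto
    obtain V where V: "\<And>A. A \<in> nsubsets n n \<Longrightarrow> minor n V A = t * minor n U A +
       (if - int n \<in> A \<and> int n \<notin> A then ?c * of_int (sg (int n) (- int n) A) * minor n U (insert (int n) (A - {- int n})) else 0)"
      "lg \<Longrightarrow> \<forall>i<n. \<forall>j<n. Omega n (\<lambda>k. V k i) (\<lambda>k. V k j) = 0"
      using loop_frame[OF n U(2), of lg t ?c] by blast
    have "?P' A = minor n V A" if "A \<in> nsubsets n n" for A
      unfolding P'[OF that] V(1)[OF that] using U(1)[OF that] U(1)[OF ins[OF that]] by auto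
    moreover have "\<exists>A\<in>nsubsets n n. ?P' A \<noteq> 0"
    proof (cases "t = 0")
      case False
      show ?thesis
      proof (rule ccontr)
        assume a: "\<not> ?thesis"
        have "?P A = 0" if "A \<in> nsubsets n n" for A
        proof (rule nonvanishing_add_box[where t = t and c = "\<lambda>A. ?c * of_int (sg (int n) (- int n) A)" and y = "int n", OF _ False _ _ n that])
          show "t * ?P A + (if hi n (int n) \<in> A \<and> lo (int n) \<notin> A then ?c * of_int (sg (int n) (- int n) A) * ?P (insert (lo (int n)) (A - {hi n (int n)})) else 0) = 0"
            if "A \<in> nsubsets n n" for A using P'[OF that] a that unfolding lh by auto
        qed (use n in auto)
        then show False using P unfolding frameable_def by blast
      qed
    next
      case True
      then have s: "s \<noteq> 0" using st by simp
      let ?A = "insert (- int n) (B - {int n})"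
      have "- int n \<in> bracket n" using n by (auto simp: bracket_def)
      then have A: "?A \<in> nsubsets n n" using B n nsubsetsD(1,2)[OF B(1)] unfolding nsubsets_def
        by (auto simp: card_insert_if)
      have BA: "insert (int n) (?A - {- int n}) = B" using B n by auto
      have "?P B = (\<Sum>a\<le>k. if a = k then poly (x (k, B)) z * s ^ k else 0)"
        unfolding plueval_def True by (intro sum.cong) auto
      also have "\<dots> = poly (x (k, B)) z * s ^ k" by simp
      finally have "?P B \<noteq> 0" using z s by simp
      then have "?P' ?A \<noteq> 0" unfolding P'[OF A] BA using True s z n sg_nonzero B by auto
      then show ?thesis using A by blast
    qed
    ultimately show "frameable n lg ?P'" unfolding frameable_def using V(2) by (intro conjI exI[of _ V]) auto
  qed
  then have sub: "{z. \<not> ?ok (Suc k) ?x' z} \<subseteq> {z. \<not> ?ok k x z} \<union> {0} \<union> {z. poly (x (k, B)) z = 0}" by blast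
  have "finite ({z. \<not> ?ok k x z} \<union> {0} \<union> {z. poly (x (k, B)) z = 0})"
    using x B(4) unfolding good_family_def by (intro finite_UnI poly_roots_finite) auto
  then show ?thesis unfolding good_family_def by (rule finite_subset[OF sub])
qed

text \<open>The constant map to the span of the basis vectors with negative index; its only
  coordinate carries the weights of level zero at all gaps.\<close>

definition base_point :: "nat \<Rightarrow> (int \<Rightarrow> nat \<Rightarrow> nat) \<Rightarrow> pvar \<Rightarrow> complex poly" where
  "base_point n w v = (if v = (0, {- int n..-1}) then monom 1 (\<Sum>y\<in>{- int n + 1..int n}. w y 0) else 0)"

lemma negatives_nsubsets: "{- int n..-1} \<in> nsubsets n n"
  by (auto simp: nsubsets_def bracket_def)

lemma ht_negatives: "- int n \<le> z \<Longrightarrow> ht (0, {- int n..-1}) z = 0"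
proof (cases "0 \<le> z")
  case True
  then have "{k \<in> {- int n..-1}. z < k} = {}" by auto
  then have "card {k \<in> {- int n..-1}. z < k} = 0" by (simp only: card.empty)
  then show ?thesis using True unfolding ht_def by simp
next
  case False
  assume "- int n \<le> z"
  then have "{k \<in> {- int n..-1}. z \<le> k} = {z..-1}" by auto
  then have "card {k \<in> {- int n..-1}. z \<le> k} = nat (- z)" by simp
  then show ?thesis using False unfolding ht_def by simp
qed

lemma alg_inv_base: "alg_inv n w (\<lambda>_. 0) (base_point n w)"
  unfolding alg_inv_def
proof (intro allI impI)
  fix a A assume A: "A \<in> nsubsets n n"
  show "if below n (\<lambda>_. 0) (a, A) then \<exists>g. base_point n w (a, A) = monom 1 (wt n w (a, A)) * g \<and> poly g 0 \<noteq> 0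
     else base_point n w (a, A) = 0"
  proof (cases "(a, A) = (0, {- int n..-1})")
    case True
    have "below n (\<lambda>_. 0) (a, A)" unfolding below_def True using ht_negatives by simp
    moreover have "wt n w (a, A) = (\<Sum>y\<in>{- int n + 1..int n}. w y 0)"
      unfolding wt_def True by (intro sum.cong refl) (simp add: ht_negatives)
    ultimately show ?thesis using True by (auto simp: base_point_def intro!: exI[of _ 1])
  next
    case False
    have "\<not> below n (\<lambda>_. 0) (a, A)"
    proof
      assume b: "below n (\<lambda>_. 0) (a, A)"
      have h0: "ht (a, A) z = 0" and a0: "a = 0" if "- int n \<le> z" "z \<le> int n" for z
        using b ht_nonneg[OF A, of z a] that by (auto simp: below_def intro: order_antisym)
      have "a = 0" using a0[of 0] by simp
      have "A \<subseteq> {- int n..-1}"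
      proof
        fix k assume k: "k \<in> A"
        have r: "- int n \<le> k" "k \<le> int n" "k \<noteq> 0" using nsubsetsD[OF A] k by auto
        have "k < 0"
        proof (rule ccontr)
          assume "\<not> k < 0"
          then have "1 \<le> k" using r by simp
          then show False using ht_step_pos[OF A, of k a] h0[of k] h0[of "k - 1"] k r by simp
        qed
        then show "k \<in> {- int n..-1}" using r by simp
      qed
      then have "A = {- int n..-1}" using nsubsetsD(2)[OF A] by (intro card_subset_eq) auto
      then show False using False \<open>a = 0\<close> by simp
    qed
    then show ?thesis using False by (simp add: base_point_def)
  qed
qed

lemma good_family_base:
  assumes n: "n \<ge> 1"
  shows "good_family n lg 0 (base_point n w)"
proof -
  let ?N = "{- int n..-1}" let ?e = "\<Sum>y\<in>{- int n + 1..int n}. w y 0"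
  have fr: "frameable n lg (\<lambda>A. plueval 0 (\<lambda>v. poly (base_point n w v) z) A s t)" if z: "z \<noteq> 0" for z s t
  proof -
    have P: "plueval 0 (\<lambda>v. poly (base_point n w v) z) A s t = (if A = ?N then z ^ ?e else 0)" for A
      by (simp add: plueval_def base_point_def poly_monom)
    define U0 :: "int \<Rightarrow> nat \<Rightarrow> complex" where "U0 = (\<lambda>k j. if k = - int n + int j \<and> j < n then 1 else 0)"
    define U where "U = (\<lambda>k j. if j = 0 then z ^ ?e * U0 k j else U0 k j)"
    have Upos: "U k j = 0" if "k > 0" for k j using that by (auto simp: U_def U0_def)
    have "mat n n (\<lambda>(i, j). U0 (sorted_list_of_set ?N ! i) j) = 1\<^sub>m n"
      by (intro eq_matI) (auto simp: U0_def)
    then have "minor n U ?N = z ^ ?e"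
      unfolding minor_eq_mdet U_def using mdet_scale_column[of 0 n "z ^ ?e" U0 "sorted_list_of_set ?N"] n
      by (simp add: mdet_def)
    moreover have "minor n U A = 0" if A: "A \<in> nsubsets n n" "A \<noteq> ?N" for A
    proof -
      note L = nsubsets_list[OF A(1)]
      have "\<not> A \<subseteq> ?N" using A(2) L card_subset_eq[of ?N A] by auto
      then obtain k where k: "k \<in> A" "k \<notin> ?N" by blast
      then have "k > 0" using nsubsetsD(3,4)[OF A(1)] by (cases "k = 0") force+
      obtain i where i: "i < n" "sorted_list_of_set A ! i = k" using L k(1) by (metis in_set_conv_nth)
      have "(\<Prod>i = 0..<n. U (sorted_list_of_set A ! i) (\<sigma> i)) = 0" for \<sigma>
        using i Upos[OF \<open>k > 0\<close>] by (intro prod_zero bexI[of _ i]) auto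
      then show ?thesis unfolding minor_eq_mdet mdet_expand by (intro sum.neutral) simp
    qed
    ultimately have "\<forall>A\<in>nsubsets n n. (if A = ?N then z ^ ?e else 0) = minor n U A" by auto
    moreover have "\<exists>A\<in>nsubsets n n. (if A = ?N then z ^ ?e else 0) \<noteq> 0"
      using z negatives_nsubsets by (intro bexI[of _ ?N]) auto
    moreover have "Omega n (\<lambda>k. U k i) (\<lambda>k. U k j) = 0" for i j
      unfolding Omega_def by (intro sum.neutral) (auto simp: Upos)
    ultimately show ?thesis unfolding frameable_def P by blast
  qed
  have "{z. \<not> (\<forall>s t. (s, t) \<noteq> (0, 0) \<longrightarrow> frameable n lg (\<lambda>A. plueval 0 (\<lambda>v. poly (base_point n w v) z) A s t))} \<subseteq> {0}"
    using fr by blast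
  then show ?thesis unfolding good_family_def by (rule finite_subset) simp
qed

definition sym_path :: "(nat \<Rightarrow> nat) \<Rightarrow> int \<Rightarrow> int" where
  "sym_path u z = int (u (nat \<bar>z\<bar>))"

lemma alg_inv_cong:
  assumes "\<And>z. - int n \<le> z \<Longrightarrow> z \<le> int n \<Longrightarrow> W z = W' z"
  shows "alg_inv n w W x \<longleftrightarrow> alg_inv n w W' x"
proof -
  have "below n W v = below n W' v" for v using assms unfolding below_def by auto
  then show ?thesis unfolding alg_inv_def by simp
qed

text \<open>Induction on the area under the profile, which is lowered at the end \<open>X\<close> of
  its top plateau. For \<open>X = 0\<close> this is a single box in the middle, for
  \<open>0 < X < n\<close> a symmetric pair, and for \<open>X = n\<close> the profile is constant
  and the box raises the degree.\<close>

lemma family_exists: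
  assumes n: "n \<ge> 1" and w: "\<And>y. strict_mono (w y)" and sym: "\<And>y. lg \<Longrightarrow> w (- y) = w y"
  shows "(\<forall>x. 1 \<le> x \<and> x \<le> n \<longrightarrow> u (x - 1) = u x \<or> u (x - 1) = Suc (u x)) \<Longrightarrow>
    \<exists>x. alg_inv n w (sym_path u) x \<and> good_family n lg (u n) x"
proof (induction "\<Sum>x\<le>n. u x" arbitrary: u rule: less_induct)
  case less
  note st = less.prems[rule_format]
  have anti: "u y \<le> u x" if "x \<le> y" "y \<le> n" for x y
    using that
  proof (induction y rule: dec_induct)
    case (step m)
    then show ?case using st[of "Suc m"] by auto
  qed simp
  show ?case
  proof (cases "u 0 = 0")
    case True
    then have z: "u x = 0" if "x \<le> n" for x using anti[of 0 x] that by simp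
    have "alg_inv n w (sym_path u) (base_point n w)"
      using alg_inv_base[of n w] z by (subst alg_inv_cong[of n _ "\<lambda>_. 0"]) (auto simp: sym_path_def)
    then show ?thesis using good_family_base[OF n] z[of n] by auto
  next
    case False
    define X where "X = (GREATEST x. x \<le> n \<and> u x = u 0)"
    have X: "X \<le> n \<and> u X = u 0"
      unfolding X_def by (rule GreatestI_nat[where k = 0 and b = n]) auto
    have Xmax: "x \<le> X" if "x \<le> n" "u x = u 0" for x
      unfolding X_def using that by (intro Greatest_le_nat[where b = n]) auto
    have before: "u x = u 0" if "x \<le> X" for x using anti[of x X] anti[of 0 x] X that by simp
    have after: "u (Suc X) = u 0 - 1" if "X < n"
      using st[of "Suc X"] X Xmax[of "Suc X"] that by auto
    define u' where "u' = u(X := u 0 - 1)"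
    have "\<forall>x. 1 \<le> x \<and> x \<le> n \<longrightarrow> u' (x - 1) = u' x \<or> u' (x - 1) = Suc (u' x)"
    proof (intro allI impI)
      fix x assume x: "1 \<le> x \<and> x \<le> n"
      consider "x = X" | "x - 1 = X" | "x \<noteq> X" "x - 1 \<noteq> X" by blast
      then show "u' (x - 1) = u' x \<or> u' (x - 1) = Suc (u' x)"
      proof cases
        case 1
        then have "u' (x - 1) = u 0" using x before[of "x - 1"] by (auto simp: u'_def)
        then show ?thesis using 1 False by (simp add: u'_def)
      next
        case 2
        then have "x = Suc X" using x by linarith
        then show ?thesis using after x by (simp add: u'_def)
      next
        case 3
        then show ?thesis using st x by (simp add: u'_def)
      qed
    qed
    moreover have "(\<Sum>x\<le>n. u' x) < (\<Sum>x\<le>n. u x)"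
      using X False by (intro sum_strict_mono_ex1) (auto simp: u'_def)
    ultimately obtain x where x: "alg_inv n w (sym_path u') x" "good_family n lg (u' n) x"
      using less.hyps by blast
    have W: "sym_path u' z = (if \<bar>z\<bar> = int X then int (u 0) - 1 else int (u (nat \<bar>z\<bar>)))" for z
      using False by (auto simp: sym_path_def u'_def)
    have Wu: "sym_path u z = int (u (nat \<bar>z\<bar>))" for z by (simp add: sym_path_def)
    have cnz: "c \<noteq> 0 \<Longrightarrow> c * of_int (sg l h A) \<noteq> (0 :: complex)" for c l h A using sg_nonzero by simp
    consider "X = 0" | "0 < X" "X < n" | "X = n" using X by linarith
    then show ?thesis
    proof cases
      case 1
      then have u1: "u 1 = u 0 - 1" using after n by simp
      have ad: "addable n (sym_path u') 0" using 1 n u1 False by (auto simp: addable_def W)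
      let ?x' = "add_box n 0 (w 0 (nat (sym_path u' 0 + 1))) (\<lambda>A. 1 * of_int (sg (lo 0) (hi n 0) A)) x"
      have "alg_inv n w (raise n (sym_path u') 0) ?x'"
        by (rule alg_inv_add_box[OF x(1) ad n _ _ w cnz]) (use n in auto)
      then have "alg_inv n w (sym_path u) ?x'"
        by (subst (asm) alg_inv_cong[of n _ "sym_path u"]) (use 1 n False in \<open>auto simp: raise_def W Wu\<close>)
      moreover have "good_family n lg (u' n) ?x'"
        by (rule good_family_add_box[OF _ _ n x(2)]) (use n in auto)
      moreover have "u' n = u n" using 1 n by (simp add: u'_def)
      ultimately show ?thesis by (intro exI[of _ ?x'] conjI) (simp_all only:)
    next
      case 2
      let ?y = "int X"
      let ?W1 = "raise n (sym_path u') ?y"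
      have y: "0 < ?y" "?y < int n" using 2 by auto
      have prev: "u (X - 1) = u 0" using before[of "X - 1"] by simp
      have nx: "nat (int X - 1) = X - 1" "nat (int X + 1) = Suc X" "nat (1 + int X) = Suc X" by auto
      have ad1: "addable n (sym_path u') ?y"
        using 2 prev after False by (auto simp: addable_def W nx)
      have ad2: "addable n ?W1 (- ?y)"
        using 2 prev after False by (auto simp: addable_def raise_def W nx)
      define e where "e = w ?y (nat (sym_path u' ?y + 1))"
      define e' where "e' = w (- ?y) (nat (?W1 (- ?y) + 1))"
      have W1y: "?W1 (- ?y) = sym_path u' ?y" using 2 by (auto simp: raise_def sym_path_def)
      let ?x' = "add_box n ?y e (\<lambda>A. 1 * of_int (sg (lo ?y) (hi n ?y) A)) x"
      let ?x'' = "add_box n (- ?y) e' (\<lambda>A. - 1 * of_int (sg (lo (- ?y)) (hi n (- ?y)) A)) ?x'"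
      have a1: "alg_inv n w ?W1 ?x'" unfolding e_def
        by (rule alg_inv_add_box[OF x(1) ad1 n _ _ w cnz]) (use y in auto)
      have "alg_inv n w (raise n ?W1 (- ?y)) ?x''" unfolding e'_def
        by (rule alg_inv_add_box[OF a1 ad2 n _ _ w cnz]) (use y in auto)
      then have "alg_inv n w (sym_path u) ?x''"
        by (subst (asm) alg_inv_cong[of n _ "sym_path u"]) (use 2 X False in \<open>auto simp: raise_def W Wu\<close>)
      moreover have "good_family n lg (u' n) ?x''"
      proof (cases lg)
        case True
        \<comment> \<open>The symmetry of the weights is used here: the isotropic pair of row
          operations has one common parameter.\<close>
        then have "e' = e" unfolding e_def e'_def W1y using sym[of ?y] by simp
        then show ?thesis using good_family_add_pair[OF y n x(2), of e] by simp
      next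
        case lgF: False
        have "good_family n lg (u' n) ?x'"
          by (rule good_family_add_box[OF _ _ n x(2)]) (use y lgF in auto)
        then show ?thesis
          by (rule good_family_add_box[rotated 3]) (use y n lgF in auto)
      qed
      moreover have "u' n = u n" using 2 by (simp add: u'_def)
      ultimately have F: "alg_inv n w (sym_path u) ?x'' \<and> good_family n lg (u n) ?x''" by argo
      define x2 where "x2 = ?x''"
      have "alg_inv n w (sym_path u) x2 \<and> good_family n lg (u n) x2" unfolding x2_def by (rule F)
      then show ?thesis by blast
    next
      case 3
      have const: "u x = u 0" if "x \<le> n" for x using before[of x] that 3 by simp
      have nx: "nat (int n - 1) = n - 1" "\<bar>int n - 1\<bar> = int n - 1" using n by auto
      have ad: "addable n (sym_path u') (int n)"
        using 3 n False const[of "n - 1"] by (auto simp: addable_def W nx)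
      define k where "k = u 0 - 1"
      have k: "u' n = k" "u 0 = Suc k" using 3 False by (auto simp: u'_def k_def)
      let ?x' = "add_box n (int n) (w (int n) (nat (sym_path u' (int n) + 1))) (\<lambda>A. 1 * of_int (sg (lo (int n)) (hi n (int n)) A)) x"
      have "alg_inv n w (raise n (sym_path u') (int n)) ?x'"
        by (rule alg_inv_add_box[OF x(1) ad n _ _ w cnz]) (use n in auto)
      then have "alg_inv n w (sym_path u) ?x'"
        by (subst (asm) alg_inv_cong[of n _ "sym_path u"]) (use 3 const[of "nat \<bar>_\<bar>"] in \<open>auto simp: raise_def W Wu\<close>)
      moreover have "good_family n lg (Suc k) ?x'"
      proof (rule good_family_add_loop[OF n])
        show "good_family n lg k x" using x(2) k by simp
        show "x (Suc k, B) = 0 \<or> B \<notin> nsubsets n n" for B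
        proof (cases "B \<in> nsubsets n n")
          case True
          have "\<not> below n (sym_path u') (Suc k, B)"
          proof
            assume "below n (sym_path u') (Suc k, B)"
            then have "ht (Suc k, B) (int n) \<le> sym_path u' (int n)" by (simp add: below_def)
            then show False using ht_at_n[OF True, of "Suc k"] 3 k by (simp add: W)
          qed
          then show ?thesis using x(1) True unfolding alg_inv_def by auto
        qed simp
        \<comment> \<open>The witness for nonvanishing at \<open>t = 0\<close>. It lies below the
          profile, which equals \<open>k\<close> at the gap \<open>n\<close> and
          \<open>k + 1\<close> elsewhere, so the invariant makes its coordinate nonzero.\<close>
        let ?B = "insert (int n) {- int n + 1..-1}"
        show B: "?B \<in> nsubsets n n"
          using n by (auto simp: nsubsets_def bracket_def card_insert_if)
        show "int n \<in> ?B" "- int n \<notin> ?B" using n by auto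
        have "ht (k, ?B) z \<le> sym_path u' z" if z: "- int n \<le> z" "z \<le> int n" for z
        proof -
          have 1: "ht (k, ?B) z \<le> int k + 1"
          proof (cases "0 \<le> z")
            case True
            then have "{j \<in> ?B. z < j} \<subseteq> {int n}" by auto
            then have "card {j \<in> ?B. z < j} \<le> card {int n}" by (intro card_mono) auto
            then show ?thesis using True unfolding ht_def by simp
          next
            case False
            then have "{j \<in> ?B. z \<le> j} \<subseteq> insert (int n) {z..-1}" by auto
            then have "card {j \<in> ?B. z \<le> j} \<le> card (insert (int n) {z..-1})" by (intro card_mono) auto
            also have "\<dots> = Suc (nat (- z))" by (subst card_insert_disjoint) auto
            finally show ?thesis using False unfolding ht_def by simp
          qed
          show ?thesis
          proof (cases "\<bar>z\<bar> = int n")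
            case True
            then have "z = int n \<or> z = - int n" by auto
            then have "ht (k, ?B) z = int k" using ht_at_n[OF B] ht_at_minus_n[OF B] by auto
            then show ?thesis using True 3 k by (simp add: W)
          next
            case False
            then have "sym_path u' z = int (Suc k)" using 3 const[of "nat \<bar>z\<bar>"] z k by (simp add: W)
            then show ?thesis using 1 by simp
          qed
        qed
        then have "below n (sym_path u') (k, ?B)" by (simp add: below_def)
        then obtain g where "x (k, ?B) = monom 1 (wt n w (k, ?B)) * g" "poly g 0 \<noteq> 0"
          using x(1) B unfolding alg_inv_def by (metis (no_types, lifting))
        then show "x (k, ?B) \<noteq> 0" by auto
      qed
      moreover have "u n = Suc k" using const[of n] k by simp
      ultimately show ?thesis by (intro exI[of _ ?x'] conjI) (simp_all only:)
    qed
  qed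
qed

theorem leading_family:
  assumes n: "n \<ge> 1" and w: "\<And>y. strict_mono (w y)" and sym: "\<And>y. lg \<Longrightarrow> w (- y) = w y"
  obtains x where "\<And>v. v \<in> Vars d n \<Longrightarrow> \<exists>g. x v = monom 1 (wt n w v) * g \<and> poly g 0 \<noteq> 0"
    and "finite {z. (\<lambda>v. poly (x v) z) \<notin> (if lg then LGMaps d n else GrMaps d n)}"
proof -
  \<comment> \<open>The largest possible heights, by \<open>ht_upper\<close>: the completed profile
    lies above every variable, so no coordinate remains zero.\<close>
  define u where "u = (\<lambda>x. d + n - x)"
  have "\<forall>x. 1 \<le> x \<and> x \<le> n \<longrightarrow> u (x - 1) = u x \<or> u (x - 1) = Suc (u x)" by (auto simp: u_def)
  then obtain x where x: "alg_inv n w (sym_path u) x" "good_family n lg (u n) x"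
    using family_exists[where w = w and lg = lg and u = u, OF n w sym] by blast
  have "\<exists>g. x v = monom 1 (wt n w v) * g \<and> poly g 0 \<noteq> 0" if v: "v \<in> Vars d n" for v
  proof -
    obtain a A where aA: "v = (a, A)" "a \<le> d" "A \<in> nsubsets n n" using v by (auto simp: Vars_def)
    have "below n (sym_path u) v" unfolding below_def
    proof (intro allI impI)
      fix z assume z: "- int n \<le> z \<and> z \<le> int n"
      have "sym_path u z = int d + int n - \<bar>z\<bar>" using z by (auto simp: sym_path_def u_def of_nat_diff)
      then show "ht v z \<le> sym_path u z" using ht_upper[OF aA(3), of z a] z aA by simp
    qed
    then show ?thesis using x(1) aA unfolding alg_inv_def by (metis (no_types, lifting))
  qed
  moreover have "finite {z. (\<lambda>v. poly (x v) z) \<notin> (if lg then LGMaps d n else GrMaps d n)}"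
  proof -
    have "y \<in> (if lg then LGMaps d n else GrMaps d n) \<longleftrightarrow> (\<forall>s t. (s, t) \<noteq> (0, 0) \<longrightarrow> frameable n lg (\<lambda>A. plueval d y A s t))" for y
      by (simp add: LGMaps_def GrMaps_def frameable_def)
    then show ?thesis using x(2) unfolding good_family_def by (simp add: u_def)
  qed
  ultimately show thesis by (rule that)
qed

section \<open>Monomials and evaluation\<close>

definition cst :: "complex \<Rightarrow> mpoly" where "cst c = Poly_Mapping.single 0 c"

text \<open>Monomials are handled as multisets of variables, from which one or two factors can be
  taken out and replaced.\<close>

definition vmonom :: "pvar multiset \<Rightarrow> mpoly" where "vmonom M = prod_mset (image_mset pvar M)"

definition val :: "(pvar \<Rightarrow> 'a) \<Rightarrow> pvar multiset \<Rightarrow> 'a::comm_monoid_mult" where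
  "val x M = prod_mset (image_mset x M)"

definition mm :: "(pvar \<Rightarrow> complex) \<Rightarrow> (pvar \<Rightarrow>\<^sub>0 nat) \<Rightarrow> complex" where
  "mm x m = (\<Prod>v\<in>Poly_Mapping.keys m. x v ^ Poly_Mapping.lookup m v)"

lemma mm_superset:
  assumes "finite S" "Poly_Mapping.keys m \<subseteq> S"
  shows "mm x m = (\<Prod>v\<in>S. x v ^ Poly_Mapping.lookup m v)"
  unfolding mm_def using assms by (intro prod.mono_neutral_left) (auto simp: in_keys_iff)

lemma mm_add: "mm x (m + m') = mm x m * mm x m'"
proof -
  let ?S = "Poly_Mapping.keys m \<union> Poly_Mapping.keys m'"
  have "mm x (m + m') = (\<Prod>v\<in>?S. x v ^ Poly_Mapping.lookup (m + m') v)"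
    using keys_add[of m m'] by (intro mm_superset) auto
  also have "\<dots> = (\<Prod>v\<in>?S. x v ^ Poly_Mapping.lookup m v) * (\<Prod>v\<in>?S. x v ^ Poly_Mapping.lookup m' v)"
    by (simp add: lookup_add power_add prod.distrib)
  finally show ?thesis by (simp add: mm_superset[of ?S])
qed

lemma meval_superset:
  assumes "finite S" "Poly_Mapping.keys p \<subseteq> S"
  shows "meval x p = (\<Sum>m\<in>S. Poly_Mapping.lookup p m * mm x m)"
  unfolding meval_def mm_def[symmetric] using assms by (intro sum.mono_neutral_left) (auto simp: in_keys_iff)

lemma meval_add: "meval x (p + q) = meval x p + meval x q"
proof -
  let ?S = "Poly_Mapping.keys p \<union> Poly_Mapping.keys q"
  have "meval x (p + q) = (\<Sum>m\<in>?S. Poly_Mapping.lookup (p + q) m * mm x m)"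
    using keys_add[of p q] by (intro meval_superset) auto
  then show ?thesis by (simp add: meval_superset[of ?S] lookup_add distrib_right sum.distrib)
qed

lemma meval_0: "meval x 0 = 0"
  by (simp add: meval_def)

lemma meval_sum: "meval x (sum f I) = (\<Sum>i\<in>I. meval x (f i))"
  by (induction I rule: infinite_finite_induct) (simp_all add: meval_0 meval_add)

lemma meval_single: "meval x (Poly_Mapping.single m c) = c * mm x m"
  by (subst meval_superset[of "{m}"]) auto

lemma sum_singles: "p = (\<Sum>m\<in>Poly_Mapping.keys p. Poly_Mapping.single m (Poly_Mapping.lookup p m))"
proof (rule poly_mapping_eqI)
  fix k
  have "Poly_Mapping.lookup (\<Sum>m\<in>Poly_Mapping.keys p. Poly_Mapping.single m (Poly_Mapping.lookup p m)) k =
     (\<Sum>m\<in>Poly_Mapping.keys p. if m = k then Poly_Mapping.lookup p k else 0)"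
    unfolding lookup_sum by (intro sum.cong) (auto simp: lookup_single when_def)
  also have "\<dots> = Poly_Mapping.lookup p k" by (simp add: in_keys_iff)
  finally show "Poly_Mapping.lookup p k = Poly_Mapping.lookup (\<Sum>m\<in>Poly_Mapping.keys p. Poly_Mapping.single m (Poly_Mapping.lookup p m)) k" ..
qed

lemma meval_mult: "meval x (p * q) = meval x p * meval x q"
proof -
  let ?p = "\<Sum>m\<in>Poly_Mapping.keys p. Poly_Mapping.single m (Poly_Mapping.lookup p m)"
  let ?q = "\<Sum>m\<in>Poly_Mapping.keys q. Poly_Mapping.single m (Poly_Mapping.lookup q m)"
  have "meval x (?p * ?q) = meval x ?p * meval x ?q"
    by (simp add: sum_product meval_sum mult_single meval_single mm_add) (intro sum.cong refl, simp add: ac_simps)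
  then show ?thesis by (simp flip: sum_singles)
qed

lemma meval_cst: "meval x (cst c) = c"
  by (simp add: cst_def meval_single mm_def)

lemma meval_pvar: "meval x (pvar v) = x v"
  by (simp add: pvar_def meval_single mm_def)

lemma meval_uminus: "meval x (- p) = - meval x p"
  using meval_add[of x p "- p"] by (simp add: meval_0 add_eq_0_iff2)

lemma meval_diff: "meval x (p - q) = meval x p - meval x q"
  using meval_add[of x p "- q"] by (simp add: meval_uminus)

lemma meval_1: "meval x 1 = 1"
  using meval_cst[of x 1] by (simp add: cst_def)

lemma meval_mono: "meval x (vmonom M) = val x M"
  unfolding vmonom_def val_def by (induction M) (simp_all add: meval_1 meval_mult meval_pvar)

lemma mono_simps: "vmonom {#} = 1" "vmonom (add_mset v M) = pvar v * vmonom M" "vmonom (M + N) = vmonom M * vmonom N"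
  by (simp_all add: vmonom_def)

lemma val_simps: "val x {#} = 1" "val x (add_mset v M) = x v * val x M" "val x (M + N) = val x M * val x N"
  by (simp_all add: val_def)

lemma cst_0 [simp]: "cst 0 = 0" and cst_1 [simp]: "cst 1 = 1"
  by (simp_all add: cst_def)

lemma cst_mult: "cst (a * b) = cst a * cst b"
  by (simp add: cst_def mult_single)

lemma cst_add: "cst (a + b) = cst a + cst b"
  by (simp add: cst_def single_add)

lemma cst_minus: "cst (- a) = - cst a"
  using minus_unique[of "cst a" "cst (- a)"] cst_add[of a "- a"] by simp

lemma of_nat_eq_cst: "of_nat r = cst (of_nat r)"
  by (induction r) (simp_all add: cst_add)

lemma of_int_eq_cst: "of_int r = cst (of_int r)"
  by (cases r) (simp_all add: of_nat_eq_cst cst_minus[symmetric] del: of_nat_Suc)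

lemma pvar_power: "pvar v ^ k = Poly_Mapping.single (Poly_Mapping.single v k) 1"
  by (induction k) (simp_all add: pvar_def mult_single single_add[symmetric])

lemma single_eq_mono:
  "\<exists>M. set_mset M = Poly_Mapping.keys m \<and> Poly_Mapping.single m c = cst c * vmonom M"
proof -
  define M where "M = (\<Sum>v\<in>Poly_Mapping.keys m. replicate_mset (Poly_Mapping.lookup m v) v)"
  have "set_mset M = Poly_Mapping.keys m"
    unfolding M_def by (auto simp: set_mset_sum in_keys_iff split: if_splits)
  moreover have "vmonom M = Poly_Mapping.single m 1"
  proof -
    have s: "vmonom (sum f S) = (\<Prod>v\<in>S. vmonom (f v))" if "finite S" for f and S :: "pvar set"
      using that by (induction S rule: finite_induct) (simp_all add: mono_simps)
    have p: "(\<Prod>v\<in>S. Poly_Mapping.single (f v) 1 :: mpoly) = Poly_Mapping.single (sum f S) 1" if "finite S" for f and S :: "pvar set"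
      using that by (induction S rule: finite_induct) (simp_all add: mult_single)
    have "vmonom (replicate_mset k v) = pvar v ^ k" for k v
      by (induction k) (simp_all add: mono_simps)
    then have "vmonom M = (\<Prod>v\<in>Poly_Mapping.keys m. Poly_Mapping.single (Poly_Mapping.single v (Poly_Mapping.lookup m v)) 1)"
      unfolding M_def by (simp add: s pvar_power)
    also have "\<dots> = Poly_Mapping.single (\<Sum>v\<in>Poly_Mapping.keys m. Poly_Mapping.single v (Poly_Mapping.lookup m v)) 1"
      by (simp add: p)
    also have "(\<Sum>v\<in>Poly_Mapping.keys m. Poly_Mapping.single v (Poly_Mapping.lookup m v)) = m"
    proof (rule poly_mapping_eqI)
      fix k
      have "Poly_Mapping.lookup (\<Sum>v\<in>Poly_Mapping.keys m. Poly_Mapping.single v (Poly_Mapping.lookup m v)) k =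
        (\<Sum>v\<in>Poly_Mapping.keys m. if v = k then Poly_Mapping.lookup m k else 0)"
        unfolding lookup_sum by (intro sum.cong) (auto simp: lookup_single when_def)
      then show "Poly_Mapping.lookup (\<Sum>v\<in>Poly_Mapping.keys m. Poly_Mapping.single v (Poly_Mapping.lookup m v)) k = Poly_Mapping.lookup m k"
        by (simp add: in_keys_iff)
    qed
    finally show ?thesis .
  qed
  ultimately show ?thesis by (intro exI[of _ M]) (simp add: cst_def mult_single)
qed

lemma PRing_add: "p \<in> PRing d n \<Longrightarrow> q \<in> PRing d n \<Longrightarrow> p + q \<in> PRing d n"
  using keys_add[of p q] unfolding PRing_def by blast

lemma PRing_0: "0 \<in> PRing d n"
  by (simp add: PRing_def)

lemma PRing_cst: "cst c \<in> PRing d n"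
  by (auto simp: PRing_def cst_def)

lemma PRing_mult: "p \<in> PRing d n \<Longrightarrow> q \<in> PRing d n \<Longrightarrow> p * q \<in> PRing d n"
proof -
  assume p: "p \<in> PRing d n" and q: "q \<in> PRing d n"
  show ?thesis unfolding PRing_def
  proof (intro CollectI ballI)
    fix m assume "m \<in> Poly_Mapping.keys (p * q)"
    then obtain a b where "m = a + b" "a \<in> Poly_Mapping.keys p" "b \<in> Poly_Mapping.keys q"
      using keys_mult[of p q] by blast
    then show "Poly_Mapping.keys m \<subseteq> Vars d n"
      using p q keys_add[of a b] unfolding PRing_def by blast
  qed
qed

lemma PRing_uminus: "p \<in> PRing d n \<Longrightarrow> - p \<in> PRing d n"
  using PRing_mult[OF PRing_cst[of "-1"], of p] by (simp add: cst_minus)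

lemma PRing_diff: "p \<in> PRing d n \<Longrightarrow> q \<in> PRing d n \<Longrightarrow> p - q \<in> PRing d n"
  using PRing_add[of p d n "- q"] PRing_uminus by simp

lemma PRing_sum: "(\<And>i. i \<in> I \<Longrightarrow> f i \<in> PRing d n) \<Longrightarrow> sum f I \<in> PRing d n"
  by (induction I rule: infinite_finite_induct) (auto simp: PRing_0 intro: PRing_add)

lemma PRing_pvar: "v \<in> Vars d n \<Longrightarrow> pvar v \<in> PRing d n"
  by (simp add: PRing_def pvar_def)

lemma PRing_mono: "set_mset M \<subseteq> Vars d n \<Longrightarrow> vmonom M \<in> PRing d n"
  by (induction M) (auto simp: mono_simps intro: PRing_mult PRing_pvar PRing_cst[of 1, simplified])

lemma PRing_expand:
  assumes "p \<in> PRing d n"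
  obtains K :: "(pvar \<Rightarrow>\<^sub>0 nat) set" and c M where "finite K" "p = (\<Sum>m\<in>K. cst (c m) * vmonom (M m))" "\<And>m. m \<in> K \<Longrightarrow> set_mset (M m) \<subseteq> Vars d n"
proof -
  have "\<forall>m. \<exists>M. set_mset M = Poly_Mapping.keys m \<and> Poly_Mapping.single m (Poly_Mapping.lookup p m) = cst (Poly_Mapping.lookup p m) * vmonom M"
    using single_eq_mono by blast
  then obtain M where M: "\<And>m. set_mset (M m) = Poly_Mapping.keys m"
    "\<And>m. Poly_Mapping.single m (Poly_Mapping.lookup p m) = cst (Poly_Mapping.lookup p m) * vmonom (M m)" by metis
  have "p = (\<Sum>m\<in>Poly_Mapping.keys p. cst (Poly_Mapping.lookup p m) * vmonom (M m))"
    by (subst sum_singles) (simp only: M(2))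
  then show thesis using assms M(1) unfolding PRing_def by (intro that[of "Poly_Mapping.keys p"]) auto
qed

section \<open>Ideals\<close>

lemma ideal_gen_0: "0 \<in> ideal_gen R G"
  unfolding ideal_gen_def by (intro CollectI exI[of _ "{}"]) simp

lemma ideal_gen_add:
  assumes "p \<in> ideal_gen (PRing d n) G" "q \<in> ideal_gen (PRing d n) G"
  shows "p + q \<in> ideal_gen (PRing d n) G"
proof -
  obtain F g where F: "finite F" "F \<subseteq> G" "\<And>f. f \<in> F \<Longrightarrow> g f \<in> PRing d n" "p = (\<Sum>f\<in>F. g f * f)"
    using assms(1) unfolding ideal_gen_def by blast
  obtain F' g' where F': "finite F'" "F' \<subseteq> G" "\<And>f. f \<in> F' \<Longrightarrow> g' f \<in> PRing d n" "q = (\<Sum>f\<in>F'. g' f * f)"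
    using assms(2) unfolding ideal_gen_def by blast
  define h where "h = (\<lambda>f. (if f \<in> F then g f else 0) + (if f \<in> F' then g' f else 0))"
  have e: "(\<Sum>f\<in>F \<union> F'. (if f \<in> A then k f else 0) * f) = (\<Sum>f\<in>A. k f * f)" if "A \<subseteq> F \<union> F'" for A k
    using that F(1) F'(1) by (intro sum.mono_neutral_cong_right) auto
  have "p + q = (\<Sum>f\<in>F \<union> F'. h f * f)"
    unfolding h_def distrib_right sum.distrib by (subst (1 2) e) (auto simp: F(4) F'(4))
  moreover have "\<forall>f\<in>F \<union> F'. h f \<in> PRing d n" using F(3) F'(3) by (auto simp: h_def PRing_0 intro!: PRing_add)
  ultimately show ?thesis unfolding ideal_gen_def using F F' by (intro CollectI exI[of _ "F \<union> F'"] exI[of _ h]) auto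
qed

lemma ideal_gen_mult:
  assumes "r \<in> PRing d n" "p \<in> ideal_gen (PRing d n) G"
  shows "r * p \<in> ideal_gen (PRing d n) G"
proof -
  obtain F g where F: "finite F" "F \<subseteq> G" "\<And>f. f \<in> F \<Longrightarrow> g f \<in> PRing d n" "p = (\<Sum>f\<in>F. g f * f)"
    using assms(2) unfolding ideal_gen_def by blast
  have "r * p = (\<Sum>f\<in>F. (r * g f) * f)" unfolding F(4) sum_distrib_left by (simp add: mult.assoc)
  then show ?thesis unfolding ideal_gen_def using F assms(1)
    by (intro CollectI exI[of _ F] exI[of _ "\<lambda>f. r * g f"]) (auto intro: PRing_mult)
qed

lemma ideal_gen_base: "f \<in> G \<Longrightarrow> f \<in> ideal_gen (PRing d n) G"
  unfolding ideal_gen_def using PRing_cst[of 1 d n] by (intro CollectI exI[of _ "{f}"] exI[of _ "\<lambda>_. 1"]) simp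

section \<open>Comparing leading exponents\<close>

definition wtm :: "nat \<Rightarrow> (int \<Rightarrow> nat \<Rightarrow> nat) \<Rightarrow> pvar multiset \<Rightarrow> nat" where
  "wtm n w M = (\<Sum>v\<in>#M. wt n w v)"

definition maps :: "bool \<Rightarrow> nat \<Rightarrow> nat \<Rightarrow> (pvar \<Rightarrow> complex) set" where
  "maps lg d n = (if lg then LGMaps d n else GrMaps d n)"

text \<open>Along the family the relation becomes a polynomial in the parameter with infinitely many
  zeros. A single term of least order would leave its lowest coefficient uncancelled.\<close>

lemma leading_exponent_not_unique:
  assumes n: "n \<ge> 1" and w: "\<And>y. strict_mono (w y)" and sym: "\<And>y. lg \<Longrightarrow> w (- y) = w y"
    and S: "finite S" "\<And>i. i \<in> S \<Longrightarrow> set_mset (M i) \<subseteq> Vars d n"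
    and rel: "\<And>x. x \<in> maps lg d n \<Longrightarrow> (\<Sum>i\<in>S. a i * val x (M i)) = (0 :: complex)"
    and i1: "i1 \<in> S" "a i1 \<noteq> 0"
  shows "\<exists>i2\<in>S. i2 \<noteq> i1 \<and> a i2 \<noteq> 0 \<and> wtm n w (M i2) \<le> wtm n w (M i1)"
proof (rule ccontr)
  assume neg: "\<not> ?thesis"
  obtain x where x: "\<And>v. v \<in> Vars d n \<Longrightarrow> \<exists>g. x v = monom 1 (wt n w v) * g \<and> poly g 0 \<noteq> 0"
    and fin: "finite {z. (\<lambda>v. poly (x v) z) \<notin> (if lg then LGMaps d n else GrMaps d n)}"
    using leading_family[where w = w and lg = lg and d = d, OF n w sym] by blast
  have val: "\<exists>g. val x N = monom 1 (wtm n w N) * g \<and> poly g 0 \<noteq> 0" if "set_mset N \<subseteq> Vars d n" for N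
    using that
  proof (induction N)
    case empty
    then show ?case by (intro exI[of _ 1]) (simp add: val_simps wtm_def)
  next
    case (add v N)
    obtain g where g: "x v = monom 1 (wt n w v) * g" "poly g 0 \<noteq> 0" using x[of v] add.prems by auto
    obtain g' where g': "val x N = monom 1 (wtm n w N) * g'" "poly g' 0 \<noteq> 0" using add.IH add.prems by auto
    have "val x (add_mset v N) = (monom 1 (wt n w v) * monom 1 (wtm n w N)) * (g * g')"
      unfolding val_simps g(1) g'(1) by (simp only: ac_simps)
    also have "monom 1 (wt n w v) * monom 1 (wtm n w N) = (monom 1 (wtm n w (add_mset v N)) :: complex poly)"
      by (simp add: mult_monom wtm_def)
    finally show ?case using g(2) g'(2) by (intro exI[of _ "g * g'"]) simp
  qed
  have pv: "poly (val x N) z = val (\<lambda>v. poly (x v) z) N" for N z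
    by (induction N) (simp_all add: val_simps)
  define q where "q = (\<Sum>i\<in>S. smult (a i) (val x (M i)))"
  have "{z. poly q z \<noteq> 0} \<subseteq> {z. (\<lambda>v. poly (x v) z) \<notin> (if lg then LGMaps d n else GrMaps d n)}"
    proof
    fix z assume "z \<in> {z. poly q z \<noteq> 0}"
    then have "(\<Sum>i\<in>S. a i * val (\<lambda>v. poly (x v) z) (M i)) \<noteq> 0" by (simp add: q_def poly_sum pv)
    then show "z \<in> {z. (\<lambda>v. poly (x v) z) \<notin> (if lg then LGMaps d n else GrMaps d n)}"
      using rel[of "\<lambda>v. poly (x v) z"] unfolding maps_def by blast
  qed
  then have "finite {z. poly q z \<noteq> 0}" using fin by (rule finite_subset)
  then have "infinite {z. poly q z = 0}"
    using infinite_UNIV_char_0[where ?'a = complex] finite_UnI[of "{z. poly q z = 0}" "{z. poly q z \<noteq> 0}"]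
    by (auto simp: Un_def)
  then have q0: "q = 0" using poly_roots_finite by blast
  define k where "k = wtm n w (M i1)"
  have z: "coeff (smult (a i) (val x (M i))) k = 0" if iS: "i \<in> S" "i \<noteq> i1" for i
  proof (cases "a i = 0")
    case False
    then have "k < wtm n w (M i)" using neg iS by (auto simp: k_def not_le)
    moreover obtain g where "val x (M i) = monom 1 (wtm n w (M i)) * g" using val[OF S(2)[OF iS(1)]] by blast
    ultimately show ?thesis by (simp add: coeff_monom_mult)
  qed simp
  obtain g where g: "val x (M i1) = monom 1 k * g" "poly g 0 \<noteq> 0" using val[OF S(2)[OF i1(1)]] unfolding k_def by blast
  have "coeff q k = (\<Sum>i\<in>S. coeff (smult (a i) (val x (M i))) k)" by (simp add: q_def coeff_sum)
  also have "\<dots> = coeff (smult (a i1) (val x (M i1))) k"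
  proof -
    have "(\<Sum>i\<in>S - {i1}. coeff (smult (a i) (val x (M i))) k) = 0" using z by (intro sum.neutral) blast
    then show ?thesis by (subst sum.remove[OF S(1) i1(1)]) simp
  qed
  also have "\<dots> = a i1 * coeff g 0" unfolding g(1) by (simp add: coeff_monom_mult)
  finally have "coeff q k \<noteq> 0" using i1(2) g(2) by (simp add: poly_0_coeff_0)
  then show False using q0 by simp
qed

text \<open>Comparison in base \<open>K\<close>: above the position \<open>f y0\<close> the digits
  agree, and all positions below it together stay under \<open>K ^ f y0\<close>.\<close>

lemma digits_less:
  fixes c c' :: "'a \<Rightarrow> nat"
  assumes Y: "finite Y" "inj_on f Y" "y0 \<in> Y" and K: "\<And>y. y \<in> Y \<Longrightarrow> c y < K"
    and lt: "c y0 < c' y0" and eq: "\<And>y. y \<in> Y \<Longrightarrow> f y0 < f y \<Longrightarrow> c y = c' y"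
  shows "(\<Sum>y\<in>Y. K ^ f y * c y) < (\<Sum>y\<in>Y. K ^ f y * c' y)"
proof -
  define L where "L = {y\<in>Y. f y < f y0}"
  define H where "H = {y\<in>Y. f y0 < f y}"
  have "y = y0" if "y \<in> Y" "f y = f y0" for y using inj_onD[OF Y(2) that(2) that(1) Y(3)] .
  then have YLH: "Y = insert y0 (L \<union> H)" using Y(3) by (auto simp: L_def H_def) (metis linorder_neqE_nat)
  have fin: "finite L" "finite H" "L \<inter> H = {}" "y0 \<notin> L \<union> H" using Y(1) by (auto simp: L_def H_def)
  have split: "(\<Sum>y\<in>Y. g y) = g y0 + (sum g L + sum g H)" for g :: "'a \<Rightarrow> nat"
    using fin by (simp add: YLH sum.union_disjoint)
  have geo: "(\<Sum>j<m. K ^ j * (K - 1)) < K ^ m" for m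
  proof (induction m)
    case 0
    then show ?case using K[OF Y(3)] by simp
  next
    case (Suc m)
    have "K ^ Suc m = K ^ m * (K - 1) + K ^ m" using K[OF Y(3)] by (cases K) auto
    then show ?case using Suc by simp
  qed
  have "(\<Sum>y\<in>L. K ^ f y * c y) \<le> (\<Sum>y\<in>L. K ^ f y * (K - 1))"
    using K by (intro sum_mono mult_left_mono) (force simp: L_def)+
  also have "\<dots> = (\<Sum>j\<in>f ` L. K ^ j * (K - 1))"
    using inj_on_subset[OF Y(2), of L] by (subst sum.reindex) (auto simp: L_def)
  also have "\<dots> \<le> (\<Sum>j<f y0. K ^ j * (K - 1))" by (intro sum_mono2) (auto simp: L_def)
  also have "\<dots> < K ^ f y0" by (rule geo)
  finally have low: "(\<Sum>y\<in>L. K ^ f y * c y) < K ^ f y0" .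
  have high: "(\<Sum>y\<in>H. K ^ f y * c y) = (\<Sum>y\<in>H. K ^ f y * c' y)" using eq by (intro sum.cong) (auto simp: H_def)
  have "K ^ f y0 * c y0 + K ^ f y0 \<le> K ^ f y0 * c' y0"
    using lt mult_le_mono2[of "Suc (c y0)" "c' y0" "K ^ f y0"] by simp
  then show ?thesis unfolding split high using low by linarith
qed

lemma digits_inj:
  fixes c c' :: "'a \<Rightarrow> nat"
  assumes Y: "finite Y" "inj_on f Y" and K: "\<And>y. y \<in> Y \<Longrightarrow> c y < K" "\<And>y. y \<in> Y \<Longrightarrow> c' y < K"
    and eq: "(\<Sum>y\<in>Y. K ^ f y * c y) = (\<Sum>y\<in>Y. K ^ f y * c' y)" and y: "y \<in> Y"
  shows "c y = c' y"
proof (rule ccontr)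
  assume "c y \<noteq> c' y"
  define D where "D = {y\<in>Y. c y \<noteq> c' y}"
  have D: "finite D" "D \<noteq> {}" using Y(1) y \<open>c y \<noteq> c' y\<close> by (auto simp: D_def)
  have "Max (f ` D) \<in> f ` D" using D by (intro Max_in) auto
  then obtain y0 where y0: "y0 \<in> D" "f y0 = Max (f ` D)" by auto
  have e: "c z = c' z" if "z \<in> Y" "f y0 < f z" for z
  proof (rule ccontr)
    assume "c z \<noteq> c' z"
    then have "f z \<le> Max (f ` D)" using that(1) D(1) by (intro Max_ge) (auto simp: D_def)
    then show False using that(2) y0(2) by simp
  qed
  have y0Y: "y0 \<in> Y" "c y0 \<noteq> c' y0" using y0 by (auto simp: D_def)
  consider "c y0 < c' y0" | "c' y0 < c y0" using y0Y(2) by linarith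
  then show False
  proof cases
    case 1
    then show False using digits_less[where c = c and c' = c' and K = K and f = f, OF Y y0Y(1) K(1) 1 e] eq by simp
  next
    case 2
    then show False
      using digits_less[where c = c' and c' = c and K = K and f = f, OF Y y0Y(1) K(2) 2 e[symmetric]] eq by simp
  qed
qed

section \<open>Straightening quadratic monomials on maps to the Grassmannian\<close>

lemma ht_inj:
  assumes v: "v \<in> Vars d n" "v' \<in> Vars d n" and eq: "\<And>y. - int n \<le> y \<Longrightarrow> y \<le> int n \<Longrightarrow> ht v y = ht v' y"
  shows "v = v'"
proof -
  obtain a A a' A' where vv: "v = (a, A)" "v' = (a', A')" "A \<in> nsubsets n n" "A' \<in> nsubsets n n"
    using v by (auto simp: Vars_def)
  have "a = a'" using eq[of "int n"] ht_at_n[OF vv(3), of a] ht_at_n[OF vv(4), of a'] vv by simp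
  moreover have "k \<in> A \<longleftrightarrow> k \<in> A'" for k
  proof (cases "k = 0 \<or> k < - int n \<or> int n < k")
    case True
    then show ?thesis using nsubsetsD(3,4)[OF vv(3)] nsubsetsD(3,4)[OF vv(4)] by fastforce
  next
    case False
    then consider "1 \<le> k" "k \<le> int n" | "1 \<le> - k" "- k \<le> int n" by linarith
    then show ?thesis
    proof cases
      case 1
      then show ?thesis using ht_step_pos[OF vv(3) 1(1), of a] ht_step_pos[OF vv(4) 1(1), of a'] eq[of k] eq[of "k - 1"] vv
        by (auto split: if_splits)
    next
      case 2
      then show ?thesis using ht_step_neg[OF vv(3) 2(1), of a] ht_step_neg[OF vv(4) 2(1), of a'] eq[of k] eq[of "- (- k - 1)"] vv
        by (auto split: if_splits)
    qed
  qed
  ultimately show ?thesis using vv by auto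
qed

lemma Vars_ht_bounds:
  assumes "v \<in> Vars d n" "- int n \<le> y" "y \<le> int n"
  shows "0 \<le> ht v y" "ht v y \<le> int (d + n)"
proof -
  obtain a A where vv: "v = (a, A)" "A \<in> nsubsets n n" "a \<le> d" using assms by (auto simp: Vars_def)
  show "0 \<le> ht v y" using ht_nonneg[OF vv(2) assms(2), of a] vv by simp
  show "ht v y \<le> int (d + n)" using ht_upper[OF vv(2) assms(2,3), of a] vv by simp
qed

lemma Vars_ht_minus_n: "v \<in> Vars d n \<Longrightarrow> ht v (- int n) = ht v (int n)"
  using ht_at_n ht_at_minus_n by (force simp: Vars_def)

text \<open>Odd numbers add up to squares, so the order of vanishing becomes a weighted sum of
  squared heights. Truncated subtraction gives weight zero at \<open>h = 0\<close>.\<close>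

definition qw :: "(int \<Rightarrow> nat) \<Rightarrow> int \<Rightarrow> nat \<Rightarrow> nat" where
  "qw W y h = W y * (2 * h - 1)"

lemma strict_mono_qw: "W y > 0 \<Longrightarrow> strict_mono (qw W y)"
  unfolding strict_mono_Suc_iff qw_def by (intro allI mult_strict_left_mono) auto

lemma sum_qw: "(\<Sum>h\<le>H. qw W y h) = W y * H ^ 2"
proof (induction H)
  case (Suc H)
  then show ?case by (simp add: qw_def power2_eq_square algebra_simps)
qed (simp add: qw_def)

lemma wt_qw: "wt n (qw W) v = (\<Sum>y\<in>{- int n + 1..int n}. W y * nat (ht v y) ^ 2)"
  unfolding wt_def sum_qw ..

lemma sumsq_identity: "2 * (a\<^sup>2 + b\<^sup>2) = (a + b)\<^sup>2 + (b - a)\<^sup>2" for a b :: int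
  by (simp add: power2_eq_square algebra_simps)

text \<open>Products of one weight have the same sum of heights at each gap. The sum of squares then
  determines the difference, and it grows with the difference.\<close>

lemma sumsq_inj:
  fixes a b :: int
  assumes "a + b = a' + b'" "a\<^sup>2 + b\<^sup>2 = a'\<^sup>2 + b'\<^sup>2" "a \<le> b" "a' \<le> b'"
  shows "a = a' \<and> b = b'"
proof -
  have "(b - a)\<^sup>2 = (b' - a')\<^sup>2" using sumsq_identity[of a b] sumsq_identity[of a' b'] assms by simp
  then have "b - a = b' - a' \<or> b - a = - (b' - a')" by (simp only: power2_eq_iff)
  then show ?thesis using assms(1,3,4) by linarith
qed

lemma sumsq_less:
  fixes a b :: int
  assumes "a + b = a' + b'" "\<bar>b - a\<bar> < \<bar>b' - a'\<bar>"
  shows "a\<^sup>2 + b\<^sup>2 < a'\<^sup>2 + b'\<^sup>2"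
proof -
  have "\<bar>b - a\<bar>\<^sup>2 < \<bar>b' - a'\<bar>\<^sup>2" using assms(2) by (intro power_strict_mono) auto
  then show ?thesis using sumsq_identity[of a b] sumsq_identity[of a' b'] assms(1) by simp
qed

lemma nat_sumsq_less_iff:
  "0 \<le> a \<Longrightarrow> 0 \<le> b \<Longrightarrow> 0 \<le> a' \<Longrightarrow> 0 \<le> b' \<Longrightarrow> nat a ^ 2 + nat b ^ 2 < nat a' ^ 2 + nat b' ^ 2 \<longleftrightarrow> a\<^sup>2 + b\<^sup>2 < a'\<^sup>2 + b'\<^sup>2"
  by (subst of_nat_less_iff[symmetric, where ?'a = int]) simp

lemma nat_sumsq_eq_iff:
  "0 \<le> a \<Longrightarrow> 0 \<le> b \<Longrightarrow> 0 \<le> a' \<Longrightarrow> 0 \<le> b' \<Longrightarrow> nat a ^ 2 + nat b ^ 2 = nat a' ^ 2 + nat b' ^ 2 \<longleftrightarrow> a\<^sup>2 + b\<^sup>2 = a'\<^sup>2 + b'\<^sup>2"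
  by (subst of_nat_eq_iff[symmetric, where ?'a = int]) simp

definition pr :: "nat \<Rightarrow> nat \<Rightarrow> int set \<Rightarrow> int set \<Rightarrow> int set \<times> nat \<Rightarrow> pvar \<times> pvar" where
  "pr d N X T = (\<lambda>(C, i). ((N - d + i, X \<union> (T - C)), (N - (N - d) - i, X \<union> C)))"

lemma quad_pr: "quad d N x X T s = (-1) ^ invs (T - fst s) (fst s) * (x (fst (pr d N X T s)) * x (snd (pr d N X T s)))"
  by (cases s) (simp add: quad_def pr_def)

text \<open>One threshold for the gaps on either side of zero, which makes heights additive over
  disjoint sets of letters.\<close>

definition above :: "int \<Rightarrow> int set \<Rightarrow> nat" where
  "above y A = card {k\<in>A. (if 0 \<le> y then y else y - 1) < k}"

lemma ht_above: "ht (a, A) y = int a + min 0 y + int (above y A)"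
proof -
  have "{k\<in>A. y - 1 < k} = {k\<in>A. y \<le> k}" by auto
  then show ?thesis by (simp add: ht_def above_def)
qed

lemma above_Un: "finite A \<Longrightarrow> finite B \<Longrightarrow> A \<inter> B = {} \<Longrightarrow> above y (A \<union> B) = above y A + above y B"
proof -
  assume a: "finite A" "finite B" "A \<inter> B = {}"
  let ?t = "if 0 \<le> y then y else y - 1"
  have "{k\<in>A \<union> B. ?t < k} = {k\<in>A. ?t < k} \<union> {k\<in>B. ?t < k}" by auto
  then have "card {k\<in>A \<union> B. ?t < k} = card ({k\<in>A. ?t < k} \<union> {k\<in>B. ?t < k})" by (simp only:)
  also have "\<dots> = card {k\<in>A. ?t < k} + card {k\<in>B. ?t < k}" using a by (intro card_Un_disjoint) auto
  finally show ?thesis unfolding above_def .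
qed

text \<open>All products of two variables with common letters \<open>X\<close>, remaining letters
  \<open>T\<close> and total exponent \<open>N\<close>.\<close>

locale weight_space =
  fixes d n N p :: nat and X T :: "int set"
  assumes n: "n \<ge> 1" and sub: "X \<subseteq> bracket n" "T \<subseteq> bracket n" "X \<inter> T = {}"
    and cards: "card T = 2 * p" "card X + p = n" and N: "N \<le> 2 * d"
begin

abbreviation "M \<equiv> N - 2 * (N - d)"
abbreviation "g s \<equiv> fst (pr d N X T s)"
abbreviation "h s \<equiv> snd (pr d N X T s)"

lemma fin: "finite X" "finite T"
  using sub finite_subset[OF _ finite_bracket[of n]] by auto

lemma valid_Vars:
  assumes "fst s \<subseteq> T" "card (fst s) = p" "snd s \<le> M"
  shows "g s \<in> Vars d n" "h s \<in> Vars d n"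
proof -
  obtain C i where s: "s = (C, i)" by (cases s)
  have C: "C \<subseteq> T" "card C = p" "i \<le> M" using assms s by auto
  have fC: "finite C" using C fin finite_subset by blast
  have "card (T - C) = p" using C cards fC by (simp add: card_Diff_subset)
  then have "card (X \<union> (T - C)) = n" using card_Un_disjoint[of X "T - C"] fin sub cards by auto
  moreover have "card (X \<union> C) = n" using card_Un_disjoint[of X C] fin fC sub cards C by auto
  moreover have "N - d + i \<le> d" "N - (N - d) - i \<le> d" using C N by auto
  ultimately show "g s \<in> Vars d n" "h s \<in> Vars d n"
    using sub C s by (auto simp: pr_def Vars_def nsubsets_def)
qed

lemma ht_sum:
  assumes "fst s \<subseteq> T" "snd s \<le> M"
  shows "ht (g s) y + ht (h s) y = int N + 2 * min 0 y + 2 * int (above y X) + int (above y T)"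
proof -
  obtain C i where s: "s = (C, i)" by (cases s)
  have C: "C \<subseteq> T" "i \<le> M" using assms s by auto
  have fC: "finite C" using C fin finite_subset by blast
  have "T = (T - C) \<union> C" using C by auto
  then have "above y T = above y (T - C) + above y C" using above_Un[of "T - C" C y] fin fC by auto
  moreover have "above y (X \<union> (T - C)) = above y X + above y (T - C)" "above y (X \<union> C) = above y X + above y C"
    using fin fC sub C by (auto intro!: above_Un)
  ultimately show ?thesis using C N by (simp add: s pr_def ht_above of_nat_diff)
qed

lemma ht_diff:
  assumes "fst s \<subseteq> T" "snd s \<le> M"
  shows "ht (h s) y - ht (g s) y = int M - 2 * int (snd s) + int (above y (fst s)) - int (above y (T - fst s))"
proof -
  obtain C i where s: "s = (C, i)" by (cases s)
  have C: "C \<subseteq> T" "i \<le> M" using assms s by auto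
  have fC: "finite C" using C fin finite_subset by blast
  have "above y (X \<union> (T - C)) = above y X + above y (T - C)" "above y (X \<union> C) = above y X + above y C"
    using fin fC sub C by (auto intro!: above_Un)
  then show ?thesis using C N by (simp add: s pr_def ht_above of_nat_diff)
qed

lemma std_valid: "s \<in> std_pairs T p M \<Longrightarrow> fst s \<subseteq> T \<and> card (fst s) = p \<and> snd s \<le> M"
  by (auto simp: std_pairs_def)

lemma std_ht_le:
  assumes "s \<in> std_pairs T p M"
  shows "ht (g s) y \<le> ht (h s) y"
proof -
  obtain C i where s: "s = (C, i)" by (cases s)
  have "dip T C \<le> M - 2 * i" "2 * i \<le> M" using assms s by (auto simp: std_pairs_def)
  then have "above y (T - C) \<le> above y C + (M - 2 * i)"
    using dip_le_iff[OF fin(2)] unfolding above_def by blast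
  then show ?thesis using ht_diff[of s y] std_valid[OF assms] \<open>2 * i \<le> M\<close> s by simp
qed

text \<open>Exceeds every sum of two squared heights, since heights are at most
  \<open>d + n\<close>; these sums are the digits in the orders compared below.\<close>

definition K :: nat where "K = 2 * (d + n)\<^sup>2 + 1"
text \<open>The gap \<open>y0\<close> is given the most significant digit, as the other gaps occupy
  positions up to \<open>2 * n\<close>.\<close>

definition ix :: "int \<Rightarrow> int \<Rightarrow> nat" where "ix y0 y = (if y = y0 then 2 * n + 1 else nat (y + int n))"
definition W :: "int \<Rightarrow> int \<Rightarrow> nat" where "W y0 y = K ^ ix y0 y"
definition cc :: "int set \<times> nat \<Rightarrow> int \<Rightarrow> nat" where "cc s y = nat (ht (g s) y) ^ 2 + nat (ht (h s) y) ^ 2"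

abbreviation "Y \<equiv> {- int n + 1..int n}"
abbreviation "mset2 s \<equiv> {#g s, h s#}"

lemma ix: "inj_on (ix y0) Y" "\<And>y. y \<in> Y \<Longrightarrow> y \<noteq> y0 \<Longrightarrow> ix y0 y < ix y0 y0"
  by (auto simp: inj_on_def ix_def split: if_splits)

lemma wtm_eq: "wtm n (qw (W y0)) (mset2 s) = (\<Sum>y\<in>Y. K ^ ix y0 y * cc s y)"
  by (simp add: wtm_def wt_qw W_def cc_def sum.distrib distrib_left)

lemma cc_less: "g s \<in> Vars d n \<Longrightarrow> h s \<in> Vars d n \<Longrightarrow> y \<in> Y \<Longrightarrow> cc s y < K"
proof -
  assume a: "g s \<in> Vars d n" "h s \<in> Vars d n" "y \<in> Y"
  have "nat (ht (g s) y) \<le> d + n" "nat (ht (h s) y) \<le> d + n"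
    using Vars_ht_bounds[OF a(1), of y] Vars_ht_bounds[OF a(2), of y] a(3) by auto
  then have "nat (ht (g s) y) ^ 2 \<le> (d + n)\<^sup>2" "nat (ht (h s) y) ^ 2 \<le> (d + n)\<^sup>2" by (auto intro: power_mono)
  then show ?thesis unfolding cc_def K_def by linarith
qed

text \<open>The order determines its digits, a digit determines the two heights at a gap up to
  interchange, and standardness tells which is the smaller one.\<close>

lemma std_weights_distinct:
  assumes s: "s \<in> std_pairs T p M" "s' \<in> std_pairs T p M"
    and eq: "wtm n (qw (W y0)) (mset2 s) = wtm n (qw (W y0)) (mset2 s')"
  shows "s = s'"
proof -
  have V: "g s \<in> Vars d n" "h s \<in> Vars d n" "g s' \<in> Vars d n" "h s' \<in> Vars d n"
    using valid_Vars std_valid s by auto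
  have c: "cc s y = cc s' y" if "y \<in> Y" for y
    by (rule digits_inj[OF _ ix(1), where K = K]) (use cc_less V eq that in \<open>auto simp: wtm_eq\<close>)
  have e: "ht (g s) y = ht (g s') y \<and> ht (h s) y = ht (h s') y" if y: "y \<in> Y" for y
  proof (rule sumsq_inj)
    show "ht (g s) y + ht (h s) y = ht (g s') y + ht (h s') y"
      using ht_sum std_valid[OF s(1)] std_valid[OF s(2)] by simp
    show "(ht (g s) y)\<^sup>2 + (ht (h s) y)\<^sup>2 = (ht (g s') y)\<^sup>2 + (ht (h s') y)\<^sup>2"
      using c[OF y] y Vars_ht_bounds(1)[OF V(1), of y] Vars_ht_bounds(1)[OF V(2), of y]
        Vars_ht_bounds(1)[OF V(3), of y] Vars_ht_bounds(1)[OF V(4), of y]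
      unfolding cc_def by (subst (asm) nat_sumsq_eq_iff) auto
  qed (use std_ht_le s in auto)
  have "h s = h s'"
  proof (rule ht_inj[OF V(2,4)])
    fix y assume y: "- int n \<le> y" "y \<le> int n"
    show "ht (h s) y = ht (h s') y"
    proof (cases "y = - int n")
      case True
      then show ?thesis using Vars_ht_minus_n[OF V(2)] Vars_ht_minus_n[OF V(4)] e[of "int n"] n by simp
    next
      case False
      then show ?thesis using e[of y] y by simp
    qed
  qed
  then have "N - (N - d) - snd s = N - (N - d) - snd s'" "X \<union> fst s = X \<union> fst s'"
    by (auto simp: pr_def split: prod.splits)
  moreover have "fst s = (X \<union> fst s) - X" "fst s' = (X \<union> fst s') - X"
    using std_valid[OF s(1)] std_valid[OF s(2)] sub(3) by auto
  ultimately show ?thesis using std_valid[OF s(1)] std_valid[OF s(2)] N by (intro prod_eqI) auto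
qed

lemma W_pos: "W y0 y > 0" by (simp add: W_def K_def)

lemma not_unique:
  assumes S: "finite S" "\<And>i. i \<in> S \<Longrightarrow> set_mset (Ms i) \<subseteq> Vars d n"
    and rel: "\<And>x. x \<in> GrMaps d n \<Longrightarrow> (\<Sum>i\<in>S. a i * val x (Ms i)) = (0 :: complex)"
    and i1: "i1 \<in> S" "a i1 \<noteq> 0"
  shows "\<exists>i2\<in>S. i2 \<noteq> i1 \<and> a i2 \<noteq> 0 \<and> wtm n (qw (W y0)) (Ms i2) \<le> wtm n (qw (W y0)) (Ms i1)"
proof (rule leading_exponent_not_unique[where lg = False and w = "qw (W y0)" and M = Ms and a = a and S = S])
  show "(\<Sum>i\<in>S. a i * val x (Ms i)) = 0" if "x \<in> maps False d n" for x
    using rel that by (simp add: maps_def)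
qed (use n S i1 W_pos strict_mono_qw in auto)

lemma std_finite: "finite (std_pairs T p M)"
  using card_pairs[OF fin(2) cards(1)] by blast

definition e :: "int set \<times> nat \<Rightarrow> complex" where "e s = (-1) ^ invs (T - fst s) (fst s)"

lemma e_square: "e s * e s = 1" and e_nonzero: "e s \<noteq> 0"
  unfolding e_def by (simp_all flip: power_add)

lemma val_mset2: "quad d N x X T s = e s * val x (mset2 s)"
  by (simp add: quad_pr e_def val_def)

text \<open>A relation among the standard evaluations on \<open>sols\<close> holds in particular for
  the quadrics of maps, where the distinct orders along a family exclude it.\<close>

lemma std_independent:
  assumes "\<forall>\<phi>\<in>sols T p M. (\<Sum>s\<in>std_pairs T p M. a s * \<phi> s) = 0"
  shows "\<forall>s\<in>std_pairs T p M. a s = 0"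
proof (rule ccontr)
  assume neg: "\<not> ?thesis"
  define S where "S = {s\<in>std_pairs T p M. a s \<noteq> 0}"
  have S: "finite S" "S \<noteq> {}" using neg std_finite by (auto simp: S_def)
  let ?w = "\<lambda>s. wtm n (qw (W 0)) (mset2 s)"
  obtain s1 where s1: "s1 \<in> S" "\<And>s. s \<in> S \<Longrightarrow> ?w s1 \<le> ?w s"
    using arg_min_if_finite(1)[OF S, of ?w] arg_min_least[OF S, of _ ?w] by blast
  have "(\<Sum>s\<in>std_pairs T p M. (a s * e s) * val x (mset2 s)) = 0" if "x \<in> GrMaps d n" for x
  proof -
    have "(\<Sum>s\<in>std_pairs T p M. a s * quad d N x X T s) = 0" using assms quad_in_sols[OF that sub cards N] by blast
    then show ?thesis by (simp add: val_mset2 mult.assoc)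
  qed
  moreover have "s1 \<in> std_pairs T p M" "a s1 * e s1 \<noteq> 0" using s1(1) e_nonzero by (auto simp: S_def)
  ultimately obtain s2 where s2: "s2 \<in> std_pairs T p M" "s2 \<noteq> s1" "a s2 * e s2 \<noteq> 0" "?w s2 \<le> ?w s1"
    using not_unique[where S = "std_pairs T p M" and Ms = mset2 and a = "\<lambda>s. a s * e s" and ?i1.0 = s1 and ?y0.0 = 0]
      std_finite valid_Vars std_valid by auto
  then have "s2 \<in> S" by (auto simp: S_def)
  then have "?w s2 = ?w s1" using s1(2)[of s2] s2(4) by simp
  then show False using std_weights_distinct[OF s2(1), of s1] s2(2) s1(1) by (auto simp: S_def)
qed

text \<open>Comparing leading exponents for the weight concentrated at \<open>y\<close> bounds the difference of the
  heights at \<open>y\<close>.\<close>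

lemma straightening:
  assumes s0: "fst s0 \<subseteq> T" "card (fst s0) = p" "snd s0 \<le> M"
  shows "\<exists>I a. finite I \<and> I \<subseteq> std_pairs T p M \<and>
     (\<forall>s\<in>I. \<forall>y\<in>Y. \<bar>ht (h s0) y - ht (g s0) y\<bar> \<le> ht (h s) y - ht (g s) y) \<and>
     (\<forall>x\<in>GrMaps d n. x (g s0) * x (h s0) = (\<Sum>s\<in>I. a s * (x (g s) * x (h s))))"
proof -
  obtain a where a: "\<And>\<phi>. \<phi> \<in> sols T p M \<Longrightarrow> \<phi> s0 = (\<Sum>s\<in>std_pairs T p M. a s * \<phi> s)"
    using sols_straightening[OF fin(2) cards(1) s0 std_independent] by auto
  define b where "b = (\<lambda>s. e s0 * a s * e s)"
  define I where "I = {s\<in>std_pairs T p M. b s \<noteq> 0}"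
  have finI: "finite I" "I \<subseteq> std_pairs T p M" using std_finite by (auto simp: I_def)
  have rel: "val x (mset2 s0) = (\<Sum>s\<in>I. b s * val x (mset2 s))" if "x \<in> GrMaps d n" for x
  proof -
    have "e s0 * val x (mset2 s0) = (\<Sum>s\<in>std_pairs T p M. a s * (e s * val x (mset2 s)))"
      using a[OF quad_in_sols[OF that sub cards N]] unfolding val_mset2 .
    then have "e s0 * (e s0 * val x (mset2 s0)) = (\<Sum>s\<in>std_pairs T p M. b s * val x (mset2 s))"
      by (simp add: b_def sum_distrib_left mult.assoc)
    also have "\<dots> = (\<Sum>s\<in>I. b s * val x (mset2 s))"
      using std_finite by (intro sum.mono_neutral_right) (auto simp: I_def)
    finally show ?thesis using e_square[of s0] by (simp flip: mult.assoc)
  qed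
  have bound: "\<bar>ht (h s0) y - ht (g s0) y\<bar> \<le> ht (h s) y - ht (g s) y" if s: "s \<in> I" and y: "y \<in> Y" for s y
  proof (rule ccontr)
    assume neg: "\<not> ?thesis"
    let ?w = "\<lambda>s. wtm n (qw (W y)) (mset2 s)"
    have ss: "s \<in> std_pairs T p M" using s finI by auto
    have V: "g s \<in> Vars d n" "h s \<in> Vars d n" "g s0 \<in> Vars d n" "h s0 \<in> Vars d n"
      using valid_Vars std_valid[OF ss] s0 by auto
    have "(ht (g s) y)\<^sup>2 + (ht (h s) y)\<^sup>2 < (ht (g s0) y)\<^sup>2 + (ht (h s0) y)\<^sup>2"
    proof (rule sumsq_less)
      show "ht (g s) y + ht (h s) y = ht (g s0) y + ht (h s0) y" using ht_sum std_valid[OF ss] s0 by simp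
      show "\<bar>ht (h s) y - ht (g s) y\<bar> < \<bar>ht (h s0) y - ht (g s0) y\<bar>" using neg std_ht_le[OF ss, of y] by linarith
    qed
    then have "cc s y < cc s0 y"
      unfolding cc_def using y Vars_ht_bounds(1)[OF V(1), of y] Vars_ht_bounds(1)[OF V(2), of y]
        Vars_ht_bounds(1)[OF V(3), of y] Vars_ht_bounds(1)[OF V(4), of y]
      by (subst nat_sumsq_less_iff) auto
    moreover have "\<not> ix y y < ix y z" if "z \<in> Y" for z using ix(2)[OF that, of y] by (cases "z = y") auto
    ultimately have lt: "?w s < ?w s0"
      unfolding wtm_eq using cc_less[OF V(1,2)] y by (intro digits_less[OF _ ix(1) y]) auto
    \<comment> \<open>The term of least order among the standard ones is unique, and by
      \<open>lt\<close> the product \<open>s0\<close> has larger order: the relation would have a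
      single lowest term.\<close>
    obtain s1 where s1: "s1 \<in> I" "\<And>s. s \<in> I \<Longrightarrow> ?w s1 \<le> ?w s"
      using arg_min_if_finite(1)[of I ?w] arg_min_least[of I _ ?w] finI(1) s by blast
    have w1: "?w s1 < ?w s0" using lt s1(2)[OF s] by simp
    let ?S = "insert None (Some ` I)" let ?M = "\<lambda>i. mset2 (case i of None \<Rightarrow> s0 | Some s \<Rightarrow> s)"
    let ?a = "\<lambda>i. case i of None \<Rightarrow> - 1 | Some s \<Rightarrow> b s"
    have "\<exists>i2\<in>?S. i2 \<noteq> Some s1 \<and> ?a i2 \<noteq> 0 \<and> wtm n (qw (W y)) (?M i2) \<le> wtm n (qw (W y)) (?M (Some s1))"
    proof (rule not_unique)
      show "finite ?S" using finI by simp
      show "set_mset (?M i) \<subseteq> Vars d n" if "i \<in> ?S" for i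
      proof (cases i)
        case None
        then show ?thesis using valid_Vars[OF s0] by simp
      next
        case (Some s')
        then have "s' \<in> std_pairs T p M" using that finI(2) by auto
        then have "g s' \<in> Vars d n" "h s' \<in> Vars d n" using valid_Vars[of s'] std_valid[of s'] by blast+
        then show ?thesis using Some by simp
      qed
      show "(\<Sum>i\<in>?S. ?a i * val x (?M i)) = 0" if "x \<in> GrMaps d n" for x
        using finI(1) rel[OF that] by (simp add: sum.reindex)
      show "Some s1 \<in> ?S" "?a (Some s1) \<noteq> 0" using s1(1) by (auto simp: I_def)
    qed
    then obtain i2 where i2: "i2 \<in> ?S" "i2 \<noteq> Some s1" "wtm n (qw (W y)) (?M i2) \<le> ?w s1"
      unfolding option.case by blast
    show False
    proof (cases i2)
      case None
      then show False using i2(3) w1 by simp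
    next
      case (Some s2)
      then have "s2 \<in> I" "?w s2 \<le> ?w s1" using i2 by auto
      then have "?w s2 = ?w s1" using s1(2)[of s2] by simp
      then show False using std_weights_distinct[of s2 s1] \<open>s2 \<in> I\<close> s1(1) finI(2) i2(2) Some by blast
    qed
  qed
  have "\<forall>x\<in>GrMaps d n. x (g s0) * x (h s0) = (\<Sum>s\<in>I. b s * (x (g s) * x (h s)))"
    using rel by (simp add: val_def)
  then show ?thesis using finI bound by (intro exI[of _ I] exI[of _ b]) blast
qed

end

theorem quadratic_straightening:
  assumes n: "n \<ge> 1" and v: "v \<in> Vars d n" "v' \<in> Vars d n"
  obtains I :: "(int set \<times> nat) set" and a g h where "finite I"
    "\<And>s. s \<in> I \<Longrightarrow> g s \<in> Vars d n \<and> h s \<in> Vars d n"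
    "\<And>s y. s \<in> I \<Longrightarrow> - int n \<le> y \<Longrightarrow> y \<le> int n \<Longrightarrow> ht (g s) y \<le> ht (h s) y \<and>
       ht (g s) y + ht (h s) y = ht v y + ht v' y \<and> \<bar>ht v' y - ht v y\<bar> \<le> ht (h s) y - ht (g s) y"
    "\<And>x. x \<in> GrMaps d n \<Longrightarrow> x v * x v' = (\<Sum>s\<in>I. a s * (x (g s) * x (h s)))"
proof -
  obtain a0 A b0 B where vv: "v = (a0, A)" "v' = (b0, B)" "a0 \<le> d" "b0 \<le> d" "A \<in> nsubsets n n" "B \<in> nsubsets n n"
    using v by (auto simp: Vars_def)
  define X where "X = A \<inter> B"
  define T where "T = (A - B) \<union> (B - A)"
  define N where "N = a0 + b0"
  define p where "p = card (B - A)"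
  note A = nsubsets_list[OF vv(5)] and B = nsubsets_list[OF vv(6)]
  have X1: "card X + card (A - B) = n" "card X + p = n"
    using A B card_Diff_subset_Int[of A B] card_Diff_subset_Int[of B A] card_mono[of A "A \<inter> B"] card_mono[of B "A \<inter> B"]
    by (auto simp: X_def p_def Int_commute)
  have cT: "card T = 2 * p" unfolding T_def using A B X1 by (subst card_Un_disjoint) (auto simp: p_def)
  interpret weight_space d n N p X T
    using n A B X1 cT vv(3,4) by unfold_locales (auto simp: X_def T_def N_def)
  \<comment> \<open>The exponent of the first factor is counted from its minimum
    \<open>N - d\<close>.\<close>
  define s0 where "s0 = (B - A, a0 - (N - d))"
  have le: "a0 \<ge> N - d" "N - (N - d) - (a0 - (N - d)) = b0" using vv(3,4) by (auto simp: N_def)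
  have "X \<union> (T - (B - A)) = A" "X \<union> (B - A) = B" by (auto simp: X_def T_def)
  then have gh: "g s0 = v" "h s0 = v'" using le vv by (auto simp: pr_def s0_def)
  have s0: "fst s0 \<subseteq> T" "card (fst s0) = p" "snd s0 \<le> M" using vv(3,4) by (auto simp: s0_def T_def p_def N_def)
  obtain I a where I: "finite I" "I \<subseteq> std_pairs T p M"
     "\<forall>s\<in>I. \<forall>y\<in>Y. \<bar>ht (h s0) y - ht (g s0) y\<bar> \<le> ht (h s) y - ht (g s) y"
     "\<forall>x\<in>GrMaps d n. x (g s0) * x (h s0) = (\<Sum>s\<in>I. a s * (x (g s) * x (h s)))"
    using straightening[OF s0] by blast
  show thesis
  proof (rule that[of I g h a])
    show V: "g s \<in> Vars d n \<and> h s \<in> Vars d n" if "s \<in> I" for s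
      using valid_Vars[of s] std_valid[of s] I(2) that by blast
    show "ht (g s) y \<le> ht (h s) y \<and> ht (g s) y + ht (h s) y = ht v y + ht v' y \<and> \<bar>ht v' y - ht v y\<bar> \<le> ht (h s) y - ht (g s) y"
      if s: "s \<in> I" and y: "- int n \<le> y" "y \<le> int n" for s y
    proof -
      have ss: "s \<in> std_pairs T p M" using s I(2) by auto
      have "ht (g s) y + ht (h s) y = ht v y + ht v' y"
        using ht_sum[of s y] ht_sum[of s0 y] std_valid[OF ss] s0 gh by simp
      moreover have "\<bar>ht v' y - ht v y\<bar> \<le> ht (h s) y - ht (g s) y"
      proof (cases "y = - int n")
        case True
        have "int n \<in> Y" using n by simp
        then show ?thesis using I(3) s gh True Vars_ht_minus_n[OF v(1)] Vars_ht_minus_n[OF v(2)]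
            Vars_ht_minus_n[of "g s" d n] Vars_ht_minus_n[of "h s" d n] V[OF s] by auto
      next
        case False
        then have "y \<in> Y" using y by simp
        then show ?thesis using I(3) s gh by auto
      qed
      ultimately show ?thesis using std_ht_le[OF ss, of y] by blast
    qed
  qed (use I gh in auto)
qed

section \<open>The linear forms\<close>

text \<open>After expansion the sum over \<open>i\<close> is a bilinear expression in the two
  columns used by the first two rows. Interchanging these columns changes the sign of the
  permutation, so twice the sum consists of values of the symplectic form on columns.\<close>

lemma isotropic_contraction:
  fixes U :: "int \<Rightarrow> nat \<Rightarrow> complex"
  assumes len: "length bs + 2 = n"
    and iso: "\<And>i j. i < n \<Longrightarrow> j < n \<Longrightarrow> Omega n (\<lambda>k. U k i) (\<lambda>k. U k j) = 0"
  shows "(\<Sum>i\<in>{1..int n}. mdet n U (- i # i # bs)) = 0"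
proof -
  let ?Per = "{\<sigma> :: nat \<Rightarrow> nat. \<sigma> permutes {0..<n}}"
  define R where "R = (\<lambda>\<sigma> :: nat \<Rightarrow> nat. \<Prod>l = 2..<n. U (bs ! (l - 2)) (\<sigma> l))"
  define G where "G = (\<lambda>c c'. \<Sum>i\<in>{1..int n}. U (- i) c * U i c')"
  have GO: "G c c' - G c' c = Omega n (\<lambda>k. U k c) (\<lambda>k. U k c')" for c c'
    unfolding G_def Omega_def sum_subtractf[symmetric] by (intro sum.cong) (auto simp: algebra_simps)
  have "(\<Prod>l = 0..<n. U ((- i # i # bs) ! l) (\<sigma> l)) = U (- i) (\<sigma> 0) * U i (\<sigma> 1) * R \<sigma>" for i \<sigma>
  proof -
    have "(\<Prod>l = 0..<n. U ((- i # i # bs) ! l) (\<sigma> l)) =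
      (\<Prod>l = 0..<2. U ((- i # i # bs) ! l) (\<sigma> l)) * (\<Prod>l = 2..<n. U ((- i # i # bs) ! l) (\<sigma> l))"
      using len by (intro prod.atLeastLessThan_concat[symmetric]) auto
    also have "(\<Prod>l = 2..<n. U ((- i # i # bs) ! l) (\<sigma> l)) = R \<sigma>"
      unfolding R_def by (intro prod.cong) (auto simp: nth_Cons' numeral_2_eq_2)
    also have "(\<Prod>l = 0..<2. U ((- i # i # bs) ! l) (\<sigma> l)) = U (- i) (\<sigma> 0) * U i (\<sigma> 1)"
      by (simp add: numeral_2_eq_2)
    finally show ?thesis .
  qed
  then have "(\<Sum>i\<in>{1..int n}. mdet n U (- i # i # bs)) =
     (\<Sum>i\<in>{1..int n}. \<Sum>\<sigma>\<in>?Per. of_int (sign \<sigma>) * R \<sigma> * (U (- i) (\<sigma> 0) * U i (\<sigma> 1)))"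
    unfolding mdet_expand by (simp add: ac_simps)
  also have "\<dots> = (\<Sum>\<sigma>\<in>?Per. of_int (sign \<sigma>) * R \<sigma> * G (\<sigma> 0) (\<sigma> 1))"
    unfolding G_def sum_distrib_left by (rule sum.swap)
  finally have S: "(\<Sum>i\<in>{1..int n}. mdet n U (- i # i # bs)) = (\<Sum>\<sigma>\<in>?Per. of_int (sign \<sigma>) * R \<sigma> * G (\<sigma> 0) (\<sigma> 1))" (is "?L = ?S") .
  let ?t = "Transposition.transpose 0 (1 :: nat)"
  have t: "?t permutes {0..<n}" using len by (intro permutes_swap_id) auto
  have "?S = (\<Sum>\<sigma>\<in>?Per. of_int (sign (\<sigma> \<circ> ?t)) * R (\<sigma> \<circ> ?t) * G ((\<sigma> \<circ> ?t) 0) ((\<sigma> \<circ> ?t) 1))"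
    by (rule sum_permutations_compose_right[OF t])
  also have "\<dots> = (\<Sum>\<sigma>\<in>?Per. - (of_int (sign \<sigma>) * R \<sigma> * G (\<sigma> 1) (\<sigma> 0)))"
  proof (rule sum.cong[OF refl])
    fix \<sigma> assume "\<sigma> \<in> ?Per"
    then have "permutation \<sigma>" using permutation_permutes by blast
    then have "sign (\<sigma> \<circ> ?t) = sign \<sigma> * sign ?t" by (intro sign_compose) (auto simp: permutation_swap_id)
    then have "sign (\<sigma> \<circ> ?t) = - sign \<sigma>" by (simp add: sign_swap_id)
    moreover have "R (\<sigma> \<circ> ?t) = R \<sigma>" unfolding R_def by (intro prod.cong) (auto simp: transpose_def)
    ultimately show "of_int (sign (\<sigma> \<circ> ?t)) * R (\<sigma> \<circ> ?t) * G ((\<sigma> \<circ> ?t) 0) ((\<sigma> \<circ> ?t) 1) = - (of_int (sign \<sigma>) * R \<sigma> * G (\<sigma> 1) (\<sigma> 0))"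
      by simp
  qed
  finally have "?S + ?S = (\<Sum>\<sigma>\<in>?Per. of_int (sign \<sigma>) * R \<sigma> * (G (\<sigma> 0) (\<sigma> 1) - G (\<sigma> 1) (\<sigma> 0)))"
    by (simp add: sum_negf sum_subtractf right_diff_distrib)
  also have "\<dots> = 0"
  proof (rule sum.neutral, rule ballI)
    fix \<sigma> assume "\<sigma> \<in> ?Per"
    then have "\<sigma> 0 < n" "\<sigma> 1 < n" using permutes_less[of \<sigma> n] len by auto
    then show "of_int (sign \<sigma>) * R \<sigma> * (G (\<sigma> 0) (\<sigma> 1) - G (\<sigma> 1) (\<sigma> 0)) = 0" using iso by (simp add: GO)
  qed
  finally show ?thesis unfolding S by simp
qed

text \<open>A generator involves a single exponent \<open>a\<close>. The corresponding identity
  between forms holds at every point \<open>(s, 1)\<close> and is then compared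
  coefficientwise.\<close>

lemma Lgens_vanish:
  assumes f: "f \<in> Lgens d n" and x: "x \<in> LGMaps d n"
  shows "meval x f = 0"
proof -
  obtain a B where B: "2 \<le> n" "a \<le> d" "B \<in> nsubsets n (n - 2)"
    and fe: "f = (\<Sum>i\<in>{i\<in>{1..int n}. {i, - i} \<inter> B = {}}.
             of_int (sort_sign ((- i) # i # sorted_list_of_set B)) * pvar (a, B \<union> {- i, i}))"
    using f unfolding Lgens_def by blast
  let ?I = "{i\<in>{1..int n}. {i, - i} \<inter> B = {}}" let ?e = "\<lambda>i. sort_sign ((- i) # i # sorted_list_of_set B)"
  have B': "finite B" "card B = n - 2" "B \<subseteq> bracket n" using B(3) finite_subset[OF _ finite_bracket[of n]] by (auto simp: nsubsets_def)
  define q where "q = (\<Sum>b\<le>d. monom (\<Sum>i\<in>?I. of_int (?e i) * x (b, B \<union> {- i, i})) b)"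
  have "poly q s = 0" for s
  proof -
    have st: "(s, 1 :: complex) \<noteq> (0, 0)" by simp
    have "\<exists>U. (\<forall>A\<in>nsubsets n n. plueval d x A s 1 = minor n U A) \<and>
           (\<forall>i<n. \<forall>j<n. Omega n (\<lambda>k. U k i) (\<lambda>k. U k j) = 0)"
      using x st unfolding LGMaps_def mem_Collect_eq by presburger
    then obtain U where U: "\<And>A. A \<in> nsubsets n n \<Longrightarrow> plueval d x A s 1 = minor n U A"
      "\<And>i j. i < n \<Longrightarrow> j < n \<Longrightarrow> Omega n (\<lambda>k. U k i) (\<lambda>k. U k j) = 0" by auto
    have "poly q s = (\<Sum>b\<le>d. \<Sum>i\<in>?I. of_int (?e i) * (x (b, B \<union> {- i, i}) * s ^ b))"
      by (simp add: q_def poly_sum poly_monom sum_distrib_right mult.assoc)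
    also have "\<dots> = (\<Sum>i\<in>?I. of_int (?e i) * plueval d x (B \<union> {- i, i}) s 1)"
      unfolding plueval_def sum_distrib_left by (subst sum.swap) simp
    also have "\<dots> = (\<Sum>i\<in>?I. mdet n U (- i # i # sorted_list_of_set B))"
    proof (rule sum.cong[OF refl])
      fix i assume i: "i \<in> ?I"
      let ?xs = "- i # i # sorted_list_of_set B"
      have d: "distinct ?xs" using i B' by auto
      have l: "length ?xs = n" using B' B(1) by simp
      have s: "set ?xs = B \<union> {- i, i}" using B' by auto
      have "set ?xs \<subseteq> bracket n" using i B' by (auto simp: bracket_def)
      moreover have "card (set ?xs) = n" using distinct_card[OF d] l by simp
      ultimately have "set ?xs \<in> nsubsets n n" unfolding nsubsets_def mem_Collect_eq by blast
      then have "B \<union> {- i, i} \<in> nsubsets n n" unfolding s .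
      then have "plueval d x (B \<union> {- i, i}) s 1 = mdet n U (sorted_list_of_set (set ?xs))"
        using U(1) s by (simp add: minor_eq_mdet)
      then show "of_int (?e i) * plueval d x (B \<union> {- i, i}) s 1 = mdet n U ?xs"
        using mdet_sort[OF d l, of U] by simp
    qed
    also have "\<dots> = (\<Sum>i\<in>{1..int n}. mdet n U (- i # i # sorted_list_of_set B))"
    proof (rule sum.mono_neutral_left)
      show "\<forall>i\<in>{1..int n} - ?I. mdet n U (- i # i # sorted_list_of_set B) = 0"
        using B' B(1) by (intro ballI mdet_not_distinct) auto
    qed auto
    also have "\<dots> = 0" using B' B(1) U(2) by (intro isotropic_contraction) auto
    finally show ?thesis .
  qed
  then have "q = 0" using poly_all_0_iff_0 by blast
  then have "coeff q a = 0" by simp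
  then have "(\<Sum>i\<in>?I. of_int (?e i) * x (a, B \<union> {- i, i})) = 0" using B(2) by (simp add: q_def coeff_sum)
  then show ?thesis unfolding fe
    by (simp add: meval_sum meval_mult meval_pvar of_int_eq_cst meval_cst)
qed

lemma LGMaps_subset: "LGMaps d n \<subseteq> GrMaps d n"
  unfolding LGMaps_def GrMaps_def by blast

section \<open>The ideal generated by both kinds of relations, and linear spans modulo it\<close>

definition J :: "nat \<Rightarrow> nat \<Rightarrow> mpoly set" where
  "J d n = ideal_gen (PRing d n) (Iideal d n \<union> Lgens d n)"

lemma Lgens_PRing: "f \<in> Lgens d n \<Longrightarrow> f \<in> PRing d n"
proof -
  assume "f \<in> Lgens d n"
  then obtain a B where B: "2 \<le> n" "a \<le> d" "B \<in> nsubsets n (n - 2)"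
    and fe: "f = (\<Sum>i\<in>{i\<in>{1..int n}. {i, - i} \<inter> B = {}}.
             of_int (sort_sign ((- i) # i # sorted_list_of_set B)) * pvar (a, B \<union> {- i, i}))"
    unfolding Lgens_def by blast
  have "(a, B \<union> {- i, i}) \<in> Vars d n" if "i \<in> {1..int n}" "{i, - i} \<inter> B = {}" for i
  proof -
    have "finite B" using B(3) finite_subset[OF _ finite_bracket[of n]] by (auto simp: nsubsets_def)
    moreover have "- i \<noteq> i" using that by auto
    ultimately have "card (B \<union> {- i, i}) = card B + 2" using that by simp
    then show ?thesis using B that by (auto simp: Vars_def nsubsets_def bracket_def)
  qed
  then show ?thesis unfolding fe of_int_eq_cst by (intro PRing_sum PRing_mult PRing_cst PRing_pvar) auto
qed

text \<open>The easy inclusion: an isotropic map is a map to the Grassmannian, and isotropy makes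
  the linear generators vanish.\<close>

lemma J_vanishing: "J d n \<subseteq> vanishing (PRing d n) (LGMaps d n)"
proof
  fix p assume "p \<in> J d n"
  then obtain F g where F: "finite F" "F \<subseteq> Iideal d n \<union> Lgens d n" "\<forall>f\<in>F. g f \<in> PRing d n" "p = (\<Sum>f\<in>F. g f * f)"
    unfolding J_def ideal_gen_def by blast
  have "f \<in> PRing d n" "x \<in> LGMaps d n \<Longrightarrow> meval x f = 0" if "f \<in> F" for f x
    using that F(2) Lgens_vanish[of f d n x] Lgens_PRing[of f d n] LGMaps_subset[of d n]
    by (auto simp: Iideal_def vanishing_def)
  then show "p \<in> vanishing (PRing d n) (LGMaps d n)"
    unfolding vanishing_def F(4) using F(3) by (auto simp: meval_sum meval_mult intro!: PRing_sum PRing_mult)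
qed

lemma J_0: "0 \<in> J d n" and J_add: "p \<in> J d n \<Longrightarrow> q \<in> J d n \<Longrightarrow> p + q \<in> J d n"
  and J_mult: "r \<in> PRing d n \<Longrightarrow> p \<in> J d n \<Longrightarrow> r * p \<in> J d n"
  unfolding J_def by (auto intro: ideal_gen_0 ideal_gen_add ideal_gen_mult)

lemma J_cst: "p \<in> J d n \<Longrightarrow> cst c * p \<in> J d n"
  by (rule J_mult[OF PRing_cst])

lemma J_uminus: "p \<in> J d n \<Longrightarrow> - p \<in> J d n"
  using J_cst[of p d n "-1"] by (simp add: cst_minus)

definition spanJ :: "nat \<Rightarrow> nat \<Rightarrow> ('i \<Rightarrow> mpoly) \<Rightarrow> 'i set \<Rightarrow> mpoly set" where
  "spanJ d n u A = {p. \<exists>S c. finite S \<and> S \<subseteq> A \<and> p - (\<Sum>i\<in>S. cst (c i) * u i) \<in> J d n}"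

lemma spanJ_base: "i \<in> A \<Longrightarrow> u i \<in> spanJ d n u A"
  unfolding spanJ_def by (intro CollectI exI[of _ "{i}"] exI[of _ "\<lambda>_. 1"]) (simp add: J_0)

lemma spanJ_J: "p \<in> J d n \<Longrightarrow> p \<in> spanJ d n u A"
  unfolding spanJ_def by (intro CollectI exI[of _ "{}"]) simp

lemma spanJ_cst: "p \<in> spanJ d n u A \<Longrightarrow> cst b * p \<in> spanJ d n u A"
proof -
  assume "p \<in> spanJ d n u A"
  then obtain S c where S: "finite S" "S \<subseteq> A" "p - (\<Sum>i\<in>S. cst (c i) * u i) \<in> J d n" unfolding spanJ_def by blast
  have "cst b * p - (\<Sum>i\<in>S. cst (b * c i) * u i) = cst b * (p - (\<Sum>i\<in>S. cst (c i) * u i))"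
    by (simp add: cst_mult sum_distrib_left right_diff_distrib mult.assoc)
  then show ?thesis unfolding spanJ_def using S J_cst[OF S(3), of b]
    by (intro CollectI exI[of _ S] exI[of _ "\<lambda>i. b * c i"]) simp
qed

lemma spanJ_add: "p \<in> spanJ d n u A \<Longrightarrow> q \<in> spanJ d n u A \<Longrightarrow> p + q \<in> spanJ d n u A"
proof -
  assume "p \<in> spanJ d n u A" "q \<in> spanJ d n u A"
  then obtain S c S' c' where S: "finite S" "S \<subseteq> A" "p - (\<Sum>i\<in>S. cst (c i) * u i) \<in> J d n"
    and S': "finite S'" "S' \<subseteq> A" "q - (\<Sum>i\<in>S'. cst (c' i) * u i) \<in> J d n" unfolding spanJ_def by blast
  define b where "b = (\<lambda>i. (if i \<in> S then c i else 0) + (if i \<in> S' then c' i else 0))"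
  have e: "(\<Sum>i\<in>S \<union> S'. cst (if i \<in> B then k i else 0) * u i) = (\<Sum>i\<in>B. cst (k i) * u i)" if "B \<subseteq> S \<union> S'" for B k
    using that S(1) S'(1) by (intro sum.mono_neutral_cong_right) auto
  have "(\<Sum>i\<in>S \<union> S'. cst (b i) * u i) = (\<Sum>i\<in>S. cst (c i) * u i) + (\<Sum>i\<in>S'. cst (c' i) * u i)"
    unfolding b_def cst_add distrib_right sum.distrib by (subst (1 2) e) auto
  then have D: "p + q - (\<Sum>i\<in>S \<union> S'. cst (b i) * u i) = (p - (\<Sum>i\<in>S. cst (c i) * u i)) + (q - (\<Sum>i\<in>S'. cst (c' i) * u i))"
    by simp
  show ?thesis unfolding spanJ_def
  proof (intro CollectI exI[of _ "S \<union> S'"] exI[of _ b] conjI)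
    show "p + q - (\<Sum>i\<in>S \<union> S'. cst (b i) * u i) \<in> J d n" unfolding D by (rule J_add[OF S(3) S'(3)])
  qed (use S S' in auto)
qed

lemma spanJ_sum: "(\<And>i. i \<in> I \<Longrightarrow> f i \<in> spanJ d n u A) \<Longrightarrow> sum f I \<in> spanJ d n u A"
  by (induction I rule: infinite_finite_induct) (auto intro: spanJ_J J_0 spanJ_add)

lemma divisible_subgroup_spanJ: "divisible_subgroup (spanJ d n u A)"
proof
  show "0 \<in> spanJ d n u A" by (rule spanJ_J[OF J_0])
  show "a \<in> spanJ d n u A \<Longrightarrow> b \<in> spanJ d n u A \<Longrightarrow> a + b \<in> spanJ d n u A" for a b by (rule spanJ_add)
  show "a \<in> spanJ d n u A \<Longrightarrow> - a \<in> spanJ d n u A" for a using spanJ_cst[of a d n u A "-1"] by (simp add: cst_minus)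
  show "a \<in> spanJ d n u A" if "r > 0" "of_nat r * a \<in> spanJ d n u A" for r a
  proof -
    have "cst (1 / of_nat r) * (of_nat r * a) = cst (1 / of_nat r * of_nat r) * a"
      unfolding of_nat_eq_cst cst_mult by (simp only: mult.assoc)
    then have "cst (1 / of_nat r) * (of_nat r * a) = a" using that(1) by simp
    then show ?thesis using spanJ_cst[OF that(2), of "1 / of_nat r"] by simp
  qed
qed

section \<open>Straightening variables modulo the linear forms\<close>

text \<open>Up to the linear forms it suffices to compare index sets with the same unpaired part \<open>S0\<close>: such a set
  is \<open>S0 \<union> C \<union> - C\<close>, and the linear forms become the relations of the ballot problem on \<open>T\<close>.\<close>

locale lg_class =
  fixes d n a p :: nat and S0 T :: "int set"
  assumes n: "n \<ge> 1" and a: "a \<le> d" and S0: "S0 \<subseteq> bracket n" "\<And>k. k \<in> S0 \<Longrightarrow> - k \<notin> S0"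
    and T_def: "T = {i\<in>{1..int n}. i \<notin> S0 \<and> - i \<notin> S0}" and card_S0: "card S0 + 2 * p = n"
begin

definition fill :: "int set \<Rightarrow> int set" where "fill C = S0 \<union> C \<union> uminus ` C"
definition wv :: "int set \<Rightarrow> pvar" where "wv C = (a, fill C)"
text \<open>The unpaired letters' share of the sign that sorts \<open>- i, i\<close> into an index
  set; full pairs contribute an even number of inversions.\<close>

definition \<theta> :: "int \<Rightarrow> nat" where "\<theta> i = card {b\<in>S0. b < - i} + card {b\<in>S0. b < i}"
definition sgn_set :: "int set \<Rightarrow> int" where "sgn_set C = (\<Prod>i\<in>C. (-1) ^ \<theta> i)"
text \<open>Variables rescaled so that all coefficients of a linear form become equal up to one
  common sign, as the ballot problem requires.\<close>

definition PP :: "int set \<Rightarrow> mpoly" where "PP C = of_int (sgn_set C) * pvar (wv C)"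

lemma fin: "finite S0" "finite T"
proof -
  show "finite S0" by (rule finite_subset[OF S0(1) finite_bracket])
  have "T \<subseteq> {1..int n}" by (auto simp: T_def)
  then show "finite T" by (rule finite_subset) simp
qed

lemma T_D: "x \<in> T \<Longrightarrow> 1 \<le> x \<and> x \<le> int n \<and> x \<notin> S0 \<and> - x \<notin> S0"
  by (simp add: T_def)

lemma card_T: "card T = 2 * p"
proof -
  have "inj_on abs S0" using S0(2) by (auto simp: inj_on_def abs_if split: if_splits)
  then have "card (abs ` S0) = card S0" by (rule card_image)
  moreover have "abs ` S0 \<subseteq> {1..int n}" using S0(1) by (auto simp: bracket_def)
  moreover have "T = {1..int n} - abs ` S0"
  proof (rule Set.set_eqI)
    fix i show "i \<in> T \<longleftrightarrow> i \<in> {1..int n} - abs ` S0"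
    proof
      assume "i \<in> {1..int n} - abs ` S0"
      moreover have "i \<in> abs ` S0" if "i \<in> S0 \<or> - i \<in> S0" "i \<ge> 1" for i
        using that by (auto intro: image_eqI[of _ _ i] image_eqI[of _ _ "- i"])
      ultimately show "i \<in> T" by (auto simp: T_def)
    qed (auto simp: T_def abs_if split: if_splits)
  qed
  ultimately show ?thesis using card_S0 finite_imageI[OF fin(1), of abs] by (simp add: card_Diff_subset)
qed

lemma fill_mem:
  assumes "C \<subseteq> T" "1 \<le> x" "x \<le> int n"
  shows "x \<in> fill C \<longleftrightarrow> (if x \<in> T then x \<in> C else x \<in> S0)" "- x \<in> fill C \<longleftrightarrow> (if x \<in> T then x \<in> C else x \<notin> S0)"
  using assms S0(2)[of x] by (auto simp: fill_def T_def)

lemma card_fill: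
  assumes "C \<subseteq> T"
  shows "card (fill C) = card S0 + 2 * card C" "fill C \<subseteq> bracket n"
proof -
  have fC: "finite C" using assms fin finite_subset by blast
  have "(S0 \<union> C) \<inter> uminus ` C = {}"
  proof (rule Set.equals0I)
    fix z assume "z \<in> (S0 \<union> C) \<inter> uminus ` C"
    then obtain c where "c \<in> C" "z = - c" "z \<in> S0 \<or> z \<in> C" by blast
    then show False using T_D[of c] T_D[of z] subsetD[OF assms, of c] subsetD[OF assms, of z] by auto
  qed
  then have "card (fill C) = card (S0 \<union> C) + card (uminus ` C)" unfolding fill_def
    using fin fC by (intro card_Un_disjoint) auto
  also have "card (S0 \<union> C) = card S0 + card C" using assms fin fC by (intro card_Un_disjoint) (auto simp: T_def)
  also have "card (uminus ` C) = card C" by (intro card_image) auto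
  finally show "card (fill C) = card S0 + 2 * card C" by simp
  show "fill C \<subseteq> bracket n" using assms S0 by (auto simp: fill_def T_def bracket_def)
qed

lemma wv_Vars: "C \<subseteq> T \<Longrightarrow> card C = p \<Longrightarrow> wv C \<in> Vars d n"
  and fill_nsubsets: "C \<subseteq> T \<Longrightarrow> card C = p \<Longrightarrow> fill C \<in> nsubsets n n"
  using card_fill[of C] card_S0 a by (auto simp: wv_def Vars_def nsubsets_def)

text \<open>Induction from the outer gaps inwards. A full pair raises only the height on the
  positive side, an empty pair only that on the negative side, and an unpaired letter acts on both
  sides alike. So the difference traces the ballot path of \<open>C\<close>, and the sum does not
  depend on \<open>C\<close>.\<close>

lemma ht_profile:
  assumes C: "C \<subseteq> T" "card C = p" and m: "m \<le> n"
  shows "ht (wv C) (- (int n - int m)) - ht (wv C) (int n - int m)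
      = int (card {c\<in>T - C. int n - int m < c}) - int (card {c\<in>C. int n - int m < c})
    \<and> ht (wv C) (int n - int m) + ht (wv C) (- (int n - int m))
      = 2 * int a + int (card {k\<in>{1..int n}. int n - int m < k \<and> (k \<in> T \<or> k \<in> S0)})
        + int (card {k\<in>{1..int n}. int n - int m < k \<and> k \<in> S0 \<and> k \<notin> T})"
  using m
proof (induction m)
  case 0
  have e: "{c\<in>T - C. int n < c} = {}" "{c\<in>C. int n < c} = {}" "{k\<in>{1..int n}. int n < k \<and> (k \<in> T \<or> k \<in> S0)} = {}"
    "{k\<in>{1..int n}. int n < k \<and> k \<in> S0 \<and> k \<notin> T} = {}"
    using C by (auto simp: T_def)
  show ?case using ht_at_n[OF fill_nsubsets[OF C], of a] ht_at_minus_n[OF fill_nsubsets[OF C], of a]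
    unfolding wv_def of_nat_0 diff_zero e by simp
next
  case (Suc m)
  define x where "x = int n - int m"
  have x: "1 \<le> x" "x \<le> int n" "int n - int (Suc m) = x - 1" using Suc.prems by (auto simp: x_def)
  have fC: "finite C" "finite (T - C)" using C fin finite_subset by auto
  have one: "int (card {k\<in>B. x - 1 < k \<and> R k}) = int (card {k\<in>B. x < k \<and> R k}) + (if x \<in> B \<and> R x then 1 else 0)"
    if "finite B" for B R
  proof -
    have "{k\<in>B - {x}. x - 1 < k \<and> R k} = {k\<in>B - {x}. x < k \<and> R k}" by auto
    then show ?thesis using card_Collect_insert[OF that, of "\<lambda>k. x - 1 < k \<and> R k" x]
      card_Collect_insert[OF that, of "\<lambda>k. x < k \<and> R k" x] by simp
  qed
  note IH = Suc.IH[OF Suc_leD[OF Suc.prems], folded x_def]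
  have s1: "ht (wv C) (x - 1) = ht (wv C) x + (if x \<in> fill C then 1 else 0)"
    unfolding wv_def by (rule ht_step_pos[OF fill_nsubsets[OF C] x(1)])
  have s2: "ht (wv C) (- (x - 1)) = ht (wv C) (- x) + (if - x \<in> fill C then 0 else 1)"
    unfolding wv_def by (rule ht_step_neg[OF fill_nsubsets[OF C] x(1)])
  have c1: "int (card {c\<in>T - C. x - 1 < c}) = int (card {c\<in>T - C. x < c}) + (if x \<in> T - C then 1 else 0)"
    using one[OF fC(2), of "\<lambda>_. True"] by simp
  have c2: "int (card {c\<in>C. x - 1 < c}) = int (card {c\<in>C. x < c}) + (if x \<in> C then 1 else 0)"
    using one[OF fC(1), of "\<lambda>_. True"] by simp
  have c3: "int (card {k\<in>{1..int n}. x - 1 < k \<and> (k \<in> T \<or> k \<in> S0)}) = int (card {k\<in>{1..int n}. x < k \<and> (k \<in> T \<or> k \<in> S0)}) + (if x \<in> T \<or> x \<in> S0 then 1 else 0)"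
    using one[of "{1..int n}" "\<lambda>k. k \<in> T \<or> k \<in> S0"] x by simp
  have c4: "int (card {k\<in>{1..int n}. x - 1 < k \<and> k \<in> S0 \<and> k \<notin> T}) = int (card {k\<in>{1..int n}. x < k \<and> k \<in> S0 \<and> k \<notin> T}) + (if x \<in> S0 \<and> x \<notin> T then 1 else 0)"
    using one[of "{1..int n}" "\<lambda>k. k \<in> S0 \<and> k \<notin> T"] x by simp
  have TS: "x \<in> T \<Longrightarrow> x \<notin> S0" by (simp add: T_def)
  have CT: "x \<in> C \<Longrightarrow> x \<in> T" using C(1) by blast
  note m = fill_mem[OF C(1) x(1,2)]
  show ?case unfolding x(3) s1 s2 c1 c2 c3 c4 m
    using IH TS CT by (cases "x \<in> T"; cases "x \<in> C"; cases "x \<in> S0") simp_all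
qed

lemma ht_profile':
  assumes C: "C \<subseteq> T" "card C = p" and x: "0 \<le> x" "x \<le> int n"
  shows "ht (wv C) (- x) - ht (wv C) x = int (card {c\<in>T - C. x < c}) - int (card {c\<in>C. x < c})"
    and "ht (wv C) x + ht (wv C) (- x) = 2 * int a + int (card {k\<in>{1..int n}. x < k \<and> (k \<in> T \<or> k \<in> S0)})
        + int (card {k\<in>{1..int n}. x < k \<and> k \<in> S0 \<and> k \<notin> T})"
proof -
  have "int n - int (nat (int n - x)) = x" "nat (int n - x) \<le> n" using x by auto
  then show "ht (wv C) (- x) - ht (wv C) x = int (card {c\<in>T - C. x < c}) - int (card {c\<in>C. x < c})"
    "ht (wv C) x + ht (wv C) (- x) = 2 * int a + int (card {k\<in>{1..int n}. x < k \<and> (k \<in> T \<or> k \<in> S0)})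
        + int (card {k\<in>{1..int n}. x < k \<and> k \<in> S0 \<and> k \<notin> T})"
    using ht_profile[OF C, of "nat (int n - x)"] by metis+
qed

lemma ballot_ht:
  assumes "C \<subseteq> T" "card C = p" "ballot T C" "0 \<le> x" "x \<le> int n"
  shows "ht (wv C) x \<le> ht (wv C) (- x)"
proof -
  have "card {c\<in>C. x < c} \<le> card {c\<in>T - C. x < c}" using assms(3) unfolding ballot_def by blast
  then show ?thesis using ht_profile'(1)[OF assms(1,2,4,5)] by linarith
qed

lemma sgn_set_unit: "sgn_set C * sgn_set C = 1"
  unfolding sgn_set_def prod.distrib[symmetric] by (intro prod.neutral ballI) (simp flip: power_add)

text \<open>The generator attached to \<open>fill D\<close>, whose summands are the ways to fill one
  of the empty pairs.\<close>

lemma linear_relation: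
  assumes D: "D \<subseteq> T" "Suc (card D) = p"
  shows "(\<Sum>e\<in>T - D. PP (insert e D)) \<in> J d n"
proof -
  have fD: "finite D" using D fin finite_subset by blast
  have n2: "2 \<le> n" using D card_S0 by simp
  let ?B = "fill D"
  have cB: "card ?B = n - 2" "?B \<subseteq> bracket n" using card_fill[OF D(1)] D(2) card_S0 by auto
  have finB: "finite ?B" using finite_subset[OF cB(2)] by simp
  have I: "{i\<in>{1..int n}. {i, - i} \<inter> ?B = {}} = T - D"
  proof (rule Set.set_eqI)
    fix i show "i \<in> {i\<in>{1..int n}. {i, - i} \<inter> ?B = {}} \<longleftrightarrow> i \<in> T - D"
    proof (cases "i \<in> {1..int n}")
      case True
      then show ?thesis using fill_mem[OF D(1), of i] by auto
    qed (auto simp: T_def)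
  qed
  have sgn: "sort_sign ((- i) # i # sorted_list_of_set ?B) = (-1) ^ \<theta> i" if i: "i \<in> T - D" for i
  proof -
    have i1: "i \<ge> 1" using i by (auto simp: T_def)
    have len: "length (filter (\<lambda>y. y < z) (sorted_list_of_set ?B)) = card {b\<in>?B. b < z}" for z
      using distinct_card[of "filter (\<lambda>y. y < z) (sorted_list_of_set ?B)"] finB by simp
    have cnt: "card {b\<in>?B. b < z} = card {b\<in>S0. b < z} + card {b\<in>D. b < z} + card {b\<in>D. - b < z}" for z
    proof -
      have "{b\<in>?B. b < z} = ({b\<in>S0. b < z} \<union> {b\<in>D. b < z}) \<union> uminus ` {b\<in>D. - b < z}" by (auto simp: fill_def)
      moreover have "card (({b\<in>S0. b < z} \<union> {b\<in>D. b < z}) \<union> uminus ` {b\<in>D. - b < z})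
         = card ({b\<in>S0. b < z} \<union> {b\<in>D. b < z}) + card (uminus ` {b\<in>D. - b < z})"
      proof (rule card_Un_disjoint)
        show "({b\<in>S0. b < z} \<union> {b\<in>D. b < z}) \<inter> uminus ` {b\<in>D. - b < z} = {}"
        proof (rule Set.equals0I)
          fix u assume "u \<in> ({b\<in>S0. b < z} \<union> {b\<in>D. b < z}) \<inter> uminus ` {b\<in>D. - b < z}"
          then obtain c where "c \<in> D" "u = - c" "u \<in> S0 \<or> u \<in> D" by blast
          then show False using T_D[of c] T_D[of u] subsetD[OF D(1), of c] subsetD[OF D(1), of u] by auto
        qed
      qed (use fin fD in auto)
      moreover have "card ({b\<in>S0. b < z} \<union> {b\<in>D. b < z}) = card {b\<in>S0. b < z} + card {b\<in>D. b < z}"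
        using fin fD D(1) by (intro card_Un_disjoint) (auto simp: T_def)
      moreover have "card (uminus ` {b\<in>D. - b < z}) = card {b\<in>D. - b < z}" by (intro card_image) auto
      ultimately show ?thesis by simp
    qed
    have e1: "{b\<in>D. b < - i} = {}" using D(1) i1 by (auto simp: T_def)
    have e2: "{b\<in>D. - b < i} = D" using D(1) i1 by (auto simp: T_def)
    have e3: "{b\<in>D. - b < - i} = {b\<in>D. i < b}" by auto
    have "b < i \<or> i < b" if "b \<in> D" for b using i that by (cases b i rule: linorder_cases) auto
    then have "D = {b\<in>D. b < i} \<union> {b\<in>D. i < b}" by blast
    then have e4: "card D = card {b\<in>D. b < i} + card {b\<in>D. i < b}"
      using fD by (metis (no_types, lifting) card_Un_disjoint disjoint_iff finite_Un mem_Collect_eq order_less_asym)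
    have "sort_sign ((- i) # i # sorted_list_of_set ?B) = (-1) ^ (card {b\<in>?B. b < - i} + card {b\<in>?B. b < i})"
      unfolding sort_sign_Cons sort_sign_sorted[OF sorted_sorted_list_of_set] using i1 len by (simp add: power_add)
    \<comment> \<open>Each pair \<open>b, - b\<close> of \<open>D\<close> contributes two:
      \<open>- b\<close> lies below \<open>i\<close>, and either \<open>b\<close> lies below
      \<open>i\<close> or \<open>- b\<close> lies below \<open>- i\<close>.\<close>
    also have "card {b\<in>?B. b < - i} + card {b\<in>?B. b < i} = \<theta> i + 2 * card D"
      unfolding cnt e1 e2 e3 \<theta>_def using e4 by simp
    also have "(-1 :: int) ^ (\<theta> i + 2 * card D) = (-1) ^ \<theta> i" by (simp add: power_add)
    finally show ?thesis .
  qed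
  define f where "f = (\<Sum>i\<in>{i\<in>{1..int n}. {i, - i} \<inter> ?B = {}}.
             of_int (sort_sign ((- i) # i # sorted_list_of_set ?B)) * pvar (a, ?B \<union> {- i, i}))"
  have "f \<in> Lgens d n" unfolding Lgens_def f_def using n2 a cB by (intro CollectI exI[of _ a] exI[of _ ?B]) (auto simp: nsubsets_def)
  then have "f \<in> J d n" unfolding J_def by (intro ideal_gen_base) auto
  have "(\<Sum>e\<in>T - D. PP (insert e D)) = of_int (sgn_set D) * f"
    unfolding f_def I sum_distrib_left
  proof (rule sum.cong[OF refl])
    fix i assume i: "i \<in> T - D"
    have "fill (insert i D) = ?B \<union> {- i, i}" by (auto simp: fill_def)
    moreover have "sgn_set (insert i D) = (-1) ^ \<theta> i * sgn_set D" using i fD by (simp add: sgn_set_def)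
    ultimately show "PP (insert i D) = of_int (sgn_set D) * (of_int (sort_sign (- i # i # sorted_list_of_set ?B)) * pvar (a, ?B \<union> {- i, i}))"
      unfolding PP_def wv_def sgn[OF i] by (simp add: ac_simps)
  qed
  then show ?thesis using J_cst[OF \<open>f \<in> J d n\<close>] by (simp add: of_int_eq_cst)
qed

lemma pvar_PP: "pvar (wv C) = cst (of_int (sgn_set C)) * PP C"
  unfolding PP_def of_int_eq_cst[symmetric] by (simp flip: mult.assoc of_int_mult add: sgn_set_unit)

lemma ballots_span:
  assumes "C \<subseteq> T" "card C = p"
  shows "pvar (wv C) \<in> spanJ d n (\<lambda>C. pvar (wv C)) {C. C \<subseteq> T \<and> card C = p \<and> ballot T C}"
    (is "_ \<in> ?Y")
proof -
  interpret divisible_subgroup ?Y by (rule divisible_subgroup_spanJ)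
  have "PP C \<in> ?Y"
  proof (rule ballot_span[OF fin(2) _ _ assms])
    show "(\<Sum>e\<in>T - D. PP (insert e D)) \<in> ?Y" if "D \<subseteq> T" "Suc (card D) = p" for D
      by (rule spanJ_J[OF linear_relation[OF that]])
    show "PP C' \<in> ?Y" if "C' \<subseteq> T" "card C' = p" "ballot T C'" for C'
      unfolding PP_def of_int_eq_cst using that by (intro spanJ_cst spanJ_base) auto
  qed
  then show ?thesis unfolding pvar_PP by (rule spanJ_cst)
qed

text \<open>The complement in \<open>T\<close> exchanges full and empty pairs, which reflects the
  heights (\<open>ht_flip\<close>); modulo the linear forms this only multiplies the variable by a
  scalar.\<close>

lemma flip_mod_J:
  assumes "C \<subseteq> T" "card C = p"
  shows "\<exists>c. pvar (wv C) - cst c * pvar (wv (T - C)) \<in> J d n"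
proof -
  interpret divisible_subgroup "J d n"
  proof
    show "a \<in> J d n" if "r > 0" "of_nat r * a \<in> J d n" for r a
    proof -
      have "cst (1 / of_nat r) * (of_nat r * a) = cst (1 / of_nat r * of_nat r) * a"
        unfolding of_nat_eq_cst cst_mult by (simp only: mult.assoc)
      then have "cst (1 / of_nat r) * (of_nat r * a) = a" using that(1) by simp
      then show ?thesis using J_cst[OF that(2), of "1 / of_nat r"] by simp
    qed
  qed (auto intro: J_0 J_add J_uminus)
  let ?e = "of_int (sgn_set C) * (-1) ^ p :: complex"
  have "PP (T - C) - (-1) ^ p * PP C \<in> J d n"
    by (rule complement_flip[OF fin(2) card_T linear_relation assms])
  then have "cst (- ?e) * (PP (T - C) - (-1) ^ p * PP C) \<in> J d n" by (rule J_cst)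
  moreover have "cst (- ?e) * (PP (T - C) - (-1) ^ p * PP C) = pvar (wv C) - cst (?e * of_int (sgn_set (T - C))) * pvar (wv (T - C))"
  proof -
    have m: "(-1) ^ p = cst ((-1) ^ p)" by (cases "even p") (simp_all add: cst_minus)
    have one: "(-1) ^ p * ((-1) ^ p :: complex) = 1" by (simp flip: power_add)
    have "cst (- ?e) * (PP (T - C) - (-1) ^ p * PP C) = cst (?e * (-1) ^ p) * PP C - cst ?e * PP (T - C)"
      unfolding m cst_mult[of ?e] cst_minus by (simp add: algebra_simps)
    also have "?e * (-1) ^ p = of_int (sgn_set C)" using one by (simp add: mult.assoc)
    also have "cst (of_int (sgn_set C)) * PP C = pvar (wv C)" by (rule pvar_PP[symmetric])
    also have "cst ?e * PP (T - C) = cst (?e * of_int (sgn_set (T - C))) * pvar (wv (T - C))"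
      unfolding PP_def of_int_eq_cst cst_mult by (simp only: mult.assoc)
    finally show ?thesis .
  qed
  ultimately show ?thesis by (intro exI) simp
qed

lemma ht_flip:
  assumes C: "C \<subseteq> T" "card C = p" and y: "- int n \<le> y" "y \<le> int n"
  shows "ht (wv (T - C)) y = ht (wv C) (- y)"
proof -
  have C': "T - C \<subseteq> T" "card (T - C) = p" "T - (T - C) = C"
    using C card_T fin finite_subset[of C T] by (auto simp: card_Diff_subset)
  have *: "ht (wv (T - C)) x = ht (wv C) (- x)" "ht (wv (T - C)) (- x) = ht (wv C) x" if "0 \<le> x" "x \<le> int n" for x
    using ht_profile'[OF C that] ht_profile'[OF C'(1,2) that] unfolding C'(3) by linarith+
  show ?thesis using *[of y] *[of "- y"] y by (cases "0 \<le> y") auto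
qed

lemma ballot_straightening:
  assumes C0: "C0 \<subseteq> T" "card C0 = p"
  shows "\<exists>I c. finite I \<and> I \<subseteq> {C. C \<subseteq> T \<and> card C = p \<and> ballot T C} \<and>
      pvar (wv C0) - (\<Sum>C\<in>I. cst (c C) * pvar (wv C)) \<in> J d n"
  using ballots_span[OF C0] unfolding spanJ_def by blast

end

section \<open>Standard monomials span\<close>

text \<open>An index set is split into its unpaired letters \<open>S0\<close> and its full pairs
  \<open>B\<close>. As it has \<open>n\<close> letters, there are equally many empty pairs, which
  make up the rest of \<open>T\<close>.\<close>

lemma lg_class_of:
  assumes n: "n \<ge> 1" and v: "(a, A) \<in> Vars d n"
  defines "B \<equiv> {i\<in>{1..int n}. i \<in> A \<and> - i \<in> A}" and "S0 \<equiv> {k\<in>A. - k \<notin> A}"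
  defines "T \<equiv> {i\<in>{1..int n}. i \<notin> S0 \<and> - i \<notin> S0}"
  shows "lg_class d n a (card B) S0 T" "B \<subseteq> T" "lg_class.wv a S0 B = (a, A)"
proof -
  have A: "A \<in> nsubsets n n" "a \<le> d" using v by (auto simp: Vars_def)
  note A' = nsubsetsD[OF A(1)]
  have Ab: "A \<subseteq> bracket n" using A(1) by (auto simp: nsubsets_def)
  have fB: "finite B" "finite S0" using A'(1) by (auto simp: B_def S0_def)
  have pos: "1 \<le> k" if "k \<in> B" for k using that by (simp add: B_def)
  have AE: "A = S0 \<union> B \<union> uminus ` B"
  proof
    show "A \<subseteq> S0 \<union> B \<union> uminus ` B"
    proof
      fix k assume k: "k \<in> A"
      then have k0: "k \<noteq> 0" using A'(3) by auto
      show "k \<in> S0 \<union> B \<union> uminus ` B"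
      proof (cases "- k \<in> A")
        case True
        show ?thesis
        proof (cases "0 < k")
          case True
          then have "k \<in> B" using k \<open>- k \<in> A\<close> A'(4)[OF k] by (simp add: B_def)
          then show ?thesis by blast
        next
          case False
          then have "- k \<in> B" using k k0 \<open>- k \<in> A\<close> A'(4)[OF k] by (simp add: B_def)
          then have "- (- k) \<in> uminus ` B" by (rule imageI)
          then show ?thesis by simp
        qed
      qed (use k in \<open>simp add: S0_def\<close>)
    qed
  qed (auto simp: S0_def B_def)
  have d1: "S0 \<inter> B = {}" by (auto simp: S0_def B_def)
  have d2: "(S0 \<union> B) \<inter> uminus ` B = {}"
  proof (rule Set.equals0I)
    fix z assume "z \<in> (S0 \<union> B) \<inter> uminus ` B"
    then obtain b where b: "b \<in> B" "z = - b" "z \<in> S0 \<or> z \<in> B" by blast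
    then have "b \<in> A" "1 \<le> b" by (auto simp: B_def)
    then show False using b pos[of z] by (auto simp: S0_def)
  qed
  have "card A = card S0 + card B + card (uminus ` B)"
    by (subst AE) (simp only: card_Un_disjoint[OF _ _ d2] card_Un_disjoint[OF _ _ d1] fB finite_UnI finite_imageI)
  then have cA: "card S0 + 2 * card B = n" using A'(2) by (simp add: card_image)
  show L: "lg_class d n a (card B) S0 T"
    by unfold_locales (use n A(2) Ab cA in \<open>auto simp: S0_def T_def\<close>)
  show "B \<subseteq> T" by (auto simp: B_def T_def S0_def)
  show "lg_class.wv a S0 B = (a, A)" unfolding lg_class.wv_def[OF L] lg_class.fill_def[OF L] AE[symmetric] ..
qed

text \<open>The ballot condition expressed by heights; it singles out the variables that remain
  after linear straightening.\<close>

definition doset :: "nat \<Rightarrow> pvar \<Rightarrow> bool" where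
  "doset n v \<longleftrightarrow> (\<forall>x. 0 \<le> x \<longrightarrow> x \<le> int n \<longrightarrow> ht v x \<le> ht v (- x))"

theorem linear_straightening:
  assumes n: "n \<ge> 1" and v: "v \<in> Vars d n"
  obtains I :: "int set set" and c w where "finite I"
    "\<And>s. s \<in> I \<Longrightarrow> w s \<in> Vars d n \<and> doset n (w s)"
    "\<And>s y. s \<in> I \<Longrightarrow> - int n \<le> y \<Longrightarrow> y \<le> int n \<Longrightarrow> ht (w s) y + ht (w s) (- y) = ht v y + ht v (- y)"
    "pvar v - (\<Sum>s\<in>I. cst (c s) * pvar (w s)) \<in> J d n"
proof -
  obtain a A where vA: "v = (a, A)" by (cases v)
  define B where "B = {i\<in>{1..int n}. i \<in> A \<and> - i \<in> A}"
  define S0 where "S0 = {k\<in>A. - k \<notin> A}"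
  define T where "T = {i\<in>{1..int n}. i \<notin> S0 \<and> - i \<notin> S0}"
  have L: "lg_class d n a (card B) S0 T" and B: "B \<subseteq> T" and wB: "lg_class.wv a S0 B = v"
    using lg_class_of[OF n v[unfolded vA]] unfolding B_def S0_def T_def vA by auto
  interpret lg_class d n a "card B" S0 T by (rule L)
  obtain I c where I: "finite I" "I \<subseteq> {C. C \<subseteq> T \<and> card C = card B \<and> ballot T C}"
      "pvar v - (\<Sum>C\<in>I. cst (c C) * pvar (wv C)) \<in> J d n"
    using ballot_straightening[OF B refl] unfolding wB by blast
  show thesis
  proof (rule that[of I wv c])
    fix s assume "s \<in> I"
    then have s: "s \<subseteq> T" "card s = card B" "ballot T s" using I(2) by auto
    show "wv s \<in> Vars d n \<and> doset n (wv s)" using wv_Vars[OF s(1,2)] ballot_ht[OF s] by (simp add: doset_def)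
    have pos: "ht (wv s) x + ht (wv s) (- x) = ht v x + ht v (- x)" if "0 \<le> x" "x \<le> int n" for x
      using ht_profile'(2)[OF s(1,2) that] ht_profile'(2)[OF B refl that] wB by simp
    fix y assume "- int n \<le> y" "y \<le> int n"
    then show "ht (wv s) y + ht (wv s) (- y) = ht v y + ht v (- y)"
      using pos[of y] pos[of "- y"] by (cases "0 \<le> y") auto
  qed (rule I)+
qed

lemma flip_exists:
  assumes n: "n \<ge> 1" and v: "v \<in> Vars d n"
  obtains v' c where "v' \<in> Vars d n" "\<And>y. - int n \<le> y \<Longrightarrow> y \<le> int n \<Longrightarrow> ht v' y = ht v (- y)"
    "pvar v - cst c * pvar v' \<in> J d n"
proof -
  obtain a A where vA: "v = (a, A)" by (cases v)
  define B where "B = {i\<in>{1..int n}. i \<in> A \<and> - i \<in> A}"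
  define S0 where "S0 = {k\<in>A. - k \<notin> A}"
  define T where "T = {i\<in>{1..int n}. i \<notin> S0 \<and> - i \<notin> S0}"
  have L: "lg_class d n a (card B) S0 T" and B: "B \<subseteq> T" and wB: "lg_class.wv a S0 B = v"
    using lg_class_of[OF n v[unfolded vA]] unfolding B_def S0_def T_def vA by auto
  interpret lg_class d n a "card B" S0 T by (rule L)
  obtain c where c: "pvar v - cst c * pvar (wv (T - B)) \<in> J d n" using flip_mod_J[OF B refl] unfolding wB by blast
  have "card (T - B) = card B" using B card_T finite_subset[OF B fin(2)] by (simp add: card_Diff_subset)
  then have "wv (T - B) \<in> Vars d n" by (intro wv_Vars) auto
  then show thesis using that c ht_flip[OF B refl] unfolding wB by blast
qed

lemma quadratic_straightening_J:
  assumes n: "n \<ge> 1" and v: "v \<in> Vars d n" "v' \<in> Vars d n"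
  obtains I :: "(int set \<times> nat) set" and a g h where "finite I"
    "\<And>s. s \<in> I \<Longrightarrow> g s \<in> Vars d n \<and> h s \<in> Vars d n"
    "\<And>s y. s \<in> I \<Longrightarrow> - int n \<le> y \<Longrightarrow> y \<le> int n \<Longrightarrow>
       ht (g s) y + ht (h s) y = ht v y + ht v' y \<and> \<bar>ht v' y - ht v y\<bar> \<le> ht (h s) y - ht (g s) y"
    "pvar v * pvar v' - (\<Sum>s\<in>I. cst (a s) * (pvar (g s) * pvar (h s))) \<in> J d n"
proof -
  obtain I :: "(int set \<times> nat) set" and a g h where I: "finite I"
    "\<And>s. s \<in> I \<Longrightarrow> g s \<in> Vars d n \<and> h s \<in> Vars d n"
    "\<And>s y. s \<in> I \<Longrightarrow> - int n \<le> y \<Longrightarrow> y \<le> int n \<Longrightarrow> ht (g s) y \<le> ht (h s) y \<and>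
       ht (g s) y + ht (h s) y = ht v y + ht v' y \<and> \<bar>ht v' y - ht v y\<bar> \<le> ht (h s) y - ht (g s) y"
    "\<And>x. x \<in> GrMaps d n \<Longrightarrow> x v * x v' = (\<Sum>s\<in>I. a s * (x (g s) * x (h s)))"
    by (rule quadratic_straightening[OF n v]) (rule that; assumption)
  let ?q = "pvar v * pvar v' - (\<Sum>s\<in>I. cst (a s) * (pvar (g s) * pvar (h s)))"
  have "?q \<in> PRing d n"
    using I(2) v by (intro PRing_diff PRing_mult PRing_sum PRing_pvar PRing_cst) auto
  moreover have "meval x ?q = 0" if "x \<in> GrMaps d n" for x
    using I(4)[OF that] by (simp add: meval_diff meval_sum meval_mult meval_pvar meval_cst)
  ultimately have "?q \<in> Iideal d n" unfolding Iideal_def vanishing_def by blast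
  then have "?q \<in> J d n" unfolding J_def by (intro ideal_gen_base) auto
  then have q: "?q \<in> J d n" .
  show thesis
  proof (rule that[OF I(1,2) _ q])
    fix s y assume "s \<in> I" "- int n \<le> y" "y \<le> int n"
    from I(3)[OF this] show "ht (g s) y + ht (h s) y = ht v y + ht v' y \<and> \<bar>ht v' y - ht v y\<bar> \<le> ht (h s) y - ht (g s) y" by simp
  qed
qed

section \<open>The termination measure and standard monomials\<close>

definition hsum :: "nat \<Rightarrow> pvar \<Rightarrow> int" where "hsum n v = (\<Sum>y\<in>{- int n..int n}. ht v y)"

lemma sum_symmetric: "(\<Sum>y\<in>{- int n..int n}. f (- y)) = (\<Sum>y\<in>{- int n..int n}. f y)" for f :: "int \<Rightarrow> int"
  by (rule sum.reindex_bij_witness[of _ uminus uminus]) auto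

text \<open>The range of gaps is symmetric, so the total height depends only on the sums at
  \<open>y\<close> and \<open>- y\<close>, which linear straightening and reflection
  preserve.\<close>

lemma hsum_symmetrized:
  assumes "\<And>y. - int n \<le> y \<Longrightarrow> y \<le> int n \<Longrightarrow> ht w y + ht w (- y) = ht v y + ht v (- y)"
  shows "hsum n w = hsum n v"
proof -
  have "2 * hsum n u = (\<Sum>y\<in>{- int n..int n}. ht u y + ht u (- y))" for u
    unfolding sum.distrib sum_symmetric[of "ht u"] hsum_def by simp
  from this[of w] this[of v] show ?thesis using assms by simp
qed

lemma hsum_bounds:
  assumes "v \<in> Vars d n"
  shows "0 \<le> hsum n v" "hsum n v \<le> int ((2 * n + 1) * (d + n))"
proof -
  show "0 \<le> hsum n v" unfolding hsum_def using Vars_ht_bounds(1)[OF assms] by (intro sum_nonneg) auto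
  have "hsum n v \<le> (\<Sum>y\<in>{- int n..int n}. int (d + n))" unfolding hsum_def using Vars_ht_bounds(2)[OF assms] by (intro sum_mono) auto
  also have "\<dots> = int ((2 * n + 1) * (d + n))" by (simp add: algebra_simps)
  finally show "hsum n v \<le> int ((2 * n + 1) * (d + n))" .
qed

text \<open>The square of the total height is subtracted from its bound, so that an increase becomes
  a decrease of natural numbers.\<close>

definition hdef :: "nat \<Rightarrow> nat \<Rightarrow> pvar \<Rightarrow> nat" where
  "hdef d n v = nat ((int ((2 * n + 1) * (d + n)))\<^sup>2 - (hsum n v)\<^sup>2)"

lemma int_hdef: "v \<in> Vars d n \<Longrightarrow> int (hdef d n v) = (int ((2 * n + 1) * (d + n)))\<^sup>2 - (hsum n v)\<^sup>2"
proof -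
  assume v: "v \<in> Vars d n"
  have "(hsum n v)\<^sup>2 \<le> (int ((2 * n + 1) * (d + n)))\<^sup>2" by (rule power_mono[OF hsum_bounds(2,1)[OF v]])
  then show ?thesis unfolding hdef_def by (simp only: nat_0_le diff_ge_0_iff_ge)
qed

definition ht_le :: "nat \<Rightarrow> (int \<Rightarrow> int) \<Rightarrow> (int \<Rightarrow> int) \<Rightarrow> bool" where
  "ht_le n f g \<longleftrightarrow> (\<forall>y. - int n \<le> y \<longrightarrow> y \<le> int n \<longrightarrow> f y \<le> g y)"

text \<open>Incomparability means that the differences between \<open>v\<close> and
  \<open>v'\<close> have both signs and partly cancel in the total, whereas those between
  \<open>g\<close> and \<open>h\<close> are nonnegative and at least as large. The totals move apart
  while their sum is fixed, so the sum of their squares grows.\<close>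

lemma hdef_decreases:
  assumes V: "v \<in> Vars d n" "v' \<in> Vars d n" "g \<in> Vars d n" "h \<in> Vars d n"
    and gh: "\<And>y. - int n \<le> y \<Longrightarrow> y \<le> int n \<Longrightarrow> ht g y + ht h y = ht v y + ht v' y \<and> \<bar>ht v' y - ht v y\<bar> \<le> ht h y - ht g y"
    and inc: "\<not> ht_le n (ht v) (ht v')" "\<not> ht_le n (ht v') (ht v)"
  shows "hdef d n g + hdef d n h < hdef d n v + hdef d n v'"
proof -
  let ?Y = "{- int n..int n}"
  have D: "hsum n h - hsum n g = (\<Sum>y\<in>?Y. ht h y - ht g y)" "hsum n v' - hsum n v = (\<Sum>y\<in>?Y. ht v' y - ht v y)"
    by (simp_all add: hsum_def sum_subtractf)
  have S: "hsum n g + hsum n h = hsum n v + hsum n v'" unfolding hsum_def sum.distrib[symmetric] using gh by (intro sum.cong) auto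
  obtain y1 where y1: "y1 \<in> ?Y" "ht v' y1 < ht v y1" using inc(1) by (auto simp: ht_le_def not_le)
  obtain y2 where y2: "y2 \<in> ?Y" "ht v y2 < ht v' y2" using inc(2) by (auto simp: ht_le_def not_le)
  have le: "\<bar>ht v' y - ht v y\<bar> \<le> ht h y - ht g y" if "y \<in> ?Y" for y using gh[of y] that by simp
  have "(\<Sum>y\<in>?Y. ht v' y - ht v y) < (\<Sum>y\<in>?Y. ht h y - ht g y)"
  proof (rule sum_strict_mono_ex1)
    show "\<forall>y\<in>?Y. ht v' y - ht v y \<le> ht h y - ht g y" using le by force
    show "\<exists>y\<in>?Y. ht v' y - ht v y < ht h y - ht g y" using le[OF y1(1)] y1 by (intro bexI[of _ y1]) auto
  qed simp
  moreover have "(\<Sum>y\<in>?Y. - (ht v' y - ht v y)) < (\<Sum>y\<in>?Y. ht h y - ht g y)"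
  proof (rule sum_strict_mono_ex1)
    show "\<forall>y\<in>?Y. - (ht v' y - ht v y) \<le> ht h y - ht g y" using le by force
    show "\<exists>y\<in>?Y. - (ht v' y - ht v y) < ht h y - ht g y" using le[OF y2(1)] y2 by (intro bexI[of _ y2]) auto
  qed simp
  ultimately have "\<bar>hsum n v' - hsum n v\<bar> < \<bar>hsum n h - hsum n g\<bar>" unfolding D sum_negf by linarith
  then have "(hsum n v' - hsum n v)\<^sup>2 < (hsum n h - hsum n g)\<^sup>2" using power_strict_mono[of "\<bar>hsum n v' - hsum n v\<bar>" "\<bar>hsum n h - hsum n g\<bar>" 2] by simp
  then have "2 * ((hsum n v)\<^sup>2 + (hsum n v')\<^sup>2) < 2 * ((hsum n g)\<^sup>2 + (hsum n h)\<^sup>2)"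
    unfolding sumsq_identity S by simp
  then have "int (hdef d n g + hdef d n h) < int (hdef d n v + hdef d n v')"
    by (simp add: int_hdef V)
  then show ?thesis by simp
qed

definition flip :: "(int \<Rightarrow> int) \<Rightarrow> int \<Rightarrow> int" where "flip f y = f (- y)"

text \<open>Pairs are sub-multisets, so a repeated variable is also paired with itself and must be
  comparable with its own reflection.\<close>

definition std :: "nat \<Rightarrow> pvar multiset \<Rightarrow> bool" where
  "std n M \<longleftrightarrow> (\<forall>v\<in>#M. doset n v) \<and> (\<forall>v v'. {#v, v'#} \<subseteq># M \<longrightarrow>
     (ht_le n (ht v) (ht v') \<or> ht_le n (ht v') (ht v)) \<and>
     (ht_le n (ht v) (flip (ht v')) \<or> ht_le n (flip (ht v')) (ht v)))"

abbreviation Std :: "nat \<Rightarrow> nat \<Rightarrow> pvar multiset set" where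
  "Std d n \<equiv> {M. set_mset M \<subseteq> Vars d n \<and> std n M}"

lemma spanJ_reduce:
  assumes "p - (\<Sum>s\<in>I. cst (c s) * q s) \<in> J d n" "r \<in> PRing d n" "\<And>s. s \<in> I \<Longrightarrow> r * q s \<in> spanJ d n u A"
  shows "r * p \<in> spanJ d n u A"
proof -
  have "r * (p - (\<Sum>s\<in>I. cst (c s) * q s)) \<in> spanJ d n u A" by (rule spanJ_J[OF J_mult[OF assms(2,1)]])
  moreover have "(\<Sum>s\<in>I. cst (c s) * (r * q s)) \<in> spanJ d n u A" by (intro spanJ_sum spanJ_cst assms(3))
  ultimately have "r * (p - (\<Sum>s\<in>I. cst (c s) * q s)) + (\<Sum>s\<in>I. cst (c s) * (r * q s)) \<in> spanJ d n u A" by (rule spanJ_add)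
  moreover have "(\<Sum>s\<in>I. cst (c s) * (r * q s)) = r * (\<Sum>s\<in>I. cst (c s) * q s)"
    unfolding sum_distrib_left by (intro sum.cong refl) (simp only: ac_simps)
  ultimately show ?thesis by (simp add: right_diff_distrib)
qed

lemma spanJ_reduce1:
  assumes "p - cst c * q \<in> J d n" "r \<in> PRing d n" "r * q \<in> spanJ d n u A"
  shows "r * p \<in> spanJ d n u A"
proof (rule spanJ_reduce[OF _ assms(2)])
  show "p - (\<Sum>s\<in>{()}. cst c * q) \<in> J d n" using assms(1) by simp
qed (rule assms(3))

lemma spanJ_incomparable:
  assumes n: "n \<ge> 1" and V: "v \<in> Vars d n" "v' \<in> Vars d n" "set_mset N \<subseteq> Vars d n"
    and inc: "\<not> ht_le n (ht v) (ht v')" "\<not> ht_le n (ht v') (ht v)"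
    and IH: "\<And>g h. g \<in> Vars d n \<Longrightarrow> h \<in> Vars d n \<Longrightarrow> hdef d n g + hdef d n h < hdef d n v + hdef d n v' \<Longrightarrow>
       vmonom (add_mset g (add_mset h N)) \<in> spanJ d n u A"
  shows "vmonom (add_mset v (add_mset v' N)) \<in> spanJ d n u A"
proof -
  obtain I :: "(int set \<times> nat) set" and a g h where I: "finite I"
    "\<And>s. s \<in> I \<Longrightarrow> g s \<in> Vars d n \<and> h s \<in> Vars d n"
    "\<And>s y. s \<in> I \<Longrightarrow> - int n \<le> y \<Longrightarrow> y \<le> int n \<Longrightarrow>
       ht (g s) y + ht (h s) y = ht v y + ht v' y \<and> \<bar>ht v' y - ht v y\<bar> \<le> ht (h s) y - ht (g s) y"
    "pvar v * pvar v' - (\<Sum>s\<in>I. cst (a s) * (pvar (g s) * pvar (h s))) \<in> J d n"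
    by (rule quadratic_straightening_J[OF n V(1,2)]) (rule that; assumption)
  have e: "vmonom (add_mset g (add_mset h N)) = vmonom N * (pvar g * pvar h)" for g h
    by (simp only: mono_simps ac_simps)
  show ?thesis unfolding e
  proof (rule spanJ_reduce[OF I(4) PRing_mono[OF V(3)]])
    fix s assume s: "s \<in> I"
    have "hdef d n (g s) + hdef d n (h s) < hdef d n v + hdef d n v'"
      using I(2)[OF s] I(3)[OF s] by (intro hdef_decreases[OF V(1,2) _ _ _ inc]) auto
    then show "vmonom N * (pvar (g s) * pvar (h s)) \<in> spanJ d n u A"
      using IH[of "g s" "h s"] I(2)[OF s] unfolding e by blast
  qed
qed

theorem std_spans:
  assumes n: "n \<ge> 1" and M: "set_mset M \<subseteq> Vars d n"
  shows "vmonom M \<in> spanJ d n vmonom (Std d n)"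
  using M
\<comment> \<open>A quadratic step may create variables violating \<open>doset\<close> but lowers
  the first component; a linear step keeps the first component and lowers the number of violating
  variables.\<close>
proof (induction M rule: wf_induct_rule[OF wf_measures[of "[\<lambda>M. \<Sum>v\<in>#M. hdef d n v, \<lambda>M. \<Sum>v\<in>#M. if doset n v then 0 else 1]"]])
  case (1 M)
  let ?Y = "spanJ d n vmonom (Std d n)"
  have IH: "vmonom M' \<in> ?Y" if "set_mset M' \<subseteq> Vars d n" "(\<Sum>v\<in>#M'. hdef d n v) < (\<Sum>v\<in>#M. hdef d n v) \<or>
     (\<Sum>v\<in>#M'. hdef d n v) = (\<Sum>v\<in>#M. hdef d n v) \<and> (\<Sum>v\<in>#M'. if doset n v then 0 else 1 :: nat) < (\<Sum>v\<in>#M. if doset n v then 0 else 1)" for M'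
    by (rule "1.IH"[OF _ that(1)]) (use that(2) in simp)
  show ?case
  proof (cases "\<forall>v\<in>#M. doset n v")
    case False
    then obtain v N where v: "\<not> doset n v" "M = add_mset v N" by (meson mset_add)
    then have V: "v \<in> Vars d n" "set_mset N \<subseteq> Vars d n" using "1.prems" by auto
    obtain I :: "int set set" and c w where I: "finite I"
      "\<And>s. s \<in> I \<Longrightarrow> w s \<in> Vars d n \<and> doset n (w s)"
      "\<And>s y. s \<in> I \<Longrightarrow> - int n \<le> y \<Longrightarrow> y \<le> int n \<Longrightarrow> ht (w s) y + ht (w s) (- y) = ht v y + ht v (- y)"
      "pvar v - (\<Sum>s\<in>I. cst (c s) * pvar (w s)) \<in> J d n"
      by (rule linear_straightening[OF n V(1)]) (rule that; assumption)
    have e: "vmonom (add_mset g N) = vmonom N * pvar g" for g by (simp only: mono_simps ac_simps)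
    show ?thesis unfolding v(2) e
    proof (rule spanJ_reduce[OF I(4) PRing_mono[OF V(2)]])
      fix s assume s: "s \<in> I"
      have "hsum n (w s) = hsum n v" by (rule hsum_symmetrized[OF I(3)[OF s]])
      then have "vmonom (add_mset (w s) N) \<in> ?Y" using I(2)[OF s] V v by (intro IH) (auto simp: hdef_def)
      then show "vmonom N * pvar (w s) \<in> ?Y" unfolding e .
    qed
  next
    case dos: True
    show ?thesis
    proof (cases "std n M")
      case True
      then show ?thesis using "1.prems" by (intro spanJ_base) auto
    next
      case False
      then obtain v v' where vv: "{#v, v'#} \<subseteq># M" and
        neg: "\<not> ((ht_le n (ht v) (ht v') \<or> ht_le n (ht v') (ht v)) \<and>
           (ht_le n (ht v) (flip (ht v')) \<or> ht_le n (flip (ht v')) (ht v)))"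
        using dos unfolding std_def by blast
      obtain N where N: "M = {#v, v'#} + N" using vv by (auto simp: subset_mset.le_iff_add)
      then have MN: "M = add_mset v (add_mset v' N)" by simp
      have V: "v \<in> Vars d n" "v' \<in> Vars d n" "set_mset N \<subseteq> Vars d n" using "1.prems" unfolding MN by auto
      have IH': "vmonom (add_mset g (add_mset h N)) \<in> ?Y"
        if "g \<in> Vars d n" "h \<in> Vars d n" "hdef d n g + hdef d n h < hdef d n v + hdef d n v'" for g h
        by (rule IH) (use that V in \<open>auto simp: MN\<close>)
      show ?thesis
      proof (cases "ht_le n (ht v) (ht v') \<or> ht_le n (ht v') (ht v)")
        case False
        then show ?thesis unfolding MN using IH' by (intro spanJ_incomparable[OF n V]) auto
      next
        case True
        then have neg': "\<not> ht_le n (ht v) (flip (ht v'))" "\<not> ht_le n (flip (ht v')) (ht v)" using neg by auto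
        \<comment> \<open>Incomparability with the reflection of \<open>v'\<close> becomes ordinary
          incomparability once \<open>v'\<close> is replaced by the proportional variable with
          reflected heights.\<close>
        obtain u c where u: "u \<in> Vars d n" "\<And>y. - int n \<le> y \<Longrightarrow> y \<le> int n \<Longrightarrow> ht u y = ht v' (- y)"
          "pvar v' - cst c * pvar u \<in> J d n"
          by (rule flip_exists[OF n V(2)]) (rule that; assumption)
        have "hsum n u = hsum n v'" by (rule hsum_symmetrized) (simp add: u(2))
        then have eq: "hdef d n u = hdef d n v'" by (simp add: hdef_def)
        have inc: "\<not> ht_le n (ht v) (ht u)" "\<not> ht_le n (ht u) (ht v)" using neg' u(2) by (auto simp: ht_le_def flip_def)
        have "vmonom (add_mset v (add_mset u N)) \<in> ?Y"
          by (rule spanJ_incomparable[OF n V(1) u(1) V(3) inc]) (use IH' eq in auto)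
        moreover have e: "vmonom (add_mset v (add_mset g N)) = vmonom (add_mset v N) * pvar g" for g by (simp only: mono_simps ac_simps)
        ultimately have r: "vmonom (add_mset v N) * pvar u \<in> ?Y" by (simp only:)
        have "vmonom (add_mset v N) \<in> PRing d n" using V by (intro PRing_mono) auto
        then show ?thesis unfolding MN e by (rule spanJ_reduce1[OF u(3) _ r])
      qed
    qed
  qed
qed

section \<open>Standard monomials are independent\<close>

text \<open>Symmetric weights depend only on \<bar>y\<bar>, so the gaps \<open>x\<close> and
  \<open>- x\<close> are merged; \<open>0\<close> and \<open>n\<close> are fixed by reflection on
  the circle and occur once.\<close>

lemma sum_fold: "n \<ge> 1 \<Longrightarrow> (\<Sum>y\<in>{- int n + 1..int n}. f y) = (\<Sum>x\<in>{0..int n}. if 0 < x \<and> x < int n then f x + f (- x) else f x)"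
  for f :: "int \<Rightarrow> nat"
proof -
  assume n: "n \<ge> 1"
  have "{- int n + 1..int n} = {0..int n} \<union> uminus ` {1..int n - 1}" using n by (auto simp: image_iff)
  moreover have "{0..int n} \<inter> uminus ` {1..int n - 1} = {}" by auto
  ultimately have "(\<Sum>y\<in>{- int n + 1..int n}. f y) = (\<Sum>x\<in>{0..int n}. f x) + (\<Sum>x\<in>{1..int n - 1}. f (- x))"
    by (simp only: sum.union_disjoint finite_atLeastAtMost_int finite_imageI sum.reindex[OF inj_uminus] comp_def)
  also have "(\<Sum>x\<in>{1..int n - 1}. f (- x)) = (\<Sum>x\<in>{0..int n}. if 0 < x \<and> x < int n then f (- x) else 0)"
    by (rule sum.mono_neutral_cong_left) auto
  finally show ?thesis unfolding sum.distrib[symmetric] by (simp add: if_distrib cong: if_cong)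
qed

definition cells :: "nat \<Rightarrow> int \<times> nat \<Rightarrow> pvar \<Rightarrow> nat" where
  "cells n = (\<lambda>(x, h) v. (if int h \<le> ht v x then 1 else 0) + (if 0 < x \<and> x < int n \<and> int h \<le> ht v (- x) then 1 else 0))"

text \<open>For the weights \<open>K ^ cell_index n (\<bar>y\<bar>, h)\<close> with large \<open>K\<close>, the leading exponent of a monomial lists its
  content as digits in base \<open>K\<close>.\<close>

definition content :: "nat \<Rightarrow> pvar multiset \<Rightarrow> int \<times> nat \<Rightarrow> nat" where
  "content n M xh = (\<Sum>v\<in>#M. cells n xh v)"

lemma content_simps: "content n {#} xh = 0" "content n (add_mset v M) xh = cells n xh v + content n M xh"
  by (simp_all add: content_def)

lemma content_le: "content n M xh \<le> 2 * size M"
proof (induction M)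
  case (add v M)
  have "cells n xh v \<le> 2" by (cases xh) (simp add: cells_def)
  then show ?case using add by (simp add: content_simps)
qed (simp add: content_simps)

text \<open>Levels take precedence over gaps, so that the weight at a fixed gap increases with the
  level.\<close>

definition cell_index :: "nat \<Rightarrow> int \<times> nat \<Rightarrow> nat" where "cell_index n = (\<lambda>(x, h). h * (n + 1) + nat x)"

lemma cell_index_inj: "inj_on (cell_index n) ({0..int n} \<times> B)"
proof (rule inj_onI)
  fix p q assume p: "p \<in> {0..int n} \<times> B" and q: "q \<in> {0..int n} \<times> B" and eq: "cell_index n p = cell_index n q"
  obtain x h x' h' where e: "p = (x, h)" "q = (x', h')" by (cases p, cases q)
  have l: "nat x < n + 1" "nat x' < n + 1" using p q e by auto
  have E: "h * (n + 1) + nat x = h' * (n + 1) + nat x'" using eq e by (simp add: cell_index_def)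
  have "(h * (n + 1) + nat x) div (n + 1) = h" "(h' * (n + 1) + nat x') div (n + 1) = h'" using l by (simp_all del: mult_Suc_right)
  then have "h = h'" using E by metis
  then have "nat x = nat x'" using E by simp
  then show "p = q" using p q e \<open>h = h'\<close> by auto
qed

lemma wt_cells:
  assumes n: "n \<ge> 1" and v: "v \<in> Vars d n"
  shows "wt n (\<lambda>y h. K ^ cell_index n (\<bar>y\<bar>, h)) v = (\<Sum>xh\<in>{0..int n} \<times> {..d + n}. K ^ cell_index n xh * cells n xh v)"
proof -
  have row: "(\<Sum>h\<le>nat (ht v y). F h) = (\<Sum>h\<le>d + n. F h * (if int h \<le> ht v y then 1 else 0))"
    if "- int n \<le> y" "y \<le> int n" for y and F :: "nat \<Rightarrow> nat"
  proof -
    have b: "0 \<le> ht v y" "ht v y \<le> int (d + n)" using Vars_ht_bounds[OF v that] .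
    have "(\<Sum>h\<le>d + n. F h * (if int h \<le> ht v y then 1 else 0)) = (\<Sum>h\<le>nat (ht v y). F h * (if int h \<le> ht v y then 1 else 0))"
      using b by (intro sum.mono_neutral_right) auto
    also have "\<dots> = (\<Sum>h\<le>nat (ht v y). F h)" using b by (intro sum.cong) auto
    finally show ?thesis ..
  qed
  have "(\<Sum>xh\<in>{0..int n} \<times> {..d + n}. K ^ cell_index n xh * cells n xh v) = (\<Sum>x\<in>{0..int n}. \<Sum>h\<le>d + n. K ^ cell_index n (x, h) * cells n (x, h) v)"
    by (simp add: sum.cartesian_product prod.case_distrib)
  then show ?thesis unfolding wt_def sum_fold[OF n]
  proof (elim ssubst, intro sum.cong[OF refl])
    fix x assume x: "x \<in> {0..int n}"
    let ?F = "\<lambda>h. K ^ cell_index n (x, h)"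
    have r: "(\<Sum>h\<le>nat (ht v x). ?F h) = (\<Sum>h\<le>d + n. ?F h * (if int h \<le> ht v x then 1 else 0))"
      "(\<Sum>h\<le>nat (ht v (- x)). ?F h) = (\<Sum>h\<le>d + n. ?F h * (if int h \<le> ht v (- x) then 1 else 0))"
      using x by (intro row; simp)+
    have a: "\<bar>x\<bar> = x" "\<bar>- x\<bar> = x" using x by auto
    show "(if 0 < x \<and> x < int n then (\<Sum>h\<le>nat (ht v x). K ^ cell_index n (\<bar>x\<bar>, h)) + (\<Sum>h\<le>nat (ht v (- x)). K ^ cell_index n (\<bar>- x\<bar>, h))
        else \<Sum>h\<le>nat (ht v x). K ^ cell_index n (\<bar>x\<bar>, h)) = (\<Sum>h\<le>d + n. K ^ cell_index n (x, h) * cells n (x, h) v)"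
    proof (cases "0 < x \<and> x < int n")
      case True
      then have "cells n (x, h) v = (if int h \<le> ht v x then 1 else 0) + (if int h \<le> ht v (- x) then 1 else 0)" for h
        by (simp add: cells_def)
      then show ?thesis unfolding a r if_P[OF True] by (simp only: distrib_left sum.distrib)
    next
      case False
      then have "cells n (x, h) v = (if int h \<le> ht v x then 1 else 0)" for h
        unfolding cells_def by auto
      then show ?thesis unfolding a r if_not_P[OF False] by (simp only:)
    qed
  qed
qed

lemma wtm_content:
  assumes n: "n \<ge> 1" and M: "set_mset M \<subseteq> Vars d n"
  shows "wtm n (\<lambda>y h. K ^ cell_index n (\<bar>y\<bar>, h)) M = (\<Sum>xh\<in>{0..int n} \<times> {..d + n}. K ^ cell_index n xh * content n M xh)"
  using M
proof (induction M)
  case (add v M)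
  then have "wtm n (\<lambda>y h. K ^ cell_index n (\<bar>y\<bar>, h)) M = (\<Sum>xh\<in>{0..int n} \<times> {..d + n}. K ^ cell_index n xh * content n M xh)" by simp
  moreover have "v \<in> Vars d n" using add.prems by simp
  ultimately show ?case
    by (simp only: wtm_def image_mset_add_mset sum_mset.add_mset wt_cells[OF n] content_simps distrib_left sum.distrib)
qed (simp add: wtm_def content_simps)

lemma std_doset: "std n M \<Longrightarrow> v \<in># M \<Longrightarrow> doset n v"
  by (simp add: std_def)

lemma std_pair:
  assumes "std n M" "{#v, v'#} \<subseteq># M"
  shows "(ht_le n (ht v) (ht v') \<or> ht_le n (ht v') (ht v)) \<and>
     (ht_le n (ht v) (flip (ht v')) \<or> ht_le n (flip (ht v')) (ht v))"
  by (rule assms(1)[unfolded std_def, THEN conjunct2, THEN spec, THEN spec, THEN mp, OF assms(2)])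

lemma std_subset:
  assumes "std n M" "N \<subseteq># M"
  shows "std n N"
  unfolding std_def
proof (intro conjI allI impI ballI)
  show "doset n v" if "v \<in># N" for v using assms mset_subset_eqD[OF assms(2) that] by (simp add: std_def)
  fix v v' assume "{#v, v'#} \<subseteq># N"
  then have "{#v, v'#} \<subseteq># M" using assms(2) by (rule subset_mset.order_trans)
  from std_pair[OF assms(1) this] show "ht_le n (ht v) (ht v') \<or> ht_le n (ht v') (ht v)"
    "ht_le n (ht v) (flip (ht v')) \<or> ht_le n (flip (ht v')) (ht v)" by (rule conjunct1, rule conjunct2)
qed

lemma ht_le_hsum_antisym:
  assumes "ht_le n f g" "(\<Sum>y\<in>{- int n..int n}. g y) \<le> (\<Sum>y\<in>{- int n..int n}. f y)"
  shows "ht_le n g f"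
proof -
  have le: "f y \<le> g y" if "y \<in> {- int n..int n}" for y using assms(1) that unfolding ht_le_def by simp
  have "f y = g y" if y: "y \<in> {- int n..int n}" for y
  proof (rule ccontr)
    assume "f y \<noteq> g y"
    then have "f y < g y" using le[OF y] by linarith
    then have "(\<Sum>y\<in>{- int n..int n}. f y) < (\<Sum>y\<in>{- int n..int n}. g y)"
      by (intro sum_strict_mono_ex1 ballI bexI[OF _ y] le) simp_all
    then show False using assms(2) by simp
  qed
  then show ?thesis by (simp add: ht_le_def)
qed

text \<open>A factor of largest total height is taken. A factor comparable with it and of no larger
  total must lie below it, and the same holds for its reflection, which has the same total.\<close>

lemma std_top:
  assumes "std n M" "M \<noteq> {#}"
  obtains b N where "M = add_mset b N" "\<And>v. v \<in># N \<Longrightarrow> ht_le n (ht v) (ht b) \<and> ht_le n (ht v) (flip (ht b))"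
proof -
  have "\<exists>b\<in>set_mset M. \<forall>v\<in>set_mset M. hsum n v \<le> hsum n b"
    using Max_in[of "hsum n ` set_mset M"] Max_ge[of "hsum n ` set_mset M"] assms(2) by fastforce
  then obtain b where b: "b \<in># M" "\<And>v. v \<in># M \<Longrightarrow> hsum n v \<le> hsum n b" by blast
  then obtain N where N: "M = add_mset b N" by (meson mset_add)
  show thesis
  proof (rule that[OF N])
    fix v assume v: "v \<in># N"
    then obtain N' where N': "N = add_mset v N'" by (meson mset_add)
    have "{#v, b#} \<subseteq># M" unfolding N N' by simp
    then have cmp: "ht_le n (ht v) (ht b) \<or> ht_le n (ht b) (ht v)"
      "ht_le n (ht v) (flip (ht b)) \<or> ht_le n (flip (ht b)) (ht v)" using std_pair[OF assms(1), of v b] by blast+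
    have le: "hsum n v \<le> hsum n b" using b(2) v N by simp
    have fl: "(\<Sum>y\<in>{- int n..int n}. flip (ht b) y) = hsum n b" unfolding flip_def sum_symmetric hsum_def ..
    show "ht_le n (ht v) (ht b) \<and> ht_le n (ht v) (flip (ht b))"
      using cmp ht_le_hsum_antisym[of n "ht b" "ht v"] ht_le_hsum_antisym[of n "flip (ht b)" "ht v"] le
      unfolding fl hsum_def[symmetric] by blast
  qed
qed

text \<open>The top element is read off the content: at \<open>0 < x < n\<close> its larger height (at \<open>- x\<close>) is the last level
  with content at least one and its smaller height the last level with content at least two.\<close>

lemma content_top:
  assumes b: "doset n b" and N: "\<And>v. v \<in># N \<Longrightarrow> ht_le n (ht v) (ht b) \<and> ht_le n (ht v) (flip (ht b))"
    and x: "0 \<le> x" "x \<le> int n"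
  shows "1 \<le> content n (add_mset b N) (x, h) \<longleftrightarrow> (if 0 < x \<and> x < int n then int h \<le> ht b (- x) else int h \<le> ht b x)"
    and "0 < x \<Longrightarrow> x < int n \<Longrightarrow> 2 \<le> content n (add_mset b N) (x, h) \<longleftrightarrow> int h \<le> ht b x"
proof -
  have bx: "ht b x \<le> ht b (- x)" using b x by (simp add: doset_def)
  have vx: "ht v x \<le> ht b x \<and> ht v (- x) \<le> ht b x" if "v \<in># N" for v
  proof -
    have "ht v x \<le> ht b x" "ht v (- x) \<le> flip (ht b) (- x)" using N[OF that] x unfolding ht_le_def by auto
    then show ?thesis by (simp add: flip_def)
  qed
  have z: "content n N (x, h) = 0" if h: "\<not> int h \<le> ht b x"
  proof -
    have "cells n (x, h) v = 0" if "v \<in># N" for v using vx[OF that] h by (simp add: cells_def)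
    then show ?thesis unfolding content_def by (auto simp: sum_mset_0_iff)
  qed
  show "1 \<le> content n (add_mset b N) (x, h) \<longleftrightarrow> (if 0 < x \<and> x < int n then int h \<le> ht b (- x) else int h \<le> ht b x)"
    using z bx by (cases "int h \<le> ht b x") (auto simp: content_simps cells_def)
  show "2 \<le> content n (add_mset b N) (x, h) \<longleftrightarrow> int h \<le> ht b x" if "0 < x" "x < int n"
    using z bx that by (cases "int h \<le> ht b x") (auto simp: content_simps cells_def)
qed

lemma int_eq_levels:
  fixes a b :: int
  assumes "0 \<le> a" "a \<le> int m" "0 \<le> b" "b \<le> int m" "\<And>h. h \<le> m \<Longrightarrow> int h \<le> a \<longleftrightarrow> int h \<le> b"
  shows "a = b"
  using assms(5)[of "nat a"] assms(5)[of "nat b"] assms(1-4) by (simp add: nat_le_iff)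

text \<open>Equal contents give equal heights of the top factors, hence equal top factors; these are
  removed and the size decreases.\<close>

lemma std_content_inj:
  assumes n: "n \<ge> 1" and "M \<in> Std d n" "M' \<in> Std d n"
    and "\<And>xh. xh \<in> {0..int n} \<times> {..d + n} \<Longrightarrow> content n M xh = content n M' xh"
  shows "M = M'"
  using assms(2-)
proof (induction "size M" arbitrary: M M')
  case 0
  have "content n M' (0, 0) = 0" using "0.prems"(3)[of "(0, 0)"] "0.hyps" by (simp add: content_simps)
  have "M' = {#}"
  proof (rule ccontr)
    assume "M' \<noteq> {#}"
    then obtain v N where v: "M' = add_mset v N" by (meson multiset_cases)
    then have "v \<in> Vars d n" using "0.prems" by auto
    then have "0 \<le> ht v 0" using Vars_ht_bounds(1)[of v d n 0] by simp
    then show False using \<open>content n M' (0, 0) = 0\<close> unfolding v content_simps by (simp add: cells_def)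
  qed
  then show ?case using "0.hyps" by simp
next
  case (Suc k)
  then have Mne: "M \<noteq> {#}" by auto
  have st: "std n M" "std n M'" using Suc.prems(1,2) by simp_all
  obtain b N where b: "M = add_mset b N" "\<And>v. v \<in># N \<Longrightarrow> ht_le n (ht v) (ht b) \<and> ht_le n (ht v) (flip (ht b))"
    by (rule std_top[OF st(1) Mne]) (rule that; assumption)
  have V: "b \<in> Vars d n" "doset n b" using Suc.prems(1) std_doset[OF st(1), of b] unfolding b(1) by auto
  have M'ne: "M' \<noteq> {#}"
  proof
    assume "M' = {#}"
    then have "content n M (0, 0) = 0" using Suc.prems(3)[of "(0, 0)"] by (simp add: content_simps)
    moreover have "0 \<le> ht b 0" using Vars_ht_bounds(1)[OF V(1), of 0] by simp
    ultimately show False unfolding b content_simps by (simp add: cells_def)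
  qed
  obtain b' N' where b': "M' = add_mset b' N'" "\<And>v. v \<in># N' \<Longrightarrow> ht_le n (ht v) (ht b') \<and> ht_le n (ht v) (flip (ht b'))"
    by (rule std_top[OF st(2) M'ne]) (rule that; assumption)
  have V': "b' \<in> Vars d n" "doset n b'" using Suc.prems(2) std_doset[OF st(2), of b'] unfolding b'(1) by auto
  have c: "content n (add_mset b N) (x, h) = content n (add_mset b' N') (x, h)" if "0 \<le> x" "x \<le> int n" "h \<le> d + n" for x h
    using Suc.prems(3)[of "(x, h)"] that unfolding b(1) b'(1) by simp
  have e: "ht b x = ht b' x \<and> ht b (- x) = ht b' (- x)" if x: "0 \<le> x" "x \<le> int n" for x
  proof -
    have x': "- int n \<le> x" "- int n \<le> - x" "- x \<le> int n" using x by auto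
    note B = Vars_ht_bounds[OF V(1) x'(1) x(2)] Vars_ht_bounds[OF V'(1) x'(1) x(2)]
      Vars_ht_bounds[OF V(1) x'(2,3)] Vars_ht_bounds[OF V'(1) x'(2,3)]
    have t: "1 \<le> content n (add_mset b N) (x, h) \<longleftrightarrow> (if 0 < x \<and> x < int n then int h \<le> ht b (- x) else int h \<le> ht b x)"
      "0 < x \<Longrightarrow> x < int n \<Longrightarrow> 2 \<le> content n (add_mset b N) (x, h) \<longleftrightarrow> int h \<le> ht b x" for h
      by (rule content_top[OF V(2) b(2) x]; assumption)+
    have t': "1 \<le> content n (add_mset b' N') (x, h) \<longleftrightarrow> (if 0 < x \<and> x < int n then int h \<le> ht b' (- x) else int h \<le> ht b' x)"
      "0 < x \<Longrightarrow> x < int n \<Longrightarrow> 2 \<le> content n (add_mset b' N') (x, h) \<longleftrightarrow> int h \<le> ht b' x" for h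
      by (rule content_top[OF V'(2) b'(2) x]; assumption)+
    show ?thesis
    proof (cases "0 < x \<and> x < int n")
      case True
      have "ht b x = ht b' x"
      proof (rule int_eq_levels[OF B(1-4)])
        fix h assume "h \<le> d + n"
        from c[OF x this] show "int h \<le> ht b x \<longleftrightarrow> int h \<le> ht b' x"
          using t(2)[of h] t'(2)[of h] True by simp
      qed
      moreover have "ht b (- x) = ht b' (- x)"
      proof (rule int_eq_levels[OF B(5-8)])
        fix h assume "h \<le> d + n"
        from c[OF x this] show "int h \<le> ht b (- x) \<longleftrightarrow> int h \<le> ht b' (- x)"
          using t(1)[of h] t'(1)[of h] unfolding if_P[OF True] by simp
      qed
      ultimately show ?thesis by simp
    next
      case False
      have "ht b x = ht b' x"
      proof (rule int_eq_levels[OF B(1-4)])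
        fix h assume "h \<le> d + n"
        from c[OF x this] show "int h \<le> ht b x \<longleftrightarrow> int h \<le> ht b' x"
          using t(1)[of h] t'(1)[of h] unfolding if_not_P[OF False] by simp
      qed
      moreover have "x = 0 \<or> x = int n" using False x by auto
      ultimately show ?thesis using Vars_ht_minus_n[OF V(1)] Vars_ht_minus_n[OF V'(1)] by auto
    qed
  qed
  have bb: "b = b'"
  proof (rule ht_inj[OF V(1) V'(1)])
    fix y assume "- int n \<le> y" "y \<le> int n"
    then show "ht b y = ht b' y" using e[of y] e[of "- y"] by (cases "0 \<le> y") auto
  qed
  have "N = N'"
  proof (rule Suc.hyps(1))
    show "k = size N" using Suc.hyps(2) b(1) by simp
    show "N \<in> Std d n" using Suc.prems(1) std_subset[OF st(1), of N] unfolding b(1) by simp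
    show "N' \<in> Std d n" using Suc.prems(2) std_subset[OF st(2), of N'] unfolding b'(1) by simp
    show "content n N xh = content n N' xh" if "xh \<in> {0..int n} \<times> {..d + n}" for xh
      using Suc.prems(3)[OF that] unfolding b(1) b'(1) bb content_simps by simp
  qed
  then show ?case using b(1) b'(1) bb by simp
qed

text \<open>For the symmetric weights in base \<open>K\<close> the order of a monomial encodes its
  content, and the content determines a standard monomial. Hence the lowest term of a relation could
  not be cancelled.\<close>

theorem std_independent:
  assumes n: "n \<ge> 1" and S: "finite S" "S \<subseteq> Std d n"
    and rel: "\<And>x. x \<in> LGMaps d n \<Longrightarrow> (\<Sum>M\<in>S. a M * val x M) = 0" and M: "M \<in> S"
  shows "a M = 0"
proof (rule ccontr)
  assume aM: "a M \<noteq> 0"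
  \<comment> \<open>Larger than every content that occurs, and at least two so that the powers of
    \<open>K\<close> increase strictly.\<close>
  define K where "K = Suc (Suc (\<Sum>M\<in>S. 2 * size M))"
  define w where "w = (\<lambda>y h. K ^ cell_index n (\<bar>y\<bar>, h))"
  have K: "content n M xh < K" if "M \<in> S" for M xh
    using content_le[of n M xh] member_le_sum[OF that, of "\<lambda>M. 2 * size M"] S(1) by (simp add: K_def)
  define S' where "S' = {M\<in>S. a M \<noteq> 0}"
  have S': "finite S'" "M \<in> S'" using S(1) aM M by (auto simp: S'_def)
  obtain M1 where M1: "M1 \<in> S'" "\<And>M. M \<in> S' \<Longrightarrow> wtm n w M1 \<le> wtm n w M"
    using arg_min_if_finite(1)[of S' "wtm n w"] arg_min_least[of S' _ "wtm n w"] S' by blast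
  have "\<exists>M2\<in>S. M2 \<noteq> M1 \<and> a M2 \<noteq> 0 \<and> wtm n w M2 \<le> wtm n w M1"
  proof (rule leading_exponent_not_unique[where lg = True and d = d and M = "\<lambda>M. M"])
    show "strict_mono (w y)" for y
    proof (rule strict_monoI)
      fix h h' :: nat assume "h < h'"
      then have "h * (n + 1) < h' * (n + 1)" by (rule mult_strict_right_mono) simp
      then show "w y h < w y h'" unfolding w_def cell_index_def by (intro power_strict_increasing) (simp_all add: K_def)
    qed
    show "w (- y) = w y" for y by (simp add: w_def)
    show "(\<Sum>M\<in>S. a M * val x M) = 0" if "x \<in> maps True d n" for x using rel that by (simp add: maps_def)
    show "M1 \<in> S" "a M1 \<noteq> 0" using M1(1) by (auto simp: S'_def)
  qed (use n S in auto)
  then obtain M2 where M2: "M2 \<in> S" "M2 \<noteq> M1" "a M2 \<noteq> 0" "wtm n w M2 \<le> wtm n w M1" by blast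
  have M1S: "M1 \<in> S" using M1(1) by (simp add: S'_def)
  have V: "set_mset M1 \<subseteq> Vars d n" "set_mset M2 \<subseteq> Vars d n" using M1S M2(1) S(2) by blast+
  have "wtm n w M2 = wtm n w M1" using M1(2)[of M2] M2 by (simp add: S'_def)
  then have eq: "(\<Sum>xh\<in>{0..int n} \<times> {..d + n}. K ^ cell_index n xh * content n M2 xh) = (\<Sum>xh\<in>{0..int n} \<times> {..d + n}. K ^ cell_index n xh * content n M1 xh)"
    using wtm_content[OF n V(1), of K] wtm_content[OF n V(2), of K] unfolding w_def by simp
  have "M2 = M1"
  proof (rule std_content_inj[OF n])
    show "M2 \<in> Std d n" "M1 \<in> Std d n" using M2(1) M1S S(2) by auto
    show "content n M2 xh = content n M1 xh" if "xh \<in> {0..int n} \<times> {..d + n}" for xh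
      by (rule digits_inj[OF _ cell_index_inj K[OF M2(1)] K[OF M1S] eq that]) simp
  qed
  then show False using M2(2) by simp
qed

theorem theorem5p10:
  fixes n d :: nat
  assumes "n \<ge> 1"
  shows "ideal_gen (PRing d n) (Iideal d n \<union> Lgens d n) = vanishing (PRing d n) (LGMaps d n)"
  unfolding J_def[symmetric]
proof
  show "J d n \<subseteq> vanishing (PRing d n) (LGMaps d n)" by (rule J_vanishing)
  show "vanishing (PRing d n) (LGMaps d n) \<subseteq> J d n"
  proof
    fix p assume "p \<in> vanishing (PRing d n) (LGMaps d n)"
    then have p: "p \<in> PRing d n" "\<And>x. x \<in> LGMaps d n \<Longrightarrow> meval x p = 0" by (auto simp: vanishing_def)
    obtain K :: "(pvar \<Rightarrow>\<^sub>0 nat) set" and c M where K: "p = (\<Sum>m\<in>K. cst (c m) * vmonom (M m))" "\<And>m. m \<in> K \<Longrightarrow> set_mset (M m) \<subseteq> Vars d n"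
      by (rule PRing_expand[OF p(1)]) (rule that; assumption)
    have "p \<in> spanJ d n vmonom (Std d n)" unfolding K(1) by (intro spanJ_sum spanJ_cst std_spans[OF assms K(2)])
    then obtain S a where S: "finite S" "S \<subseteq> Std d n" "p - (\<Sum>M\<in>S. cst (a M) * vmonom M) \<in> J d n"
      unfolding spanJ_def by blast
    have rel: "(\<Sum>M\<in>S. a M * val x M) = 0" if "x \<in> LGMaps d n" for x
    proof -
      have "meval x (p - (\<Sum>M\<in>S. cst (a M) * vmonom M)) = 0" using S(3) J_vanishing[of d n] that unfolding vanishing_def by blast
      then show ?thesis using p(2)[OF that] by (simp add: meval_diff meval_sum meval_mult meval_cst meval_mono)
    qed
    \<comment> \<open>The standard representative of \<open>p\<close> vanishes on all isotropic
      maps, so it is zero and \<open>p\<close> itself lies in \<open>J\<close>.\<close>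
    have "a M = 0" if "M \<in> S" for M by (rule std_independent[OF assms S(1,2) rel that])
    then show "p \<in> J d n" using S(3) by simp
  qed
qed

end
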